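(* Let $\mathcal{W}$ be a biclosed bicategory whose hom-categories are locally small, complete and cocomplete. Let $\mathcal{A}$ and $\mathcal{B}$ be small $\mathcal{W}$-categories and let $\mathcal{C}$ be a $\mathcal{W}$-category. Let $\varphi \colon \mathcal{A} \nrightarrow \mathcal{B}$ be a $\mathcal{W}$-profunctor admitting the right adjoint $\psi \colon \mathcal{B} \nrightarrow \mathcal{A}$ in the bicategory $\mathcal{W}\text{-}\mathbf{Mod}$, with unit $\eta \colon \mathcal{A} \to \psi \otimes_{\mathcal{B}} \varphi$ and counit $\varepsilon \colon \varphi \otimes_{\mathcal{A}} \psi \to \mathcal{B}$. Let $F \colon \mathcal{B} \to \mathcal{C}$ and $Z \colon \mathcal{A} \to \mathcal{C}$ be $\mathcal{W}$-functors. Then there is a bijective correspondence between data of the following forms: (a) A profunctor map $a \colon \varphi \to \mathcal{C}(F,Z)$ exhibiting $Z$ as a $\varphi$-weighted colimit of $F$; (b) A profunctor map $b \colon \psi \to \mathcal{C}(Z,F)$ exhibiting $Z$ as a $\psi$-weighted limit of $F$; (c) A pair of profunctor maps $a \colon \varphi \to \mathcal{C}(F,Z)$ and $b \colon \psi \to \mathcal{C}(Z,F)$ such that the following two equations hold, in $\mathcal{W}\text{-}\mathbf{Mod}(\mathcal{A},\mathcal{A})$ and $\mathcal{W}\text{-}\mathbf{Mod}(\mathcal{B},\mathcal{B})$ respectively: (i) the composite $$\mathcal{A} \xrightarrow{\ \eta\ } \psi \otimes_{\mathcal{B}} \varphi \xrightarrow{\ b \otimes_{\mathcal{B}} a\ }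 \mathcal{C}(Z,F) \otimes_{\mathcal{B}} \mathcal{C}(F,Z) \xrightarrow{\ \mu\ } \mathcal{C}(Z,Z)$$ is equal to the map $Z \colon \mathcal{A} \to \mathcal{C}(Z,Z)$ given by the action of $Z$ on homs; (ii) the composite $$\varphi \otimes_{\mathcal{A}} \psi \xrightarrow{\ a \otimes_{\mathcal{A}} b\ } \mathcal{C}(F,Z) \otimes_{\mathcal{A}} \mathcal{C}(Z,F) \xrightarrow{\ \mu\ } \mathcal{C}(F,F)$$ is equal to the composite $\varphi \otimes_{\mathcal{A}} \psi \xrightarrow{\ \varepsilon\ } \mathcal{B} \xrightarrow{\ F\ } \mathcal{C}(F,F)$, whose second map is given by the action of $F$ on homs.
   Context: **Base bicategory.** Composition of $1$-cells in $\mathcal{W}$ is written $\otimes$, in the order such that for $A \colon x \to y$ one has functors $A \otimes (-) \colon \mathcal{W}(z,x) \to \mathcal{W}(z,y)$ and $(-) \otimes A \colon \mathcal{W}(y,z) \to \mathcal{W}(x,z)$; identity $1$-cells are written $I_x$. That $\mathcal{W}$ is *biclosed* means that for every $1$-cell $A$ both of these functors have right adjoints. **$\mathcal{W}$-categories.** A $\mathcal{W}$-category $\mathcal{A}$ comprises a set $\mathrm{ob}\,\mathcal{A}$ of objects; for each object $a$ an object $\epsilon a$ of $\mathcal{W}$, its *extent*; for each pair of objects $a,b$ a hom-object $\mathcal{A}(b,a) \in \mathcal{W}(\epsilon a, \epsilon b)$; and identity and composition $2$-cells $\iota \colon I_{\epsilon a} \to \mathcal{A}(a,a)$ and $\mu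 \colon \mathcal{A}(c,b) \otimes \mathcal{A}(b,a) \to \mathcal{A}(c,a)$ satisfying the usual unit and associativity axioms. It is *small* if its set of objects is small. **$\mathcal{W}$-functors.** A $\mathcal{W}$-functor $F \colon \mathcal{A} \to \mathcal{B}$ comprises an extent-preserving assignment on objects, together with $2$-cells $\mathcal{A}(b,a) \to \mathcal{B}(Fb,Fa)$ compatible with identities and composition. **Profunctors.** A $\mathcal{W}$-profunctor $M \colon \mathcal{A} \nrightarrow \mathcal{B}$ is given by objects $M(b,a) \in \mathcal{W}(\epsilon a, \epsilon b)$ (for $a \in \mathrm{ob}\,\mathcal{A}$, $b \in \mathrm{ob}\,\mathcal{B}$) and action maps $\mathcal{B}(b',b) \otimes M(b,a) \otimes \mathcal{A}(a,a') \to M(b',a')$ satisfying unitality and associativity axioms. A profunctor map $M \to M'$ comprises maps $M(b,a) \to M'(b,a)$ compatible with the actions by $\mathcal{A}$ and $\mathcal{B}$. The identity profunctor $\mathcal{A} \colon \mathcal{A} \nrightarrow \mathcal{A}$ has components $\mathcal{A}(b,a)$, with action given by composition. For $M \colon \mathcal{A} \nrightarrow \mathcal{B}$ and $N \colon \mathcal{B} \nrightarrow \mathcal{D}$ with $\mathcal{B}$ small, the tensor product $N \otimes_{\mathcal{B}} M \colon \mathcal{A} \nrightarrow \mathcal{D}$ has components given by the coequalisers $$\textstyle\sum_{b,b'} N(d,b) \otimes \mathcal{B}(b,b') \otimes M(b',a) \rightrightarrows \sum_b N(d,b) \otimes M(b,a) \twoheadrightarrow (N \otimes_{\mathcal{B}}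 M)(d,a)$$ (the two parallel maps being the actions of $\mathcal{B}$ on $N$ and on $M$), with actions by $\mathcal{D}$ and $\mathcal{A}$ inherited from $N$ and $M$. Small $\mathcal{W}$-categories, profunctors and profunctor maps form a bicategory $\mathcal{W}\text{-}\mathbf{Mod}$, in which the composite of $M \colon \mathcal{A} \nrightarrow \mathcal{B}$ and $N \colon \mathcal{B} \nrightarrow \mathcal{D}$ is the tensor product $N \otimes_{\mathcal{B}} M$ and the identity on $\mathcal{A}$ is the identity profunctor $\mathcal{A}$. Each object $X$ of $\mathcal{W}$ is identified with the $\mathcal{W}$-category $X$ having one object $\star$, with $\epsilon(\star) = X$ and $X(\star,\star) = I_X$. **Profunctors induced by functors.** For $\mathcal{W}$-functors $H \colon \mathcal{A} \to \mathcal{C}$ and $G \colon \mathcal{B} \to \mathcal{C}$, the profunctor $\mathcal{C}(G,H) \colon \mathcal{A} \nrightarrow \mathcal{B}$ has components $\mathcal{C}(G,H)(b,a) = \mathcal{C}(Gb,Ha)$, with action derived from the actions of $G$ and $H$ on homs and composition in $\mathcal{C}$. An object $C$ of $\mathcal{C}$ is regarded as a $\mathcal{W}$-functor $\epsilon C \to \mathcal{C}$ out of the one-object $\mathcal{W}$-category $\epsilon C$; so $\mathcal{C}(G,C) \colon \epsilon C \nrightarrow \mathcal{B}$ and $\mathcal{C}(C,H) \colon \mathcal{A} \nrightarrow \epsilon C$. Composition in $\mathcal{C}$ induces profunctor maps $\mu \colon \mathcal{C}(G,H) \otimes_{\mathcal{A}} \mathcal{C}(H,K) \to \mathcal{C}(G,K)$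 when the domain $\mathcal{A}$ of $H$ is small. The action of $H$ on homs gives a profunctor map $H \colon \mathcal{A} \to \mathcal{C}(H,H)$. **Universal maps.** Let $M \colon \mathcal{A} \nrightarrow \mathcal{B}$, $N \colon \mathcal{B} \nrightarrow \mathcal{D}$ and $L \colon \mathcal{A} \nrightarrow \mathcal{D}$ be profunctors with $\mathcal{B}$ small. A profunctor map $u \colon N \otimes_{\mathcal{B}} M \to L$ *exhibits $M$ as $[N,L]$* if every map $f \colon N \otimes_{\mathcal{B}} K \to L$ (with $K \colon \mathcal{A} \nrightarrow \mathcal{B}$) is of the form $u \circ (N \otimes_{\mathcal{B}} \bar f)$ for a unique $\bar f \colon K \to M$. It *exhibits $N$ as $\langle M,L\rangle$* if every map $f \colon K \otimes_{\mathcal{B}} M \to L$ (with $K \colon \mathcal{B} \nrightarrow \mathcal{D}$) is of the form $u \circ (\bar f \otimes_{\mathcal{B}} M)$ for a unique $\bar f \colon K \to N$. **Weighted colimits.** Given $\varphi \colon \mathcal{A} \nrightarrow \mathcal{B}$ in $\mathcal{W}\text{-}\mathbf{Mod}$ and a functor $F \colon \mathcal{B} \to \mathcal{C}$, a map $a \colon \varphi \to \mathcal{C}(F,Z)$, where $Z \colon \mathcal{A} \to \mathcal{C}$ is a functor, *exhibits $Z$ as a $\varphi$-weighted colimit of $F$* if for each object $C$ of $\mathcal{C}$ the map $$\varphi \otimes_{\mathcal{A}} \mathcal{C}(Z,C) \xrightarrow{a \otimes_{\mathcal{A}} 1} \mathcal{C}(F,Z) \otimes_{\mathcal{A}} \mathcal{C}(Z,C)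 \xrightarrow{\ \mu\ } \mathcal{C}(F,C)$$ exhibits $\mathcal{C}(Z,C)$ as $[\varphi, \mathcal{C}(F,C)]$. **Weighted limits.** Given $\psi \colon \mathcal{B} \nrightarrow \mathcal{A}$ in $\mathcal{W}\text{-}\mathbf{Mod}$ and a functor $F \colon \mathcal{B} \to \mathcal{C}$, a map $b \colon \psi \to \mathcal{C}(Z,F)$, where $Z \colon \mathcal{A} \to \mathcal{C}$ is a functor, *exhibits $Z$ as a $\psi$-weighted limit of $F$* if for each object $C$ of $\mathcal{C}$ the map $$\mathcal{C}(C,Z) \otimes_{\mathcal{A}} \psi \xrightarrow{1 \otimes_{\mathcal{A}} b} \mathcal{C}(C,Z) \otimes_{\mathcal{A}} \mathcal{C}(Z,F) \xrightarrow{\ \mu\ } \mathcal{C}(C,F)$$ exhibits $\mathcal{C}(C,Z)$ as $\langle \psi, \mathcal{C}(C,F)\rangle$. *)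

theory Defs
  imports "HOL-Library.FuncSet"
begin

text \<open>
  Smallness is relative to a cardinal \<open>\<kappa>\<close>: a set is small if it has fewer than \<open>\<kappa>\<close> elements.
  Only infinity and regularity of \<open>\<kappa>\<close> are required. Taking \<open>\<kappa>\<close> strongly inaccessible gives the
  sets that are small with respect to a Grothendieck universe.
\<close>

definition smallness_cardinal :: "'k rel \<Rightarrow> bool" where
  "smallness_cardinal \<kappa> \<longleftrightarrow> Card_order \<kappa> \<and> infinite (Field \<kappa>) \<and> regularCard \<kappa>"

context
  includes cardinal_syntax
begin

definition small_set :: "'k rel \<Rightarrow> 'a set \<Rightarrow> bool" where
  "small_set \<kappa> X \<longleftrightarrow> |X| <o \<kappa>"

end

record ('a, 'm) cat =
  Ob :: "'a set"
  Ar :: "'m set"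
  Dom :: "'m \<Rightarrow> 'a"
  Cod :: "'m \<Rightarrow> 'a"
  Idt :: "'a \<Rightarrow> 'm"
  Comp :: "'m \<Rightarrow> 'm \<Rightarrow> 'm"  (infixr "\<star>\<index>" 55)

definition arrows :: "('a, 'm) cat \<Rightarrow> 'a \<Rightarrow> 'a \<Rightarrow> 'm set" where
  "arrows C x y = {f \<in> Ar C. Dom C f = x \<and> Cod C f = y}"

definition category :: "('a, 'm) cat \<Rightarrow> bool" where
  "category C \<longleftrightarrow>
     (\<forall>f \<in> Ar C. Dom C f \<in> Ob C \<and> Cod C f \<in> Ob C) \<and>
     (\<forall>x \<in> Ob C. Idt C x \<in> arrows C x x) \<and>
     (\<forall>f \<in> Ar C. \<forall>g \<in> Ar C. Cod C f = Dom C g \<longrightarrow> g \<star>\<^bsub>C\<^esub> f \<in> arrows C (Dom C f) (Cod C g)) \<and>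
     (\<forall>f \<in> Ar C. f \<star>\<^bsub>C\<^esub> Idt C (Dom C f) = f \<and> Idt C (Cod C f) \<star>\<^bsub>C\<^esub> f = f) \<and>
     (\<forall>f \<in> Ar C. \<forall>g \<in> Ar C. \<forall>h \<in> Ar C. Cod C f = Dom C g \<longrightarrow> Cod C g = Dom C h \<longrightarrow>
        (h \<star>\<^bsub>C\<^esub> g) \<star>\<^bsub>C\<^esub> f = h \<star>\<^bsub>C\<^esub> (g \<star>\<^bsub>C\<^esub> f))"

record ('a, 'm, 'b, 'n) catfun =
  on_ob :: "'a \<Rightarrow> 'b"
  on_ar :: "'m \<Rightarrow> 'n"

definition cat_functor ::
  "('a, 'm) cat \<Rightarrow> ('b, 'n) cat \<Rightarrow> ('a, 'm, 'b, 'n) catfun \<Rightarrow> bool" where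
  "cat_functor C D F \<longleftrightarrow>
     (\<forall>x \<in> Ob C. on_ob F x \<in> Ob D) \<and>
     (\<forall>f \<in> Ar C. on_ar F f \<in> arrows D (on_ob F (Dom C f)) (on_ob F (Cod C f))) \<and>
     (\<forall>x \<in> Ob C. on_ar F (Idt C x) = Idt D (on_ob F x)) \<and>
     (\<forall>f \<in> Ar C. \<forall>g \<in> Ar C. Cod C f = Dom C g \<longrightarrow>
        on_ar F (g \<star>\<^bsub>C\<^esub> f) = on_ar F g \<star>\<^bsub>D\<^esub> on_ar F f)"

definition has_right_adjoint ::
  "('a, 'm) cat \<Rightarrow> ('b, 'n) cat \<Rightarrow> ('a, 'm, 'b, 'n) catfun \<Rightarrow> bool" where
  "has_right_adjoint C D F \<longleftrightarrow>
     cat_functor C D F \<and>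
     (\<exists>(G :: ('b, 'n, 'a, 'm) catfun) (\<eta> :: 'a \<Rightarrow> 'm) (\<epsilon> :: 'b \<Rightarrow> 'n).
        cat_functor D C G \<and>
        (\<forall>x \<in> Ob C. \<eta> x \<in> arrows C x (on_ob G (on_ob F x))) \<and>
        (\<forall>f \<in> Ar C. \<eta> (Cod C f) \<star>\<^bsub>C\<^esub> f = on_ar G (on_ar F f) \<star>\<^bsub>C\<^esub> \<eta> (Dom C f)) \<and>
        (\<forall>y \<in> Ob D. \<epsilon> y \<in> arrows D (on_ob F (on_ob G y)) y) \<and>
        (\<forall>g \<in> Ar D. g \<star>\<^bsub>D\<^esub> \<epsilon> (Dom D g) = \<epsilon> (Cod D g) \<star>\<^bsub>D\<^esub> on_ar F (on_ar G g)) \<and>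
        (\<forall>x \<in> Ob C. \<epsilon> (on_ob F x) \<star>\<^bsub>D\<^esub> on_ar F (\<eta> x) = Idt D (on_ob F x)) \<and>
        (\<forall>y \<in> Ob D. on_ar G (\<epsilon> y) \<star>\<^bsub>C\<^esub> \<eta> (on_ob G y) = Idt C (on_ob G y)))"

definition is_cone ::
  "('j, 'i) cat \<Rightarrow> ('a, 'm) cat \<Rightarrow> ('j, 'i, 'a, 'm) catfun \<Rightarrow> 'a \<Rightarrow> ('j \<Rightarrow> 'm) \<Rightarrow> bool" where
  "is_cone J C D v p \<longleftrightarrow>
     v \<in> Ob C \<and> (\<forall>j \<in> Ob J. p j \<in> arrows C v (on_ob D j)) \<and>
     (\<forall>u \<in> Ar J. on_ar D u \<star>\<^bsub>C\<^esub> p (Dom J u) = p (Cod J u))"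

definition is_limit ::
  "('j, 'i) cat \<Rightarrow> ('a, 'm) cat \<Rightarrow> ('j, 'i, 'a, 'm) catfun \<Rightarrow> 'a \<Rightarrow> ('j \<Rightarrow> 'm) \<Rightarrow> bool" where
  "is_limit J C D v p \<longleftrightarrow>
     is_cone J C D v p \<and>
     (\<forall>w q. is_cone J C D w q \<longrightarrow>
        (\<exists>!h. h \<in> arrows C w v \<and> (\<forall>j \<in> Ob J. p j \<star>\<^bsub>C\<^esub> h = q j)))"

definition is_cocone ::
  "('j, 'i) cat \<Rightarrow> ('a, 'm) cat \<Rightarrow> ('j, 'i, 'a, 'm) catfun \<Rightarrow> 'a \<Rightarrow> ('j \<Rightarrow> 'm) \<Rightarrow> bool" where
  "is_cocone J C D v p \<longleftrightarrow>
     v \<in> Ob C \<and> (\<forall>j \<in> Ob J. p j \<in> arrows C (on_ob D j) v) \<and>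
     (\<forall>u \<in> Ar J. p (Cod J u) \<star>\<^bsub>C\<^esub> on_ar D u = p (Dom J u))"

definition is_colimit ::
  "('j, 'i) cat \<Rightarrow> ('a, 'm) cat \<Rightarrow> ('j, 'i, 'a, 'm) catfun \<Rightarrow> 'a \<Rightarrow> ('j \<Rightarrow> 'm) \<Rightarrow> bool" where
  "is_colimit J C D v p \<longleftrightarrow>
     is_cocone J C D v p \<and>
     (\<forall>w q. is_cocone J C D w q \<longrightarrow>
        (\<exists>!h. h \<in> arrows C v w \<and> (\<forall>j \<in> Ob J. h \<star>\<^bsub>C\<^esub> p j = q j)))"

definition locally_small :: "'k rel \<Rightarrow> ('a, 'm) cat \<Rightarrow> bool" where
  "locally_small \<kappa> C \<longleftrightarrow> (\<forall>x \<in> Ob C. \<forall>y \<in> Ob C. small_set \<kappa> (arrows C x y))"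

text \<open>
  Diagram shapes may be taken with objects and arrows in the type underlying \<open>\<kappa>\<close>: every
  category with fewer than \<open>\<kappa>\<close> arrows is isomorphic to one of those.
\<close>

definition small_complete :: "'k rel \<Rightarrow> ('a, 'm) cat \<Rightarrow> bool" where
  "small_complete \<kappa> C \<longleftrightarrow>
     (\<forall>(J :: ('k, 'k) cat) D. category J \<longrightarrow> small_set \<kappa> (Ar J) \<longrightarrow> cat_functor J C D \<longrightarrow>
        (\<exists>v p. is_limit J C D v p))"

definition small_cocomplete :: "'k rel \<Rightarrow> ('a, 'm) cat \<Rightarrow> bool" where
  "small_cocomplete \<kappa> C \<longleftrightarrow>
     (\<forall>(J :: ('k, 'k) cat) D. category J \<longrightarrow> small_set \<kappa> (Ar J) \<longrightarrow> cat_functor J C D \<longrightarrow>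
        (\<exists>v p. is_colimit J C D v p))"

definition is_coproduct ::
  "('a, 'm) cat \<Rightarrow> 'i set \<Rightarrow> ('i \<Rightarrow> 'a) \<Rightarrow> 'a \<times> ('i \<Rightarrow> 'm) \<Rightarrow> bool" where
  "is_coproduct C I X = (\<lambda>(s, j).
     s \<in> Ob C \<and> (\<forall>i \<in> I. j i \<in> arrows C (X i) s) \<and>
     (\<forall>t \<in> Ob C. \<forall>f. (\<forall>i \<in> I. f i \<in> arrows C (X i) t) \<longrightarrow>
        (\<exists>!h. h \<in> arrows C s t \<and> (\<forall>i \<in> I. h \<star>\<^bsub>C\<^esub> j i = f i))))"

text \<open>Coproducts and coequalisers are chosen once and for all, whenever they exist.\<close>

definition coproduct :: "('a, 'm) cat \<Rightarrow> 'i set \<Rightarrow> ('i \<Rightarrow> 'a) \<Rightarrow> 'a \<times> ('i \<Rightarrow> 'm)" where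
  "coproduct C I X = (SOME c. is_coproduct C I X c)"

definition coprod_ob :: "('a, 'm) cat \<Rightarrow> 'i set \<Rightarrow> ('i \<Rightarrow> 'a) \<Rightarrow> 'a" where
  "coprod_ob C I X = fst (coproduct C I X)"

definition coprod_in :: "('a, 'm) cat \<Rightarrow> 'i set \<Rightarrow> ('i \<Rightarrow> 'a) \<Rightarrow> 'i \<Rightarrow> 'm" where
  "coprod_in C I X = snd (coproduct C I X)"

definition copair :: "('a, 'm) cat \<Rightarrow> 'i set \<Rightarrow> ('i \<Rightarrow> 'a) \<Rightarrow> 'a \<Rightarrow> ('i \<Rightarrow> 'm) \<Rightarrow> 'm" where
  "copair C I X t f =
     (THE h. h \<in> arrows C (coprod_ob C I X) t \<and> (\<forall>i \<in> I. h \<star>\<^bsub>C\<^esub> coprod_in C I X i = f i))"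

definition is_coequaliser :: "('a, 'm) cat \<Rightarrow> 'm \<Rightarrow> 'm \<Rightarrow> 'a \<times> 'm \<Rightarrow> bool" where
  "is_coequaliser C f g = (\<lambda>(q, e).
     q \<in> Ob C \<and> e \<in> arrows C (Cod C f) q \<and> e \<star>\<^bsub>C\<^esub> f = e \<star>\<^bsub>C\<^esub> g \<and>
     (\<forall>t \<in> Ob C. \<forall>k \<in> arrows C (Cod C f) t. k \<star>\<^bsub>C\<^esub> f = k \<star>\<^bsub>C\<^esub> g \<longrightarrow>
        (\<exists>!h. h \<in> arrows C q t \<and> h \<star>\<^bsub>C\<^esub> e = k)))"

definition coequaliser :: "('a, 'm) cat \<Rightarrow> 'm \<Rightarrow> 'm \<Rightarrow> 'a \<times> 'm" where
  "coequaliser C f g = (SOME c. is_coequaliser C f g c)"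

text \<open>
  \<open>t \<cdot> s\<close> is vertical composition (first \<open>s\<close>), \<open>g \<otimes> f\<close> composition of 1-cells (first \<open>f\<close>) and
  \<open>t \<odot> s\<close> the tensor product of 2-cells. The constraint cells are
  \<open>assoc h g f : (h \<otimes> g) \<otimes> f \<rightarrow> h \<otimes> (g \<otimes> f)\<close>, \<open>lun f : I \<otimes> f \<rightarrow> f\<close> and \<open>run f : f \<otimes> I \<rightarrow> f\<close>.
\<close>

record ('o, 'f, 'c) bicat =
  zero_cells :: "'o set"
  one_cells :: "'f set"
  two_cells :: "'c set"
  src :: "'f \<Rightarrow> 'o"
  trg :: "'f \<Rightarrow> 'o"
  dom2 :: "'c \<Rightarrow> 'f"
  cod2 :: "'c \<Rightarrow> 'f"
  id2 :: "'f \<Rightarrow> 'c"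
  vcomp :: "'c \<Rightarrow> 'c \<Rightarrow> 'c"  (infixr "\<cdot>\<index>" 60)
  unit1 :: "'o \<Rightarrow> 'f"
  tens1 :: "'f \<Rightarrow> 'f \<Rightarrow> 'f"  (infixr "\<otimes>\<index>" 70)
  tens2 :: "'c \<Rightarrow> 'c \<Rightarrow> 'c"  (infixr "\<odot>\<index>" 70)
  assoc :: "'f \<Rightarrow> 'f \<Rightarrow> 'f \<Rightarrow> 'c"
  lun :: "'f \<Rightarrow> 'c"
  run :: "'f \<Rightarrow> 'c"

context
  fixes W :: "('o, 'f, 'c) bicat"  (structure)
begin

definition one_hom :: "'o \<Rightarrow> 'o \<Rightarrow> 'f set" where
  "one_hom x y = {f \<in> one_cells W. src W f = x \<and> trg W f = y}"

definition cells :: "'f \<Rightarrow> 'f \<Rightarrow> 'c set" where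
  "cells f g = {t \<in> two_cells W. dom2 W t = f \<and> cod2 W t = g}"

definition hom_cat :: "'o \<Rightarrow> 'o \<Rightarrow> ('f, 'c) cat" where
  "hom_cat x y =
     \<lparr>Ob = one_hom x y, Ar = {t \<in> two_cells W. dom2 W t \<in> one_hom x y},
      Dom = dom2 W, Cod = cod2 W, Idt = id2 W, Comp = vcomp W\<rparr>"

definition inverse_cells :: "'c \<Rightarrow> 'c \<Rightarrow> bool" where
  "inverse_cells t s \<longleftrightarrow>
     t \<in> two_cells W \<and> s \<in> cells (cod2 W t) (dom2 W t) \<and>
     s \<cdot> t = id2 W (dom2 W t) \<and> t \<cdot> s = id2 W (cod2 W t)"

definition invertible :: "'c \<Rightarrow> bool" where
  "invertible t \<longleftrightarrow> (\<exists>s. inverse_cells t s)"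

definition inv2 :: "'c \<Rightarrow> 'c" where
  "inv2 t = (THE s. inverse_cells t s)"

definition bicategory :: bool where
  "bicategory \<longleftrightarrow>
     (\<forall>f \<in> one_cells W. src W f \<in> zero_cells W \<and> trg W f \<in> zero_cells W) \<and>
     (\<forall>t \<in> two_cells W. dom2 W t \<in> one_cells W \<and>
        cod2 W t \<in> one_hom (src W (dom2 W t)) (trg W (dom2 W t))) \<and>
     (\<forall>x \<in> zero_cells W. \<forall>y \<in> zero_cells W. category (hom_cat x y)) \<and>
     (\<forall>x \<in> zero_cells W. unit1 W x \<in> one_hom x x) \<and>
     (\<forall>f \<in> one_cells W. \<forall>g \<in> one_cells W. trg W f = src W g \<longrightarrow>
        g \<otimes> f \<in> one_hom (src W f) (trg W g) \<and> id2 W g \<odot> id2 W f = id2 W (g \<otimes> f)) \<and>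
     (\<forall>s \<in> two_cells W. \<forall>t \<in> two_cells W. trg W (dom2 W s) = src W (dom2 W t) \<longrightarrow>
        t \<odot> s \<in> cells (dom2 W t \<otimes> dom2 W s) (cod2 W t \<otimes> cod2 W s)) \<and>
     (\<forall>s \<in> two_cells W. \<forall>s' \<in> two_cells W. \<forall>t \<in> two_cells W. \<forall>t' \<in> two_cells W.
        cod2 W s = dom2 W s' \<longrightarrow> cod2 W t = dom2 W t' \<longrightarrow> trg W (dom2 W s) = src W (dom2 W t) \<longrightarrow>
        (t' \<cdot> t) \<odot> (s' \<cdot> s) = (t' \<odot> s') \<cdot> (t \<odot> s)) \<and>
     (\<forall>f \<in> one_cells W. \<forall>g \<in> one_cells W. \<forall>h \<in> one_cells W.
        trg W f = src W g \<longrightarrow> trg W g = src W h \<longrightarrow>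
        assoc W h g f \<in> cells ((h \<otimes> g) \<otimes> f) (h \<otimes> (g \<otimes> f)) \<and> invertible (assoc W h g f)) \<and>
     (\<forall>r \<in> two_cells W. \<forall>s \<in> two_cells W. \<forall>t \<in> two_cells W.
        trg W (dom2 W r) = src W (dom2 W s) \<longrightarrow> trg W (dom2 W s) = src W (dom2 W t) \<longrightarrow>
        assoc W (cod2 W t) (cod2 W s) (cod2 W r) \<cdot> ((t \<odot> s) \<odot> r) =
        (t \<odot> (s \<odot> r)) \<cdot> assoc W (dom2 W t) (dom2 W s) (dom2 W r)) \<and>
     (\<forall>f \<in> one_cells W.
        lun W f \<in> cells (unit1 W (trg W f) \<otimes> f) f \<and> invertible (lun W f) \<and>
        run W f \<in> cells (f \<otimes> unit1 W (src W f)) f \<and> invertible (run W f)) \<and>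
     (\<forall>t \<in> two_cells W.
        lun W (cod2 W t) \<cdot> (id2 W (unit1 W (trg W (dom2 W t))) \<odot> t) = t \<cdot> lun W (dom2 W t) \<and>
        run W (cod2 W t) \<cdot> (t \<odot> id2 W (unit1 W (src W (dom2 W t)))) = t \<cdot> run W (dom2 W t)) \<and>
     (\<forall>f \<in> one_cells W. \<forall>g \<in> one_cells W. trg W f = src W g \<longrightarrow>
        (id2 W g \<odot> lun W f) \<cdot> assoc W g (unit1 W (src W g)) f = run W g \<odot> id2 W f) \<and>
     (\<forall>f \<in> one_cells W. \<forall>g \<in> one_cells W. \<forall>h \<in> one_cells W. \<forall>k \<in> one_cells W.
        trg W f = src W g \<longrightarrow> trg W g = src W h \<longrightarrow> trg W h = src W k \<longrightarrow>
        assoc W k h (g \<otimes> f) \<cdot> assoc W (k \<otimes> h) g f =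
        (id2 W k \<odot> assoc W h g f) \<cdot> assoc W k (h \<otimes> g) f \<cdot> (assoc W k h g \<odot> id2 W f))"

definition biclosed :: bool where
  "biclosed \<longleftrightarrow>
     (\<forall>x \<in> zero_cells W. \<forall>y \<in> zero_cells W. \<forall>z \<in> zero_cells W. \<forall>f \<in> one_hom x y.
        has_right_adjoint (hom_cat z x) (hom_cat z y)
          \<lparr>on_ob = \<lambda>g. f \<otimes> g, on_ar = \<lambda>t. id2 W f \<odot> t\<rparr> \<and>
        has_right_adjoint (hom_cat y z) (hom_cat x z)
          \<lparr>on_ob = \<lambda>g. g \<otimes> f, on_ar = \<lambda>t. t \<odot> id2 W f\<rparr>)"

definition adjunction_in :: "'f \<Rightarrow> 'f \<Rightarrow> 'c \<Rightarrow> 'c \<Rightarrow> bool" where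
  "adjunction_in f g \<eta> \<epsilon> \<longleftrightarrow>
     f \<in> one_cells W \<and> g \<in> one_hom (trg W f) (src W f) \<and>
     \<eta> \<in> cells (unit1 W (src W f)) (g \<otimes> f) \<and>
     \<epsilon> \<in> cells (f \<otimes> g) (unit1 W (trg W f)) \<and>
     lun W f \<cdot> (\<epsilon> \<odot> id2 W f) \<cdot> inv2 (assoc W f g f) \<cdot> (id2 W f \<odot> \<eta>) \<cdot> inv2 (run W f) = id2 W f \<and>
     run W g \<cdot> (id2 W g \<odot> \<epsilon>) \<cdot> assoc W g f g \<cdot> (\<eta> \<odot> id2 W g) \<cdot> inv2 (lun W g) = id2 W g"

end

text \<open>
  \<open>whom A b a\<close> is the hom-object \<open>A(b,a)\<close>, a 1-cell from \<open>extent A a\<close> to \<open>extent A b\<close>, and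
  \<open>wmult A c b a : A(c,b) \<otimes> A(b,a) \<rightarrow> A(c,a)\<close>.
\<close>

record ('x, 'o, 'f, 'c) wcat =
  obj :: "'x set"
  extent :: "'x \<Rightarrow> 'o"
  whom :: "'x \<Rightarrow> 'x \<Rightarrow> 'f"
  wid :: "'x \<Rightarrow> 'c"
  wmult :: "'x \<Rightarrow> 'x \<Rightarrow> 'x \<Rightarrow> 'c"

text \<open>\<open>fhom F b a : A(b,a) \<rightarrow> B(F b, F a)\<close>.\<close>

record ('x, 'y, 'o, 'f, 'c) wfun =
  fdom :: "('x, 'o, 'f, 'c) wcat"
  fcod :: "('y, 'o, 'f, 'c) wcat"
  fobj :: "'x \<Rightarrow> 'y"
  fhom :: "'x \<Rightarrow> 'x \<Rightarrow> 'c"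

text \<open>
  A profunctor \<open>M\<close> from \<open>A = pdom M\<close> to \<open>B = pcod M\<close> has components \<open>pcmp M b a = M(b,a)\<close> and
  action maps \<open>pact M b' b a a' : (B(b',b) \<otimes> M(b,a)) \<otimes> A(a,a') \<rightarrow> M(b',a')\<close>.
\<close>

record ('x, 'y, 'o, 'f, 'c) prof =
  pdom :: "('x, 'o, 'f, 'c) wcat"
  pcod :: "('y, 'o, 'f, 'c) wcat"
  pcmp :: "'y \<Rightarrow> 'x \<Rightarrow> 'f"
  pact :: "'y \<Rightarrow> 'y \<Rightarrow> 'x \<Rightarrow> 'x \<Rightarrow> 'c"

text \<open>
  The families of components of profunctor maps are kept extensional, so that profunctor maps
  with the same components are equal.
\<close>

record ('x, 'y, 'o, 'f, 'c) pmap =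
  mdom :: "('x, 'y, 'o, 'f, 'c) prof"
  mcod :: "('x, 'y, 'o, 'f, 'c) prof"
  mcmp :: "'y \<times> 'x \<Rightarrow> 'c"

context
  fixes W :: "('o, 'f, 'c) bicat"  (structure)
begin

definition wcategory :: "('x, 'o, 'f, 'c) wcat \<Rightarrow> bool" where
  "wcategory A \<longleftrightarrow>
     (\<forall>a \<in> obj A. extent A a \<in> zero_cells W) \<and>
     (\<forall>a \<in> obj A. \<forall>b \<in> obj A. whom A b a \<in> one_hom W (extent A a) (extent A b)) \<and>
     (\<forall>a \<in> obj A. wid A a \<in> cells W (unit1 W (extent A a)) (whom A a a)) \<and>
     (\<forall>a \<in> obj A. \<forall>b \<in> obj A. \<forall>c \<in> obj A.
        wmult A c b a \<in> cells W (whom A c b \<otimes> whom A b a) (whom A c a)) \<and>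
     (\<forall>a \<in> obj A. \<forall>b \<in> obj A.
        wmult A b b a \<cdot> (wid A b \<odot> id2 W (whom A b a)) = lun W (whom A b a) \<and>
        wmult A b a a \<cdot> (id2 W (whom A b a) \<odot> wid A a) = run W (whom A b a)) \<and>
     (\<forall>a \<in> obj A. \<forall>b \<in> obj A. \<forall>c \<in> obj A. \<forall>d \<in> obj A.
        wmult A d b a \<cdot> (wmult A d c b \<odot> id2 W (whom A b a)) =
        wmult A d c a \<cdot> (id2 W (whom A d c) \<odot> wmult A c b a) \<cdot>
          assoc W (whom A d c) (whom A c b) (whom A b a))"

definition small_wcategory :: "'k rel \<Rightarrow> ('x, 'o, 'f, 'c) wcat \<Rightarrow> bool" where
  "small_wcategory \<kappa> A \<longleftrightarrow> wcategory A \<and> small_set \<kappa> (obj A)"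

definition wfunctor ::
  "('x, 'o, 'f, 'c) wcat \<Rightarrow> ('y, 'o, 'f, 'c) wcat \<Rightarrow> ('x, 'y, 'o, 'f, 'c) wfun \<Rightarrow> bool" where
  "wfunctor A B F \<longleftrightarrow>
     wcategory A \<and> wcategory B \<and> fdom F = A \<and> fcod F = B \<and>
     (\<forall>a \<in> obj A. fobj F a \<in> obj B \<and> extent B (fobj F a) = extent A a) \<and>
     (\<forall>a \<in> obj A. \<forall>b \<in> obj A.
        fhom F b a \<in> cells W (whom A b a) (whom B (fobj F b) (fobj F a))) \<and>
     (\<forall>a \<in> obj A. fhom F a a \<cdot> wid A a = wid B (fobj F a)) \<and>
     (\<forall>a \<in> obj A. \<forall>b \<in> obj A. \<forall>c \<in> obj A.
        fhom F c a \<cdot> wmult A c b a =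
        wmult B (fobj F c) (fobj F b) (fobj F a) \<cdot> (fhom F c b \<odot> fhom F b a))"

text \<open>
  The axioms are \<open>(1\<^sub>b \<cdot> m) \<cdot> 1\<^sub>a = m\<close> and \<open>(g' \<cdot> ((g \<cdot> m) \<cdot> f)) \<cdot> f' = ((g' g) \<cdot> m) \<cdot> (f f')\<close>; the chain
  of inverse associativity constraints and the final associativity constraint in the latter
  only rebracket the source.
\<close>

definition profunctor ::
  "('x, 'o, 'f, 'c) wcat \<Rightarrow> ('y, 'o, 'f, 'c) wcat \<Rightarrow> ('x, 'y, 'o, 'f, 'c) prof \<Rightarrow> bool" where
  "profunctor A B M \<longleftrightarrow>
     wcategory A \<and> wcategory B \<and> pdom M = A \<and> pcod M = B \<and>
     (\<forall>a \<in> obj A. \<forall>b \<in> obj B. pcmp M b a \<in> one_hom W (extent A a) (extent B b)) \<and>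
     (\<forall>a \<in> obj A. \<forall>a' \<in> obj A. \<forall>b \<in> obj B. \<forall>b' \<in> obj B.
        pact M b' b a a' \<in> cells W ((whom B b' b \<otimes> pcmp M b a) \<otimes> whom A a a') (pcmp M b' a')) \<and>
     (\<forall>a \<in> obj A. \<forall>b \<in> obj B.
        pact M b b a a \<cdot> ((wid B b \<odot> id2 W (pcmp M b a)) \<odot> wid A a) =
        lun W (pcmp M b a) \<cdot> run W (unit1 W (extent B b) \<otimes> pcmp M b a)) \<and>
     (\<forall>a \<in> obj A. \<forall>a' \<in> obj A. \<forall>a'' \<in> obj A. \<forall>b \<in> obj B. \<forall>b' \<in> obj B. \<forall>b'' \<in> obj B.
        pact M b'' b' a' a'' \<cdot>
          ((id2 W (whom B b'' b') \<odot> pact M b' b a a') \<odot> id2 W (whom A a' a'')) =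
        pact M b'' b a a'' \<cdot>
          ((wmult B b'' b' b \<odot> id2 W (pcmp M b a)) \<odot> wmult A a a' a'') \<cdot>
          assoc W ((whom B b'' b' \<otimes> whom B b' b) \<otimes> pcmp M b a) (whom A a a') (whom A a' a'') \<cdot>
          ((inv2 W (assoc W (whom B b'' b') (whom B b' b) (pcmp M b a)) \<odot> id2 W (whom A a a'))
            \<odot> id2 W (whom A a' a'')) \<cdot>
          (inv2 W (assoc W (whom B b'' b') (whom B b' b \<otimes> pcmp M b a) (whom A a a'))
            \<odot> id2 W (whom A a' a'')))"

definition pmaps ::
  "('x, 'y, 'o, 'f, 'c) prof \<Rightarrow> ('x, 'y, 'o, 'f, 'c) prof \<Rightarrow> ('x, 'y, 'o, 'f, 'c) pmap set" where
  "pmaps M N = {t.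
     (\<exists>A B. profunctor A B M \<and> profunctor A B N) \<and> mdom t = M \<and> mcod t = N \<and>
     mcmp t \<in> (\<Pi>\<^sub>E (b, a) \<in> obj (pcod M) \<times> obj (pdom M). cells W (pcmp M b a) (pcmp N b a)) \<and>
     (\<forall>a \<in> obj (pdom M). \<forall>a' \<in> obj (pdom M). \<forall>b \<in> obj (pcod M). \<forall>b' \<in> obj (pcod M).
        mcmp t (b', a') \<cdot> pact M b' b a a' =
        pact N b' b a a' \<cdot>
          ((id2 W (whom (pcod M) b' b) \<odot> mcmp t (b, a)) \<odot> id2 W (whom (pdom M) a a')))}"

definition pmap_id :: "('x, 'y, 'o, 'f, 'c) prof \<Rightarrow> ('x, 'y, 'o, 'f, 'c) pmap" where
  "pmap_id M =
     \<lparr>mdom = M, mcod = M,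
      mcmp = (\<lambda>(b, a) \<in> obj (pcod M) \<times> obj (pdom M). id2 W (pcmp M b a))\<rparr>"

definition pmap_comp ::
  "('x, 'y, 'o, 'f, 'c) pmap \<Rightarrow> ('x, 'y, 'o, 'f, 'c) pmap \<Rightarrow> ('x, 'y, 'o, 'f, 'c) pmap"
  (infixr "\<bullet>" 60) where
  "t \<bullet> s =
     \<lparr>mdom = mdom s, mcod = mcod t,
      mcmp = (\<lambda>(b, a) \<in> obj (pcod (mdom s)) \<times> obj (pdom (mdom s)). mcmp t (b, a) \<cdot> mcmp s (b, a))\<rparr>"

definition id_prof :: "('x, 'o, 'f, 'c) wcat \<Rightarrow> ('x, 'x, 'o, 'f, 'c) prof" where
  "id_prof A =
     \<lparr>pdom = A, pcod = A, pcmp = whom A,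
      pact = (\<lambda>b' b a a'. wmult A b' a a' \<cdot> (wmult A b' b a \<odot> id2 W (whom A a a')))\<rparr>"

text \<open>
  The one-sided actions \<open>lact M b' b a : B(b',b) \<otimes> M(b,a) \<rightarrow> M(b',a)\<close> and
  \<open>ract M b a a' : M(b,a) \<otimes> A(a,a') \<rightarrow> M(b,a')\<close> of a profunctor.
\<close>

definition lact :: "('x, 'y, 'o, 'f, 'c) prof \<Rightarrow> 'y \<Rightarrow> 'y \<Rightarrow> 'x \<Rightarrow> 'c" where
  "lact M b' b a =
     pact M b' b a a \<cdot>
       (id2 W (whom (pcod M) b' b \<otimes> pcmp M b a) \<odot> wid (pdom M) a) \<cdot>
       inv2 W (run W (whom (pcod M) b' b \<otimes> pcmp M b a))"

definition ract :: "('x, 'y, 'o, 'f, 'c) prof \<Rightarrow> 'y \<Rightarrow> 'x \<Rightarrow> 'x \<Rightarrow> 'c" where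
  "ract M b a a' =
     pact M b b a a' \<cdot>
       ((wid (pcod M) b \<odot> id2 W (pcmp M b a)) \<odot> id2 W (whom (pdom M) a a')) \<cdot>
       (inv2 W (lun W (pcmp M b a)) \<odot> id2 W (whom (pdom M) a a'))"

definition tens_hom ::
  "('y, 'z, 'o, 'f, 'c) prof \<Rightarrow> ('x, 'y, 'o, 'f, 'c) prof \<Rightarrow> 'z \<Rightarrow> 'x \<Rightarrow> ('f, 'c) cat" where
  "tens_hom N M d a = hom_cat W (extent (pdom M) a) (extent (pcod N) d)"

definition tens_summand ::
  "('y, 'z, 'o, 'f, 'c) prof \<Rightarrow> ('x, 'y, 'o, 'f, 'c) prof \<Rightarrow> 'z \<Rightarrow> 'x \<Rightarrow> 'y \<Rightarrow> 'f" where
  "tens_summand N M d a b = pcmp N d b \<otimes> pcmp M b a"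

definition tens_summand2 ::
  "('y, 'z, 'o, 'f, 'c) prof \<Rightarrow> ('x, 'y, 'o, 'f, 'c) prof \<Rightarrow> 'z \<Rightarrow> 'x \<Rightarrow> 'y \<times> 'y \<Rightarrow> 'f" where
  "tens_summand2 N M d a = (\<lambda>(b, b'). (pcmp N d b \<otimes> whom (pcod M) b b') \<otimes> pcmp M b' a)"

definition tens_coeq ::
  "('y, 'z, 'o, 'f, 'c) prof \<Rightarrow> ('x, 'y, 'o, 'f, 'c) prof \<Rightarrow> 'z \<Rightarrow> 'x \<Rightarrow> 'f \<times> 'c" where
  "tens_coeq N M d a =
     (let H = tens_hom N M d a; Y = obj (pcod M);
          S = coprod_ob H Y (tens_summand N M d a);
          j = coprod_in H Y (tens_summand N M d a)
      in coequaliser H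
           (copair H (Y \<times> Y) (tens_summand2 N M d a) S
              (\<lambda>(b, b'). j b' \<cdot> (ract N d b b' \<odot> id2 W (pcmp M b' a))))
           (copair H (Y \<times> Y) (tens_summand2 N M d a) S
              (\<lambda>(b, b'). j b \<cdot> (id2 W (pcmp N d b) \<odot> lact M b b' a) \<cdot>
                 assoc W (pcmp N d b) (whom (pcod M) b b') (pcmp M b' a))))"

definition tens_cmp ::
  "('y, 'z, 'o, 'f, 'c) prof \<Rightarrow> ('x, 'y, 'o, 'f, 'c) prof \<Rightarrow> 'z \<Rightarrow> 'x \<Rightarrow> 'f" where
  "tens_cmp N M d a = fst (tens_coeq N M d a)"

text \<open>The restriction \<open>N(d,b) \<otimes> M(b,a) \<rightarrow> (N \<otimes> M)(d,a)\<close> of the coequaliser map to a summand.\<close>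

definition tens_in ::
  "('y, 'z, 'o, 'f, 'c) prof \<Rightarrow> ('x, 'y, 'o, 'f, 'c) prof \<Rightarrow> 'z \<Rightarrow> 'x \<Rightarrow> 'y \<Rightarrow> 'c" where
  "tens_in N M d a b =
     snd (tens_coeq N M d a) \<cdot>
     coprod_in (tens_hom N M d a) (obj (pcod M)) (tens_summand N M d a) b"

definition tens_prof ::
  "('y, 'z, 'o, 'f, 'c) prof \<Rightarrow> ('x, 'y, 'o, 'f, 'c) prof \<Rightarrow> ('x, 'z, 'o, 'f, 'c) prof" where
  "tens_prof N M =
     \<lparr>pdom = pdom M, pcod = pcod N, pcmp = tens_cmp N M,
      pact = (\<lambda>d' d a a'. THE u.
        u \<in> cells W ((whom (pcod N) d' d \<otimes> tens_cmp N M d a) \<otimes> whom (pdom M) a a')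
              (tens_cmp N M d' a') \<and>
        (\<forall>b \<in> obj (pcod M).
           u \<cdot> ((id2 W (whom (pcod N) d' d) \<odot> tens_in N M d a b) \<odot> id2 W (whom (pdom M) a a')) =
           tens_in N M d' a' b \<cdot>
             (lact N d' d b \<odot> ract M b a a') \<cdot>
             assoc W (whom (pcod N) d' d \<otimes> pcmp N d b) (pcmp M b a) (whom (pdom M) a a') \<cdot>
             (inv2 W (assoc W (whom (pcod N) d' d) (pcmp N d b) (pcmp M b a))
               \<odot> id2 W (whom (pdom M) a a'))))\<rparr>"

definition tens_map ::
  "('y, 'z, 'o, 'f, 'c) pmap \<Rightarrow> ('x, 'y, 'o, 'f, 'c) pmap \<Rightarrow> ('x, 'z, 'o, 'f, 'c) pmap" where
  "tens_map t s =
     (let N = mdom t; N' = mcod t; M = mdom s; M' = mcod s in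
      \<lparr>mdom = tens_prof N M, mcod = tens_prof N' M',
       mcmp = (\<lambda>(d, a) \<in> obj (pcod N) \<times> obj (pdom M). THE u.
         u \<in> cells W (tens_cmp N M d a) (tens_cmp N' M' d a) \<and>
         (\<forall>b \<in> obj (pcod M).
            u \<cdot> tens_in N M d a b = tens_in N' M' d a b \<cdot> (mcmp t (d, b) \<odot> mcmp s (b, a))))\<rparr>)"

definition prof_lun :: "('x, 'y, 'o, 'f, 'c) prof \<Rightarrow> ('x, 'y, 'o, 'f, 'c) pmap" where
  "prof_lun M =
     (let B = id_prof (pcod M) in
      \<lparr>mdom = tens_prof B M, mcod = M,
       mcmp = (\<lambda>(b', a) \<in> obj (pcod M) \<times> obj (pdom M). THE u.
         u \<in> cells W (tens_cmp B M b' a) (pcmp M b' a) \<and>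
         (\<forall>b \<in> obj (pcod M). u \<cdot> tens_in B M b' a b = lact M b' b a))\<rparr>)"

definition prof_run :: "('x, 'y, 'o, 'f, 'c) prof \<Rightarrow> ('x, 'y, 'o, 'f, 'c) pmap" where
  "prof_run M =
     (let A = id_prof (pdom M) in
      \<lparr>mdom = tens_prof M A, mcod = M,
       mcmp = (\<lambda>(b, a') \<in> obj (pcod M) \<times> obj (pdom M). THE u.
         u \<in> cells W (tens_cmp M A b a') (pcmp M b a') \<and>
         (\<forall>a \<in> obj (pdom M). u \<cdot> tens_in M A b a' a = ract M b a a'))\<rparr>)"

definition prof_assoc ::
  "('y, 'z, 'o, 'f, 'c) prof \<Rightarrow> ('x, 'y, 'o, 'f, 'c) prof \<Rightarrow> ('w, 'x, 'o, 'f, 'c) prof \<Rightarrow>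
   ('w, 'z, 'o, 'f, 'c) pmap" where
  "prof_assoc P N M =
     \<lparr>mdom = tens_prof (tens_prof P N) M, mcod = tens_prof P (tens_prof N M),
      mcmp = (\<lambda>(d, a) \<in> obj (pcod P) \<times> obj (pdom M). THE u.
        u \<in> cells W (tens_cmp (tens_prof P N) M d a) (tens_cmp P (tens_prof N M) d a) \<and>
        (\<forall>b \<in> obj (pcod M). \<forall>c \<in> obj (pcod N).
           u \<cdot> tens_in (tens_prof P N) M d a b \<cdot> (tens_in P N d b c \<odot> id2 W (pcmp M b a)) =
           tens_in P (tens_prof N M) d a c \<cdot> (id2 W (pcmp P d c) \<odot> tens_in N M c a b) \<cdot>
             assoc W (pcmp P d c) (pcmp N c b) (pcmp M b a)))\<rparr>"

text \<open>
  The bicategory of small enriched categories, profunctors and profunctor maps. The objects of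
  the enriched categories are drawn from one type, as the 0-cells must form a set.
\<close>

definition Mod ::
  "'k rel \<Rightarrow>
   (('x, 'o, 'f, 'c) wcat, ('x, 'x, 'o, 'f, 'c) prof, ('x, 'x, 'o, 'f, 'c) pmap) bicat" where
  "Mod \<kappa> =
     \<lparr>zero_cells = {A. small_wcategory \<kappa> A},
      one_cells = {M. \<exists>A B. small_wcategory \<kappa> A \<and> small_wcategory \<kappa> B \<and> profunctor A B M},
      two_cells = {t. \<exists>A B M N. small_wcategory \<kappa> A \<and> small_wcategory \<kappa> B \<and>
                        profunctor A B M \<and> profunctor A B N \<and> t \<in> pmaps M N},
      src = pdom, trg = pcod, dom2 = mdom, cod2 = mcod,
      id2 = pmap_id, vcomp = pmap_comp,
      unit1 = id_prof, tens1 = tens_prof, tens2 = tens_map,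
      assoc = prof_assoc, lun = prof_lun, run = prof_run\<rparr>"

definition fun_prof ::
  "('y, 'z, 'o, 'f, 'c) wfun \<Rightarrow> ('x, 'z, 'o, 'f, 'c) wfun \<Rightarrow> ('x, 'y, 'o, 'f, 'c) prof" where
  "fun_prof G H =
     (let C = fcod H in
      \<lparr>pdom = fdom H, pcod = fdom G,
       pcmp = (\<lambda>b a. whom C (fobj G b) (fobj H a)),
       pact = (\<lambda>b' b a a'.
         wmult C (fobj G b') (fobj H a) (fobj H a') \<cdot>
         (wmult C (fobj G b') (fobj G b) (fobj H a) \<odot> id2 W (whom C (fobj H a) (fobj H a'))) \<cdot>
         ((fhom G b' b \<odot> id2 W (whom C (fobj G b) (fobj H a))) \<odot> fhom H a a'))\<rparr>)"

text \<open>A 0-cell \<open>x\<close> as a one-object enriched category, and an object of \<open>C\<close> as a functor into \<open>C\<close>.\<close>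

definition unit_wcat :: "'o \<Rightarrow> (unit, 'o, 'f, 'c) wcat" where
  "unit_wcat x =
     \<lparr>obj = {()}, extent = (\<lambda>_. x), whom = (\<lambda>_ _. unit1 W x),
      wid = (\<lambda>_. id2 W (unit1 W x)), wmult = (\<lambda>_ _ _. lun W (unit1 W x))\<rparr>"

definition obj_fun :: "('z, 'o, 'f, 'c) wcat \<Rightarrow> 'z \<Rightarrow> (unit, 'z, 'o, 'f, 'c) wfun" where
  "obj_fun C c =
     \<lparr>fdom = unit_wcat (extent C c), fcod = C, fobj = (\<lambda>_. c), fhom = (\<lambda>_ _. wid C c)\<rparr>"

text \<open>The map \<open>C(G,H) \<otimes> C(H,K) \<rightarrow> C(G,K)\<close> induced by composition in \<open>C\<close>.\<close>

definition mult_map ::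
  "('y, 'z, 'o, 'f, 'c) wfun \<Rightarrow> ('x, 'z, 'o, 'f, 'c) wfun \<Rightarrow> ('w, 'z, 'o, 'f, 'c) wfun \<Rightarrow>
   ('w, 'y, 'o, 'f, 'c) pmap" where
  "mult_map G H K =
     (let N = fun_prof G H; M = fun_prof H K in
      \<lparr>mdom = tens_prof N M, mcod = fun_prof G K,
       mcmp = (\<lambda>(b, d) \<in> obj (fdom G) \<times> obj (fdom K). THE u.
         u \<in> cells W (tens_cmp N M b d) (whom (fcod H) (fobj G b) (fobj K d)) \<and>
         (\<forall>a \<in> obj (fdom H).
            u \<cdot> tens_in N M b d a = wmult (fcod H) (fobj G b) (fobj H a) (fobj K d)))\<rparr>)"

text \<open>The action of \<open>H\<close> on homs, as a map from the identity profunctor to \<open>C(H,H)\<close>.\<close>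

definition hom_map :: "('x, 'z, 'o, 'f, 'c) wfun \<Rightarrow> ('x, 'x, 'o, 'f, 'c) pmap" where
  "hom_map H =
     \<lparr>mdom = id_prof (fdom H), mcod = fun_prof H H,
      mcmp = (\<lambda>(b, a) \<in> obj (fdom H) \<times> obj (fdom H). fhom H b a)\<rparr>"

text \<open>\<open>u : N \<otimes> M \<rightarrow> L\<close> exhibits \<open>M\<close> as \<open>[N, L]\<close>.\<close>

definition exhibits_right_hom ::
  "('x, 'z, 'o, 'f, 'c) pmap \<Rightarrow> ('x, 'y, 'o, 'f, 'c) prof \<Rightarrow>
   ('y, 'z, 'o, 'f, 'c) prof \<Rightarrow> ('x, 'z, 'o, 'f, 'c) prof \<Rightarrow> bool" where
  "exhibits_right_hom u M N L \<longleftrightarrow>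
     (\<exists>A B D. profunctor A B M \<and> profunctor B D N \<and> profunctor A D L \<and>
        u \<in> pmaps (tens_prof N M) L \<and>
        (\<forall>K. profunctor A B K \<longrightarrow>
           (\<forall>f \<in> pmaps (tens_prof N K) L.
              \<exists>!f'. f' \<in> pmaps K M \<and> f = u \<bullet> tens_map (pmap_id N) f')))"

text \<open>\<open>u : N \<otimes> M \<rightarrow> L\<close> exhibits \<open>N\<close> as \<open>\<langle>M, L\<rangle>\<close>.\<close>

definition exhibits_left_hom ::
  "('x, 'z, 'o, 'f, 'c) pmap \<Rightarrow> ('y, 'z, 'o, 'f, 'c) prof \<Rightarrow>
   ('x, 'y, 'o, 'f, 'c) prof \<Rightarrow> ('x, 'z, 'o, 'f, 'c) prof \<Rightarrow> bool" where
  "exhibits_left_hom u N M L \<longleftrightarrow>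
     (\<exists>A B D. profunctor A B M \<and> profunctor B D N \<and> profunctor A D L \<and>
        u \<in> pmaps (tens_prof N M) L \<and>
        (\<forall>K. profunctor B D K \<longrightarrow>
           (\<forall>f \<in> pmaps (tens_prof K M) L.
              \<exists>!f'. f' \<in> pmaps K N \<and> f = u \<bullet> tens_map f' (pmap_id M))))"

definition exhibits_weighted_colimit ::
  "('x, 'y, 'o, 'f, 'c) prof \<Rightarrow> ('y, 'z, 'o, 'f, 'c) wfun \<Rightarrow> ('x, 'z, 'o, 'f, 'c) wfun \<Rightarrow>
   ('x, 'y, 'o, 'f, 'c) pmap \<Rightarrow> bool" where
  "exhibits_weighted_colimit \<phi> F Z a \<longleftrightarrow>
     a \<in> pmaps \<phi> (fun_prof F Z) \<and>
     (\<forall>c \<in> obj (fcod F).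
        let X = obj_fun (fcod F) c in
        exhibits_right_hom
          (mult_map F Z X \<bullet> tens_map a (pmap_id (fun_prof Z X)))
          (fun_prof Z X) \<phi> (fun_prof F X))"

definition exhibits_weighted_limit ::
  "('y, 'x, 'o, 'f, 'c) prof \<Rightarrow> ('y, 'z, 'o, 'f, 'c) wfun \<Rightarrow> ('x, 'z, 'o, 'f, 'c) wfun \<Rightarrow>
   ('y, 'x, 'o, 'f, 'c) pmap \<Rightarrow> bool" where
  "exhibits_weighted_limit \<psi> F Z b \<longleftrightarrow>
     b \<in> pmaps \<psi> (fun_prof Z F) \<and>
     (\<forall>c \<in> obj (fcod F).
        let X = obj_fun (fcod F) c in
        exhibits_left_hom
          (mult_map X Z F \<bullet> tens_map (pmap_id (fun_prof X Z)) b)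
          (fun_prof X Z) \<psi> (fun_prof X F))"

end

end

theory Submission
  imports Defs
begin

text \<open>
  A 2-cell \<open>j \<rightarrow> f \<otimes> k\<close> is treated as an element of the 1-cell \<open>f\<close> with source \<open>j\<close> and target \<open>k\<close>.
  2-cells out of \<open>f\<close> act on such elements (\<open>t \<rhd> x\<close>), and elements \<open>x\<close> of \<open>f\<close> and \<open>y\<close> of \<open>g\<close> that are
  composable have a pairing \<open>x >< y\<close>, an element of \<open>f \<otimes> g\<close>. The constraints of the bicategory act on
  pairings by rebracketing, and 2-cells out of an iterated tensor product are determined by their
  values on iterated pairings. Since \<open>h \<otimes> -\<close> and \<open>- \<otimes> k\<close> are left adjoints, the same is true with a
  tensor product of profunctors as one of the factors. So all equations between 2-cells become
  equations between elements.

  Testing on the free profunctors \<open>A(-,i) \<otimes> k\<close> shows that \<open>a\<close> exhibits \<open>Z\<close> as a weighted colimit if and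
  only if every family \<open>f b : \<phi>(b,i) \<otimes> k \<rightarrow> C(F b,c)\<close>, natural in \<open>b\<close>, factors through the components
  \<open>a(b,i)\<close> by a unique 2-cell \<open>s : k \<rightarrow> C(Z i,c)\<close>; similarly for limits.

  If \<open>a\<close> and \<open>b\<close> satisfy (i) and (ii), then \<open>s\<close> is the composite of \<open>\<eta> \<otimes> k : k \<rightarrow> (\<psi> \<otimes> \<phi>)(i,i) \<otimes> k\<close> with
  \<open>(p \<otimes> q) \<otimes> y \<mapsto> b(p) f(q \<otimes> y)\<close>: it is a factorisation by (ii) and a triangle identity, and the only
  one by (i). Conversely, if \<open>a\<close> exhibits a weighted colimit, then the families
  \<open>F \<epsilon> : \<phi>(b',i) \<otimes> \<psi>(i,b) \<rightarrow> C(F b',F b)\<close> factor through \<open>a\<close> by unique 2-cells \<open>\<psi>(i,b) \<rightarrow> C(Z i,F b)\<close>.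
  These are the components of the only \<open>b\<close> that satisfies (ii), and (i) follows from (ii) and the
  triangle identity because \<open>a\<close> can be cancelled.
\<close>

section \<open>Bicategories\<close>

text \<open>The obstacle is coherence: a tensor product of profunctors is a chosen coequaliser in a
  bicategory that need not be strict, and its laws, written as composites of 2-cells, would drown in
  constraint cells. Sending \<open>f\<close> to the functor \<open>f \<otimes> -\<close> turns
  tensoring of 1-cells into composition of functors, which is strictly associative, and 2-cells
  \<open>j \<rightarrow> f \<otimes> k\<close> are what is visible of \<open>f\<close> there. This
  is why an element carries a target: the second factor of a pairing lives in the target of the
  first. Targets that are unit 1-cells suffice for testing, since \<open>- \<otimes> I\<close> is
  faithful.

  The laws of \<open>Mod\<close> are not established as a whole. An adjunction there is a pair of
  equations that contain inverses of a few constraint cells, so explicit inverses of these are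
  enough to turn the triangle identities into the rules \<open>\<tau>_one\<close> and
  \<open>\<sigma>_one\<close>.

  Where a profunctor map is assembled from factorisations chosen one by one, its compatibility with
  the actions comes from uniqueness in the universal property, which acts as a cancellation
  rule.\<close>

locale bicat =
  fixes W :: "('o, 'f, 'c) bicat"  (structure)
  assumes bic: "bicategory W"
begin

lemma ax:
  shows src_in: "f \<in> one_cells W \<Longrightarrow> src W f \<in> zero_cells W"
    and trg_in: "f \<in> one_cells W \<Longrightarrow> trg W f \<in> zero_cells W"
    and dom2_in: "t \<in> two_cells W \<Longrightarrow> dom2 W t \<in> one_cells W"
    and cod2_in: "t \<in> two_cells W \<Longrightarrow> cod2 W t \<in> one_cells W"
    and src_cod2: "t \<in> two_cells W \<Longrightarrow> src W (cod2 W t) = src W (dom2 W t)"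
    and trg_cod2: "t \<in> two_cells W \<Longrightarrow> trg W (cod2 W t) = trg W (dom2 W t)"
  using bic[unfolded bicategory_def] by (elim conjE; auto simp: one_hom_def)+

lemma cat_hom: "x \<in> zero_cells W \<Longrightarrow> y \<in> zero_cells W \<Longrightarrow> category (hom_cat W x y)"
  using bic[unfolded bicategory_def] by (elim conjE) blast

lemma id2_cells:
  assumes "f \<in> one_cells W"
  shows "id2 W f \<in> two_cells W" "dom2 W (id2 W f) = f" "cod2 W (id2 W f) = f"
proof -
  have "category (hom_cat W (src W f) (trg W f))"
    using assms ax by (intro cat_hom) auto
  then have "id2 W f \<in> arrows (hom_cat W (src W f) (trg W f)) f f"
    using assms unfolding category_def by (auto simp: hom_cat_def one_hom_def)
  then show "id2 W f \<in> two_cells W" "dom2 W (id2 W f) = f" "cod2 W (id2 W f) = f"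
    by (auto simp: arrows_def hom_cat_def)
qed

lemma hom_cat_sel [simp]:
  "Ob (hom_cat W x y) = one_hom W x y" "Dom (hom_cat W x y) = dom2 W" "Cod (hom_cat W x y) = cod2 W"
  "Idt (hom_cat W x y) = id2 W" "Comp (hom_cat W x y) = vcomp W"
  "Ar (hom_cat W x y) = {t \<in> two_cells W. dom2 W t \<in> one_hom W x y}"
  by (auto simp: hom_cat_def)

lemma vc:
  assumes "s \<in> two_cells W" "t \<in> two_cells W" "cod2 W s = dom2 W t"
  shows vc_in: "t \<cdot> s \<in> two_cells W"
    and vc_dom: "dom2 W (t \<cdot> s) = dom2 W s" and vc_cod: "cod2 W (t \<cdot> s) = cod2 W t"
proof -
  let ?H = "hom_cat W (src W (dom2 W s)) (trg W (dom2 W s))"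
  have "category ?H"
    using assms ax by (intro cat_hom) auto
  moreover have "s \<in> Ar ?H" "t \<in> Ar ?H"
    using assms src_cod2[of s] trg_cod2[of s] dom2_in[of t] dom2_in[of s]
    by (auto simp: one_hom_def)
  ultimately have "t \<cdot> s \<in> arrows ?H (dom2 W s) (cod2 W t)"
    using assms(3) unfolding category_def by (metis hom_cat_sel(2,3,5))
  then show "t \<cdot> s \<in> two_cells W" "dom2 W (t \<cdot> s) = dom2 W s" "cod2 W (t \<cdot> s) = cod2 W t"
    by (auto simp: arrows_def)
qed

lemma vc_id:
  assumes "t \<in> two_cells W"
  shows vc_id_right: "dom2 W t = f \<Longrightarrow> t \<cdot> id2 W f = t" and vc_id_left: "cod2 W t = g \<Longrightarrow> id2 W g \<cdot> t = t"
proof -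
  let ?H = "hom_cat W (src W (dom2 W t)) (trg W (dom2 W t))"
  have "category ?H"
    using assms ax by (intro cat_hom) auto
  moreover have "t \<in> Ar ?H"
    using assms dom2_in[of t] by (auto simp: one_hom_def)
  ultimately have "t \<cdot> id2 W (dom2 W t) = t \<and> id2 W (cod2 W t) \<cdot> t = t"
    unfolding category_def by (metis hom_cat_sel(2,3,4,5))
  then show "dom2 W t = f \<Longrightarrow> t \<cdot> id2 W f = t" "cod2 W t = g \<Longrightarrow> id2 W g \<cdot> t = t"
    by auto
qed

lemma vc_assoc:
  assumes "r \<in> two_cells W" "s \<in> two_cells W" "t \<in> two_cells W" "cod2 W r = dom2 W s" "cod2 W s = dom2 W t"
  shows "(t \<cdot> s) \<cdot> r = t \<cdot> s \<cdot> r"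
proof -
  let ?H = "hom_cat W (src W (dom2 W r)) (trg W (dom2 W r))"
  have "category ?H"
    using assms ax by (intro cat_hom) auto
  moreover have "r \<in> Ar ?H" "s \<in> Ar ?H" "t \<in> Ar ?H"
    using assms src_cod2[of r] trg_cod2[of r] src_cod2[of s] trg_cod2[of s]
      dom2_in[of t] dom2_in[of s] dom2_in[of r]
    by (auto simp: one_hom_def)
  ultimately show ?thesis
    using assms unfolding category_def by (metis hom_cat_sel(2,3,5))
qed

lemma unit1_in:
  assumes "x \<in> zero_cells W"
  shows "unit1 W x \<in> one_cells W" "src W (unit1 W x) = x" "trg W (unit1 W x) = x"
  using bic[unfolded bicategory_def] assms by (elim conjE; auto simp: one_hom_def)+

lemma tens1_in:
  assumes "f \<in> one_cells W" "g \<in> one_cells W" "trg W f = src W g"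
  shows "g \<otimes> f \<in> one_cells W" "src W (g \<otimes> f) = src W f" "trg W (g \<otimes> f) = trg W g"
    "id2 W g \<odot> id2 W f = id2 W (g \<otimes> f)"
  using bic[unfolded bicategory_def] assms by (elim conjE; auto simp: one_hom_def)+

lemma tens2_in:
  assumes "s \<in> two_cells W" "t \<in> two_cells W" "trg W (dom2 W s) = src W (dom2 W t)"
  shows "t \<odot> s \<in> two_cells W" "dom2 W (t \<odot> s) = dom2 W t \<otimes> dom2 W s"
    "cod2 W (t \<odot> s) = cod2 W t \<otimes> cod2 W s"
  using bic[unfolded bicategory_def] assms by (elim conjE; auto simp: cells_def)+

lemma interchange:
  assumes "s \<in> two_cells W" "s' \<in> two_cells W" "t \<in> two_cells W" "t' \<in> two_cells W"
    "cod2 W s = dom2 W s'" "cod2 W t = dom2 W t'" "trg W (dom2 W s) = src W (dom2 W t)"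
  shows "(t' \<odot> s') \<cdot> (t \<odot> s) = (t' \<cdot> t) \<odot> (s' \<cdot> s)"
  using bic[unfolded bicategory_def] assms by (elim conjE) (rule sym, blast)

section \<open>Inverse 2-cells and unit coherence\<close>

lemma inv2_props:
  assumes "invertible W t"
  shows "inverse_cells W t (inv2 W t)"
proof -
  obtain s where s: "inverse_cells W t s" using assms by (auto simp: invertible_def)
  have "s' = s" if s': "inverse_cells W t s'" for s'
  proof -
    have "s' = s' \<cdot> (t \<cdot> s)"
      using s s' by (auto simp: inverse_cells_def cells_def vc_id)
    also have "\<dots> = (s' \<cdot> t) \<cdot> s"
      using s s' by (subst vc_assoc) (auto simp: inverse_cells_def cells_def)
    also have "\<dots> = s"
      using s s' by (auto simp: inverse_cells_def cells_def vc_id)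
    finally show ?thesis .
  qed
  with s show ?thesis unfolding inv2_def by (metis theI)
qed

lemma inv2_in:
  assumes "invertible W t"
  shows "t \<in> two_cells W" "inv2 W t \<in> two_cells W" "dom2 W (inv2 W t) = cod2 W t"
    "cod2 W (inv2 W t) = dom2 W t"
    "inv2 W t \<cdot> t = id2 W (dom2 W t)" "t \<cdot> inv2 W t = id2 W (cod2 W t)"
  using inv2_props[OF assms] by (auto simp: inverse_cells_def cells_def)

lemma inv2_cancel:
  assumes "invertible W t" "s \<in> two_cells W"
  shows "cod2 W s = dom2 W t \<Longrightarrow> inv2 W t \<cdot> t \<cdot> s = s"
    and "cod2 W s = cod2 W t \<Longrightarrow> t \<cdot> inv2 W t \<cdot> s = s"
proof -
  note i = inv2_in[OF assms(1)]
  show "inv2 W t \<cdot> t \<cdot> s = s" if "cod2 W s = dom2 W t"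
    using vc_assoc[OF assms(2) i(1,2) that i(3)[symmetric]] i(5) vc_id_left[OF assms(2) that] by simp
  show "t \<cdot> inv2 W t \<cdot> s = s" if "cod2 W s = cod2 W t"
    using vc_assoc[OF assms(2) i(2,1) _ i(4)] that i(3,6) vc_id_left[OF assms(2) that] by simp
qed

lemma inv2_eqI:
  assumes "t \<in> two_cells W" "s \<in> two_cells W" "dom2 W s = cod2 W t" "cod2 W s = dom2 W t"
    "s \<cdot> t = id2 W (dom2 W t)" "t \<cdot> s = id2 W (cod2 W t)"
  shows "invertible W t" "inv2 W t = s"
proof -
  have s: "inverse_cells W t s" using assms by (auto simp: inverse_cells_def cells_def)
  then show i: "invertible W t" by (auto simp: invertible_def)
  have "inv2 W t = inv2 W t \<cdot> t \<cdot> s"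
    using vc_id_right[OF inv2_in(2,3)[OF i]] assms(6) by simp
  also have "\<dots> = s" by (rule inv2_cancel(1)[OF i assms(2,4)])
  finally show "inv2 W t = s" .
qed

lemma invertible_comp:
  assumes "invertible W s" "invertible W t" "cod2 W s = dom2 W t"
  shows "invertible W (t \<cdot> s)"
proof (rule inv2_eqI(1)[of _ "inv2 W s \<cdot> inv2 W t"])
qed (use assms inv2_in[OF assms(1)] inv2_in[OF assms(2)] in
    \<open>auto simp: vc vc_assoc inv2_cancel\<close>)

lemma invertible_inv: "invertible W t \<Longrightarrow> invertible W (inv2 W t)"
  by (rule inv2_eqI(1)[of _ t]) (auto simp: inv2_in)

lemma invertible_id: "f \<in> one_cells W \<Longrightarrow> invertible W (id2 W f)"
  by (rule inv2_eqI(1)[of _ "id2 W f"]) (auto simp: id2_cells vc_id)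

lemma invertible_tens:
  assumes "invertible W s" "invertible W t" "trg W (dom2 W s) = src W (dom2 W t)"
  shows "invertible W (t \<odot> s)" "inv2 W (t \<odot> s) = inv2 W t \<odot> inv2 W s"
proof -
  have 1: "trg W (cod2 W s) = src W (cod2 W t)"
    using assms inv2_in[OF assms(1)] inv2_in[OF assms(2)] by (simp add: src_cod2 trg_cod2)
  note * = inv2_eqI[of "t \<odot> s" "inv2 W t \<odot> inv2 W s"]
  have "t \<odot> s \<in> two_cells W" "inv2 W t \<odot> inv2 W s \<in> two_cells W"
    "dom2 W (inv2 W t \<odot> inv2 W s) = cod2 W (t \<odot> s)"
    "cod2 W (inv2 W t \<odot> inv2 W s) = dom2 W (t \<odot> s)"
    "(inv2 W t \<odot> inv2 W s) \<cdot> (t \<odot> s) = id2 W (dom2 W (t \<odot> s))"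
    "(t \<odot> s) \<cdot> (inv2 W t \<odot> inv2 W s) = id2 W (cod2 W (t \<odot> s))"
    using assms inv2_in[OF assms(1)] inv2_in[OF assms(2)] 1
    by (auto simp: tens2_in interchange tens1_in dom2_in cod2_in)
  from *[OF this] show "invertible W (t \<odot> s)" "inv2 W (t \<odot> s) = inv2 W t \<odot> inv2 W s" by auto
qed

lemma assoc_in:
  assumes "f \<in> one_cells W" "g \<in> one_cells W" "h \<in> one_cells W" "trg W f = src W g" "trg W g = src W h"
  shows "assoc W h g f \<in> two_cells W" "dom2 W (assoc W h g f) = (h \<otimes> g) \<otimes> f"
    "cod2 W (assoc W h g f) = h \<otimes> g \<otimes> f" "invertible W (assoc W h g f)"
  using bic[unfolded bicategory_def] assms by (elim conjE; auto simp: cells_def)+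

lemma assoc_nat:
  assumes "r \<in> two_cells W" "s \<in> two_cells W" "t \<in> two_cells W"
    "trg W (dom2 W r) = src W (dom2 W s)" "trg W (dom2 W s) = src W (dom2 W t)"
  shows "assoc W (cod2 W t) (cod2 W s) (cod2 W r) \<cdot> ((t \<odot> s) \<odot> r) =
        (t \<odot> (s \<odot> r)) \<cdot> assoc W (dom2 W t) (dom2 W s) (dom2 W r)"
  using bic[unfolded bicategory_def] assms by (elim conjE) blast

lemma lun_in:
  assumes "f \<in> one_cells W"
  shows "lun W f \<in> two_cells W" "dom2 W (lun W f) = unit1 W (trg W f) \<otimes> f"
    "cod2 W (lun W f) = f" "invertible W (lun W f)"
  using bic[unfolded bicategory_def] assms by (elim conjE; auto simp: cells_def)+

lemma run_in:
  assumes "f \<in> one_cells W"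
  shows "run W f \<in> two_cells W" "dom2 W (run W f) = f \<otimes> unit1 W (src W f)"
    "cod2 W (run W f) = f" "invertible W (run W f)"
  using bic[unfolded bicategory_def] assms by (elim conjE; auto simp: cells_def)+

lemma unit_nat:
  assumes "t \<in> two_cells W"
  shows lun_nat: "lun W (cod2 W t) \<cdot> (id2 W (unit1 W (trg W (dom2 W t))) \<odot> t) = t \<cdot> lun W (dom2 W t)"
    and run_nat: "run W (cod2 W t) \<cdot> (t \<odot> id2 W (unit1 W (src W (dom2 W t)))) = t \<cdot> run W (dom2 W t)"
  using bic[unfolded bicategory_def] assms by (elim conjE; auto)+

lemma triangle:
  assumes "f \<in> one_cells W" "g \<in> one_cells W" "trg W f = src W g"
  shows "(id2 W g \<odot> lun W f) \<cdot> assoc W g (unit1 W (src W g)) f = run W g \<odot> id2 W f"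
  using bic[unfolded bicategory_def] assms by (elim conjE; auto)

lemma pentagon:
  assumes "f \<in> one_cells W" "g \<in> one_cells W" "h \<in> one_cells W" "k \<in> one_cells W"
        "trg W f = src W g" "trg W g = src W h" "trg W h = src W k"
  shows "assoc W k h (g \<otimes> f) \<cdot> assoc W (k \<otimes> h) g f =
        (id2 W k \<odot> assoc W h g f) \<cdot> assoc W k (h \<otimes> g) f \<cdot> (assoc W k h g \<odot> id2 W f)"
  using bic[unfolded bicategory_def] assms by (elim conjE; auto)

lemmas bi [simp] = src_in trg_in dom2_in cod2_in src_cod2 trg_cod2 id2_cells vc vc_id unit1_in
  tens1_in(1-3) tens2_in assoc_in(1-3) lun_in(1-3) run_in(1-3)
lemmas bi_inv [simp] = assoc_in(4) lun_in(4) run_in(4) inv2_in(2-6) inv2_cancel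

lemma cancel_left:
  assumes "t \<cdot> r = t \<cdot> s"
    and "invertible W t" "r \<in> two_cells W" "s \<in> two_cells W" "cod2 W r = dom2 W t" "cod2 W s = dom2 W t"
  shows "r = s"
  using assms by (metis inv2_cancel(1))

lemma cancel_right:
  assumes eq: "r \<cdot> t = s \<cdot> t"
    and "invertible W t" "r \<in> two_cells W" "s \<in> two_cells W" "cod2 W t = dom2 W r" "cod2 W t = dom2 W s"
  shows "r = s"
proof -
  have "r = (r \<cdot> t) \<cdot> inv2 W t" using assms(2-6) inv2_in(1)[OF assms(2)] by (simp add: vc_assoc)
  also have "\<dots> = s" unfolding eq using assms(2-6) inv2_in(1)[OF assms(2)] by (simp add: vc_assoc)
  finally show ?thesis .
qed

text \<open>Naturality of the unit constraints conjugates \<open>I \<otimes> s\<close> and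
  \<open>s \<otimes> I\<close> into \<open>s\<close>, and the constraints are invertible.\<close>

lemma unit_faithful:
  assumes "s \<in> two_cells W" "t \<in> two_cells W" "dom2 W s = dom2 W t" "cod2 W s = cod2 W t"
  shows "id2 W (unit1 W (trg W (dom2 W s))) \<odot> s = id2 W (unit1 W (trg W (dom2 W s))) \<odot> t \<Longrightarrow> s = t"
    and "s \<odot> id2 W (unit1 W (src W (dom2 W s))) = t \<odot> id2 W (unit1 W (src W (dom2 W s))) \<Longrightarrow> s = t"
proof -
  assume "id2 W (unit1 W (trg W (dom2 W s))) \<odot> s = id2 W (unit1 W (trg W (dom2 W s))) \<odot> t"
  then have "s \<cdot> lun W (dom2 W s) = t \<cdot> lun W (dom2 W s)"
    using assms lun_nat[of s] lun_nat[of t] by simp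
  then show "s = t" by (rule cancel_right) (use assms in auto)
next
  assume "s \<odot> id2 W (unit1 W (src W (dom2 W s))) = t \<odot> id2 W (unit1 W (src W (dom2 W s)))"
  then have "s \<cdot> run W (dom2 W s) = t \<cdot> run W (dom2 W s)"
    using assms run_nat[of s] run_nat[of t] by simp
  then show "s = t" by (rule cancel_right) (use assms in auto)
qed

text \<open>This unit law is not an axiom; the axioms contain only the triangle with the unit in the
  middle. As tensoring with a unit is faithful, it may be proved after applying
  \<open>I \<otimes> -\<close>, where the pentagon for \<open>I\<close>, \<open>I\<close>,
  \<open>g\<close>, \<open>f\<close> and two instances of the triangle give it.\<close>

lemma lun_tens:
  assumes "f \<in> one_cells W" "g \<in> one_cells W" "trg W f = src W g"
  shows "lun W (g \<otimes> f) \<cdot> assoc W (unit1 W (trg W g)) g f = lun W g \<odot> id2 W f"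
proof -
  let ?I = "unit1 W (trg W g)"
  let ?r = "lun W (g \<otimes> f) \<cdot> assoc W ?I g f" and ?s = "lun W g \<odot> id2 W f"
  \<comment> \<open>The rebracketing \<open>((I \<otimes> I) \<otimes> g) \<otimes> f \<rightarrow>
    I \<otimes> (I \<otimes> g) \<otimes> f\<close>. It is invertible, hence can be cancelled at the
    end, and it is part of one side of the pentagon.\<close>
  let ?p = "assoc W ?I (?I \<otimes> g) f \<cdot> (assoc W ?I ?I g \<odot> id2 W f)"
  have "invertible W ?p"
    using assms by (intro invertible_comp invertible_tens invertible_id) auto
  have "(id2 W ?I \<odot> ?r) \<cdot> ?p = (id2 W ?I \<odot> ?s) \<cdot> ?p"
  proof -
    have "(id2 W ?I \<odot> ?r) \<cdot> ?p =
        (id2 W ?I \<odot> lun W (g \<otimes> f)) \<cdot> (id2 W ?I \<odot> assoc W ?I g f) \<cdot> ?p"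
      using assms by (simp add: vc_assoc[symmetric] interchange del: vc_assoc)
    also have "\<dots> = (id2 W ?I \<odot> lun W (g \<otimes> f)) \<cdot> assoc W ?I ?I (g \<otimes> f) \<cdot> assoc W (?I \<otimes> ?I) g f"
      using assms by (simp add: pentagon)
    also have "\<dots> = (run W ?I \<odot> id2 W (g \<otimes> f)) \<cdot> assoc W (?I \<otimes> ?I) g f"
      using assms triangle[of "g \<otimes> f" ?I] by (simp add: vc_assoc[symmetric])
    also have "\<dots> = assoc W ?I g f \<cdot> ((run W ?I \<odot> id2 W g) \<odot> id2 W f)"
      using assms assoc_nat[of "id2 W f" "id2 W g" "run W ?I"] by (simp add: tens1_in)
    also have "(run W ?I \<odot> id2 W g) \<odot> id2 W f =
        ((id2 W ?I \<odot> lun W g) \<odot> id2 W f) \<cdot> (assoc W ?I ?I g \<odot> id2 W f)"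
      using assms triangle[of g ?I] by (simp add: interchange)
    also have "assoc W ?I g f \<cdot> \<dots> = (id2 W ?I \<odot> ?s) \<cdot> ?p"
      using assms assoc_nat[of "id2 W f" "lun W g" "id2 W ?I"] by (simp add: vc_assoc[symmetric])
    finally show ?thesis .
  qed
  then have eq: "id2 W ?I \<odot> ?r = id2 W ?I \<odot> ?s"
    by (rule cancel_right) (fact | (use assms in \<open>simp; fail\<close>))+
  show ?thesis
  proof (rule unit_faithful(1))
    show "id2 W (unit1 W (trg W (dom2 W ?r))) \<odot> ?r = id2 W (unit1 W (trg W (dom2 W ?r))) \<odot> ?s"
      using assms eq by simp
  qed (use assms in simp_all)
qed

end

section \<open>Elements of 1-cells\<close>

text \<open>\<open>Elem f k t\<close> stands for a 2-cell \<open>t : j \<rightarrow> f \<otimes> k\<close>; the source \<open>j\<close> is recovered as the domain of \<open>t\<close>.\<close>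

datatype ('f, 'c) elem = Elem (lab: 'f) (tgt: 'f) (cel: 'c)

context bicat
begin

definition sor :: "('f, 'c) elem \<Rightarrow> 'f" where "sor x = dom2 W (cel x)"

definition el :: "('f, 'c) elem \<Rightarrow> bool" where
  "el x \<longleftrightarrow> lab x \<in> one_cells W \<and> tgt x \<in> one_cells W \<and> trg W (tgt x) = src W (lab x) \<and>
     cel x \<in> two_cells W \<and> cod2 W (cel x) = lab x \<otimes> tgt x"

definition ap :: "'c \<Rightarrow> ('f, 'c) elem \<Rightarrow> ('f, 'c) elem"  (infixr "\<rhd>" 65) where
  "t \<rhd> x = Elem (cod2 W t) (tgt x) ((t \<odot> id2 W (tgt x)) \<cdot> cel x)"

text \<open>The 2-cell of \<open>y\<close> is plugged into the target of \<open>x\<close>: \<open>j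
  \<rightarrow> f \<otimes> k \<rightarrow> f \<otimes> (g \<otimes> l)\<close>, with the brackets
  moved once so that the result is again an element.\<close>

definition pr :: "('f, 'c) elem \<Rightarrow> ('f, 'c) elem \<Rightarrow> ('f, 'c) elem"  (infixr "><" 75) where
  "x >< y = Elem (lab x \<otimes> lab y) (tgt y)
     (inv2 W (assoc W (lab x) (lab y) (tgt y)) \<cdot> (id2 W (lab x) \<odot> cel y) \<cdot> cel x)"

text \<open>The neutral factor for pairings, up to \<open>lun\<close> and \<open>run\<close>. Its
  2-cell \<open>k \<rightarrow> I \<otimes> k\<close> is invertible, so it can be used for
  testing.\<close>

definition one :: "'f \<Rightarrow> ('f, 'c) elem" where
  "one k = Elem (unit1 W (trg W k)) k (inv2 W (lun W k))"

text \<open>The universal element of \<open>f\<close> with target \<open>k\<close>: the 2-cell of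
  \<open>t \<rhd> gen f k\<close> is \<open>t \<otimes> k\<close> itself.\<close>

definition gen :: "'f \<Rightarrow> 'f \<Rightarrow> ('f, 'c) elem" where
  "gen f k = Elem f k (id2 W (f \<otimes> k))"

lemma elem_eqI: "\<lbrakk>lab x = lab y; tgt x = tgt y; cel x = cel y\<rbrakk> \<Longrightarrow> x = y"
  by (rule elem.expand) simp

lemma el_D:
  assumes "el x"
  shows "lab x \<in> one_cells W" "tgt x \<in> one_cells W" "trg W (tgt x) = src W (lab x)"
    "cel x \<in> two_cells W" "cod2 W (cel x) = lab x \<otimes> tgt x" "dom2 W (cel x) = sor x"
    "sor x \<in> one_cells W" "src W (sor x) = src W (tgt x)" "trg W (sor x) = trg W (lab x)"
proof -
  show *: "lab x \<in> one_cells W" "tgt x \<in> one_cells W" "trg W (tgt x) = src W (lab x)"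
    "cel x \<in> two_cells W" "cod2 W (cel x) = lab x \<otimes> tgt x" "dom2 W (cel x) = sor x"
    "sor x \<in> one_cells W"
    using assms by (auto simp: el_def sor_def)
  show "src W (sor x) = src W (tgt x)" "trg W (sor x) = trg W (lab x)"
    using src_cod2[OF *(4)] trg_cod2[OF *(4)] * by simp_all
qed

lemmas el_trg [simp] = el_D(3,9)

lemma el_sel [simp]:
  "lab (t \<rhd> x) = cod2 W t" "tgt (t \<rhd> x) = tgt x"
  "lab (x >< y) = lab x \<otimes> lab y" "tgt (x >< y) = tgt y"
  "lab (one k) = unit1 W (trg W k)" "tgt (one k) = k"
  "lab (gen f k) = f" "tgt (gen f k) = k"
  by (auto simp: ap_def pr_def one_def gen_def)

lemma cel_sel:
  "cel (t \<rhd> x) = (t \<odot> id2 W (tgt x)) \<cdot> cel x"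
  "cel (x >< y) = inv2 W (assoc W (lab x) (lab y) (tgt y)) \<cdot> (id2 W (lab x) \<odot> cel y) \<cdot> cel x"
  "cel (one k) = inv2 W (lun W k)" "cel (gen f k) = id2 W (f \<otimes> k)"
  by (auto simp: ap_def pr_def one_def gen_def)

lemma ap_el [simp]:
  assumes "el x" "t \<in> two_cells W" "dom2 W t = lab x"
  shows "el (t \<rhd> x)" "sor (t \<rhd> x) = sor x"
  using assms(2,3) el_D[OF assms(1)] src_cod2[of t] by (auto simp: el_def[of "t \<rhd> x"] sor_def[of "t \<rhd> x"] cel_sel)

lemma pr_el [simp]:
  assumes "el x" "el y" "tgt x = sor y"
  shows "el (x >< y)" "sor (x >< y) = sor x"
proof -
  have "src W (lab x) = trg W (lab y)"
    using el_D[OF assms(1)] el_D[OF assms(2)] assms(3) by metis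
  then show "el (x >< y)" "sor (x >< y) = sor x"
    using assms(3) el_D[OF assms(1)] el_D[OF assms(2)]
    by (auto simp: el_def[of "x >< y"] sor_def[of "x >< y"] cel_sel)
qed

lemma one_el [simp]:
  assumes "k \<in> one_cells W"
  shows "el (one k)" "sor (one k) = k"
  using assms by (auto simp: el_def sor_def cel_sel)

lemma gen_el [simp]:
  assumes "f \<in> one_cells W" "k \<in> one_cells W" "trg W k = src W f"
  shows "el (gen f k)" "sor (gen f k) = f \<otimes> k"
  using assms by (auto simp: el_def sor_def cel_sel)

lemma el_simps [simp]:
  "el x \<Longrightarrow> lab x \<in> one_cells W" "el x \<Longrightarrow> tgt x \<in> one_cells W" "el x \<Longrightarrow> sor x \<in> one_cells W"
  by (auto simp: el_D)

lemma el_seq: "\<lbrakk>el x; el y; tgt x = sor y\<rbrakk> \<Longrightarrow> src W (lab x) = trg W (lab y)"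
  by (metis el_D(3,9))

lemma ap_comp:
  assumes "el x" "s \<in> two_cells W" "t \<in> two_cells W" "dom2 W s = lab x" "cod2 W s = dom2 W t"
  shows "(t \<cdot> s) \<rhd> x = t \<rhd> s \<rhd> x"
proof (rule elem_eqI)
  note e = el_D[OF assms(1)]
  have "(t \<odot> id2 W (tgt x)) \<cdot> (s \<odot> id2 W (tgt x)) = (t \<cdot> s) \<odot> id2 W (tgt x)"
    using assms(2-) e by (subst interchange) auto
  moreover have "src W (dom2 W t) = src W (lab x)"
    using assms(2-) e src_cod2[of s] by simp
  ultimately show "cel ((t \<cdot> s) \<rhd> x) = cel (t \<rhd> s \<rhd> x)"
    using assms(2-) e unfolding cel_sel el_sel by (subst vc_assoc[symmetric]) auto
qed (use assms in auto)

lemma ap_id [simp]: "el x \<Longrightarrow> lab x = f \<Longrightarrow> id2 W f \<rhd> x = x"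
  using el_D[of x] by (intro elem_eqI) (auto simp: cel_sel tens1_in(4))

text \<open>Interchange separates \<open>t\<close> from \<open>s\<close>, and naturality of the
  associativity constraint carries both through the rebracketing inside a pairing.\<close>

lemma ap_tens:
  assumes "el x" "el y" "tgt x = sor y" "t \<in> two_cells W" "s \<in> two_cells W" "dom2 W t = lab x" "dom2 W s = lab y"
  shows "(t \<odot> s) \<rhd> (x >< y) = (t \<rhd> x) >< (s \<rhd> y)"
proof (rule elem_eqI)
  note x = el_D[OF assms(1)] and y = el_D[OF assms(2)]
  have 1: "src W (lab x) = trg W (lab y)" using assms el_seq by blast
  let ?l = "tgt y" and ?f' = "cod2 W t" and ?g' = "cod2 W s"
  have c: "src W ?f' = trg W (lab y)" "src W ?g' = src W (lab y)" "trg W ?g' = trg W (lab y)"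
    using assms(4-7) 1 by auto
  let ?\<alpha> = "assoc W (lab x) (lab y) ?l" and ?\<beta> = "assoc W ?f' ?g' ?l"
  have nat: "?\<beta> \<cdot> ((t \<odot> s) \<odot> id2 W ?l) = (t \<odot> (s \<odot> id2 W ?l)) \<cdot> ?\<alpha>"
    using assoc_nat[of "id2 W ?l" s t] assms(3-) x y 1 c by simp
  \<comment> \<open>Composing with the constraint at the codomains cancels the inverse on the
    right-hand side and lets naturality act on the left-hand side.\<close>
  have "?\<beta> \<cdot> cel ((t \<odot> s) \<rhd> (x >< y)) = ?\<beta> \<cdot> cel ((t \<rhd> x) >< (s \<rhd> y))"
  proof -
    have i: "inv2 W ?\<alpha> \<in> two_cells W" "dom2 W (inv2 W ?\<alpha>) = lab x \<otimes> lab y \<otimes> ?l"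
      "cod2 W (inv2 W ?\<alpha>) = (lab x \<otimes> lab y) \<otimes> ?l" "invertible W ?\<alpha>" "?\<alpha> \<in> two_cells W"
      "dom2 W ?\<alpha> = (lab x \<otimes> lab y) \<otimes> ?l" "cod2 W ?\<alpha> = lab x \<otimes> lab y \<otimes> ?l"
      using x y 1 by auto
    have b: "?\<beta> \<in> two_cells W" "dom2 W ?\<beta> = (?f' \<otimes> ?g') \<otimes> ?l" "invertible W ?\<beta>"
      "cod2 W ?\<beta> = ?f' \<otimes> ?g' \<otimes> ?l"
      using assms(3-) x y c by auto
    let ?z = "(id2 W (lab x) \<odot> cel y) \<cdot> cel x"
    have z: "?z \<in> two_cells W" "dom2 W ?z = sor x" "cod2 W ?z = lab x \<otimes> lab y \<otimes> ?l"
      using assms(3-) x y 1 by auto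
    have t: "(t \<odot> s) \<odot> id2 W ?l \<in> two_cells W" "dom2 W ((t \<odot> s) \<odot> id2 W ?l) = (lab x \<otimes> lab y) \<otimes> ?l"
      "cod2 W ((t \<odot> s) \<odot> id2 W ?l) = (?f' \<otimes> ?g') \<otimes> ?l"
      "t \<odot> (s \<odot> id2 W ?l) \<in> two_cells W" "dom2 W (t \<odot> (s \<odot> id2 W ?l)) = lab x \<otimes> lab y \<otimes> ?l"
      using assms(3-) x y 1 c by auto
    have "?\<beta> \<cdot> cel ((t \<odot> s) \<rhd> (x >< y)) = (?\<beta> \<cdot> ((t \<odot> s) \<odot> id2 W ?l)) \<cdot> inv2 W ?\<alpha> \<cdot> ?z"
      unfolding cel_sel el_sel using i b t z by (simp add: vc_assoc)
    also have "\<dots> = (t \<odot> (s \<odot> id2 W ?l)) \<cdot> ?z"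
      unfolding nat using i t z by (simp add: vc_assoc)
    also have "\<dots> = (id2 W ?f' \<odot> ((s \<odot> id2 W ?l) \<cdot> cel y)) \<cdot> (t \<odot> id2 W (tgt x)) \<cdot> cel x"
      using assms(3-) x y 1 c by (simp add: vc_assoc[symmetric] interchange)
    also have "\<dots> = ?\<beta> \<cdot> cel ((t \<rhd> x) >< (s \<rhd> y))"
      unfolding cel_sel el_sel using b assms(3-) x y 1 c by (subst inv2_cancel) auto
    finally show ?thesis .
  qed
  then show "cel ((t \<odot> s) \<rhd> (x >< y)) = cel ((t \<rhd> x) >< (s \<rhd> y))"
  proof (rule cancel_left)
    have e: "el ((t \<odot> s) \<rhd> (x >< y))" "el ((t \<rhd> x) >< (s \<rhd> y))"
      using assms 1 by auto
    show "cel ((t \<odot> s) \<rhd> (x >< y)) \<in> two_cells W" "cel ((t \<rhd> x) >< (s \<rhd> y)) \<in> two_cells W"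
      using el_D[OF e(1)] el_D[OF e(2)] by auto
  qed (use assms(3-) x y c 1 el_D(5)[of "(t \<odot> s) \<rhd> (x >< y)"] el_D(5)[of "(t \<rhd> x) >< (s \<rhd> y)"] assms(1,2) in auto)
qed (use assms el_seq in \<open>auto\<close>)

text \<open>This is the pentagon: the two sides follow its two routes for \<open>f\<close>,
  \<open>g\<close>, \<open>h\<close> and the target of \<open>z\<close>.\<close>

lemma ap_assoc:
  assumes "el x" "el y" "el z" "tgt x = sor y" "tgt y = sor z" "lab x = f" "lab y = g" "lab z = h"
  shows "assoc W f g h \<rhd> ((x >< y) >< z) = x >< y >< z"
proof (rule elem_eqI)
  note x = el_D[OF assms(1)] and y = el_D[OF assms(2)] and z = el_D[OF assms(3)]
  have 1: "src W f = trg W g" "src W g = trg W h"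
    using assms el_seq[OF assms(1,2)] el_seq[OF assms(2,3)] by auto
  let ?l = "tgt z" and ?a = "assoc W f g h"
  note [simp] = assms(4-) x[unfolded assms(4-)] y[unfolded assms(4-)] z[unfolded assms(4-)] 1
  let ?f = "id2 W f" and ?a1 = "assoc W f g (sor z)" and ?a2 = "assoc W f g (h \<otimes> ?l)"
    and ?a3 = "assoc W (f \<otimes> g) h ?l" and ?a4 = "assoc W g h ?l" and ?a5 = "assoc W f (g \<otimes> h) ?l"
  let ?w = "inv2 W ?a1 \<cdot> (?f \<odot> cel y) \<cdot> cel x"
  have o[simp]: "f \<in> one_cells W" "g \<in> one_cells W" "h \<in> one_cells W"
    using x y z by auto
  have [simp]: "?a1 \<in> two_cells W" "?a2 \<in> two_cells W" "?a3 \<in> two_cells W" "?a4 \<in> two_cells W" "?a5 \<in> two_cells W"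
    "inv2 W ?a1 \<in> two_cells W" "inv2 W ?a2 \<in> two_cells W" "inv2 W ?a3 \<in> two_cells W" "inv2 W ?a4 \<in> two_cells W" "inv2 W ?a5 \<in> two_cells W"
    by auto
  have p: "?a2 \<cdot> ?a3 = (?f \<odot> ?a4) \<cdot> ?a5 \<cdot> (?a \<odot> id2 W ?l)"
    by (rule pentagon) auto
  have w[simp]: "?w \<in> two_cells W" "dom2 W ?w = sor x" "cod2 W ?w = (f \<otimes> g) \<otimes> sor z"
    by auto
  let ?c = "(id2 W (f \<otimes> g) \<odot> cel z) \<cdot> ?w"
  have c[simp]: "?c \<in> two_cells W" "dom2 W ?c = sor x" "cod2 W ?c = (f \<otimes> g) \<otimes> h \<otimes> ?l"
    by auto
  \<comment> \<open>Naturality at \<open>cel z\<close> makes the constraint \<open>?a1\<close>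
    appear, which cancels against its inverse inside \<open>?w\<close>.\<close>
  have 2: "?a2 \<cdot> ?c = (?f \<odot> ((id2 W g \<odot> cel z) \<cdot> cel y)) \<cdot> cel x"
  proof -
    have "?a2 \<cdot> ?c = (?a2 \<cdot> ((?f \<odot> id2 W g) \<odot> cel z)) \<cdot> ?w"
      by (simp add: vc_assoc tens1_in(4))
    also have "?a2 \<cdot> ((?f \<odot> id2 W g) \<odot> cel z) = (?f \<odot> (id2 W g \<odot> cel z)) \<cdot> ?a1"
      using assoc_nat[of "cel z" "id2 W g" ?f] by simp
    also have "\<dots> \<cdot> ?w = (?f \<odot> (id2 W g \<odot> cel z)) \<cdot> (?f \<odot> cel y) \<cdot> cel x"
      by (simp add: vc_assoc)
    also have "\<dots> = (?f \<odot> ((id2 W g \<odot> cel z) \<cdot> cel y)) \<cdot> cel x"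
      by (simp add: vc_assoc[symmetric] interchange)
    finally show ?thesis .
  qed
  let ?q = "(?a \<odot> id2 W ?l) \<cdot> inv2 W ?a3 \<cdot> ?c"
  have q[simp]: "?q \<in> two_cells W" "cod2 W ?q = (f \<otimes> g \<otimes> h) \<otimes> ?l" by auto
  have "(?f \<odot> ?a4) \<cdot> ?a5 \<cdot> ?q = ((?f \<odot> ?a4) \<cdot> ?a5 \<cdot> (?a \<odot> id2 W ?l)) \<cdot> inv2 W ?a3 \<cdot> ?c"
    by (simp add: vc_assoc)
  also have "\<dots> = ?a2 \<cdot> ?c"
    unfolding p[symmetric] by (simp add: vc_assoc)
  finally have 3: "(?f \<odot> ?a4) \<cdot> ?a5 \<cdot> ?q = (?f \<odot> ((id2 W g \<odot> cel z) \<cdot> cel y)) \<cdot> cel x"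
    unfolding 2 .
  let ?r = "inv2 W ?a5 \<cdot> (?f \<odot> (inv2 W ?a4 \<cdot> (id2 W g \<odot> cel z) \<cdot> cel y)) \<cdot> cel x"
  have "(?f \<odot> ?a4) \<cdot> ?a5 \<cdot> ?r = (?f \<odot> ((id2 W g \<odot> cel z) \<cdot> cel y)) \<cdot> cel x"
    by (simp add: vc_assoc[symmetric] interchange)
  with 3 have "((?f \<odot> ?a4) \<cdot> ?a5) \<cdot> ?q = ((?f \<odot> ?a4) \<cdot> ?a5) \<cdot> ?r"
    by (simp add: vc_assoc)
  then have "?q = ?r"
    by (rule cancel_left) (auto intro!: invertible_comp invertible_tens invertible_id)
  then show "cel (?a \<rhd> ((x >< y) >< z)) = cel (x >< y >< z)"
    by (simp add: cel_sel)
qed (use assms el_seq[OF assms(1,2)] el_seq[OF assms(2,3)] in auto)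

lemma ap_inv:
  assumes "invertible W t" "el x" "dom2 W t = lab x"
  shows "inv2 W t \<rhd> t \<rhd> x = x"
  using assms inv2_in[OF assms(1)] ap_comp[of x t "inv2 W t"] by simp

lemma ap_inv_eq:
  assumes "invertible W t" "el x" "dom2 W t = lab x" "t \<rhd> x = y"
  shows "inv2 W t \<rhd> y = x"
  using ap_inv assms by metis

lemma ap_assoc_inv:
  assumes "el x" "el y" "el z" "tgt x = sor y" "tgt y = sor z" "lab x = f" "lab y = g" "lab z = h"
  shows "inv2 W (assoc W f g h) \<rhd> (x >< y >< z) = (x >< y) >< z"
  using assms el_seq[OF assms(1,2)] el_seq[OF assms(2,3)]
  by (intro ap_inv_eq ap_assoc) auto

text \<open>\<open>lun_tens\<close> replaces the constraint of \<open>f\<close> by that of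
  \<open>f \<otimes> k\<close>; naturality moves it past the 2-cell of \<open>x\<close>, where it
  meets the inverse stored in \<open>one\<close>.\<close>

lemma ap_lun:
  assumes "el x" "lab x = f" "sor x = j"
  shows "lun W f \<rhd> (one j >< x) = x"
proof (rule elem_eqI)
  note [simp] = assms(2-) el_D[OF assms(1), unfolded assms(2-)]
  let ?k = "tgt x" and ?I = "unit1 W (trg W f)"
  let ?a = "assoc W ?I f ?k"
  have f[simp]: "f \<in> one_cells W" using assms by auto
  have j[simp]: "j \<in> one_cells W" using assms el_simps(3) by metis
  have "cel (lun W f \<rhd> (one j >< x)) = (lun W f \<odot> id2 W ?k) \<cdot> inv2 W ?a \<cdot> (id2 W ?I \<odot> cel x) \<cdot> inv2 W (lun W j)"
    by (simp add: cel_sel)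
  also have "\<dots> = (lun W (f \<otimes> ?k) \<cdot> ?a) \<cdot> inv2 W ?a \<cdot> (id2 W ?I \<odot> cel x) \<cdot> inv2 W (lun W j)"
    by (subst lun_tens) auto
  also have "\<dots> = (lun W (f \<otimes> ?k) \<cdot> (id2 W ?I \<odot> cel x)) \<cdot> inv2 W (lun W j)"
    by (simp add: vc_assoc)
  also have "lun W (f \<otimes> ?k) \<cdot> (id2 W ?I \<odot> cel x) = cel x \<cdot> lun W j"
    using lun_nat[of "cel x"] by simp
  also have "\<dots> \<cdot> inv2 W (lun W j) = cel x"
    by (simp add: vc_assoc)
  finally show "cel (lun W f \<rhd> (one j >< x)) = cel x" .
qed (use assms in auto)

text \<open>Here the unit stands between \<open>f\<close> and the target \<open>k\<close>, so the
  triangle axiom applies directly.\<close>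

lemma ap_run:
  assumes "el x" "lab x = f" "tgt x = k"
  shows "run W f \<rhd> (x >< one k) = x"
proof (rule elem_eqI)
  note [simp] = assms(2-) el_D[OF assms(1), unfolded assms(2-)]
  let ?I = "unit1 W (src W f)"
  let ?a = "assoc W f ?I k"
  have f[simp]: "f \<in> one_cells W" using assms by auto
  have "cel (run W f \<rhd> (x >< one k)) = (run W f \<odot> id2 W k) \<cdot> inv2 W ?a \<cdot> (id2 W f \<odot> inv2 W (lun W k)) \<cdot> cel x"
    by (simp add: cel_sel)
  also have "run W f \<odot> id2 W k = (id2 W f \<odot> lun W k) \<cdot> ?a"
    by (rule triangle[symmetric]) auto
  also have "\<dots> \<cdot> inv2 W ?a \<cdot> (id2 W f \<odot> inv2 W (lun W k)) \<cdot> cel x = ((id2 W f \<odot> lun W k) \<cdot> (id2 W f \<odot> inv2 W (lun W k))) \<cdot> cel x"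
    by (simp add: vc_assoc)
  also have "\<dots> = cel x"
    by (simp add: interchange tens1_in(4))
  finally show "cel (run W f \<rhd> (x >< one k)) = cel x" .
qed (use assms in auto)

lemma ap_lun_inv:
  assumes "el x" "lab x = f"
  shows "inv2 W (lun W f) \<rhd> x = one (sor x) >< x"
  using assms el_D[OF assms(1)] by (intro ap_inv_eq ap_lun) auto

lemma ap_run_inv:
  assumes "el x" "lab x = f"
  shows "inv2 W (run W f) \<rhd> x = x >< one (tgt x)"
  using assms el_D[OF assms(1)] by (intro ap_inv_eq ap_run) auto

text \<open>An invertible \<open>cel x\<close> cancels on the right, which leaves
  \<open>s \<otimes> I = t \<otimes> I\<close> because the target is a unit 1-cell; faithfulness of
  \<open>- \<otimes> I\<close> does the rest.\<close>

lemma cell_eqI: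
  assumes "s \<in> two_cells W" "t \<in> two_cells W" "dom2 W s = lab x" "dom2 W t = lab x"
    "el x" "invertible W (cel x)" "tgt x = unit1 W (src W (lab x))" "s \<rhd> x = t \<rhd> x"
  shows "s = t"
proof -
  note e = el_D[OF assms(5)]
  let ?I = "id2 W (unit1 W (src W (lab x)))"
  have c: "cod2 W s = cod2 W t" using assms(8) by (metis el_sel(1))
  have "(s \<odot> ?I) \<cdot> cel x = (t \<odot> ?I) \<cdot> cel x"
    using arg_cong[OF assms(8), of cel] assms(7) by (simp add: cel_sel)
  then have "s \<odot> ?I = t \<odot> ?I"
    by (rule cancel_right) (use assms(1-4,6,7) e in auto)
  then show ?thesis
    using assms(1-4) c by (auto intro: unit_faithful(2)[of s t])
qed

text \<open>The elements that can detect equality of 2-cells, by \<open>cell_eqI\<close>. They are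
  closed under pairing, so pairings of generic elements are tests for iterated tensor
  products.\<close>

definition iel :: "('f, 'c) elem \<Rightarrow> bool" where
  "iel x \<longleftrightarrow> el x \<and> invertible W (cel x)"

lemma iel_gen: "\<lbrakk>f \<in> one_cells W; k \<in> one_cells W; trg W k = src W f\<rbrakk> \<Longrightarrow> iel (gen f k)"
  by (auto simp: iel_def cel_sel intro: invertible_id)

lemma iel_one: "k \<in> one_cells W \<Longrightarrow> iel (one k)"
  by (auto simp: iel_def cel_sel intro!: invertible_inv)

lemma iel_pr:
  assumes "iel x" "iel y" "tgt x = sor y"
  shows "iel (x >< y)"
proof -
  have e: "el x" "el y" "invertible W (cel x)" "invertible W (cel y)"
    using assms by (auto simp: iel_def)
  note x = el_D[OF e(1)] and y = el_D[OF e(2)] and s = el_seq[OF e(1,2) assms(3)]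
  have "invertible W ((id2 W (lab x) \<odot> cel y) \<cdot> cel x)"
    using x y s e assms(3) by (intro invertible_comp invertible_tens invertible_id) auto
  then have "invertible W (cel (x >< y))"
    unfolding cel_sel using x y s assms(3)
    by (intro invertible_comp[OF _ invertible_inv]) auto
  then show ?thesis using assms e by (auto simp: iel_def)
qed

lemma cell_eqI_iel:
  assumes "s \<in> two_cells W" "t \<in> two_cells W" "dom2 W s = f" "dom2 W t = f"
    "iel x" "lab x = f" "tgt x = unit1 W (src W f)" "s \<rhd> x = t \<rhd> x"
  shows "s = t"
  using cell_eqI[of s t x] assms by (auto simp: iel_def)

lemma cell_eqI_lab:
  assumes "iel x" "s \<in> two_cells W" "t \<in> two_cells W" "dom2 W s = lab x" "dom2 W t = lab x"
    "tgt x = unit1 W (src W (lab x))" "s \<rhd> x = t \<rhd> x"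
  shows "s = t"
  using cell_eqI[of s t x] assms by (auto simp: iel_def)

lemma ext1:
  assumes "s \<in> two_cells W" "t \<in> two_cells W" "dom2 W s = f" "dom2 W t = f"
    and "\<And>x. el x \<Longrightarrow> lab x = f \<Longrightarrow> s \<rhd> x = t \<rhd> x"
  shows "s = t"
proof -
  have f: "f \<in> one_cells W" using assms(1,3) by auto
  show ?thesis
    by (rule cell_eqI_iel[OF assms(1-4) iel_gen[of f "unit1 W (src W f)"]])
      (use f in \<open>auto intro!: assms(5)\<close>)
qed

text \<open>The test elements are chosen from right to left: the last one is generic with a unit
  1-cell as target, and each earlier one has the source of its right neighbour as target. The
  versions for three and four factors repeat this in the bracketings that occur later.\<close>

lemma ext2:
  assumes "s \<in> two_cells W" "t \<in> two_cells W" "dom2 W s = f \<otimes> g" "dom2 W t = f \<otimes> g"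
    and "f \<in> one_cells W" "g \<in> one_cells W" "src W f = trg W g"
    and *: "\<And>x y. \<lbrakk>el x; el y; tgt x = sor y; lab x = f; lab y = g\<rbrakk> \<Longrightarrow>
      s \<rhd> (x >< y) = t \<rhd> (x >< y)"
  shows "s = t"
proof -
  let ?y = "gen g (unit1 W (src W g))"
  show ?thesis
    by (rule cell_eqI_iel[OF assms(1-4) iel_pr[of "gen f (sor ?y)" ?y]])
      (use assms(5-7) in \<open>auto intro!: * iel_gen\<close>)
qed

lemma ext3:
  assumes "s \<in> two_cells W" "t \<in> two_cells W" "dom2 W s = f \<otimes> g \<otimes> h" "dom2 W t = f \<otimes> g \<otimes> h"
    and "f \<in> one_cells W" "g \<in> one_cells W" "h \<in> one_cells W" "src W f = trg W g" "src W g = trg W h"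
    and *: "\<And>x y z. \<lbrakk>el x; el y; el z; tgt x = sor y; tgt y = sor z;
      lab x = f; lab y = g; lab z = h\<rbrakk> \<Longrightarrow>
      s \<rhd> (x >< y >< z) = t \<rhd> (x >< y >< z)"
  shows "s = t"
proof -
  let ?z = "gen h (unit1 W (src W h))"
  let ?y = "gen g (sor ?z)"
  show ?thesis
    by (rule cell_eqI_iel[OF assms(1-4) iel_pr[of "gen f (sor ?y)" "?y >< ?z"]])
      (use assms(5-9) in \<open>auto intro!: * iel_gen iel_pr\<close>)
qed

lemma ext3':
  assumes "s \<in> two_cells W" "t \<in> two_cells W" "dom2 W s = (f \<otimes> g) \<otimes> h" "dom2 W t = (f \<otimes> g) \<otimes> h"
    and "f \<in> one_cells W" "g \<in> one_cells W" "h \<in> one_cells W" "src W f = trg W g" "src W g = trg W h"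
    and *: "\<And>x y z. \<lbrakk>el x; el y; el z; tgt x = sor y; tgt y = sor z;
      lab x = f; lab y = g; lab z = h\<rbrakk> \<Longrightarrow>
      s \<rhd> ((x >< y) >< z) = t \<rhd> ((x >< y) >< z)"
  shows "s = t"
proof -
  let ?z = "gen h (unit1 W (src W h))"
  let ?y = "gen g (sor ?z)"
  show ?thesis
    by (rule cell_eqI_iel[OF assms(1-4) iel_pr[of "gen f (sor ?y) >< ?y" "?z"]])
      (use assms(5-9) in \<open>auto intro!: * iel_gen iel_pr\<close>)
qed

lemma ext4:
  assumes "s \<in> two_cells W" "t \<in> two_cells W" "dom2 W s = (f \<otimes> g) \<otimes> h \<otimes> k" "dom2 W t = (f \<otimes> g) \<otimes> h \<otimes> k"
    and [simp]: "f \<in> one_cells W" "g \<in> one_cells W" "h \<in> one_cells W" "k \<in> one_cells W"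
      "src W f = trg W g" "src W g = trg W h" "src W h = trg W k"
    and *: "\<And>x y z u. \<lbrakk>el x; el y; el z; el u; tgt x = sor y; tgt y = sor z; tgt z = sor u;
      lab x = f; lab y = g; lab z = h; lab u = k\<rbrakk> \<Longrightarrow> s \<rhd> ((x >< y) >< z >< u) = t \<rhd> ((x >< y) >< z >< u)"
  shows "s = t"
proof -
  let ?u = "gen k (unit1 W (src W k))" let ?z = "gen h (sor ?u)"
  let ?y = "gen g (sor ?z)" let ?x = "gen f (sor ?y)"
  show ?thesis
  proof (rule cell_eqI_lab)
    show "iel ((?x >< ?y) >< ?z >< ?u)" by (intro iel_pr iel_gen) simp_all
    show "s \<rhd> ((?x >< ?y) >< ?z >< ?u) = t \<rhd> ((?x >< ?y) >< ?z >< ?u)" by (rule *) simp_all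
  qed (use assms in simp_all)
qed

lemma ext4':
  assumes "s \<in> two_cells W" "t \<in> two_cells W" "dom2 W s = ((f \<otimes> g) \<otimes> h) \<otimes> k" "dom2 W t = ((f \<otimes> g) \<otimes> h) \<otimes> k"
    and [simp]: "f \<in> one_cells W" "g \<in> one_cells W" "h \<in> one_cells W" "k \<in> one_cells W"
      "src W f = trg W g" "src W g = trg W h" "src W h = trg W k"
    and *: "\<And>x y z u. \<lbrakk>el x; el y; el z; el u; tgt x = sor y; tgt y = sor z; tgt z = sor u;
      lab x = f; lab y = g; lab z = h; lab u = k\<rbrakk> \<Longrightarrow> s \<rhd> (((x >< y) >< z) >< u) = t \<rhd> (((x >< y) >< z) >< u)"
  shows "s = t"
proof -
  let ?u = "gen k (unit1 W (src W k))" let ?z = "gen h (sor ?u)"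
  let ?y = "gen g (sor ?z)" let ?x = "gen f (sor ?y)"
  show ?thesis
  proof (rule cell_eqI_lab)
    show "iel (((?x >< ?y) >< ?z) >< ?u)" by (intro iel_pr iel_gen) simp_all
    show "s \<rhd> (((?x >< ?y) >< ?z) >< ?u) = t \<rhd> (((?x >< ?y) >< ?z) >< ?u)" by (rule *) simp_all
  qed (use assms in simp_all)
qed

text \<open>For a unit factor \<open>one\<close> has an invertible 2-cell already, so it decides the
  equation alone.\<close>

lemma ext_one_right:
  assumes "s \<in> two_cells W" "t \<in> two_cells W" "dom2 W s = f \<otimes> unit1 W (src W f)" "dom2 W t = f \<otimes> unit1 W (src W f)"
    and "f \<in> one_cells W"
    and *: "\<And>x. el x \<Longrightarrow> lab x = f \<Longrightarrow> s \<rhd> (x >< one (tgt x)) = t \<rhd> (x >< one (tgt x))"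
  shows "s = t"
proof -
  let ?I = "unit1 W (src W f)"
  have "src W (f \<otimes> ?I) = src W f" using assms by auto
  then show ?thesis
    using assms(5) *[of "gen f ?I"]
    by (intro cell_eqI_iel[OF assms(1-4) iel_pr[of "gen f ?I" "one ?I"]])
      (auto intro!: iel_gen iel_one)
qed

lemma ext_one_left:
  assumes "s \<in> two_cells W" "t \<in> two_cells W" "dom2 W s = unit1 W (trg W f) \<otimes> f" "dom2 W t = unit1 W (trg W f) \<otimes> f"
    and "f \<in> one_cells W"
    and *: "\<And>x. el x \<Longrightarrow> lab x = f \<Longrightarrow> s \<rhd> (one (sor x) >< x) = t \<rhd> (one (sor x) >< x)"
  shows "s = t"
proof -
  let ?g = "gen f (unit1 W (src W f))"
  show ?thesis
    using assms(5) *[of ?g]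
    by (intro cell_eqI_iel[OF assms(1-4) iel_pr[of "one (sor ?g)" ?g]])
      (auto intro!: iel_gen iel_one)
qed

text \<open>Both constraints send \<open>y >< one (tgt y)\<close> to \<open>y\<close>: the right one
  by \<open>ap_run\<close>, the left one by \<open>lun_tens\<close> and naturality of
  \<open>lun\<close> at the inverse constraint stored in \<open>one\<close>.\<close>

lemma lun_unit_eq_run_unit:
  assumes "x \<in> zero_cells W"
  shows "lun W (unit1 W x) = run W (unit1 W x)"
proof (rule ext_one_right)
  fix y assume y: "el y" "lab y = unit1 W x"
  define v where "v = lun W (tgt y) \<cdot> cel y"
  have [simp]: "trg W (tgt y) = x" "trg W (sor y) = x" using y el_D[of y] assms by auto
  have v: "v \<in> two_cells W" "dom2 W v = sor y" "cod2 W v = tgt y"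
    using y el_D[of y] by (auto simp: v_def)
  have "lun W (unit1 W x) \<rhd> (y >< one (tgt y)) = y"
  proof (rule elem_eqI)
    let ?I = "unit1 W x" and ?k = "tgt y"
    let ?a = "assoc W ?I ?I ?k"
    note d[simp] = el_D[OF y(1), unfolded y(2)]
    have [simp]: "sor y \<in> one_cells W" using y by auto
    have "cel (lun W ?I \<rhd> (y >< one ?k)) =
        (lun W ?I \<odot> id2 W ?k) \<cdot> inv2 W ?a \<cdot> (id2 W ?I \<odot> inv2 W (lun W ?k)) \<cdot> cel y"
      by (simp add: cel_sel y)
    also have "lun W ?I \<odot> id2 W ?k = lun W (?I \<otimes> ?k) \<cdot> ?a"
      using assms by (subst lun_tens[symmetric]) auto
    also have "\<dots> \<cdot> inv2 W ?a \<cdot> (id2 W ?I \<odot> inv2 W (lun W ?k)) \<cdot> cel y =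
        (lun W (?I \<otimes> ?k) \<cdot> (id2 W ?I \<odot> inv2 W (lun W ?k))) \<cdot> cel y"
      using assms by (simp add: vc_assoc)
    also have "lun W (?I \<otimes> ?k) \<cdot> (id2 W ?I \<odot> inv2 W (lun W ?k)) = id2 W (?I \<otimes> ?k)"
      using assms lun_nat[of "inv2 W (lun W ?k)"] by simp
    also have "\<dots> \<cdot> cel y = cel y"
      using assms by simp
    finally show "cel (lun W ?I \<rhd> (y >< one ?k)) = cel y" .
  qed (use assms y in auto)
  also have "y = run W (unit1 W x) \<rhd> (y >< one (tgt y))"
    using y by (subst ap_run) auto
  finally show "lun W (unit1 W x) \<rhd> (y >< one (tgt y)) = run W (unit1 W x) \<rhd> (y >< one (tgt y))" .
qed (use assms in auto)

end

section \<open>Colimits in hom-categories\<close>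

lemma categoryD:
  assumes "category C"
  shows "f \<in> arrows C x y \<Longrightarrow> x \<in> Ob C" "f \<in> arrows C x y \<Longrightarrow> y \<in> Ob C"
    "x \<in> Ob C \<Longrightarrow> Idt C x \<in> arrows C x x"
    "f \<in> arrows C x y \<Longrightarrow> g \<in> arrows C y z \<Longrightarrow> g \<star>\<^bsub>C\<^esub> f \<in> arrows C x z"
    "f \<in> arrows C x y \<Longrightarrow> f \<star>\<^bsub>C\<^esub> Idt C x = f" "f \<in> arrows C x y \<Longrightarrow> Idt C y \<star>\<^bsub>C\<^esub> f = f"
    "\<lbrakk>f \<in> arrows C x y; g \<in> arrows C y z; h \<in> arrows C z w\<rbrakk> \<Longrightarrow>
      (h \<star>\<^bsub>C\<^esub> g) \<star>\<^bsub>C\<^esub> f = h \<star>\<^bsub>C\<^esub> g \<star>\<^bsub>C\<^esub> f"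
  using assms unfolding category_def arrows_def by auto

text \<open>
  \<open>T\<close> is the colimit of the objects \<open>X i\<close> subject to the identifications of the parallel maps
  \<open>u (b, b') : Y (b, b') \<rightarrow> X b'\<close> and \<open>v (b, b') : Y (b, b') \<rightarrow> X b\<close>.
\<close>

definition presents ::
  "('a, 'm) cat \<Rightarrow> 'i set \<Rightarrow> ('i \<Rightarrow> 'a) \<Rightarrow> ('i \<times> 'i \<Rightarrow> 'm) \<Rightarrow> ('i \<times> 'i \<Rightarrow> 'm) \<Rightarrow> 'a \<Rightarrow> ('i \<Rightarrow> 'm) \<Rightarrow> bool" where
  "presents C I X u v T e \<longleftrightarrow>
     T \<in> Ob C \<and> (\<forall>i\<in>I. e i \<in> arrows C (X i) T) \<and>
     (\<forall>b\<in>I. \<forall>b'\<in>I. e b' \<star>\<^bsub>C\<^esub> u (b, b') = e b \<star>\<^bsub>C\<^esub> v (b, b')) \<and>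
     (\<forall>t\<in>Ob C. \<forall>f. (\<forall>i\<in>I. f i \<in> arrows C (X i) t) \<longrightarrow>
        (\<forall>b\<in>I. \<forall>b'\<in>I. f b' \<star>\<^bsub>C\<^esub> u (b, b') = f b \<star>\<^bsub>C\<^esub> v (b, b')) \<longrightarrow>
        (\<exists>!h. h \<in> arrows C T t \<and> (\<forall>i\<in>I. h \<star>\<^bsub>C\<^esub> e i = f i)))"

lemma cat_functorD:
  assumes "cat_functor C D F"
  shows "x \<in> Ob C \<Longrightarrow> on_ob F x \<in> Ob D"
    "f \<in> arrows C x y \<Longrightarrow> on_ar F f \<in> arrows D (on_ob F x) (on_ob F y)"
    "x \<in> Ob C \<Longrightarrow> on_ar F (Idt C x) = Idt D (on_ob F x)"
    "f \<in> arrows C x y \<Longrightarrow> g \<in> arrows C y z \<Longrightarrow> on_ar F (g \<star>\<^bsub>C\<^esub> f) = on_ar F g \<star>\<^bsub>D\<^esub> on_ar F f"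
  using assms unfolding cat_functor_def arrows_def by auto

text \<open>Left adjoints preserve colimits: transposition sends a compatible family into
  \<open>t\<close> to a compatible family into \<open>G t\<close>, and the induced map is transposed
  back.\<close>

lemma left_adjoint_presents:
  fixes C :: "('a, 'm) cat" and D :: "('b, 'n) cat"
  assumes C: "category C" and D: "category D" and adj: "has_right_adjoint C D F"
    and p: "presents C I X u v T e"
    and uv: "\<And>b b'. b \<in> I \<Longrightarrow> b' \<in> I \<Longrightarrow>
      u (b, b') \<in> arrows C (Y (b, b')) (X b') \<and> v (b, b') \<in> arrows C (Y (b, b')) (X b)"
  shows "presents D I (\<lambda>i. on_ob F (X i)) (\<lambda>r. on_ar F (u r)) (\<lambda>r. on_ar F (v r))
    (on_ob F T) (\<lambda>i. on_ar F (e i))"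
proof -
  from adj obtain G :: "('b, 'n, 'a, 'm) catfun" and \<eta> \<epsilon> where
    F: "cat_functor C D F" and G: "cat_functor D C G"
    and \<eta>: "\<And>x. x \<in> Ob C \<Longrightarrow> \<eta> x \<in> arrows C x (on_ob G (on_ob F x))"
    and \<eta>n: "\<And>f. f \<in> Ar C \<Longrightarrow> \<eta> (Cod C f) \<star>\<^bsub>C\<^esub> f = on_ar G (on_ar F f) \<star>\<^bsub>C\<^esub> \<eta> (Dom C f)"
    and \<epsilon>: "\<And>y. y \<in> Ob D \<Longrightarrow> \<epsilon> y \<in> arrows D (on_ob F (on_ob G y)) y"
    and \<epsilon>n: "\<And>g. g \<in> Ar D \<Longrightarrow> g \<star>\<^bsub>D\<^esub> \<epsilon> (Dom D g) = \<epsilon> (Cod D g) \<star>\<^bsub>D\<^esub> on_ar F (on_ar G g)"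
    and tr1: "\<And>x. x \<in> Ob C \<Longrightarrow> \<epsilon> (on_ob F x) \<star>\<^bsub>D\<^esub> on_ar F (\<eta> x) = Idt D (on_ob F x)"
    and tr2: "\<And>y. y \<in> Ob D \<Longrightarrow> on_ar G (\<epsilon> y) \<star>\<^bsub>C\<^esub> \<eta> (on_ob G y) = Idt C (on_ob G y)"
    unfolding has_right_adjoint_def by blast
  note Cd = categoryD[OF C] and Dd = categoryD[OF D] and Fd = cat_functorD[OF F] and Gd = cat_functorD[OF G]
  \<comment> \<open>The two transposes, from maps \<open>F x \<rightarrow> y\<close> to maps
    \<open>x \<rightarrow> G y\<close> and back. Naturality and the triangle identities make them
    mutually inverse.\<close>
  define down where "down x h = on_ar G h \<star>\<^bsub>C\<^esub> \<eta> x" for x h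
  define up where "up y k = \<epsilon> y \<star>\<^bsub>D\<^esub> on_ar F k" for y k
  have down: "down x h \<in> arrows C x (on_ob G y)" if "x \<in> Ob C" "h \<in> arrows D (on_ob F x) y" for x y h
    unfolding down_def using that \<eta> Gd Cd by meson
  have up: "up y k \<in> arrows D (on_ob F x) y" if "y \<in> Ob D" "k \<in> arrows C x (on_ob G y)" for x y k
    unfolding up_def using that \<epsilon> Fd Dd by meson
  have up_down: "up y (down x h) = h" if x: "x \<in> Ob C" and h: "h \<in> arrows D (on_ob F x) y" for x y h
  proof -
    have y: "y \<in> Ob D" using h Dd by blast
    note a = \<eta>[OF x] Gd(2)[OF h] \<epsilon>[OF y] \<epsilon>[OF Fd(1)[OF x]]
    have "up y (down x h) = \<epsilon> y \<star>\<^bsub>D\<^esub> on_ar F (on_ar G h) \<star>\<^bsub>D\<^esub> on_ar F (\<eta> x)"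
      unfolding up_def down_def using a by (simp add: Fd(4))
    also have "\<dots> = (\<epsilon> y \<star>\<^bsub>D\<^esub> on_ar F (on_ar G h)) \<star>\<^bsub>D\<^esub> on_ar F (\<eta> x)"
      using a Fd(2) Dd(7) by metis
    also have "\<epsilon> y \<star>\<^bsub>D\<^esub> on_ar F (on_ar G h) = h \<star>\<^bsub>D\<^esub> \<epsilon> (on_ob F x)"
      using \<epsilon>n[of h] h by (simp add: arrows_def)
    also have "\<dots> \<star>\<^bsub>D\<^esub> on_ar F (\<eta> x) = h \<star>\<^bsub>D\<^esub> Idt D (on_ob F x)"
      using a h Fd(2) Dd(7) tr1[OF x] by metis
    also have "\<dots> = h" using h Dd by blast
    finally show ?thesis .
  qed
  have down_up: "down x (up y k) = k" if y: "y \<in> Ob D" and k: "k \<in> arrows C x (on_ob G y)" for x y k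
  proof -
    have x: "x \<in> Ob C" using k Cd by blast
    note a = \<eta>[OF x] Fd(2)[OF k] \<epsilon>[OF y] \<eta>[OF Gd(1)[OF y]]
    have "down x (up y k) = (on_ar G (\<epsilon> y) \<star>\<^bsub>C\<^esub> on_ar G (on_ar F k)) \<star>\<^bsub>C\<^esub> \<eta> x"
      unfolding up_def down_def using a by (simp add: Gd(4))
    also have "\<dots> = on_ar G (\<epsilon> y) \<star>\<^bsub>C\<^esub> on_ar G (on_ar F k) \<star>\<^bsub>C\<^esub> \<eta> x"
      using a Gd(2) Cd(7) by metis
    also have "on_ar G (on_ar F k) \<star>\<^bsub>C\<^esub> \<eta> x = \<eta> (on_ob G y) \<star>\<^bsub>C\<^esub> k"
      using \<eta>n[of k] k by (simp add: arrows_def)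
    also have "on_ar G (\<epsilon> y) \<star>\<^bsub>C\<^esub> \<dots> = Idt C (on_ob G y) \<star>\<^bsub>C\<^esub> k"
      using Cd(7)[OF k a(4) Gd(2)[OF a(3)]] tr2[OF y] by simp
    also have "\<dots> = k" using k Cd by blast
    finally show ?thesis .
  qed
  \<comment> \<open>Naturality of transposition in the source carries both the identifications by
    \<open>u\<close> and \<open>v\<close> and the equations for the legs \<open>e i\<close> across
    the adjunction.\<close>
  have down_comp: "down x' (h \<star>\<^bsub>D\<^esub> on_ar F m) = down x h \<star>\<^bsub>C\<^esub> m"
    if m: "m \<in> arrows C x' x" and h: "h \<in> arrows D (on_ob F x) y" for x' x h m y
  proof -
    have x: "x \<in> Ob C" "x' \<in> Ob C" using m Cd by blast+
    note a = \<eta>[OF x(1)] \<eta>[OF x(2)] Fd(2)[OF m] Gd(2)[OF h] Gd(2)[OF Fd(2)[OF m]]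
    have "down x' (h \<star>\<^bsub>D\<^esub> on_ar F m) = (on_ar G h \<star>\<^bsub>C\<^esub> on_ar G (on_ar F m)) \<star>\<^bsub>C\<^esub> \<eta> x'"
      unfolding down_def using a h by (simp add: Gd(4))
    also have "\<dots> = on_ar G h \<star>\<^bsub>C\<^esub> on_ar G (on_ar F m) \<star>\<^bsub>C\<^esub> \<eta> x'"
      using a Cd(7) by metis
    also have "on_ar G (on_ar F m) \<star>\<^bsub>C\<^esub> \<eta> x' = \<eta> x \<star>\<^bsub>C\<^esub> m"
      using \<eta>n[of m] m by (simp add: arrows_def)
    also have "on_ar G h \<star>\<^bsub>C\<^esub> \<dots> = down x h \<star>\<^bsub>C\<^esub> m"
      unfolding down_def using a m Cd(7) by metis
    finally show ?thesis .
  qed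
  have T: "T \<in> Ob C" and e: "\<And>i. i \<in> I \<Longrightarrow> e i \<in> arrows C (X i) T"
    and eq: "\<And>b b'. b \<in> I \<Longrightarrow> b' \<in> I \<Longrightarrow> e b' \<star>\<^bsub>C\<^esub> u (b, b') = e b \<star>\<^bsub>C\<^esub> v (b, b')"
    and univ: "\<And>t f. \<lbrakk>t \<in> Ob C; (\<forall>i\<in>I. f i \<in> arrows C (X i) t);
        (\<forall>b\<in>I. \<forall>b'\<in>I. f b' \<star>\<^bsub>C\<^esub> u (b, b') = f b \<star>\<^bsub>C\<^esub> v (b, b'))\<rbrakk> \<Longrightarrow>
        (\<exists>!h. h \<in> arrows C T t \<and> (\<forall>i\<in>I. h \<star>\<^bsub>C\<^esub> e i = f i))"
    using p unfolding presents_def by blast+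
  have X: "X i \<in> Ob C" if "i \<in> I" for i using e[OF that] Cd by blast
  show ?thesis
    unfolding presents_def
  proof (intro conjI ballI allI impI)
    show "on_ob F T \<in> Ob D" using T Fd by blast
    show "on_ar F (e i) \<in> arrows D (on_ob F (X i)) (on_ob F T)" if "i \<in> I" for i
      using e[OF that] Fd by blast
    show "on_ar F (e b') \<star>\<^bsub>D\<^esub> on_ar F (u (b, b')) = on_ar F (e b) \<star>\<^bsub>D\<^esub> on_ar F (v (b, b'))"
      if "b \<in> I" "b' \<in> I" for b b'
      using uv[OF that] e[OF that(1)] e[OF that(2)] eq[OF that] Fd(4) by metis
  next
    fix t f
    assume t: "t \<in> Ob D" and f: "\<forall>i\<in>I. f i \<in> arrows D (on_ob F (X i)) t"
      and bal: "\<forall>b\<in>I. \<forall>b'\<in>I. f b' \<star>\<^bsub>D\<^esub> on_ar F (u (b, b')) = f b \<star>\<^bsub>D\<^esub> on_ar F (v (b, b'))"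
    have "\<exists>!k. k \<in> arrows C T (on_ob G t) \<and> (\<forall>i\<in>I. k \<star>\<^bsub>C\<^esub> e i = down (X i) (f i))"
    proof (rule univ)
      show "on_ob G t \<in> Ob C" using t Gd by blast
      show "\<forall>i\<in>I. down (X i) (f i) \<in> arrows C (X i) (on_ob G t)" using f down X by blast
      show "\<forall>b\<in>I. \<forall>b'\<in>I. down (X b') (f b') \<star>\<^bsub>C\<^esub> u (b, b') = down (X b) (f b) \<star>\<^bsub>C\<^esub> v (b, b')"
        using bal f uv down_comp by metis
    qed
    then obtain k where k: "k \<in> arrows C T (on_ob G t)" "\<forall>i\<in>I. k \<star>\<^bsub>C\<^esub> e i = down (X i) (f i)"
      and uniq: "\<And>k'. k' \<in> arrows C T (on_ob G t) \<Longrightarrow> \<forall>i\<in>I. k' \<star>\<^bsub>C\<^esub> e i = down (X i) (f i) \<Longrightarrow> k' = k"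
      by blast
    show "\<exists>!h. h \<in> arrows D (on_ob F T) t \<and> (\<forall>i\<in>I. h \<star>\<^bsub>D\<^esub> on_ar F (e i) = f i)"
    proof (rule ex1I[of _ "up t k"], intro conjI ballI)
      show u: "up t k \<in> arrows D (on_ob F T) t" using up t k by blast
      fix i assume i: "i \<in> I"
      have "down (X i) (up t k \<star>\<^bsub>D\<^esub> on_ar F (e i)) = down (X i) (f i)"
        using down_comp[OF e[OF i] u] down_up[OF t k(1)] k(2) i by simp
      moreover have "up t k \<star>\<^bsub>D\<^esub> on_ar F (e i) \<in> arrows D (on_ob F (X i)) t"
        using u Fd(2)[OF e[OF i]] Dd by blast
      ultimately show "up t k \<star>\<^bsub>D\<^esub> on_ar F (e i) = f i"
        using up_down[OF X[OF i]] f i by metis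
    next
      fix h assume h: "h \<in> arrows D (on_ob F T) t \<and> (\<forall>i\<in>I. h \<star>\<^bsub>D\<^esub> on_ar F (e i) = f i)"
      have "down T h = k"
        using h down[OF T] down_comp[OF e] by (intro uniq) (metis, metis)
      then show "h = up t k" using up_down[OF T] h by metis
    qed
  qed
qed

section \<open>Coproducts and coequalisers from small cocompleteness\<close>

lemma finite_small:
  assumes "smallness_cardinal \<kappa>" "finite X"
  shows "small_set \<kappa> X"
proof -
  have "finite (Field (card_of X))" using assms(2) by (simp add: Field_card_of)
  then show ?thesis
    using assms unfolding smallness_cardinal_def small_set_def
    by (intro finite_ordLess_infinite) (auto simp: card_order_on_def card_of_Well_order)
qed

text \<open>The relations of a tensor product are indexed by pairs of objects. An infinite set is
  equinumerous with its square, and the square of a finite set is finite.\<close>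

lemma small_square:
  assumes "smallness_cardinal \<kappa>" "small_set \<kappa> X"
  shows "small_set \<kappa> (X \<times> X)"
proof (cases "finite X")
  case True
  then show ?thesis by (intro finite_small assms(1)) simp
next
  case False
  then show ?thesis
    using card_of_Times_same_infinite[of X] assms(2) ordIso_ordLess_trans
    unfolding small_set_def by blast
qed

text \<open>\<open>small_cocomplete\<close> speaks of diagram shapes inside the type of \<kappa>, so
  an index set has to be moved there injectively before it can serve as a shape.\<close>

lemma small_index:
  assumes "smallness_cardinal \<kappa>" "small_set \<kappa> X"
  obtains i where "inj_on i X" "small_set \<kappa> (i ` X)"
    "i ` X \<subseteq> Field \<kappa>"
proof -
  have "Card_order \<kappa>" using assms(1) by (simp add: smallness_cardinal_def)
  then have "ordIso2 (card_of (Field \<kappa>)) \<kappa>" using card_of_Field_ordIso by blast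
  moreover have "ordLess2 (card_of X) \<kappa>" using assms(2) by (simp add: small_set_def)
  ultimately have "ordLeq3 (card_of X) (card_of (Field \<kappa>))"
    using ordLess_imp_ordLeq ordLeq_ordIso_trans ordIso_symmetric by blast
  then obtain i where i: "inj_on i X" "i ` X \<subseteq> Field \<kappa>"
    using card_of_ordLeq by metis
  moreover have "small_set \<kappa> (i ` X)"
    using assms(2) card_of_image[of i X] ordLeq_ordLess_trans unfolding small_set_def by blast
  ultimately show ?thesis using that by blast
qed

lemma coproduct_exists:
  fixes \<kappa> :: "'k rel"
  assumes \<kappa>: "smallness_cardinal \<kappa>" and C: "category C" and co: "small_cocomplete \<kappa> C"
    and I: "small_set \<kappa> I" and X: "\<And>i. i \<in> I \<Longrightarrow> X i \<in> Ob C"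
  shows "is_coproduct C I X (coproduct C I X)"
proof -
  obtain n :: "_ \<Rightarrow> 'k" where n: "inj_on n I" "small_set \<kappa> (n ` I)"
    by (rule small_index[OF \<kappa> I])
  define m where "m = inv_into I n"
  have mn: "m (n i) = i" if "i \<in> I" for i using n(1) that by (simp add: m_def)
  \<comment> \<open>The discrete category on the copy of the index set, each object being its own
    identity arrow.\<close>
  define J :: "('k, 'k) cat" where
    "J = \<lparr>Ob = n ` I, Ar = n ` I, Dom = (\<lambda>k. k), Cod = (\<lambda>k. k), Idt = (\<lambda>k. k), Comp = (\<lambda>k l. k)\<rparr>"
  define D where "D = \<lparr>on_ob = (\<lambda>k. X (m k)), on_ar = (\<lambda>k. Idt C (X (m k)))\<rparr>"
  have "category J" unfolding category_def by (auto simp: J_def arrows_def)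
  moreover have "cat_functor J C D"
    unfolding cat_functor_def
    using X categoryD(3)[OF C] categoryD(5)[OF C categoryD(3)[OF C]] mn by (simp add: J_def D_def)
  moreover have "small_set \<kappa> (Ar J)" using n(2) by (simp add: J_def)
  ultimately obtain v p where vp: "is_colimit J C D v p"
    using co unfolding small_cocomplete_def by blast
  have cocone: "is_cocone J C D t q \<longleftrightarrow> t \<in> Ob C \<and> (\<forall>i\<in>I. q (n i) \<in> arrows C (X i) t)" for t q
    using categoryD(5)[OF C] mn by (auto simp: is_cocone_def J_def D_def)
  have "is_coproduct C I X (v, \<lambda>i. p (n i))"
    unfolding is_coproduct_def prod.case
  proof (intro conjI allI ballI impI)
    have c: "is_cocone J C D v p" using vp by (simp add: is_colimit_def)
    then show "v \<in> Ob C" "\<And>i. i \<in> I \<Longrightarrow> p (n i) \<in> arrows C (X i) v"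
      unfolding cocone by auto
    fix t f assume "t \<in> Ob C" "\<forall>i\<in>I. f i \<in> arrows C (X i) t"
    then have "is_cocone J C D t (\<lambda>k. f (m k))" unfolding cocone by (simp add: mn)
    then have "\<exists>!h. h \<in> arrows C v t \<and> (\<forall>j\<in>Ob J. h \<star>\<^bsub>C\<^esub> p j = f (m j))"
      using vp unfolding is_colimit_def by blast
    then show "\<exists>!h. h \<in> arrows C v t \<and> (\<forall>i\<in>I. h \<star>\<^bsub>C\<^esub> p (n i) = f i)"
      by (simp add: J_def mn)
  qed
  then show ?thesis unfolding coproduct_def by (rule someI)
qed

lemma coequaliser_exists:
  fixes \<kappa> :: "'k rel"
  assumes \<kappa>: "smallness_cardinal \<kappa>" and C: "category C" and co: "small_cocomplete \<kappa> C"
    and f: "f \<in> arrows C x y" and g: "g \<in> arrows C x y"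
  shows "is_coequaliser C f g (coequaliser C f g)"
proof -
  have "infinite (UNIV :: 'k set)"
    using \<kappa> finite_subset[of "Field \<kappa>" UNIV] unfolding smallness_cardinal_def by auto
  \<comment> \<open>The field of \<kappa> is infinite, so its type has four distinct members. They
    name two objects, which double as their identities, and two parallel arrows.\<close>
  then obtain S :: "'k set" where "card S = 4" "finite S"
    using infinite_arbitrarily_large by blast
  then obtain k0 k1 k2 k3 :: 'k where d: "k0 \<noteq> k1" "k0 \<noteq> k2" "k0 \<noteq> k3" "k1 \<noteq> k2" "k1 \<noteq> k3" "k2 \<noteq> k3"
    by (auto simp: card_Suc_eq numeral_eq_Suc)
  \<comment> \<open>In a composite of \<open>l\<close> after \<open>k\<close>, either
    \<open>k\<close> is an identity and the result is \<open>l\<close>, or \<open>k\<close> is one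
    of the parallel arrows, \<open>l\<close> is the identity of \<open>k1\<close>, and the result is
    \<open>k\<close>.\<close>
  define J :: "('k, 'k) cat" where
    "J = \<lparr>Ob = {k0, k1}, Ar = {k0, k1, k2, k3}, Dom = (\<lambda>k. if k = k1 then k1 else k0),
          Cod = (\<lambda>k. if k = k0 then k0 else k1), Idt = (\<lambda>k. k),
          Comp = (\<lambda>l k. if k = k0 \<or> k = k1 then l else k)\<rparr>"
  define D where "D = \<lparr>on_ob = (\<lambda>k. if k = k0 then x else y),
    on_ar = (\<lambda>k. if k = k0 then Idt C x else if k = k1 then Idt C y else if k = k2 then f else g)\<rparr>"
  note Cd = categoryD[OF C]
  have xy: "x \<in> Ob C" "y \<in> Ob C" using f Cd by blast+
  have "category J" unfolding category_def using d by (auto simp: J_def arrows_def)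
  moreover have "cat_functor J C D"
    unfolding cat_functor_def
    using xy d Cd(3)[OF xy(1)] Cd(3)[OF xy(2)] f g Cd(5,6)[OF f] Cd(5,6)[OF g]
      Cd(5)[OF Cd(3)[OF xy(1)]] Cd(5)[OF Cd(3)[OF xy(2)]]
    by (auto simp: J_def D_def)
  moreover have "small_set \<kappa> (Ar J)" by (rule finite_small[OF \<kappa>]) (simp add: J_def)
  ultimately obtain v p where vp: "is_colimit J C D v p"
    using co unfolding small_cocomplete_def by blast
  have cocone: "is_cocone J C D t q \<longleftrightarrow> t \<in> Ob C \<and> q k0 \<in> arrows C x t \<and> q k1 \<in> arrows C y t \<and>
      q k1 \<star>\<^bsub>C\<^esub> f = q k0 \<and> q k1 \<star>\<^bsub>C\<^esub> g = q k0" for t q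
    using Cd(5)[of "q k0" x t] Cd(5)[of "q k1" y t] d by (auto simp: is_cocone_def J_def D_def)
  have Cf: "Cod C f = y" using f by (simp add: arrows_def)
  have c: "is_cocone J C D v p" using vp by (simp add: is_colimit_def)
  have "is_coequaliser C f g (v, p k1)"
    unfolding is_coequaliser_def prod.case Cf
  proof (intro conjI allI ballI impI)
    show "v \<in> Ob C" "p k1 \<in> arrows C y v" "p k1 \<star>\<^bsub>C\<^esub> f = p k1 \<star>\<^bsub>C\<^esub> g"
      using c unfolding cocone by auto
    fix t k assume t: "t \<in> Ob C" and k: "k \<in> arrows C y t" and eq: "k \<star>\<^bsub>C\<^esub> f = k \<star>\<^bsub>C\<^esub> g"
    \<comment> \<open>The leg at the source \<open>k0\<close> is forced by the leg at
      \<open>k1\<close>.\<close>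
    then have "is_cocone J C D t (\<lambda>j. if j = k0 then k \<star>\<^bsub>C\<^esub> f else k)"
      unfolding cocone using d(1) Cd(4)[OF f k] by auto
    then have ex: "\<exists>!h. h \<in> arrows C v t \<and> (\<forall>j\<in>Ob J. h \<star>\<^bsub>C\<^esub> p j = (if j = k0 then k \<star>\<^bsub>C\<^esub> f else k))"
      using vp unfolding is_colimit_def by blast
    have "(\<forall>j\<in>Ob J. h \<star>\<^bsub>C\<^esub> p j = (if j = k0 then k \<star>\<^bsub>C\<^esub> f else k)) \<longleftrightarrow> h \<star>\<^bsub>C\<^esub> p k1 = k"
      if "h \<in> arrows C v t" for h
      using d c Cd(7)[OF f _ that] unfolding cocone by (auto simp: J_def)
    with ex show "\<exists>!h. h \<in> arrows C v t \<and> h \<star>\<^bsub>C\<^esub> p k1 = k"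
      by (metis (no_types, lifting))
  qed
  then show ?thesis unfolding coequaliser_def by (rule someI)
qed

lemma copair_props:
  assumes "is_coproduct C I X (coproduct C I X)" "t \<in> Ob C" "\<And>i. i \<in> I \<Longrightarrow> f i \<in> arrows C (X i) t"
  shows "copair C I X t f \<in> arrows C (coprod_ob C I X) t"
    "i \<in> I \<Longrightarrow> copair C I X t f \<star>\<^bsub>C\<^esub> coprod_in C I X i = f i"
proof -
  have "\<exists>!h. h \<in> arrows C (coprod_ob C I X) t \<and> (\<forall>i\<in>I. h \<star>\<^bsub>C\<^esub> coprod_in C I X i = f i)"
    using assms unfolding is_coproduct_def coprod_ob_def coprod_in_def by (auto simp: split_beta)
  from theI'[OF this] show "copair C I X t f \<in> arrows C (coprod_ob C I X) t"
    "i \<in> I \<Longrightarrow> copair C I X t f \<star>\<^bsub>C\<^esub> coprod_in C I X i = f i"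
    unfolding copair_def by auto
qed

lemma coprod_props:
  assumes "is_coproduct C I X (coproduct C I X)"
  shows "coprod_ob C I X \<in> Ob C" "i \<in> I \<Longrightarrow> coprod_in C I X i \<in> arrows C (X i) (coprod_ob C I X)"
    "t \<in> Ob C \<Longrightarrow> (\<And>i. i \<in> I \<Longrightarrow> f i \<in> arrows C (X i) t) \<Longrightarrow>
       \<exists>!h. h \<in> arrows C (coprod_ob C I X) t \<and> (\<forall>i\<in>I. h \<star>\<^bsub>C\<^esub> coprod_in C I X i = f i)"
  using assms unfolding is_coproduct_def coprod_ob_def coprod_in_def by (auto simp: split_beta)

lemma coprod_ext:
  assumes "is_coproduct C I X (coproduct C I X)" "category C"
    and h: "h \<in> arrows C (coprod_ob C I X) t" "k \<in> arrows C (coprod_ob C I X) t"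
    and eq: "\<And>i. i \<in> I \<Longrightarrow> h \<star>\<^bsub>C\<^esub> coprod_in C I X i = k \<star>\<^bsub>C\<^esub> coprod_in C I X i"
  shows "h = k"
proof -
  note d = categoryD[OF assms(2)]
  have "t \<in> Ob C" using h d by blast
  then have "\<exists>!l. l \<in> arrows C (coprod_ob C I X) t \<and>
      (\<forall>i\<in>I. l \<star>\<^bsub>C\<^esub> coprod_in C I X i = k \<star>\<^bsub>C\<^esub> coprod_in C I X i)"
    using coprod_props[OF assms(1)] h d by (intro coprod_props(3)[OF assms(1)]) meson+
  with h eq show ?thesis by blast
qed

text \<open>A map out of the coequaliser is a map out of the coproduct that equalises two
  copairings, and both kinds of data can be read off summand by summand.\<close>

lemma coequaliser_presents:
  fixes C :: "('a, 'm) cat"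
  assumes \<kappa>: "smallness_cardinal \<kappa>" and C: "category C" and co: "small_cocomplete \<kappa> C"
    and I: "small_set \<kappa> I"
    and X: "\<And>i. i \<in> I \<Longrightarrow> X i \<in> Ob C"
    and uv: "\<And>b b'. b \<in> I \<Longrightarrow> b' \<in> I \<Longrightarrow>
      u (b, b') \<in> arrows C (Y (b, b')) (X b') \<and> v (b, b') \<in> arrows C (Y (b, b')) (X b)"
    and q: "coequaliser C
      (copair C (I \<times> I) Y (coprod_ob C I X) (\<lambda>r. coprod_in C I X (snd r) \<star>\<^bsub>C\<^esub> u r))
      (copair C (I \<times> I) Y (coprod_ob C I X) (\<lambda>r. coprod_in C I X (fst r) \<star>\<^bsub>C\<^esub> v r)) = (T, q)"
  shows "presents C I X u v T (\<lambda>i. q \<star>\<^bsub>C\<^esub> coprod_in C I X i)"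
proof -
  note d = categoryD[OF C]
  let ?S = "coprod_ob C I X" and ?j = "coprod_in C I X"
  let ?f = "\<lambda>r. ?j (snd r) \<star>\<^bsub>C\<^esub> u r" and ?g = "\<lambda>r. ?j (fst r) \<star>\<^bsub>C\<^esub> v r"
  have cX: "is_coproduct C I X (coproduct C I X)" by (rule coproduct_exists[OF \<kappa> C co I X])
  have Y: "Y r \<in> Ob C" if "r \<in> I \<times> I" for r using uv d(1) that by fast
  have cY: "is_coproduct C (I \<times> I) Y (coproduct C (I \<times> I) Y)"
    by (rule coproduct_exists[OF \<kappa> C co small_square[OF \<kappa> I] Y])
  note S = coprod_props(1,2)[OF cX] and SY = coprod_props(1,2)[OF cY]
  have f: "\<And>r. r \<in> I \<times> I \<Longrightarrow> ?f r \<in> arrows C (Y r) ?S" "\<And>r. r \<in> I \<times> I \<Longrightarrow> ?g r \<in> arrows C (Y r) ?S"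
    using uv S d(4) by (auto simp: mem_Times_iff; metis prod.collapse)+
  define cf cg where "cf = copair C (I \<times> I) Y ?S ?f" and "cg = copair C (I \<times> I) Y ?S ?g"
  have cf: "cf \<in> arrows C (coprod_ob C (I \<times> I) Y) ?S"
      "\<And>r. r \<in> I \<times> I \<Longrightarrow> cf \<star>\<^bsub>C\<^esub> coprod_in C (I \<times> I) Y r = ?f r"
    and cg: "cg \<in> arrows C (coprod_ob C (I \<times> I) Y) ?S"
      "\<And>r. r \<in> I \<times> I \<Longrightarrow> cg \<star>\<^bsub>C\<^esub> coprod_in C (I \<times> I) Y r = ?g r"
    unfolding cf_def cg_def using f by (auto intro!: copair_props[OF cY S(1)])
  have "is_coequaliser C cf cg (T, q)"
    using coequaliser_exists[OF \<kappa> C co cf(1) cg(1)] q unfolding cf_def cg_def by simp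
  moreover have "Cod C cf = ?S" using cf(1) by (simp add: arrows_def)
  ultimately have T: "T \<in> Ob C" and qa: "q \<in> arrows C ?S T" and qe: "q \<star>\<^bsub>C\<^esub> cf = q \<star>\<^bsub>C\<^esub> cg"
    and univ: "\<And>t k. \<lbrakk>t \<in> Ob C; k \<in> arrows C ?S t; k \<star>\<^bsub>C\<^esub> cf = k \<star>\<^bsub>C\<^esub> cg\<rbrakk> \<Longrightarrow>
        \<exists>!h. h \<in> arrows C T t \<and> h \<star>\<^bsub>C\<^esub> q = k"
    by (auto simp: is_coequaliser_def)
  \<comment> \<open>Maps out of the coproduct of all \<open>Y (b, b')\<close> are equal as soon as
    they agree on each summand; this splits one equation of copairings into the identifications of
    \<open>presents\<close>.\<close>
  have bal: "k \<star>\<^bsub>C\<^esub> cf = k \<star>\<^bsub>C\<^esub> cg \<longleftrightarrow>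
      (\<forall>b\<in>I. \<forall>b'\<in>I. (k \<star>\<^bsub>C\<^esub> ?j b') \<star>\<^bsub>C\<^esub> u (b, b') = (k \<star>\<^bsub>C\<^esub> ?j b) \<star>\<^bsub>C\<^esub> v (b, b'))"
    if k: "k \<in> arrows C ?S t" for k t
  proof -
    have 1: "(k \<star>\<^bsub>C\<^esub> cf) \<star>\<^bsub>C\<^esub> coprod_in C (I \<times> I) Y (b, b') = (k \<star>\<^bsub>C\<^esub> ?j b') \<star>\<^bsub>C\<^esub> u (b, b')"
      "(k \<star>\<^bsub>C\<^esub> cg) \<star>\<^bsub>C\<^esub> coprod_in C (I \<times> I) Y (b, b') = (k \<star>\<^bsub>C\<^esub> ?j b) \<star>\<^bsub>C\<^esub> v (b, b')"
      if b: "b \<in> I" "b' \<in> I" for b b'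
    proof -
      have r: "(b, b') \<in> I \<times> I" using b by simp
      show "(k \<star>\<^bsub>C\<^esub> cf) \<star>\<^bsub>C\<^esub> coprod_in C (I \<times> I) Y (b, b') = (k \<star>\<^bsub>C\<^esub> ?j b') \<star>\<^bsub>C\<^esub> u (b, b')"
        using d(7)[OF SY(2)[OF r] cf(1) k] cf(2)[OF r] uv[OF b] d(7)[OF _ S(2)[OF b(2)] k] by auto
      show "(k \<star>\<^bsub>C\<^esub> cg) \<star>\<^bsub>C\<^esub> coprod_in C (I \<times> I) Y (b, b') = (k \<star>\<^bsub>C\<^esub> ?j b) \<star>\<^bsub>C\<^esub> v (b, b')"
        using d(7)[OF SY(2)[OF r] cg(1) k] cg(2)[OF r] uv[OF b] d(7)[OF _ S(2)[OF b(1)] k] by auto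
    qed
    show ?thesis
    proof
      assume "k \<star>\<^bsub>C\<^esub> cf = k \<star>\<^bsub>C\<^esub> cg"
      then show "\<forall>b\<in>I. \<forall>b'\<in>I. (k \<star>\<^bsub>C\<^esub> ?j b') \<star>\<^bsub>C\<^esub> u (b, b') = (k \<star>\<^bsub>C\<^esub> ?j b) \<star>\<^bsub>C\<^esub> v (b, b')"
        using 1 by metis
    next
      assume *: "\<forall>b\<in>I. \<forall>b'\<in>I. (k \<star>\<^bsub>C\<^esub> ?j b') \<star>\<^bsub>C\<^esub> u (b, b') = (k \<star>\<^bsub>C\<^esub> ?j b) \<star>\<^bsub>C\<^esub> v (b, b')"
      show "k \<star>\<^bsub>C\<^esub> cf = k \<star>\<^bsub>C\<^esub> cg"
        by (rule coprod_ext[OF cY C d(4)[OF cf(1) k] d(4)[OF cg(1) k]]) (use 1 * in auto)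
    qed
  qed
  show ?thesis
    unfolding presents_def
  proof (intro conjI ballI allI impI)
    show "T \<in> Ob C" by fact
    show "q \<star>\<^bsub>C\<^esub> ?j i \<in> arrows C (X i) T" if "i \<in> I" for i
      using d(4)[OF S(2)[OF that] qa] .
    show "(q \<star>\<^bsub>C\<^esub> ?j b') \<star>\<^bsub>C\<^esub> u (b, b') = (q \<star>\<^bsub>C\<^esub> ?j b) \<star>\<^bsub>C\<^esub> v (b, b')" if "b \<in> I" "b' \<in> I" for b b'
      using bal[OF qa] qe that by blast
  next
    fix t f assume t: "t \<in> Ob C" and f: "\<forall>i\<in>I. f i \<in> arrows C (X i) t"
      and b: "\<forall>b\<in>I. \<forall>b'\<in>I. f b' \<star>\<^bsub>C\<^esub> u (b, b') = f b \<star>\<^bsub>C\<^esub> v (b, b')"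
    define k where "k = copair C I X t f"
    have k: "k \<in> arrows C ?S t" "\<And>i. i \<in> I \<Longrightarrow> k \<star>\<^bsub>C\<^esub> ?j i = f i"
      unfolding k_def using copair_props[OF cX t] f by blast+
    have "k \<star>\<^bsub>C\<^esub> cf = k \<star>\<^bsub>C\<^esub> cg" unfolding bal[OF k(1)] using k(2) b by simp
    then have ex: "\<exists>!h. h \<in> arrows C T t \<and> h \<star>\<^bsub>C\<^esub> q = k" using univ[OF t k(1)] by blast
    have "h \<star>\<^bsub>C\<^esub> q = k \<longleftrightarrow> (\<forall>i\<in>I. h \<star>\<^bsub>C\<^esub> q \<star>\<^bsub>C\<^esub> ?j i = f i)" if h: "h \<in> arrows C T t" for h
    proof -
      have 1: "(h \<star>\<^bsub>C\<^esub> q) \<star>\<^bsub>C\<^esub> ?j i = h \<star>\<^bsub>C\<^esub> q \<star>\<^bsub>C\<^esub> ?j i" if "i \<in> I" for i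
        using d(7)[OF S(2)[OF that] qa h] .
      show ?thesis
        using 1 k coprod_ext[OF cX C d(4)[OF qa h] k(1)] by auto
    qed
    with ex show "\<exists>!h. h \<in> arrows C T t \<and> (\<forall>i\<in>I. h \<star>\<^bsub>C\<^esub> q \<star>\<^bsub>C\<^esub> ?j i = f i)"
      by (metis (no_types, lifting))
  qed
qed

section \<open>Enriched categories and profunctors on elements\<close>

context bicat
begin

section \<open>Enriched categories and functors on elements\<close>

lemma wcat [simp]:
  assumes "wcategory W A"
  shows "a \<in> obj A \<Longrightarrow> extent A a \<in> zero_cells W"
    "a \<in> obj A \<Longrightarrow> b \<in> obj A \<Longrightarrow> whom A b a \<in> one_cells W"
    "a \<in> obj A \<Longrightarrow> b \<in> obj A \<Longrightarrow> src W (whom A b a) = extent A a"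
    "a \<in> obj A \<Longrightarrow> b \<in> obj A \<Longrightarrow> trg W (whom A b a) = extent A b"
    "a \<in> obj A \<Longrightarrow> wid A a \<in> two_cells W"
    "a \<in> obj A \<Longrightarrow> dom2 W (wid A a) = unit1 W (extent A a)"
    "a \<in> obj A \<Longrightarrow> cod2 W (wid A a) = whom A a a"
    "\<lbrakk>a \<in> obj A; b \<in> obj A; c \<in> obj A\<rbrakk> \<Longrightarrow> wmult A c b a \<in> two_cells W"
    "\<lbrakk>a \<in> obj A; b \<in> obj A; c \<in> obj A\<rbrakk> \<Longrightarrow> dom2 W (wmult A c b a) = whom A c b \<otimes> whom A b a"
    "\<lbrakk>a \<in> obj A; b \<in> obj A; c \<in> obj A\<rbrakk> \<Longrightarrow> cod2 W (wmult A c b a) = whom A c a"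
  using assms unfolding wcategory_def one_hom_def cells_def by blast+

text \<open>On elements, \<open>wid A b \<rhd> one j\<close> plays the role of the identity of
  \<open>b\<close>, where \<open>j\<close> records the place at which it is inserted.\<close>

lemma wmult_unit_left [simp]:
  assumes "wcategory W A" "a \<in> obj A" "b \<in> obj A" "el x" "lab x = whom A b a" "sor x = j"
  shows "wmult A b b a \<rhd> ((wid A b \<rhd> one j) >< x) = x"
proof -
  have [simp]: "trg W j = extent A b" "j \<in> one_cells W"
    using el_D(9)[OF assms(4)] el_D(7)[OF assms(4)] assms by auto
  have "(wmult A b b a \<cdot> (wid A b \<odot> id2 W (whom A b a))) \<rhd> (one j >< x) = x"
    using assms ap_lun[of x "whom A b a" j] unfolding wcategory_def by simp
  then show ?thesis using assms by (simp add: ap_comp ap_tens)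
qed

lemma wmult_unit_right [simp]:
  assumes "wcategory W A" "a \<in> obj A" "b \<in> obj A" "el x" "lab x = whom A b a" "tgt x = k"
  shows "wmult A b a a \<rhd> (x >< (wid A a \<rhd> one k)) = x"
proof -
  have [simp]: "trg W k = extent A a" "k \<in> one_cells W"
    using el_D(3)[OF assms(4)] el_D(2)[OF assms(4)] assms by auto
  have "(wmult A b a a \<cdot> (id2 W (whom A b a) \<odot> wid A a)) \<rhd> (x >< one k) = x"
    using assms ap_run[of x "whom A b a" k] unfolding wcategory_def by simp
  then show ?thesis using assms by (simp add: ap_comp ap_tens)
qed

lemma wmult_assoc:
  assumes "wcategory W A" "a \<in> obj A" "b \<in> obj A" "c \<in> obj A" "d \<in> obj A"
    "el x" "el y" "el z" "tgt x = sor y" "tgt y = sor z"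
    "lab x = whom A d c" "lab y = whom A c b" "lab z = whom A b a"
  shows "wmult A d b a \<rhd> ((wmult A d c b \<rhd> (x >< y)) >< z) =
    wmult A d c a \<rhd> (x >< (wmult A c b a \<rhd> (y >< z)))"
proof -
  have "(wmult A d b a \<cdot> (wmult A d c b \<odot> id2 W (whom A b a))) \<rhd> ((x >< y) >< z) =
      (wmult A d c a \<cdot> (id2 W (whom A d c) \<odot> wmult A c b a) \<cdot>
          assoc W (whom A d c) (whom A c b) (whom A b a)) \<rhd> ((x >< y) >< z)"
    using assms unfolding wcategory_def by simp
  then show ?thesis using assms by (simp add: ap_comp ap_tens ap_assoc)
qed

text \<open>Domain and codomain are read off the record, so that typing conditions can be discharged
  from a predicate with one argument.\<close>

definition wf :: "('x, 'y, 'o, 'f, 'c) wfun \<Rightarrow> bool" where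
  "wf F \<longleftrightarrow> wfunctor W (fdom F) (fcod F) F"

lemma wf [simp]:
  assumes "wf F"
  shows "wcategory W (fdom F)" "wcategory W (fcod F)"
    "a \<in> obj (fdom F) \<Longrightarrow> fobj F a \<in> obj (fcod F)"
    "a \<in> obj (fdom F) \<Longrightarrow> extent (fcod F) (fobj F a) = extent (fdom F) a"
    "a \<in> obj (fdom F) \<Longrightarrow> b \<in> obj (fdom F) \<Longrightarrow> fhom F b a \<in> two_cells W"
    "a \<in> obj (fdom F) \<Longrightarrow> b \<in> obj (fdom F) \<Longrightarrow> dom2 W (fhom F b a) = whom (fdom F) b a"
    "a \<in> obj (fdom F) \<Longrightarrow> b \<in> obj (fdom F) \<Longrightarrow>
      cod2 W (fhom F b a) = whom (fcod F) (fobj F b) (fobj F a)"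
  using assms unfolding wf_def wfunctor_def cells_def by blast+

lemma fhom_wid [simp]:
  assumes "wf F" "a \<in> obj (fdom F)" "k \<in> one_cells W" "trg W k = extent (fdom F) a"
  shows "fhom F a a \<rhd> wid (fdom F) a \<rhd> one k = wid (fcod F) (fobj F a) \<rhd> one k"
proof -
  have "(fhom F a a \<cdot> wid (fdom F) a) \<rhd> one k = wid (fcod F) (fobj F a) \<rhd> one k"
    using assms unfolding wf_def wfunctor_def by simp
  then show ?thesis using assms by (simp add: ap_comp)
qed

lemma fhom_wmult:
  assumes "wf F" "a \<in> obj (fdom F)" "b \<in> obj (fdom F)" "c \<in> obj (fdom F)"
    "el x" "el y" "tgt x = sor y" "lab x = whom (fdom F) c b" "lab y = whom (fdom F) b a"
  shows "fhom F c a \<rhd> wmult (fdom F) c b a \<rhd> (x >< y) =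
    wmult (fcod F) (fobj F c) (fobj F b) (fobj F a) \<rhd> ((fhom F c b \<rhd> x) >< (fhom F b a \<rhd> y))"
proof -
  have "(fhom F c a \<cdot> wmult (fdom F) c b a) \<rhd> (x >< y) =
    (wmult (fcod F) (fobj F c) (fobj F b) (fobj F a) \<cdot> (fhom F c b \<odot> fhom F b a)) \<rhd> (x >< y)"
    using assms unfolding wf_def wfunctor_def by simp
  then show ?thesis using assms by (simp add: ap_comp ap_tens)
qed

section \<open>Profunctors and their one-sided actions\<close>

definition pf :: "('x, 'y, 'o, 'f, 'c) prof \<Rightarrow> bool" where
  "pf M \<longleftrightarrow> profunctor W (pdom M) (pcod M) M"

lemma pf [simp]:
  assumes "pf M"
  shows "wcategory W (pdom M)" "wcategory W (pcod M)"
    "a \<in> obj (pdom M) \<Longrightarrow> b \<in> obj (pcod M) \<Longrightarrow> pcmp M b a \<in> one_cells W"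
    "a \<in> obj (pdom M) \<Longrightarrow> b \<in> obj (pcod M) \<Longrightarrow> src W (pcmp M b a) = extent (pdom M) a"
    "a \<in> obj (pdom M) \<Longrightarrow> b \<in> obj (pcod M) \<Longrightarrow> trg W (pcmp M b a) = extent (pcod M) b"
    "\<lbrakk>a \<in> obj (pdom M); a' \<in> obj (pdom M); b \<in> obj (pcod M); b' \<in> obj (pcod M)\<rbrakk> \<Longrightarrow>
      pact M b' b a a' \<in> two_cells W"
    "\<lbrakk>a \<in> obj (pdom M); a' \<in> obj (pdom M); b \<in> obj (pcod M); b' \<in> obj (pcod M)\<rbrakk> \<Longrightarrow>
      dom2 W (pact M b' b a a') = (whom (pcod M) b' b \<otimes> pcmp M b a) \<otimes> whom (pdom M) a a'"
    "\<lbrakk>a \<in> obj (pdom M); a' \<in> obj (pdom M); b \<in> obj (pcod M); b' \<in> obj (pcod M)\<rbrakk> \<Longrightarrow>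
      cod2 W (pact M b' b a a') = pcmp M b' a'"
  using assms unfolding pf_def profunctor_def one_hom_def cells_def by blast+

lemma pact_unit:
  assumes "pf M" "a \<in> obj (pdom M)" "b \<in> obj (pcod M)" "el m" "lab m = pcmp M b a" "sor m = j" "tgt m = k"
  shows "pact M b b a a \<rhd> (((wid (pcod M) b \<rhd> one j) >< m) >< (wid (pdom M) a \<rhd> one k)) = m"
proof -
  have [simp]: "trg W k = extent (pdom M) a" "k \<in> one_cells W" "trg W j = extent (pcod M) b" "j \<in> one_cells W"
    using el_D[OF assms(4)] assms by auto
  have "(pact M b b a a \<cdot> ((wid (pcod M) b \<odot> id2 W (pcmp M b a)) \<odot> wid (pdom M) a)) \<rhd> ((one j >< m) >< one k) =
    (lun W (pcmp M b a) \<cdot> run W (unit1 W (extent (pcod M) b) \<otimes> pcmp M b a)) \<rhd> ((one j >< m) >< one k)"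
    using assms unfolding pf_def profunctor_def by simp
  then show ?thesis using assms by (simp add: ap_comp ap_tens ap_lun ap_run)
qed

lemma pact_pact:
  assumes "pf M" "a \<in> obj (pdom M)" "a' \<in> obj (pdom M)" "a'' \<in> obj (pdom M)"
    "b \<in> obj (pcod M)" "b' \<in> obj (pcod M)" "b'' \<in> obj (pcod M)"
    "el g'" "el g" "el m" "el f" "el f'" "tgt g' = sor g" "tgt g = sor m" "tgt m = sor f" "tgt f = sor f'"
    "lab g' = whom (pcod M) b'' b'" "lab g = whom (pcod M) b' b" "lab m = pcmp M b a"
    "lab f = whom (pdom M) a a'" "lab f' = whom (pdom M) a' a''"
  shows "pact M b'' b' a' a'' \<rhd> ((g' >< (pact M b' b a a' \<rhd> ((g >< m) >< f))) >< f') =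
    pact M b'' b a a'' \<rhd> (((wmult (pcod M) b'' b' b \<rhd> (g' >< g)) >< m) >< (wmult (pdom M) a a' a'' \<rhd> (f >< f')))"
proof -
  let ?A = "pdom M" and ?B = "pcod M"
  let ?x = "(g' >< ((g >< m) >< f)) >< f'"
  let ?c1 = "inv2 W (assoc W (whom ?B b'' b') (whom ?B b' b \<otimes> pcmp M b a) (whom ?A a a')) \<odot> id2 W (whom ?A a' a'')"
  let ?c2 = "(inv2 W (assoc W (whom ?B b'' b') (whom ?B b' b) (pcmp M b a)) \<odot> id2 W (whom ?A a a'))
            \<odot> id2 W (whom ?A a' a'')"
  let ?c3 = "assoc W ((whom ?B b'' b' \<otimes> whom ?B b' b) \<otimes> pcmp M b a) (whom ?A a a') (whom ?A a' a'')"
  let ?c4 = "(wmult ?B b'' b' b \<odot> id2 W (pcmp M b a)) \<odot> wmult ?A a a' a''"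
  have "pact M b'' b' a' a'' \<cdot>
          ((id2 W (whom ?B b'' b') \<odot> pact M b' b a a') \<odot> id2 W (whom ?A a' a'')) =
        pact M b'' b a a'' \<cdot> ?c4 \<cdot> ?c3 \<cdot> ?c2 \<cdot> ?c1"
    using assms(1-7) unfolding pf_def profunctor_def by blast
  then have "(pact M b'' b' a' a'' \<cdot>
          ((id2 W (whom ?B b'' b') \<odot> pact M b' b a a') \<odot> id2 W (whom ?A a' a''))) \<rhd> ?x =
        (pact M b'' b a a'' \<cdot> ?c4 \<cdot> ?c3 \<cdot> ?c2 \<cdot> ?c1) \<rhd> ?x"
    by simp
  moreover have "(pact M b'' b' a' a'' \<cdot>
          ((id2 W (whom ?B b'' b') \<odot> pact M b' b a a') \<odot> id2 W (whom ?A a' a''))) \<rhd> ?x =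
      pact M b'' b' a' a'' \<rhd> ((g' >< (pact M b' b a a' \<rhd> ((g >< m) >< f))) >< f')"
    using assms by (simp add: ap_comp ap_tens)
  moreover have "(pact M b'' b a a'' \<cdot> ?c4 \<cdot> ?c3 \<cdot> ?c2 \<cdot> ?c1) \<rhd> ?x =
      pact M b'' b a a'' \<rhd> (((wmult ?B b'' b' b \<rhd> (g' >< g)) >< m) >< (wmult ?A a a' a'' \<rhd> (f >< f')))"
    using assms by (simp add: ap_comp ap_tens ap_assoc ap_assoc_inv)
  ultimately show ?thesis by simp
qed

text \<open>
  For the axioms of a profunctor it suffices to test on elements from a generating family \<open>R\<close>; \<open>(1 \<cdot> m) \<cdot> 1 = m\<close> and
  \<open>(g' \<cdot> ((g \<cdot> m) \<cdot> f)) \<cdot> f' = (g' g \<cdot> m) \<cdot> f f'\<close>.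
\<close>

lemma profI:
  assumes M: "wcategory W (pdom M)" "wcategory W (pcod M)"
    and cmp: "\<And>a b. a \<in> obj (pdom M) \<Longrightarrow> b \<in> obj (pcod M) \<Longrightarrow> pcmp M b a \<in> one_cells W \<and>
      src W (pcmp M b a) = extent (pdom M) a \<and> trg W (pcmp M b a) = extent (pcod M) b"
    and act: "\<And>a a' b b'. \<lbrakk>a \<in> obj (pdom M); a' \<in> obj (pdom M); b \<in> obj (pcod M); b' \<in> obj (pcod M)\<rbrakk> \<Longrightarrow>
      pact M b' b a a' \<in> two_cells W \<and>
      dom2 W (pact M b' b a a') = (whom (pcod M) b' b \<otimes> pcmp M b a) \<otimes> whom (pdom M) a a' \<and>
      cod2 W (pact M b' b a a') = pcmp M b' a'"
    and R: "\<And>a b k. \<lbrakk>a \<in> obj (pdom M); b \<in> obj (pcod M); k \<in> one_cells W; trg W k = extent (pdom M) a\<rbrakk> \<Longrightarrow>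
      \<exists>m \<in> R a b. iel m \<and> lab m = pcmp M b a \<and> tgt m = k"
    and unit: "\<And>a b m. \<lbrakk>a \<in> obj (pdom M); b \<in> obj (pcod M); el m; lab m = pcmp M b a; m \<in> R a b\<rbrakk> \<Longrightarrow>
      pact M b b a a \<rhd> (((wid (pcod M) b \<rhd> one (sor m)) >< m) >< (wid (pdom M) a \<rhd> one (tgt m))) = m"
    and pact: "\<And>a a' a'' b b' b'' g' g m f f'. \<lbrakk>a \<in> obj (pdom M); a' \<in> obj (pdom M); a'' \<in> obj (pdom M);
    b \<in> obj (pcod M); b' \<in> obj (pcod M); b'' \<in> obj (pcod M);
    el g'; el g; el m; el f; el f'; tgt g' = sor g; tgt g = sor m; tgt m = sor f; tgt f = sor f';
    lab g' = whom (pcod M) b'' b'; lab g = whom (pcod M) b' b; lab m = pcmp M b a;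
    lab f = whom (pdom M) a a'; lab f' = whom (pdom M) a' a''; m \<in> R a b\<rbrakk> \<Longrightarrow>
    pact M b'' b' a' a'' \<rhd> ((g' >< (pact M b' b a a' \<rhd> ((g >< m) >< f))) >< f') =
    pact M b'' b a a'' \<rhd> (((wmult (pcod M) b'' b' b \<rhd> (g' >< g)) >< m) >< (wmult (pdom M) a a' a'' \<rhd> (f >< f')))"
  shows "pf M"
proof -
  let ?A = "pdom M" and ?B = "pcod M"
  note [simp] = M cmp[THEN conjunct1] cmp[THEN conjunct2, THEN conjunct1] cmp[THEN conjunct2, THEN conjunct2]
    act[THEN conjunct1] act[THEN conjunct2, THEN conjunct1] act[THEN conjunct2, THEN conjunct2]
  have unit': "pact M b b a a \<cdot> ((wid ?B b \<odot> id2 W (pcmp M b a)) \<odot> wid ?A a) =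
      lun W (pcmp M b a) \<cdot> run W (unit1 W (extent ?B b) \<otimes> pcmp M b a)"
    if [simp]: "a \<in> obj ?A" "b \<in> obj ?B" for a b
  proof -
    let ?J = "unit1 W (extent ?A a)"
    obtain m where "m \<in> R a b" and im: "iel m" and [simp]: "lab m = pcmp M b a" "tgt m = ?J"
      using R[of a b ?J] by auto
    then have [simp]: "el m" "pact M b b a a \<rhd> (((wid ?B b \<rhd> one (sor m)) >< m) >< (wid ?A a \<rhd> one ?J)) = m"
      using unit[of a b m] by (simp_all add: iel_def)
    have [simp]: "trg W (sor m) = extent ?B b" "src W (unit1 W (extent ?B b) \<otimes> pcmp M b a) = extent ?A a"
      using el_D[of m] by simp_all
    show ?thesis
    \<comment> \<open>Pairing the invertible \<open>m\<close> with units on both sides keeps it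
      invertible, so this one element decides the unit axiom.\<close>
    proof (rule cell_eqI_lab[where x = "(one (sor m) >< m) >< one ?J"])
      show "iel ((one (sor m) >< m) >< one ?J)" using im by (intro iel_pr iel_one) simp_all
    qed (simp_all add: ap_comp ap_tens ap_run ap_lun)
  qed
  have pact': "pact M b'' b' a' a'' \<cdot> ((id2 W (whom ?B b'' b') \<odot> pact M b' b a a') \<odot> id2 W (whom ?A a' a'')) =
    pact M b'' b a a'' \<cdot> ((wmult ?B b'' b' b \<odot> id2 W (pcmp M b a)) \<odot> wmult ?A a a' a'') \<cdot>
      assoc W ((whom ?B b'' b' \<otimes> whom ?B b' b) \<otimes> pcmp M b a) (whom ?A a a') (whom ?A a' a'') \<cdot>
      ((inv2 W (assoc W (whom ?B b'' b') (whom ?B b' b) (pcmp M b a)) \<odot> id2 W (whom ?A a a')) \<odot> id2 W (whom ?A a' a'')) \<cdot>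
      (inv2 W (assoc W (whom ?B b'' b') (whom ?B b' b \<otimes> pcmp M b a) (whom ?A a a')) \<odot> id2 W (whom ?A a' a''))"
    if [simp]: "a \<in> obj ?A" "a' \<in> obj ?A" "a'' \<in> obj ?A" "b \<in> obj ?B" "b' \<in> obj ?B" "b'' \<in> obj ?B" for a a' a'' b b' b''
  proof -
    \<comment> \<open>Each element takes the source of its right neighbour as target, hence the
      choice from the right. Only \<open>m\<close> comes from the test family \<open>R\<close>; all
      others are generic.\<close>
    let ?f' = "gen (whom ?A a' a'') (unit1 W (extent ?A a''))"
    let ?f = "gen (whom ?A a a') (sor ?f')"
    obtain m where mR: "m \<in> R a b" and im: "iel m" and [simp]: "lab m = pcmp M b a" "tgt m = sor ?f"
      using R[of a b "sor ?f"] by auto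
    let ?g = "gen (whom ?B b' b) (sor m)"
    let ?g' = "gen (whom ?B b'' b') (sor ?g)"
    let ?x = "(?g' >< ((?g >< m) >< ?f)) >< ?f'"
    have [simp]: "el m" using im by (simp add: iel_def)
    have eq: "pact M b'' b' a' a'' \<rhd> ((?g' >< (pact M b' b a a' \<rhd> ((?g >< m) >< ?f))) >< ?f') =
      pact M b'' b a a'' \<rhd> (((wmult ?B b'' b' b \<rhd> (?g' >< ?g)) >< m) >< (wmult ?A a a' a'' \<rhd> (?f >< ?f')))"
      by (rule pact) (use mR in simp_all)
    show ?thesis
    proof (rule cell_eqI_lab[where x = ?x])
      show "iel ?x" using im by (intro iel_pr iel_gen) simp_all
    qed (use eq in \<open>simp_all add: ap_comp ap_tens ap_assoc ap_assoc_inv\<close>)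
  qed
  show ?thesis unfolding pf_def profunctor_def
    using M cmp act unit' pact' by (simp add: one_hom_def cells_def)
qed

lemma gen_ex [simp]: "\<lbrakk>f \<in> one_cells W; k \<in> one_cells W; trg W k = src W f\<rbrakk> \<Longrightarrow> \<exists>m. iel m \<and> lab m = f \<and> tgt m = k"
  using iel_gen[of f k] by auto

lemma lact_cell [simp]:
  assumes "pf M" "a \<in> obj (pdom M)" "b \<in> obj (pcod M)" "b' \<in> obj (pcod M)"
  shows "lact W M b' b a \<in> two_cells W" "dom2 W (lact W M b' b a) = whom (pcod M) b' b \<otimes> pcmp M b a"
    "cod2 W (lact W M b' b a) = pcmp M b' a"
proof -
  have "src W (whom (pcod M) b' b \<otimes> pcmp M b a) = extent (pdom M) a" using assms by simp
  then show "lact W M b' b a \<in> two_cells W" "dom2 W (lact W M b' b a) = whom (pcod M) b' b \<otimes> pcmp M b a"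
    "cod2 W (lact W M b' b a) = pcmp M b' a"
    using assms unfolding lact_def by simp_all
qed

lemma ract_cell [simp]:
  assumes "pf M" "a \<in> obj (pdom M)" "a' \<in> obj (pdom M)" "b \<in> obj (pcod M)"
  shows "ract W M b a a' \<in> two_cells W" "dom2 W (ract W M b a a') = pcmp M b a \<otimes> whom (pdom M) a a'"
    "cod2 W (ract W M b a a') = pcmp M b a'"
  using assms unfolding ract_def by simp_all

lemma lact_ap:
  assumes "pf M" "a \<in> obj (pdom M)" "b \<in> obj (pcod M)" "b' \<in> obj (pcod M)"
    "el g" "el m" "tgt g = sor m" "lab g = whom (pcod M) b' b" "lab m = pcmp M b a"
  shows "lact W M b' b a \<rhd> (g >< m) =
    pact M b' b a a \<rhd> ((g >< m) >< (wid (pdom M) a \<rhd> one (tgt m)))"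
unfolding lact_def using assms by (simp add: ap_comp ap_tens ap_run_inv)

lemma ract_ap:
  assumes "pf M" "a \<in> obj (pdom M)" "a' \<in> obj (pdom M)" "b \<in> obj (pcod M)"
    "el m" "el f" "tgt m = sor f" "lab f = whom (pdom M) a a'" "lab m = pcmp M b a"
  shows "ract W M b a a' \<rhd> (m >< f) =
    pact M b b a a' \<rhd> (((wid (pcod M) b \<rhd> one (sor m)) >< m) >< f)"
unfolding ract_def using assms by (simp add: ap_comp ap_tens ap_lun_inv)

lemma lact_wid [simp]:
  assumes "pf M" "a \<in> obj (pdom M)" "b \<in> obj (pcod M)" "el m" "lab m = pcmp M b a" "sor m = j"
  shows "lact W M b b a \<rhd> ((wid (pcod M) b \<rhd> one j) >< m) = m"
proof -
  have [simp]: "trg W j = extent (pcod M) b" "j \<in> one_cells W" using el_D[OF assms(4)] assms by auto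
  show ?thesis using assms by (simp add: lact_ap pact_unit)
qed

lemma ract_wid [simp]:
  assumes "pf M" "a \<in> obj (pdom M)" "b \<in> obj (pcod M)" "el m" "lab m = pcmp M b a" "tgt m = k"
  shows "ract W M b a a \<rhd> (m >< (wid (pdom M) a \<rhd> one k)) = m"
proof -
  have [simp]: "trg W k = extent (pdom M) a" "k \<in> one_cells W" using el_D[OF assms(4)] assms by auto
  show ?thesis using assms by (simp add: ract_ap pact_unit)
qed

text \<open>Each one-sided action inserts an identity on the other side. The associativity axiom
  merges the two actions, and the unit laws of the categories absorb the identities.\<close>

lemma ract_lact_pact:
  assumes "pf M" "a \<in> obj (pdom M)" "a' \<in> obj (pdom M)" "b \<in> obj (pcod M)" "b' \<in> obj (pcod M)"
    "el g" "el m" "el f" "tgt g = sor m" "tgt m = sor f"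
    "lab g = whom (pcod M) b' b" "lab m = pcmp M b a" "lab f = whom (pdom M) a a'"
  shows "ract W M b' a a' \<rhd> ((lact W M b' b a \<rhd> (g >< m)) >< f) = pact M b' b a a' \<rhd> ((g >< m) >< f)"
    and "lact W M b' b a' \<rhd> (g >< (ract W M b a a' \<rhd> (m >< f))) = pact M b' b a a' \<rhd> ((g >< m) >< f)"
proof -
  show "ract W M b' a a' \<rhd> ((lact W M b' b a \<rhd> (g >< m)) >< f) = pact M b' b a a' \<rhd> ((g >< m) >< f)"
    using assms by (simp add: lact_ap ract_ap pact_pact)
  show "lact W M b' b a' \<rhd> (g >< (ract W M b a a' \<rhd> (m >< f))) = pact M b' b a a' \<rhd> ((g >< m) >< f)"
    using assms by (simp add: lact_ap ract_ap pact_pact)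
qed

lemma lact_lact:
  assumes "pf M" "a \<in> obj (pdom M)" "b \<in> obj (pcod M)" "b' \<in> obj (pcod M)" "b'' \<in> obj (pcod M)"
    "el h" "el g" "el m" "tgt h = sor g" "tgt g = sor m"
    "lab h = whom (pcod M) b'' b'" "lab g = whom (pcod M) b' b" "lab m = pcmp M b a"
  shows "lact W M b'' b' a \<rhd> (h >< (lact W M b' b a \<rhd> (g >< m))) =
    lact W M b'' b a \<rhd> ((wmult (pcod M) b'' b' b \<rhd> (h >< g)) >< m)"
using assms by (simp add: lact_ap pact_pact)

lemma ract_ract:
  assumes "pf M" "a \<in> obj (pdom M)" "a' \<in> obj (pdom M)" "a'' \<in> obj (pdom M)" "b \<in> obj (pcod M)"
    "el m" "el f" "el h" "tgt m = sor f" "tgt f = sor h"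
    "lab m = pcmp M b a" "lab f = whom (pdom M) a a'" "lab h = whom (pdom M) a' a''"
  shows "ract W M b a' a'' \<rhd> ((ract W M b a a' \<rhd> (m >< f)) >< h) =
    ract W M b a a'' \<rhd> (m >< (wmult (pdom M) a a' a'' \<rhd> (f >< h)))"
using assms by (simp add: ract_ap pact_pact)

lemma ract_lact:
  assumes "pf M" "a \<in> obj (pdom M)" "a' \<in> obj (pdom M)" "b \<in> obj (pcod M)" "b' \<in> obj (pcod M)"
    "el g" "el m" "el f" "tgt g = sor m" "tgt m = sor f"
    "lab g = whom (pcod M) b' b" "lab m = pcmp M b a" "lab f = whom (pdom M) a a'"
  shows "ract W M b' a a' \<rhd> ((lact W M b' b a \<rhd> (g >< m)) >< f) =
    lact W M b' b a' \<rhd> (g >< (ract W M b a a' \<rhd> (m >< f)))"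
  using ract_lact_pact[OF assms] by simp

section \<open>Maps of profunctors\<close>

lemma pmapD:
  assumes "t \<in> pmaps W M N"
  shows "pf M" "pf N" "mdom t = M" "mcod t = N" "pdom N = pdom M" "pcod N = pcod M"
    "a \<in> obj (pdom M) \<Longrightarrow> b \<in> obj (pcod M) \<Longrightarrow> mcmp t (b, a) \<in> two_cells W"
    "a \<in> obj (pdom M) \<Longrightarrow> b \<in> obj (pcod M) \<Longrightarrow> dom2 W (mcmp t (b, a)) = pcmp M b a"
    "a \<in> obj (pdom M) \<Longrightarrow> b \<in> obj (pcod M) \<Longrightarrow> cod2 W (mcmp t (b, a)) = pcmp N b a"
    "mcmp t \<in> extensional (obj (pcod M) \<times> obj (pdom M))"
proof -
  have *: "mcmp t \<in> (\<Pi>\<^sub>E (b, a) \<in> obj (pcod M) \<times> obj (pdom M). cells W (pcmp M b a) (pcmp N b a))"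
    "\<exists>A B. profunctor W A B M \<and> profunctor W A B N" "mdom t = M" "mcod t = N"
    using assms unfolding pmaps_def by auto
  then show "pf M" "pf N" "mdom t = M" "mcod t = N" "pdom N = pdom M" "pcod N = pcod M"
    unfolding pf_def by (auto simp: profunctor_def)
  have "mcmp t (b, a) \<in> cells W (pcmp M b a) (pcmp N b a)" if "a \<in> obj (pdom M)" "b \<in> obj (pcod M)"
    using PiE_mem[OF *(1), of "(b, a)"] that by simp
  then show "a \<in> obj (pdom M) \<Longrightarrow> b \<in> obj (pcod M) \<Longrightarrow> mcmp t (b, a) \<in> two_cells W"
    "a \<in> obj (pdom M) \<Longrightarrow> b \<in> obj (pcod M) \<Longrightarrow> dom2 W (mcmp t (b, a)) = pcmp M b a"
    "a \<in> obj (pdom M) \<Longrightarrow> b \<in> obj (pcod M) \<Longrightarrow> cod2 W (mcmp t (b, a)) = pcmp N b a"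
    by (auto simp: cells_def)
  show "mcmp t \<in> extensional (obj (pcod M) \<times> obj (pdom M))"
    using *(1) by (auto simp: PiE_def)
qed

lemma pmap_pact:
  assumes t: "t \<in> pmaps W M N"
    and o [simp]: "a \<in> obj (pdom M)" "a' \<in> obj (pdom M)" "b \<in> obj (pcod M)" "b' \<in> obj (pcod M)"
    and [simp]: "el g" "el m" "el f" "tgt g = sor m" "tgt m = sor f" "lab g = whom (pcod M) b' b" "lab m = pcmp M b a"
    "lab f = whom (pdom M) a a'"
  shows "mcmp t (b', a') \<rhd> pact M b' b a a' \<rhd> ((g >< m) >< f) =
    pact N b' b a a' \<rhd> ((g >< (mcmp t (b, a) \<rhd> m)) >< f)"
proof -
  note [simp] = pmapD[OF t]
  have "mcmp t (b', a') \<cdot> pact M b' b a a' =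
        pact N b' b a a' \<cdot>
          ((id2 W (whom (pcod M) b' b) \<odot> mcmp t (b, a)) \<odot> id2 W (whom (pdom M) a a'))"
    using t o unfolding pmaps_def by blast
  then have "(mcmp t (b', a') \<cdot> pact M b' b a a') \<rhd> ((g >< m) >< f) =
        (pact N b' b a a' \<cdot>
          ((id2 W (whom (pcod M) b' b) \<odot> mcmp t (b, a)) \<odot> id2 W (whom (pdom M) a a'))) \<rhd> ((g >< m) >< f)"
    by simp
  then show ?thesis by (simp add: ap_comp ap_tens)
qed

lemma pmap_lact:
  assumes t: "t \<in> pmaps W M N"
    and [simp]: "a \<in> obj (pdom M)" "b \<in> obj (pcod M)" "b' \<in> obj (pcod M)"
    and [simp]: "el g" "el m" "tgt g = sor m" "lab g = whom (pcod M) b' b" "lab m = pcmp M b a"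
  shows "mcmp t (b', a) \<rhd> lact W M b' b a \<rhd> (g >< m) =
    lact W N b' b a \<rhd> (g >< (mcmp t (b, a) \<rhd> m))"
proof -
  note [simp] = pmapD[OF t]
  show ?thesis by (simp add: lact_ap pmap_pact[OF t])
qed

lemma pmap_ract:
  assumes t: "t \<in> pmaps W M N"
    and [simp]: "a \<in> obj (pdom M)" "a' \<in> obj (pdom M)" "b \<in> obj (pcod M)"
    and [simp]: "el m" "el f" "tgt m = sor f" "lab f = whom (pdom M) a a'" "lab m = pcmp M b a"
  shows "mcmp t (b, a') \<rhd> ract W M b a a' \<rhd> (m >< f) =
    ract W N b a a' \<rhd> ((mcmp t (b, a) \<rhd> m) >< f)"
proof -
  note [simp] = pmapD[OF t]
  show ?thesis by (simp add: ract_ap pmap_pact[OF t])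
qed

text \<open>A two-sided action is a right action after a left one, so compatibility may be checked
  one side at a time.\<close>

lemma pmapI:
  assumes [simp]: "pf M" "pf N" "pdom N = pdom M" "pcod N = pcod M" and md: "mdom t = M" "mcod t = N"
    and ext: "mcmp t \<in> extensional (obj (pcod M) \<times> obj (pdom M))"
    and cell: "\<And>a b. a \<in> obj (pdom M) \<Longrightarrow> b \<in> obj (pcod M) \<Longrightarrow> mcmp t (b, a) \<in> two_cells W \<and>
      dom2 W (mcmp t (b, a)) = pcmp M b a \<and> cod2 W (mcmp t (b, a)) = pcmp N b a"
    and l: "\<And>a b b' g m. \<lbrakk>a \<in> obj (pdom M); b \<in> obj (pcod M); b' \<in> obj (pcod M);
      el g; el m; tgt g = sor m; lab g = whom (pcod M) b' b; lab m = pcmp M b a\<rbrakk> \<Longrightarrow>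
      mcmp t (b', a) \<rhd> lact W M b' b a \<rhd> (g >< m) = lact W N b' b a \<rhd> (g >< (mcmp t (b, a) \<rhd> m))"
    and r: "\<And>a a' b m f. \<lbrakk>a \<in> obj (pdom M); a' \<in> obj (pdom M); b \<in> obj (pcod M);
      el m; el f; tgt m = sor f; lab f = whom (pdom M) a a'; lab m = pcmp M b a\<rbrakk> \<Longrightarrow>
      mcmp t (b, a') \<rhd> ract W M b a a' \<rhd> (m >< f) = ract W N b a a' \<rhd> ((mcmp t (b, a) \<rhd> m) >< f)"
  shows "t \<in> pmaps W M N"
proof -
  note [simp] = cell[THEN conjunct1] cell[THEN conjunct2, THEN conjunct1] cell[THEN conjunct2, THEN conjunct2]
  have "profunctor W (pdom M) (pcod M) M \<and> profunctor W (pdom M) (pcod M) N"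
    using assms(1-4) unfolding pf_def by simp
  then have 1: "\<exists>A B. profunctor W A B M \<and> profunctor W A B N" by blast
  have 2: "mcmp t \<in> (\<Pi>\<^sub>E (b, a) \<in> obj (pcod M) \<times> obj (pdom M). cells W (pcmp M b a) (pcmp N b a))"
    using ext by (auto simp: PiE_def cells_def)
  have "mcmp t (b', a') \<cdot> pact M b' b a a' =
        pact N b' b a a' \<cdot>
          ((id2 W (whom (pcod M) b' b) \<odot> mcmp t (b, a)) \<odot> id2 W (whom (pdom M) a a'))"
    if [simp]: "a \<in> obj (pdom M)" "a' \<in> obj (pdom M)" "b \<in> obj (pcod M)" "b' \<in> obj (pcod M)" for a a' b b'
  proof (rule ext3')
    fix g m f assume [simp]: "el g" "el m" "el f" "tgt g = sor m" "tgt m = sor f"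
      "lab g = whom (pcod M) b' b" "lab m = pcmp M b a" "lab f = whom (pdom M) a a'"
    have "mcmp t (b', a') \<rhd> pact M b' b a a' \<rhd> ((g >< m) >< f) =
      mcmp t (b', a') \<rhd> ract W M b' a a' \<rhd> ((lact W M b' b a \<rhd> (g >< m)) >< f)"
      by (simp add: ract_lact_pact(1))
    also have "\<dots> = ract W N b' a a' \<rhd> ((lact W N b' b a \<rhd> (g >< (mcmp t (b, a) \<rhd> m))) >< f)"
      by (simp add: l r)
    also have "\<dots> = pact N b' b a a' \<rhd> ((g >< (mcmp t (b, a) \<rhd> m)) >< f)"
      by (subst ract_lact_pact(1)) simp_all
    finally show "(mcmp t (b', a') \<cdot> pact M b' b a a') \<rhd> ((g >< m) >< f) =
        (pact N b' b a a' \<cdot>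
          ((id2 W (whom (pcod M) b' b) \<odot> mcmp t (b, a)) \<odot> id2 W (whom (pdom M) a a'))) \<rhd> ((g >< m) >< f)"
      by (simp add: ap_comp ap_tens)
  qed simp_all
  with 1 2 md show ?thesis unfolding pmaps_def by blast
qed

lemma pmap_eqI:
  assumes "t \<in> pmaps W M N" "s \<in> pmaps W M N"
    and "\<And>a b. a \<in> obj (pdom M) \<Longrightarrow> b \<in> obj (pcod M) \<Longrightarrow> mcmp t (b, a) = mcmp s (b, a)"
  shows "t = s"
proof -
  have "mcmp t = mcmp s"
    by (rule extensionalityI[OF pmapD(10)[OF assms(1)] pmapD(10)[OF assms(2)]]) (use assms(3) in auto)
  then show ?thesis using pmapD(3,4)[OF assms(1)] pmapD(3,4)[OF assms(2)] by simp
qed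

lemma pmap_id_cmp [simp]:
  "a \<in> obj (pdom M) \<Longrightarrow> b \<in> obj (pcod M) \<Longrightarrow> mcmp (pmap_id W M) (b, a) = id2 W (pcmp M b a)"
  "mdom (pmap_id W M) = M" "mcod (pmap_id W M) = M"
  by (simp_all add: pmap_id_def)

lemma pmap_id_in:
  assumes [simp]: "pf M"
  shows "pmap_id W M \<in> pmaps W M M"
  by (rule pmapI) (simp_all, simp add: pmap_id_def)

lemma pmap_comp_sel [simp]:
  "a \<in> obj (pdom (mdom s)) \<Longrightarrow> b \<in> obj (pcod (mdom s)) \<Longrightarrow>
    mcmp (pmap_comp W t s) (b, a) = mcmp t (b, a) \<cdot> mcmp s (b, a)"
  "mdom (pmap_comp W t s) = mdom s" "mcod (pmap_comp W t s) = mcod t"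
  by (simp_all add: pmap_comp_def)

lemma pmap_comp_in:
  assumes s: "s \<in> pmaps W L M" and t: "t \<in> pmaps W M N"
  shows "pmap_comp W t s \<in> pmaps W L N"
proof -
  note [simp] = pmapD[OF s] pmapD[OF t]
  show ?thesis
    by (rule pmapI) (simp_all add: ap_comp pmap_lact[OF s] pmap_lact[OF t] pmap_ract[OF s] pmap_ract[OF t],
        simp add: pmap_comp_def)
qed

section \<open>Identity profunctors and profunctors induced by functors\<close>

lemma id_prof_sel [simp]:
  "pdom (id_prof W A) = A" "pcod (id_prof W A) = A" "pcmp (id_prof W A) = whom A"
  by (simp_all add: id_prof_def)

lemma id_prof_pact:
  assumes [simp]: "wcategory W A" "a \<in> obj A" "a' \<in> obj A" "b \<in> obj A" "b' \<in> obj A"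
    "el g" "el m" "el f" "tgt g = sor m" "tgt m = sor f"
    "lab g = whom A b' b" "lab m = whom A b a" "lab f = whom A a a'"
  shows "pact (id_prof W A) b' b a a' \<rhd> ((g >< m) >< f) =
    wmult A b' a a' \<rhd> ((wmult A b' b a \<rhd> (g >< m)) >< f)"
  by (simp add: id_prof_def ap_comp ap_tens)

lemma id_prof_pf [simp]:
  assumes [simp]: "wcategory W A"
  shows "pf (id_prof W A)"
proof (rule profI[where R = "\<lambda>_ _. UNIV"])
  fix a b m assume [simp]: "a \<in> obj (pdom (id_prof W A))" "b \<in> obj (pcod (id_prof W A))" and [simp]: "el m"
    and l: "lab m = pcmp (id_prof W A) b a"
  have [simp]: "a \<in> obj A" "b \<in> obj A" "lab m = whom A b a" using \<open>a \<in> _\<close> \<open>b \<in> _\<close> l by simp_all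
  show "pact (id_prof W A) b b a a \<rhd> (((wid (pcod (id_prof W A)) b \<rhd> one (sor m)) >< m) ><
    (wid (pdom (id_prof W A)) a \<rhd> one (tgt m))) = m"
    by (simp add: id_prof_pact)
qed (simp_all add: id_prof_pact wmult_assoc, simp_all add: id_prof_def)

lemma id_prof_act:
  assumes [simp]: "wcategory W A" "a \<in> obj A" "b \<in> obj A" "c \<in> obj A"
    "el x" "el y" "tgt x = sor y" "lab x = whom A c b" "lab y = whom A b a"
  shows "lact W (id_prof W A) c b a \<rhd> (x >< y) = wmult A c b a \<rhd> (x >< y)"
    "ract W (id_prof W A) c b a \<rhd> (x >< y) = wmult A c b a \<rhd> (x >< y)"
proof -
  show "lact W (id_prof W A) c b a \<rhd> (x >< y) = wmult A c b a \<rhd> (x >< y)"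
    by (subst lact_ap) (simp_all add: id_prof_pact)
  show "ract W (id_prof W A) c b a \<rhd> (x >< y) = wmult A c b a \<rhd> (x >< y)"
    by (subst ract_ap) (simp_all add: id_prof_pact)
qed

lemma fun_prof_sel [simp]:
  "pdom (fun_prof W G H) = fdom H" "pcod (fun_prof W G H) = fdom G"
  "pcmp (fun_prof W G H) b a = whom (fcod H) (fobj G b) (fobj H a)"
  by (simp_all add: fun_prof_def Let_def)

lemma fun_prof_pact:
  assumes [simp]: "wf G" "wf H" "fcod G = fcod H" "a \<in> obj (fdom H)" "a' \<in> obj (fdom H)"
    "b \<in> obj (fdom G)" "b' \<in> obj (fdom G)"
    "el g" "el m" "el f" "tgt g = sor m" "tgt m = sor f"
    "lab g = whom (fdom G) b' b" "lab m = whom (fcod H) (fobj G b) (fobj H a)" "lab f = whom (fdom H) a a'"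
  shows "pact (fun_prof W G H) b' b a a' \<rhd> ((g >< m) >< f) =
    wmult (fcod H) (fobj G b') (fobj H a) (fobj H a') \<rhd>
      ((wmult (fcod H) (fobj G b') (fobj G b) (fobj H a) \<rhd> ((fhom G b' b \<rhd> g) >< m)) >< (fhom H a a' \<rhd> f))"
proof -
  have [simp]: "fobj G x \<in> obj (fcod H)" "extent (fcod H) (fobj G x) = extent (fdom G) x"
    if "x \<in> obj (fdom G)" for x
    using wf(3)[of G] wf(4)[of G] that by simp_all
  have [simp]: "cod2 W (fhom G b' b) = whom (fcod H) (fobj G b') (fobj G b)" using wf(7)[of G] by simp
  show ?thesis by (simp add: fun_prof_def Let_def ap_comp ap_tens)
qed

lemma fun_prof_pf [simp]:
  assumes [simp]: "wf G" "wf H" and e: "fcod G = fcod H"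
  shows "pf (fun_prof W G H)"
proof -
  note [simp] = e
  \<comment> \<open>As \<open>fcod G\<close> is rewritten to \<open>fcod H\<close>, the typing facts
    about \<open>G\<close> are restated for the new codomain.\<close>
  have [simp]: "fobj G x \<in> obj (fcod H)" "extent (fcod H) (fobj G x) = extent (fdom G) x"
    if "x \<in> obj (fdom G)" for x
    using wf(3)[of G] wf(4)[of G] that by simp_all
  have [simp]: "cod2 W (fhom G b' b) = whom (fcod H) (fobj G b') (fobj G b)"
    if "b \<in> obj (fdom G)" "b' \<in> obj (fdom G)" for b b' using wf(7)[of G] that by simp
  have w [simp]: "fhom G b b \<rhd> wid (fdom G) b \<rhd> one k = wid (fcod H) (fobj G b) \<rhd> one k"
    if "b \<in> obj (fdom G)" "k \<in> one_cells W" "trg W k = extent (fdom G) b" for b k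
    using fhom_wid[of G b k] that by simp
  have wm: "fhom G c a \<rhd> wmult (fdom G) c b a \<rhd> (x >< y) =
    wmult (fcod H) (fobj G c) (fobj G b) (fobj G a) \<rhd> ((fhom G c b \<rhd> x) >< (fhom G b a \<rhd> y))"
    if "a \<in> obj (fdom G)" "b \<in> obj (fdom G)" "c \<in> obj (fdom G)"
    "el x" "el y" "tgt x = sor y" "lab x = whom (fdom G) c b" "lab y = whom (fdom G) b a" for a b c x y
    using fhom_wmult[of G a b c x y] that by simp
  show ?thesis
  proof (rule profI[where R = "\<lambda>_ _. UNIV"])
    fix a b m assume "a \<in> obj (pdom (fun_prof W G H))" "b \<in> obj (pcod (fun_prof W G H))" and [simp]: "el m"
      and "lab m = pcmp (fun_prof W G H) b a"
    then have [simp]: "a \<in> obj (fdom H)" "b \<in> obj (fdom G)" "lab m = whom (fcod H) (fobj G b) (fobj H a)"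
      by simp_all
    show "pact (fun_prof W G H) b b a a \<rhd> (((wid (pcod (fun_prof W G H)) b \<rhd> one (sor m)) >< m) ><
      (wid (pdom (fun_prof W G H)) a \<rhd> one (tgt m))) = m"
      by (simp add: fun_prof_pact)
  qed (simp_all add: fun_prof_pact wmult_assoc wm fhom_wmult, simp_all add: fun_prof_def Let_def)
qed

lemma fun_prof_act:
  assumes [simp]: "wf G" "wf H" and e: "fcod G = fcod H"
  shows "\<lbrakk>a \<in> obj (fdom H); b \<in> obj (fdom G); b' \<in> obj (fdom G); el g; el m; tgt g = sor m;
    lab g = whom (fdom G) b' b; lab m = whom (fcod H) (fobj G b) (fobj H a)\<rbrakk> \<Longrightarrow>
    lact W (fun_prof W G H) b' b a \<rhd> (g >< m) =
      wmult (fcod H) (fobj G b') (fobj G b) (fobj H a) \<rhd> ((fhom G b' b \<rhd> g) >< m)"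
    and "\<lbrakk>a \<in> obj (fdom H); a' \<in> obj (fdom H); b \<in> obj (fdom G); el m; el f; tgt m = sor f;
    lab f = whom (fdom H) a a'; lab m = whom (fcod H) (fobj G b) (fobj H a)\<rbrakk> \<Longrightarrow>
    ract W (fun_prof W G H) b a a' \<rhd> (m >< f) =
      wmult (fcod H) (fobj G b) (fobj H a) (fobj H a') \<rhd> (m >< (fhom H a a' \<rhd> f))"
proof -
  note [simp] = e
  have [simp]: "fobj G x \<in> obj (fcod H)" "extent (fcod H) (fobj G x) = extent (fdom G) x"
    if "x \<in> obj (fdom G)" for x
    using wf(3)[of G] wf(4)[of G] that by simp_all
  have [simp]: "cod2 W (fhom G b' b) = whom (fcod H) (fobj G b') (fobj G b)"
    if "b \<in> obj (fdom G)" "b' \<in> obj (fdom G)" for b b' using wf(7)[of G] that by simp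
  have w [simp]: "fhom G b b \<rhd> wid (fdom G) b \<rhd> one k = wid (fcod H) (fobj G b) \<rhd> one k"
    if "b \<in> obj (fdom G)" "k \<in> one_cells W" "trg W k = extent (fdom G) b" for b k
    using fhom_wid[of G b k] that by simp
  show "lact W (fun_prof W G H) b' b a \<rhd> (g >< m) =
      wmult (fcod H) (fobj G b') (fobj G b) (fobj H a) \<rhd> ((fhom G b' b \<rhd> g) >< m)"
    if [simp]: "a \<in> obj (fdom H)" "b \<in> obj (fdom G)" "b' \<in> obj (fdom G)" "el g" "el m" "tgt g = sor m"
    "lab g = whom (fdom G) b' b" "lab m = whom (fcod H) (fobj G b) (fobj H a)"
  by (simp add: lact_ap fun_prof_pact)
  show "ract W (fun_prof W G H) b a a' \<rhd> (m >< f) =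
      wmult (fcod H) (fobj G b) (fobj H a) (fobj H a') \<rhd> (m >< (fhom H a a' \<rhd> f))"
    if [simp]: "a \<in> obj (fdom H)" "a' \<in> obj (fdom H)" "b \<in> obj (fdom G)" "el m" "el f" "tgt m = sor f"
    "lab f = whom (fdom H) a a'" "lab m = whom (fcod H) (fobj G b) (fobj H a)"
  by (simp add: ract_ap fun_prof_pact)
qed

section \<open>One-object categories\<close>

lemma unit_wcat_sel [simp]:
  "obj (unit_wcat W x) = {()}" "extent (unit_wcat W x) i = x" "whom (unit_wcat W x) i j = unit1 W x"
  "wid (unit_wcat W x) i = id2 W (unit1 W x)" "wmult (unit_wcat W x) i j l = lun W (unit1 W x)"
  by (simp_all add: unit_wcat_def)

text \<open>Associativity is the triangle identity at the unit 1-cell, once its left and right unit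
  constraints are known to agree.\<close>

lemma unit_wcat_wcat [simp]:
  assumes [simp]: "x \<in> zero_cells W"
  shows "wcategory W (unit_wcat W x)"
proof -
  let ?I = "unit1 W x"
  have 1: "lun W ?I \<cdot> (lun W ?I \<odot> id2 W ?I) = lun W ?I \<cdot> (id2 W ?I \<odot> lun W ?I) \<cdot> assoc W ?I ?I ?I"
    using triangle[of ?I ?I] by (simp add: lun_unit_eq_run_unit)
  show ?thesis
    unfolding wcategory_def using 1
    by (simp add: one_hom_def cells_def tens1_in(4) lun_unit_eq_run_unit)
qed

lemma obj_fun_sel [simp]:
  "fdom (obj_fun W C c) = unit_wcat W (extent C c)" "fcod (obj_fun W C c) = C"
  "fobj (obj_fun W C c) i = c" "fhom (obj_fun W C c) i j = wid C c"
  by (simp_all add: obj_fun_def)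

text \<open>Compatibility with composition reduces to the left unit law of \<open>C\<close>, because
  the left factor may be tested on \<open>one\<close>.\<close>

lemma obj_fun_wf [simp]:
  assumes [simp]: "wcategory W C" "c \<in> obj C"
  shows "wf (obj_fun W C c)"
proof -
  let ?I = "unit1 W (extent C c)"
  have "wid C c \<cdot> lun W ?I = wmult C c c c \<cdot> (wid C c \<odot> wid C c)"
  proof (rule ext_one_left)
    fix x assume [simp]: "el x" "lab x = ?I"
    show "(wid C c \<cdot> lun W ?I) \<rhd> (one (sor x) >< x) = (wmult C c c c \<cdot> (wid C c \<odot> wid C c)) \<rhd> (one (sor x) >< x)"
      by (simp add: ap_comp ap_tens ap_lun)
  qed simp_all
  then show ?thesis
    unfolding wf_def wfunctor_def by (simp add: cells_def)
qed

text \<open>The identity of the one-object category is an identity 2-cell, so the unit law of the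
  action already prescribes the action on \<open>one\<close>, and \<open>one\<close> decides
  equality.\<close>

lemma ract_unit_wcat:
  assumes [simp]: "pf M" "pdom M = unit_wcat W x" "x \<in> zero_cells W" "b \<in> obj (pcod M)"
  shows "ract W M b () () = run W (pcmp M b ())"
proof (rule ext_one_right)
  fix m assume [simp]: "el m" "lab m = pcmp M b ()"
  show "ract W M b () () \<rhd> (m >< one (tgt m)) = run W (pcmp M b ()) \<rhd> (m >< one (tgt m))"
    using ract_wid[of M "()" b m "tgt m"] by (simp add: ap_run)
qed simp_all

lemma lact_unit_wcat:
  assumes [simp]: "pf M" "pcod M = unit_wcat W x" "x \<in> zero_cells W" "a \<in> obj (pdom M)"
  shows "lact W M () () a = lun W (pcmp M () a)"
proof (rule ext_one_left)
  fix m assume [simp]: "el m" "lab m = pcmp M () a"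
  show "lact W M () () a \<rhd> (one (sor m) >< m) = lun W (pcmp M () a) \<rhd> (one (sor m) >< m)"
    using lact_wid[of M a "()" m "sor m"] by (simp add: ap_lun)
qed simp_all

end

section \<open>Tensor products of profunctors\<close>

locale cobicat = bicat W for W :: "('o, 'f, 'c) bicat"  (structure) +
  fixes \<kappa> :: "'k rel"
  assumes \<kappa>: "smallness_cardinal \<kappa>" and biclosed: "biclosed W"
    and coco: "\<And>x y. x \<in> zero_cells W \<Longrightarrow> y \<in> zero_cells W \<Longrightarrow> small_cocomplete \<kappa> (hom_cat W x y)"
begin

section \<open>The coequaliser behind a tensor product\<close>

definition tp :: "('y, 'z, 'o, 'f, 'c) prof \<Rightarrow> ('x, 'y, 'o, 'f, 'c) prof \<Rightarrow> bool" where
  "tp N M \<longleftrightarrow> pf M \<and> pf N \<and> pdom N = pcod M \<and> small_set \<kappa> (obj (pcod M))"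

lemma ex1_implies_eq: "\<lbrakk>\<exists>!x. P x; P x; P y\<rbrakk> \<Longrightarrow> x = y"
  by blast

lemma tpD: "tp N M \<Longrightarrow> pf M" "tp N M \<Longrightarrow> pf N" "tp N M \<Longrightarrow> pdom N = pcod M"
  "tp N M \<Longrightarrow> small_set \<kappa> (obj (pcod M))"
  by (simp_all add: tp_def)

text \<open>\<open>tu\<close> and \<open>tv\<close> are the actions of the middle category on
  \<open>N\<close> and on \<open>M\<close>, that is, the two parallel maps of the coequaliser on the
  summand \<open>(b, b')\<close> before the coproduct injections.\<close>

definition tu :: "('y, 'z, 'o, 'f, 'c) prof \<Rightarrow> ('x, 'y, 'o, 'f, 'c) prof \<Rightarrow> 'z \<Rightarrow> 'x \<Rightarrow> 'y \<times> 'y \<Rightarrow> 'c" where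
  "tu N M d a = (\<lambda>r. ract W N d (fst r) (snd r) \<odot> id2 W (pcmp M (snd r) a))"

definition tv :: "('y, 'z, 'o, 'f, 'c) prof \<Rightarrow> ('x, 'y, 'o, 'f, 'c) prof \<Rightarrow> 'z \<Rightarrow> 'x \<Rightarrow> 'y \<times> 'y \<Rightarrow> 'c" where
  "tv N M d a = (\<lambda>r. (id2 W (pcmp N d (fst r)) \<odot> lact W M (fst r) (snd r) a) \<cdot>
     assoc W (pcmp N d (fst r)) (whom (pcod M) (fst r) (snd r)) (pcmp M (snd r) a))"

lemma tu_tv_cell:
  assumes t: "tp N M" and [simp]: "a \<in> obj (pdom M)" "d \<in> obj (pcod N)" "b \<in> obj (pcod M)" "b' \<in> obj (pcod M)"
  shows "tu N M d a (b, b') \<in> two_cells W"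
    "dom2 W (tu N M d a (b, b')) = (pcmp N d b \<otimes> whom (pcod M) b b') \<otimes> pcmp M b' a"
    "cod2 W (tu N M d a (b, b')) = pcmp N d b' \<otimes> pcmp M b' a"
    "tv N M d a (b, b') \<in> two_cells W"
    "dom2 W (tv N M d a (b, b')) = (pcmp N d b \<otimes> whom (pcod M) b b') \<otimes> pcmp M b' a"
    "cod2 W (tv N M d a (b, b')) = pcmp N d b \<otimes> pcmp M b a"
proof -
  note [simp] = tpD[OF t]
  show "tu N M d a (b, b') \<in> two_cells W"
    "dom2 W (tu N M d a (b, b')) = (pcmp N d b \<otimes> whom (pcod M) b b') \<otimes> pcmp M b' a"
    "cod2 W (tu N M d a (b, b')) = pcmp N d b' \<otimes> pcmp M b' a"
    "tv N M d a (b, b') \<in> two_cells W"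
    "dom2 W (tv N M d a (b, b')) = (pcmp N d b \<otimes> whom (pcod M) b b') \<otimes> pcmp M b' a"
    "cod2 W (tv N M d a (b, b')) = pcmp N d b \<otimes> pcmp M b a"
    by (simp_all add: tu_def tv_def)
qed

lemma tu_tv_ap:
  assumes t: "tp N M" and [simp]: "a \<in> obj (pdom M)" "d \<in> obj (pcod N)" "b \<in> obj (pcod M)" "b' \<in> obj (pcod M)"
    "el n" "el g" "el m" "tgt n = sor g" "tgt g = sor m"
    "lab n = pcmp N d b" "lab g = whom (pcod M) b b'" "lab m = pcmp M b' a"
  shows "tu N M d a (b, b') \<rhd> ((n >< g) >< m) = (ract W N d b b' \<rhd> (n >< g)) >< m"
    "tv N M d a (b, b') \<rhd> ((n >< g) >< m) = n >< (lact W M b b' a \<rhd> (g >< m))"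
proof -
  note [simp] = tpD[OF t]
  show "tu N M d a (b, b') \<rhd> ((n >< g) >< m) = (ract W N d b b' \<rhd> (n >< g)) >< m"
    "tv N M d a (b, b') \<rhd> ((n >< g) >< m) = n >< (lact W M b b' a \<rhd> (g >< m))"
    by (simp_all add: tu_def tv_def ap_comp ap_tens ap_assoc)
qed

text \<open>The parallel maps in \<open>tens_coeq\<close> are copairings of \<open>tu\<close> and
  \<open>tv\<close> followed by injections, which is the form that
  \<open>coequaliser_presents\<close> expects. Later arguments use the chosen coequaliser through
  this property only.\<close>

lemma tens_presents:
  assumes t: "tp N M" and o [simp]: "a \<in> obj (pdom M)" "d \<in> obj (pcod N)"
  shows "presents (hom_cat W (extent (pdom M) a) (extent (pcod N) d)) (obj (pcod M))
    (\<lambda>b. pcmp N d b \<otimes> pcmp M b a) (tu N M d a) (tv N M d a) (tens_cmp W N M d a) (tens_in W N M d a)"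
proof -
  note [simp] = tpD[OF t]
  let ?H = "hom_cat W (extent (pdom M) a) (extent (pcod N) d)" and ?Y = "obj (pcod M)"
  let ?X = "\<lambda>b. pcmp N d b \<otimes> pcmp M b a"
  let ?Z = "\<lambda>r. (pcmp N d (fst r) \<otimes> whom (pcod M) (fst r) (snd r)) \<otimes> pcmp M (snd r) a"
  have H: "tens_hom W N M d a = ?H" by (simp add: tens_hom_def)
  have X: "tens_summand W N M d a = ?X" and Z: "tens_summand2 W N M d a = ?Z"
    by (auto simp: tens_summand_def tens_summand2_def split_beta fun_eq_iff)
  have 1: "tens_coeq W N M d a = coequaliser ?H
      (copair ?H (?Y \<times> ?Y) ?Z (coprod_ob ?H ?Y ?X) (\<lambda>r. coprod_in ?H ?Y ?X (snd r) \<star>\<^bsub>?H\<^esub> tu N M d a r))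
      (copair ?H (?Y \<times> ?Y) ?Z (coprod_ob ?H ?Y ?X) (\<lambda>r. coprod_in ?H ?Y ?X (fst r) \<star>\<^bsub>?H\<^esub> tv N M d a r))"
    unfolding tens_coeq_def Let_def H X Z tu_def tv_def by (simp add: split_beta')
  have 2: "tens_in W N M d a = (\<lambda>b. snd (tens_coeq W N M d a) \<star>\<^bsub>?H\<^esub> coprod_in ?H ?Y ?X b)"
    unfolding tens_in_def H X by (simp add: fun_eq_iff)
  have c: "category ?H" "small_cocomplete \<kappa> ?H" by (simp_all add: cat_hom coco)
  show ?thesis
    unfolding tens_cmp_def 2
  proof (rule coequaliser_presents[OF \<kappa> c, where Y = ?Z])
    show "small_set \<kappa> ?Y" by simp
    show "?X b \<in> Ob ?H" if "b \<in> ?Y" for b using that by (simp add: one_hom_def)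
    show "tu N M d a (b, b') \<in> arrows ?H (?Z (b, b')) (?X b') \<and> tv N M d a (b, b') \<in> arrows ?H (?Z (b, b')) (?X b)"
      if "b \<in> ?Y" "b' \<in> ?Y" for b b'
      using that tu_tv_cell[OF t o that] by (simp add: arrows_def one_hom_def)
  qed (simp add: 1)
qed

lemma tens_cell:
  assumes t: "tp N M" and o: "a \<in> obj (pdom M)" "d \<in> obj (pcod N)"
  shows "tens_cmp W N M d a \<in> one_cells W" "src W (tens_cmp W N M d a) = extent (pdom M) a"
    "trg W (tens_cmp W N M d a) = extent (pcod N) d"
    "b \<in> obj (pcod M) \<Longrightarrow> tens_in W N M d a b \<in> two_cells W"
    "b \<in> obj (pcod M) \<Longrightarrow> dom2 W (tens_in W N M d a b) = pcmp N d b \<otimes> pcmp M b a"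
    "b \<in> obj (pcod M) \<Longrightarrow> cod2 W (tens_in W N M d a b) = tens_cmp W N M d a"
  using tens_presents[OF assms] unfolding presents_def by (auto simp: one_hom_def arrows_def)

lemma tens_balanced:
  assumes t: "tp N M" and o [simp]: "a \<in> obj (pdom M)" "d \<in> obj (pcod N)" "b \<in> obj (pcod M)" "b' \<in> obj (pcod M)"
    and e [simp]: "el n" "el g" "el m" "tgt n = sor g" "tgt g = sor m"
    "lab n = pcmp N d b" "lab g = whom (pcod M) b b'" "lab m = pcmp M b' a"
  shows "tens_in W N M d a b' \<rhd> ((ract W N d b b' \<rhd> (n >< g)) >< m) =
    tens_in W N M d a b \<rhd> (n >< (lact W M b b' a \<rhd> (g >< m)))"
proof -
  note [simp] = tpD[OF t] tens_cell[OF t] tu_tv_cell[OF t]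
  have "tens_in W N M d a b' \<cdot> tu N M d a (b, b') = tens_in W N M d a b \<cdot> tv N M d a (b, b')"
    using tens_presents[OF t o(1,2)] o unfolding presents_def by simp
  then have "(tens_in W N M d a b' \<cdot> tu N M d a (b, b')) \<rhd> ((n >< g) >< m) =
    (tens_in W N M d a b \<cdot> tv N M d a (b, b')) \<rhd> ((n >< g) >< m)" by simp
  then show ?thesis by (simp add: ap_comp tu_tv_ap[OF t])
qed

section \<open>Tensor products of profunctors next to further 1-cells\<close>

lemma tensor_right_presents:
  assumes p: "presents (hom_cat W x y) I X u v T e" and x: "x \<in> zero_cells W" "y \<in> zero_cells W"
    and k: "k \<in> one_cells W" "trg W k = x"
    and uv: "\<And>b b'. b \<in> I \<Longrightarrow> b' \<in> I \<Longrightarrow> u (b, b') \<in> two_cells W \<and> v (b, b') \<in> two_cells W \<and>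
      dom2 W (v (b, b')) = dom2 W (u (b, b'))  \<and> cod2 W (u (b, b')) = X b' \<and> cod2 W (v (b, b')) = X b"
  shows "presents (hom_cat W (src W k) y) I (\<lambda>i. X i \<otimes> k) (\<lambda>r. u r \<odot> id2 W k) (\<lambda>r. v r \<odot> id2 W k)
    (T \<otimes> k) (\<lambda>i. e i \<odot> id2 W k)"
proof -
  let ?F = "\<lparr>on_ob = \<lambda>g. g \<otimes> k, on_ar = \<lambda>t. t \<odot> id2 W k\<rparr>"
  have "k \<in> one_hom W (src W k) x" "src W k \<in> zero_cells W" using k by (auto simp: one_hom_def)
  then have adj: "has_right_adjoint (hom_cat W x y) (hom_cat W (src W k) y) ?F"
    using biclosed x unfolding biclosed_def by blast
  have X: "X i \<in> one_hom W x y" if "i \<in> I" for i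
    using p that unfolding presents_def by (auto simp: arrows_def)
  have "u (b, b') \<in> arrows (hom_cat W x y) (dom2 W (u (b, b'))) (X b') \<and>
      v (b, b') \<in> arrows (hom_cat W x y) (dom2 W (u (b, b'))) (X b)"
    if "b \<in> I" "b' \<in> I" for b b'
    using uv[OF that] X[OF that(1)] X[OF that(2)] src_cod2[of "u (b, b')"] trg_cod2[of "u (b, b')"]
    by (auto simp: arrows_def one_hom_def)
  from left_adjoint_presents[OF cat_hom[OF x] cat_hom adj p this] show ?thesis
    using x k by simp
qed

lemma tensor_left_presents:
  assumes p: "presents (hom_cat W x y) I X u v T e" and x: "x \<in> zero_cells W" "y \<in> zero_cells W"
    and k: "k \<in> one_cells W" "src W k = y"
    and uv: "\<And>b b'. b \<in> I \<Longrightarrow> b' \<in> I \<Longrightarrow> u (b, b') \<in> two_cells W \<and> v (b, b') \<in> two_cells W \<and>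
      dom2 W (v (b, b')) = dom2 W (u (b, b'))  \<and> cod2 W (u (b, b')) = X b' \<and> cod2 W (v (b, b')) = X b"
  shows "presents (hom_cat W x (trg W k)) I (\<lambda>i. k \<otimes> X i) (\<lambda>r. id2 W k \<odot> u r) (\<lambda>r. id2 W k \<odot> v r)
    (k \<otimes> T) (\<lambda>i. id2 W k \<odot> e i)"
proof -
  let ?F = "\<lparr>on_ob = \<lambda>g. k \<otimes> g, on_ar = \<lambda>t. id2 W k \<odot> t\<rparr>"
  have "k \<in> one_hom W y (trg W k)" "trg W k \<in> zero_cells W" using k by (auto simp: one_hom_def)
  then have adj: "has_right_adjoint (hom_cat W x y) (hom_cat W x (trg W k)) ?F"
    using biclosed x unfolding biclosed_def by blast
  have X: "X i \<in> one_hom W x y" if "i \<in> I" for i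
    using p that unfolding presents_def by (auto simp: arrows_def)
  have "u (b, b') \<in> arrows (hom_cat W x y) (dom2 W (u (b, b'))) (X b') \<and>
      v (b, b') \<in> arrows (hom_cat W x y) (dom2 W (u (b, b'))) (X b)"
    if "b \<in> I" "b' \<in> I" for b b'
    using uv[OF that] X[OF that(1)] X[OF that(2)] src_cod2[of "u (b, b')"] trg_cod2[of "u (b, b')"]
    by (auto simp: arrows_def one_hom_def)
  from left_adjoint_presents[OF cat_hom[OF x] cat_hom adj p this] show ?thesis
    using x k by simp
qed

lemma presents_hom_ex:
  assumes p: "presents (hom_cat W x y) I X u v T e"
    and t: "t \<in> one_cells W" "src W t = x" "trg W t = y"
    and f: "\<And>i. i \<in> I \<Longrightarrow> f i \<in> two_cells W \<and> dom2 W (f i) = X i \<and> cod2 W (f i) = t"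
    and bal: "\<And>b b'. b \<in> I \<Longrightarrow> b' \<in> I \<Longrightarrow> f b' \<cdot> u (b, b') = f b \<cdot> v (b, b')"
  obtains w where "w \<in> two_cells W" "dom2 W w = T" "cod2 W w = t" "\<And>i. i \<in> I \<Longrightarrow> w \<cdot> e i = f i"
proof -
  have X: "X i \<in> one_hom W x y" if "i \<in> I" for i
    using p that unfolding presents_def by (auto simp: arrows_def)
  have "t \<in> Ob (hom_cat W x y)" using t by (simp add: one_hom_def)
  then have "(\<forall>i\<in>I. f i \<in> arrows (hom_cat W x y) (X i) t) \<longrightarrow>
      (\<forall>b\<in>I. \<forall>b'\<in>I. f b' \<star>\<^bsub>hom_cat W x y\<^esub> u (b, b') = f b \<star>\<^bsub>hom_cat W x y\<^esub> v (b, b')) \<longrightarrow>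
      (\<exists>!w. w \<in> arrows (hom_cat W x y) T t \<and> (\<forall>i\<in>I. w \<star>\<^bsub>hom_cat W x y\<^esub> e i = f i))"
    using p unfolding presents_def by blast
  moreover have "\<forall>i\<in>I. f i \<in> arrows (hom_cat W x y) (X i) t"
    using f X by (auto simp: arrows_def)
  ultimately have "\<exists>w. w \<in> arrows (hom_cat W x y) T t \<and> (\<forall>i\<in>I. w \<cdot> e i = f i)"
    using bal by auto
  then show ?thesis using that by (auto simp: arrows_def)
qed

lemma presents_hom_ext:
  assumes p: "presents (hom_cat W x y) I X u v T e"
    and w: "w \<in> two_cells W" "w' \<in> two_cells W" "dom2 W w = T" "dom2 W w' = T" "cod2 W w' = cod2 W w"
    and uv: "\<And>b b'. b \<in> I \<Longrightarrow> b' \<in> I \<Longrightarrow> u (b, b') \<in> two_cells W \<and> v (b, b') \<in> two_cells W \<and>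
      dom2 W (v (b, b')) = dom2 W (u (b, b'))  \<and> cod2 W (u (b, b')) = X b' \<and> cod2 W (v (b, b')) = X b"
    and eq: "\<And>i. i \<in> I \<Longrightarrow> w \<cdot> e i = w' \<cdot> e i"
  shows "w = w'"
proof -
  have T: "T \<in> one_hom W x y" and e: "\<And>i. i \<in> I \<Longrightarrow> e i \<in> two_cells W \<and> dom2 W (e i) = X i \<and> cod2 W (e i) = T"
    and bal: "\<And>b b'. b \<in> I \<Longrightarrow> b' \<in> I \<Longrightarrow> e b' \<cdot> u (b, b') = e b \<cdot> v (b, b')"
    and X: "\<And>i. i \<in> I \<Longrightarrow> X i \<in> one_hom W x y"
    using p unfolding presents_def by (auto simp: arrows_def)
  let ?t = "cod2 W w"
  have t: "?t \<in> one_hom W x y"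
    using T w(1,3) src_cod2[OF w(1)] trg_cod2[OF w(1)] by (auto simp: one_hom_def)
  have "(w \<cdot> e b') \<cdot> u (b, b') = (w \<cdot> e b) \<cdot> v (b, b')" if "b \<in> I" "b' \<in> I" for b b'
    using w e that uv bal by (simp add: vc_assoc)
  then have ex: "\<exists>!h. h \<in> arrows (hom_cat W x y) T ?t \<and> (\<forall>i\<in>I. h \<cdot> e i = w \<cdot> e i)"
    using p t w e X unfolding presents_def by (auto simp: arrows_def)
  have "w \<in> arrows (hom_cat W x y) T ?t" "w' \<in> arrows (hom_cat W x y) T ?t"
    using w T by (auto simp: arrows_def)
  then show ?thesis
    using eq by (intro ex1_implies_eq[OF ex]) simp_all
qed

text \<open>The context with 1-cells on both sides, obtained by adjoining them one after the other,
  is the one in which the two-sided action on a tensor product is defined.\<close>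

lemma tens_pres:
  assumes t: "tp N M" and o [simp]: "a \<in> obj (pdom M)" "d \<in> obj (pcod N)"
  shows "k \<in> one_cells W \<Longrightarrow> trg W k = extent (pdom M) a \<Longrightarrow>
      presents (hom_cat W (src W k) (extent (pcod N) d)) (obj (pcod M))
      (\<lambda>b. (pcmp N d b \<otimes> pcmp M b a) \<otimes> k) (\<lambda>r. tu N M d a r \<odot> id2 W k) (\<lambda>r. tv N M d a r \<odot> id2 W k)
      (tens_cmp W N M d a \<otimes> k) (\<lambda>b. tens_in W N M d a b \<odot> id2 W k)"
    and "h \<in> one_cells W \<Longrightarrow> src W h = extent (pcod N) d \<Longrightarrow>
      presents (hom_cat W (extent (pdom M) a) (trg W h)) (obj (pcod M))
      (\<lambda>b. h \<otimes> (pcmp N d b \<otimes> pcmp M b a)) (\<lambda>r. id2 W h \<odot> tu N M d a r) (\<lambda>r. id2 W h \<odot> tv N M d a r)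
      (h \<otimes> tens_cmp W N M d a) (\<lambda>b. id2 W h \<odot> tens_in W N M d a b)"
    and "\<lbrakk>h \<in> one_cells W; src W h = extent (pcod N) d;
      k \<in> one_cells W; trg W k = extent (pdom M) a\<rbrakk> \<Longrightarrow>
      presents (hom_cat W (src W k) (trg W h)) (obj (pcod M))
      (\<lambda>b. (h \<otimes> (pcmp N d b \<otimes> pcmp M b a)) \<otimes> k)
      (\<lambda>r. (id2 W h \<odot> tu N M d a r) \<odot> id2 W k) (\<lambda>r. (id2 W h \<odot> tv N M d a r) \<odot> id2 W k)
      ((h \<otimes> tens_cmp W N M d a) \<otimes> k) (\<lambda>b. (id2 W h \<odot> tens_in W N M d a b) \<odot> id2 W k)"
proof -
  note [simp] = tpD[OF t] tens_cell[OF t] tu_tv_cell[OF t]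
  show 1: "presents (hom_cat W (src W k) (extent (pcod N) d)) (obj (pcod M))
      (\<lambda>b. (pcmp N d b \<otimes> pcmp M b a) \<otimes> k) (\<lambda>r. tu N M d a r \<odot> id2 W k) (\<lambda>r. tv N M d a r \<odot> id2 W k)
      (tens_cmp W N M d a \<otimes> k) (\<lambda>b. tens_in W N M d a b \<odot> id2 W k)"
    if "k \<in> one_cells W" "trg W k = extent (pdom M) a" for k
    by (rule tensor_right_presents[OF tens_presents[OF t o]]) (use that in simp_all)
  show 2: "presents (hom_cat W (extent (pdom M) a) (trg W h)) (obj (pcod M))
      (\<lambda>b. h \<otimes> (pcmp N d b \<otimes> pcmp M b a)) (\<lambda>r. id2 W h \<odot> tu N M d a r) (\<lambda>r. id2 W h \<odot> tv N M d a r)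
      (h \<otimes> tens_cmp W N M d a) (\<lambda>b. id2 W h \<odot> tens_in W N M d a b)"
    if "h \<in> one_cells W" "src W h = extent (pcod N) d" for h
    by (rule tensor_left_presents[OF tens_presents[OF t o]]) (use that in simp_all)
  show "presents (hom_cat W (src W k) (trg W h)) (obj (pcod M))
      (\<lambda>b. (h \<otimes> (pcmp N d b \<otimes> pcmp M b a)) \<otimes> k)
      (\<lambda>r. (id2 W h \<odot> tu N M d a r) \<odot> id2 W k) (\<lambda>r. (id2 W h \<odot> tv N M d a r) \<odot> id2 W k)
      ((h \<otimes> tens_cmp W N M d a) \<otimes> k) (\<lambda>b. (id2 W h \<odot> tens_in W N M d a b) \<odot> id2 W k)"
    if "h \<in> one_cells W" "src W h = extent (pcod N) d"
      "k \<in> one_cells W" "trg W k = extent (pdom M) a" for h k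
    by (rule tensor_right_presents[OF 2]) (use that in simp_all)
qed

lemma tens_ex:
  assumes t: "tp N M" and o [simp]: "a \<in> obj (pdom M)" "d \<in> obj (pcod N)"
    and p: "p \<in> one_cells W" "src W p = extent (pdom M) a" "trg W p = extent (pcod N) d"
    and f: "\<And>b. b \<in> obj (pcod M) \<Longrightarrow> f b \<in> two_cells W \<and>
      dom2 W (f b) = pcmp N d b \<otimes> pcmp M b a \<and> cod2 W (f b) = p"
    and bal: "\<And>b b' n g m. \<lbrakk>b \<in> obj (pcod M); b' \<in> obj (pcod M);
      el n; el g; el m; tgt n = sor g; tgt g = sor m;
      lab n = pcmp N d b; lab g = whom (pcod M) b b'; lab m = pcmp M b' a\<rbrakk> \<Longrightarrow>
      f b' \<rhd> ((ract W N d b b' \<rhd> (n >< g)) >< m) = f b \<rhd> (n >< (lact W M b b' a \<rhd> (g >< m)))"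
  obtains w where "w \<in> two_cells W" "dom2 W w = tens_cmp W N M d a" "cod2 W w = p"
    "\<And>b. b \<in> obj (pcod M) \<Longrightarrow> w \<cdot> tens_in W N M d a b = f b"
    "\<And>b x. \<lbrakk>b \<in> obj (pcod M); el x; lab x = pcmp N d b \<otimes> pcmp M b a\<rbrakk> \<Longrightarrow>
      w \<rhd> tens_in W N M d a b \<rhd> x = f b \<rhd> x"
proof -
  note [simp] = tpD[OF t] tens_cell[OF t] tu_tv_cell[OF t]
    f[THEN conjunct1] f[THEN conjunct2, THEN conjunct1] f[THEN conjunct2, THEN conjunct2]
  \<comment> \<open>The identification made by the coequaliser is an equation between 2-cells out of
    a triple tensor product, hence decided on triples of elements.\<close>
  have eq: "f b' \<cdot> tu N M d a (b, b') = f b \<cdot> tv N M d a (b, b')"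
    if [simp]: "b \<in> obj (pcod M)" "b' \<in> obj (pcod M)" for b b'
    by (rule ext3'[of _ _ "pcmp N d b" "whom (pcod M) b b'" "pcmp M b' a"])
      (simp_all add: ap_comp tu_tv_ap[OF t] bal)
  obtain w where w: "w \<in> two_cells W" "dom2 W w = tens_cmp W N M d a" "cod2 W w = p"
    "\<And>b. b \<in> obj (pcod M) \<Longrightarrow> w \<cdot> tens_in W N M d a b = f b"
    by (rule presents_hom_ex[OF tens_presents[OF t o] p f eq]) auto
  have "w \<rhd> tens_in W N M d a b \<rhd> x = f b \<rhd> x" if "b \<in> obj (pcod M)" "el x" "lab x = pcmp N d b \<otimes> pcmp M b a" for b x
    using that w(4)[OF that(1)] w(1-3) ap_comp[of x "tens_in W N M d a b" w] by simp
  with w that show ?thesis by blast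
qed

lemma tens_ext:
  assumes t: "tp N M" and o [simp]: "a \<in> obj (pdom M)" "d \<in> obj (pcod N)"
    and w: "w \<in> two_cells W" "w' \<in> two_cells W" "dom2 W w = tens_cmp W N M d a" "dom2 W w' = tens_cmp W N M d a"
      "cod2 W w' = cod2 W w"
    and eq: "\<And>b n m. \<lbrakk>b \<in> obj (pcod M); el n; el m; tgt n = sor m;
      lab n = pcmp N d b; lab m = pcmp M b a\<rbrakk> \<Longrightarrow>
      w \<rhd> tens_in W N M d a b \<rhd> (n >< m) = w' \<rhd> tens_in W N M d a b \<rhd> (n >< m)"
  shows "w = w'"
proof -
  note [simp] = tpD[OF t] tens_cell[OF t] tu_tv_cell[OF t] w
  show ?thesis
  proof (rule presents_hom_ext[OF tens_presents[OF t o] w])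
    fix b assume [simp]: "b \<in> obj (pcod M)"
    show "w \<cdot> tens_in W N M d a b = w' \<cdot> tens_in W N M d a b"
      by (rule ext2[of _ _ "pcmp N d b" "pcmp M b a"]) (simp_all add: ap_comp eq)
  qed simp_all
qed

lemma tens_ex_right:
  assumes t: "tp N M" and o [simp]: "a \<in> obj (pdom M)" "d \<in> obj (pcod N)"
    and k [simp]: "k \<in> one_cells W" "trg W k = extent (pdom M) a"
    and p: "p \<in> one_cells W" "src W p = src W k" "trg W p = extent (pcod N) d"
    and f: "\<And>b. b \<in> obj (pcod M) \<Longrightarrow> f b \<in> two_cells W \<and>
      dom2 W (f b) = (pcmp N d b \<otimes> pcmp M b a) \<otimes> k \<and> cod2 W (f b) = p"
    and bal: "\<And>b b' n g m y. \<lbrakk>b \<in> obj (pcod M); b' \<in> obj (pcod M);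
      el n; el g; el m; el y; tgt n = sor g; tgt g = sor m; tgt m = sor y;
      lab n = pcmp N d b; lab g = whom (pcod M) b b'; lab m = pcmp M b' a; lab y = k\<rbrakk> \<Longrightarrow>
      f b' \<rhd> (((ract W N d b b' \<rhd> (n >< g)) >< m) >< y) = f b \<rhd> ((n >< (lact W M b b' a \<rhd> (g >< m))) >< y)"
  obtains w where "w \<in> two_cells W" "dom2 W w = tens_cmp W N M d a \<otimes> k" "cod2 W w = p"
    "\<And>b x y. \<lbrakk>b \<in> obj (pcod M); el x; el y; tgt x = sor y;
      lab x = pcmp N d b \<otimes> pcmp M b a; lab y = k\<rbrakk> \<Longrightarrow>
      w \<rhd> ((tens_in W N M d a b \<rhd> x) >< y) = f b \<rhd> (x >< y)"
proof -
  note [simp] = tpD[OF t] tens_cell[OF t] tu_tv_cell[OF t]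
    f[THEN conjunct1] f[THEN conjunct2, THEN conjunct1] f[THEN conjunct2, THEN conjunct2]
  have eq: "f b' \<cdot> (tu N M d a (b, b') \<odot> id2 W k) = f b \<cdot> (tv N M d a (b, b') \<odot> id2 W k)"
    if [simp]: "b \<in> obj (pcod M)" "b' \<in> obj (pcod M)" for b b'
  proof (rule cell_eqI_lab)
    let ?y = "gen k (unit1 W (src W k))"
    let ?m = "gen (pcmp M b' a) (sor ?y)" let ?g = "gen (whom (pcod M) b b') (sor ?m)"
    let ?n = "gen (pcmp N d b) (sor ?g)"
    show "iel (((?n >< ?g) >< ?m) >< ?y)" by (intro iel_pr iel_gen) simp_all
    show "(f b' \<cdot> (tu N M d a (b, b') \<odot> id2 W k)) \<rhd> (((?n >< ?g) >< ?m) >< ?y) =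
      (f b \<cdot> (tv N M d a (b, b') \<odot> id2 W k)) \<rhd> (((?n >< ?g) >< ?m) >< ?y)"
      by (simp add: ap_comp ap_tens tu_tv_ap[OF t] bal)
  qed simp_all
  obtain w where w: "w \<in> two_cells W" "dom2 W w = tens_cmp W N M d a \<otimes> k" "cod2 W w = p"
    "\<And>b. b \<in> obj (pcod M) \<Longrightarrow> w \<cdot> (tens_in W N M d a b \<odot> id2 W k) = f b"
    by (rule presents_hom_ex[OF tens_pres(1)[OF t o k] p f eq]) auto
  have "w \<rhd> ((tens_in W N M d a b \<rhd> x) >< y) = f b \<rhd> (x >< y)"
    if [simp]: "b \<in> obj (pcod M)" "el x" "el y" "tgt x = sor y" "lab x = pcmp N d b \<otimes> pcmp M b a" "lab y = k" for b x y
    unfolding w(4)[OF that(1), symmetric] using w(1-3) by (simp add: ap_comp ap_tens)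
  with w that show ?thesis by blast
qed

lemma tens_ex_left:
  assumes t: "tp N M" and o [simp]: "a \<in> obj (pdom M)" "d \<in> obj (pcod N)"
    and h [simp]: "h \<in> one_cells W" "src W h = extent (pcod N) d"
    and p: "p \<in> one_cells W" "src W p = extent (pdom M) a" "trg W p = trg W h"
    and f: "\<And>b. b \<in> obj (pcod M) \<Longrightarrow> f b \<in> two_cells W \<and>
      dom2 W (f b) = h \<otimes> (pcmp N d b \<otimes> pcmp M b a) \<and> cod2 W (f b) = p"
    and bal: "\<And>b b' x n g m. \<lbrakk>b \<in> obj (pcod M); b' \<in> obj (pcod M);
      el x; el n; el g; el m; tgt x = sor n; tgt n = sor g; tgt g = sor m; lab x = h;
      lab n = pcmp N d b; lab g = whom (pcod M) b b'; lab m = pcmp M b' a\<rbrakk> \<Longrightarrow>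
      f b' \<rhd> (x >< ((ract W N d b b' \<rhd> (n >< g)) >< m)) = f b \<rhd> (x >< (n >< (lact W M b b' a \<rhd> (g >< m))))"
  obtains w where "w \<in> two_cells W" "dom2 W w = h \<otimes> tens_cmp W N M d a" "cod2 W w = p"
    "\<And>b x y. \<lbrakk>b \<in> obj (pcod M); el x; el y; tgt x = sor y;
      lab x = h; lab y = pcmp N d b \<otimes> pcmp M b a\<rbrakk> \<Longrightarrow>
      w \<rhd> (x >< (tens_in W N M d a b \<rhd> y)) = f b \<rhd> (x >< y)"
proof -
  note [simp] = tpD[OF t] tens_cell[OF t] tu_tv_cell[OF t]
    f[THEN conjunct1] f[THEN conjunct2, THEN conjunct1] f[THEN conjunct2, THEN conjunct2]
  have eq: "f b' \<cdot> (id2 W h \<odot> tu N M d a (b, b')) = f b \<cdot> (id2 W h \<odot> tv N M d a (b, b'))"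
    if [simp]: "b \<in> obj (pcod M)" "b' \<in> obj (pcod M)" for b b'
  proof (rule cell_eqI_lab)
    let ?m = "gen (pcmp M b' a) (unit1 W (extent (pdom M) a))" let ?g = "gen (whom (pcod M) b b') (sor ?m)"
    let ?n = "gen (pcmp N d b) (sor ?g)" let ?x = "gen h (sor ?n)"
    show "iel (?x >< ((?n >< ?g) >< ?m))" by (intro iel_pr iel_gen) simp_all
    show "(f b' \<cdot> (id2 W h \<odot> tu N M d a (b, b'))) \<rhd> (?x >< ((?n >< ?g) >< ?m)) =
      (f b \<cdot> (id2 W h \<odot> tv N M d a (b, b'))) \<rhd> (?x >< ((?n >< ?g) >< ?m))"
      by (simp add: ap_comp ap_tens tu_tv_ap[OF t] bal)
  qed simp_all
  obtain w where w: "w \<in> two_cells W" "dom2 W w = h \<otimes> tens_cmp W N M d a" "cod2 W w = p"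
    "\<And>b. b \<in> obj (pcod M) \<Longrightarrow> w \<cdot> (id2 W h \<odot> tens_in W N M d a b) = f b"
    by (rule presents_hom_ex[OF tens_pres(2)[OF t o h] p f eq]) auto
  have "w \<rhd> (x >< (tens_in W N M d a b \<rhd> y)) = f b \<rhd> (x >< y)"
    if [simp]: "b \<in> obj (pcod M)" "el x" "el y" "tgt x = sor y" "lab x = h" "lab y = pcmp N d b \<otimes> pcmp M b a" for b x y
    unfolding w(4)[OF that(1), symmetric] using w(1-3) by (simp add: ap_comp ap_tens)
  with w that show ?thesis by blast
qed

lemma tens_ex_both:
  assumes t: "tp N M" and o [simp]: "a \<in> obj (pdom M)" "d \<in> obj (pcod N)"
    and h [simp]: "h \<in> one_cells W" "src W h = extent (pcod N) d"
    and k [simp]: "k \<in> one_cells W" "trg W k = extent (pdom M) a"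
    and p: "p \<in> one_cells W" "src W p = src W k" "trg W p = trg W h"
    and f: "\<And>b. b \<in> obj (pcod M) \<Longrightarrow> f b \<in> two_cells W \<and>
      dom2 W (f b) = (h \<otimes> (pcmp N d b \<otimes> pcmp M b a)) \<otimes> k \<and> cod2 W (f b) = p"
    and bal: "\<And>b b' x n g m y. \<lbrakk>b \<in> obj (pcod M); b' \<in> obj (pcod M);
      el x; el n; el g; el m; el y; tgt x = sor n; tgt n = sor g; tgt g = sor m;
      tgt m = sor y; lab x = h; lab y = k;
      lab n = pcmp N d b; lab g = whom (pcod M) b b'; lab m = pcmp M b' a\<rbrakk> \<Longrightarrow>
      f b' \<rhd> ((x >< ((ract W N d b b' \<rhd> (n >< g)) >< m)) >< y) =
      f b \<rhd> ((x >< (n >< (lact W M b b' a \<rhd> (g >< m)))) >< y)"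
  obtains w where "w \<in> two_cells W" "dom2 W w = (h \<otimes> tens_cmp W N M d a) \<otimes> k" "cod2 W w = p"
    "\<And>b. b \<in> obj (pcod M) \<Longrightarrow> w \<cdot> ((id2 W h \<odot> tens_in W N M d a b) \<odot> id2 W k) = f b"
proof -
  note [simp] = tpD[OF t] tens_cell[OF t] tu_tv_cell[OF t]
    f[THEN conjunct1] f[THEN conjunct2, THEN conjunct1] f[THEN conjunct2, THEN conjunct2]
  have eq: "f b' \<cdot> ((id2 W h \<odot> tu N M d a (b, b')) \<odot> id2 W k) = f b \<cdot> ((id2 W h \<odot> tv N M d a (b, b')) \<odot> id2 W k)"
    if [simp]: "b \<in> obj (pcod M)" "b' \<in> obj (pcod M)" for b b'
  proof (rule cell_eqI_lab)
    let ?y = "gen k (unit1 W (src W k))"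
    let ?m = "gen (pcmp M b' a) (sor ?y)" let ?g = "gen (whom (pcod M) b b') (sor ?m)"
    let ?n = "gen (pcmp N d b) (sor ?g)" let ?x = "gen h (sor ?n)"
    show "iel ((?x >< ((?n >< ?g) >< ?m)) >< ?y)" by (intro iel_pr iel_gen) simp_all
    show "(f b' \<cdot> ((id2 W h \<odot> tu N M d a (b, b')) \<odot> id2 W k)) \<rhd> ((?x >< ((?n >< ?g) >< ?m)) >< ?y) =
      (f b \<cdot> ((id2 W h \<odot> tv N M d a (b, b')) \<odot> id2 W k)) \<rhd> ((?x >< ((?n >< ?g) >< ?m)) >< ?y)"
      by (simp add: ap_comp ap_tens tu_tv_ap[OF t] bal)
  qed simp_all
  obtain w where w: "w \<in> two_cells W" "dom2 W w = (h \<otimes> tens_cmp W N M d a) \<otimes> k" "cod2 W w = p"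
    "\<And>b. b \<in> obj (pcod M) \<Longrightarrow> w \<cdot> ((id2 W h \<odot> tens_in W N M d a b) \<odot> id2 W k) = f b"
    by (rule presents_hom_ex[OF tens_pres(3)[OF t o h k] p f eq]) auto
  with that show ?thesis by blast
qed

text \<open>
  The contexts \<open>h\<close> and \<open>k\<close> may be tested on any elements \<open>x\<close> and \<open>y\<close> with invertible underlying
  2-cell, for example on iterated pairings of generic elements.
\<close>

lemma tens_ext_iel:
  assumes t: "tp N M" and o [simp]: "a \<in> obj (pdom M)" "d \<in> obj (pcod N)"
    and h [simp]: "h \<in> one_cells W" "src W h = extent (pcod N) d"
    and k [simp]: "k \<in> one_cells W" "trg W k = extent (pdom M) a"
    and w: "w \<in> two_cells W" "w' \<in> two_cells W"
      "dom2 W w = (h \<otimes> tens_cmp W N M d a) \<otimes> k" "dom2 W w' = (h \<otimes> tens_cmp W N M d a) \<otimes> k"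
      "cod2 W w' = cod2 W w"
    and y: "iel y" "lab y = k" "tgt y = unit1 W (src W k)"
    and x: "\<And>j. j \<in> one_cells W \<Longrightarrow> trg W j = src W h \<Longrightarrow> iel (x j) \<and> lab (x j) = h \<and> tgt (x j) = j"
    and eq: "\<And>b n m. \<lbrakk>b \<in> obj (pcod M); el n; el m; tgt n = sor m; tgt m = sor y;
      lab n = pcmp N d b; lab m = pcmp M b a\<rbrakk> \<Longrightarrow>
      w \<rhd> ((x (sor n) >< (tens_in W N M d a b \<rhd> (n >< m))) >< y) =
      w' \<rhd> ((x (sor n) >< (tens_in W N M d a b \<rhd> (n >< m))) >< y)"
  shows "w = w'"
proof -
  note [simp] = tpD[OF t] tens_cell[OF t] tu_tv_cell[OF t] w
  have ey [simp]: "el y" using y by (simp add: iel_def)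
  have [simp]: "lab y = k" "tgt y = unit1 W (src W k)" "trg W (sor y) = extent (pdom M) a"
    using y el_D[OF ey] by auto
  show ?thesis
  proof (rule presents_hom_ext[OF tens_pres(3)[OF t o h k] w])
    fix b assume [simp]: "b \<in> obj (pcod M)"
    let ?m = "gen (pcmp M b a) (sor y)"
    let ?n = "gen (pcmp N d b) (sor ?m)"
    \<comment> \<open>The left context has to be tested on an element whose target is the source of
      \<open>?n\<close>, which depends on the summand; this is why \<open>x\<close> is a function of
      its target.\<close>
    let ?x = "x (sor ?n)" and ?t = "tens_in W N M d a b"
    have x': "iel ?x" "lab ?x = h" "tgt ?x = sor ?n" using x[of "sor ?n"] by auto
    have sn: "sor ?n = pcmp N d b \<otimes> pcmp M b a \<otimes> sor y" by simp
    have [simp]: "el (x (pcmp N d b \<otimes> pcmp M b a \<otimes> sor y))" "lab (x (pcmp N d b \<otimes> pcmp M b a \<otimes> sor y)) = h"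
      "tgt (x (pcmp N d b \<otimes> pcmp M b a \<otimes> sor y)) = pcmp N d b \<otimes> pcmp M b a \<otimes> sor y"
      using x' unfolding sn iel_def by blast+
    show "w \<cdot> ((id2 W h \<odot> ?t) \<odot> id2 W k) = w' \<cdot> ((id2 W h \<odot> ?t) \<odot> id2 W k)"
    proof (rule cell_eqI_lab)
      show "iel ((?x >< (?n >< ?m)) >< y)" using x'(1) y(1) by (intro iel_pr iel_gen) simp_all
      show "(w \<cdot> ((id2 W h \<odot> ?t) \<odot> id2 W k)) \<rhd> ((?x >< (?n >< ?m)) >< y) =
        (w' \<cdot> ((id2 W h \<odot> ?t) \<odot> id2 W k)) \<rhd> ((?x >< (?n >< ?m)) >< y)"
        using eq[of b ?n ?m] by (simp add: ap_comp ap_tens)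
    qed simp_all
  qed simp_all
qed

lemma tens_ext_both:
  assumes t: "tp N M" and o [simp]: "a \<in> obj (pdom M)" "d \<in> obj (pcod N)"
    and h [simp]: "h \<in> one_cells W" "src W h = extent (pcod N) d"
    and k [simp]: "k \<in> one_cells W" "trg W k = extent (pdom M) a"
    and w: "w \<in> two_cells W" "w' \<in> two_cells W"
      "dom2 W w = (h \<otimes> tens_cmp W N M d a) \<otimes> k" "dom2 W w' = (h \<otimes> tens_cmp W N M d a) \<otimes> k"
      "cod2 W w' = cod2 W w"
    and eq: "\<And>b x n m y. \<lbrakk>b \<in> obj (pcod M); el x; el n; el m; el y;
      tgt x = sor n; tgt n = sor m; tgt m = sor y;
      lab x = h; lab n = pcmp N d b; lab m = pcmp M b a; lab y = k\<rbrakk> \<Longrightarrow>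
      w \<rhd> ((x >< (tens_in W N M d a b \<rhd> (n >< m))) >< y) =
      w' \<rhd> ((x >< (tens_in W N M d a b \<rhd> (n >< m))) >< y)"
  shows "w = w'"
proof (rule tens_ext_iel[OF t o h k w, where x = "gen h" and y = "gen k (unit1 W (src W k))"])
  show "iel (gen k (unit1 W (src W k)))" by (rule iel_gen) simp_all
  show "iel (gen h j) \<and> lab (gen h j) = h \<and> tgt (gen h j) = j" if "j \<in> one_cells W" "trg W j = src W h" for j
    using that by (simp add: iel_gen)
  fix b n m assume [simp]: "b \<in> obj (pcod M)" "el n" "el m" "tgt n = sor m"
    "tgt m = sor (gen k (unit1 W (src W k)))" "lab n = pcmp N d b" "lab m = pcmp M b a"
  have [simp]: "trg W (sor n) = extent (pcod N) d" using el_D[of n] tpD[OF t] by simp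
  show "w \<rhd> ((gen h (sor n) >< (tens_in W N M d a b \<rhd> (n >< m))) >< gen k (unit1 W (src W k))) =
      w' \<rhd> ((gen h (sor n) >< (tens_in W N M d a b \<rhd> (n >< m))) >< gen k (unit1 W (src W k)))"
    by (rule eq) simp_all
qed simp_all

lemma tens_ext_right_iel:
  assumes t: "tp N M" and o [simp]: "a \<in> obj (pdom M)" "d \<in> obj (pcod N)"
    and k [simp]: "k \<in> one_cells W" "trg W k = extent (pdom M) a"
    and w: "w \<in> two_cells W" "w' \<in> two_cells W"
      "dom2 W w = tens_cmp W N M d a \<otimes> k" "dom2 W w' = tens_cmp W N M d a \<otimes> k"
      "cod2 W w' = cod2 W w"
    and y: "iel y" "lab y = k" "tgt y = unit1 W (src W k)"
    and eq: "\<And>b n m. \<lbrakk>b \<in> obj (pcod M); el n; el m; tgt n = sor m; tgt m = sor y;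
      lab n = pcmp N d b; lab m = pcmp M b a\<rbrakk> \<Longrightarrow>
      w \<rhd> ((tens_in W N M d a b \<rhd> (n >< m)) >< y) = w' \<rhd> ((tens_in W N M d a b \<rhd> (n >< m)) >< y)"
  shows "w = w'"
proof -
  note [simp] = tpD[OF t] tens_cell[OF t] tu_tv_cell[OF t] w
  have ey [simp]: "el y" using y by (simp add: iel_def)
  have [simp]: "lab y = k" "tgt y = unit1 W (src W k)" "trg W (sor y) = extent (pdom M) a"
    using y el_D[OF ey] by auto
  show ?thesis
  proof (rule presents_hom_ext[OF tens_pres(1)[OF t o k] w])
    fix b assume [simp]: "b \<in> obj (pcod M)"
    let ?m = "gen (pcmp M b a) (sor y)"
    let ?n = "gen (pcmp N d b) (sor ?m)"
    show "w \<cdot> (tens_in W N M d a b \<odot> id2 W k) = w' \<cdot> (tens_in W N M d a b \<odot> id2 W k)"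
    proof (rule cell_eqI_lab)
      show "iel ((?n >< ?m) >< y)" using y(1) by (intro iel_pr iel_gen) simp_all
      show "(w \<cdot> (tens_in W N M d a b \<odot> id2 W k)) \<rhd> ((?n >< ?m) >< y) =
        (w' \<cdot> (tens_in W N M d a b \<odot> id2 W k)) \<rhd> ((?n >< ?m) >< y)"
        using eq[of b ?n ?m] by (simp add: ap_comp ap_tens)
    qed simp_all
  qed simp_all
qed

lemma tens_ext_left_iel:
  assumes t: "tp N M" and o [simp]: "a \<in> obj (pdom M)" "d \<in> obj (pcod N)"
    and h [simp]: "h \<in> one_cells W" "src W h = extent (pcod N) d"
    and w: "w \<in> two_cells W" "w' \<in> two_cells W"
      "dom2 W w = h \<otimes> tens_cmp W N M d a" "dom2 W w' = h \<otimes> tens_cmp W N M d a"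
      "cod2 W w' = cod2 W w"
    and x: "\<And>j. j \<in> one_cells W \<Longrightarrow> trg W j = src W h \<Longrightarrow> iel (x j) \<and> lab (x j) = h \<and> tgt (x j) = j"
    and eq: "\<And>b n m. \<lbrakk>b \<in> obj (pcod M); el n; el m; tgt n = sor m;
      lab n = pcmp N d b; lab m = pcmp M b a\<rbrakk> \<Longrightarrow>
      w \<rhd> (x (sor n) >< (tens_in W N M d a b \<rhd> (n >< m))) = w' \<rhd> (x (sor n) >< (tens_in W N M d a b \<rhd> (n >< m)))"
  shows "w = w'"
proof -
  note [simp] = tpD[OF t] tens_cell[OF t] tu_tv_cell[OF t] w
  show ?thesis
  proof (rule presents_hom_ext[OF tens_pres(2)[OF t o h] w])
    fix b assume [simp]: "b \<in> obj (pcod M)"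
    let ?I = "unit1 W (extent (pdom M) a)"
    let ?m = "gen (pcmp M b a) ?I"
    let ?n = "gen (pcmp N d b) (sor ?m)"
    let ?x = "x (sor ?n)"
    have x': "iel ?x" "lab ?x = h" "tgt ?x = sor ?n" using x[of "sor ?n"] by auto
    have sn: "sor ?n = pcmp N d b \<otimes> pcmp M b a \<otimes> ?I" by simp
    have [simp]: "el (x (pcmp N d b \<otimes> pcmp M b a \<otimes> ?I))" "lab (x (pcmp N d b \<otimes> pcmp M b a \<otimes> ?I)) = h"
      "tgt (x (pcmp N d b \<otimes> pcmp M b a \<otimes> ?I)) = pcmp N d b \<otimes> pcmp M b a \<otimes> ?I"
      using x' unfolding sn iel_def by blast+
    show "w \<cdot> (id2 W h \<odot> tens_in W N M d a b) = w' \<cdot> (id2 W h \<odot> tens_in W N M d a b)"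
    proof (rule cell_eqI_lab)
      show "iel (?x >< (?n >< ?m))" using x'(1) by (intro iel_pr iel_gen) simp_all
      show "(w \<cdot> (id2 W h \<odot> tens_in W N M d a b)) \<rhd> (?x >< (?n >< ?m)) =
        (w' \<cdot> (id2 W h \<odot> tens_in W N M d a b)) \<rhd> (?x >< (?n >< ?m))"
        using eq[of b ?n ?m] by (simp add: ap_comp ap_tens)
    qed simp_all
  qed simp_all
qed

lemma tens_ext_right:
  assumes t: "tp N M" and o [simp]: "a \<in> obj (pdom M)" "d \<in> obj (pcod N)"
    and k [simp]: "k \<in> one_cells W" "trg W k = extent (pdom M) a"
    and w: "w \<in> two_cells W" "w' \<in> two_cells W"
      "dom2 W w = tens_cmp W N M d a \<otimes> k" "dom2 W w' = tens_cmp W N M d a \<otimes> k"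
      "cod2 W w' = cod2 W w"
    and eq: "\<And>b n m y. \<lbrakk>b \<in> obj (pcod M); el n; el m; el y;
      tgt n = sor m; tgt m = sor y;
      lab n = pcmp N d b; lab m = pcmp M b a; lab y = k\<rbrakk> \<Longrightarrow>
      w \<rhd> ((tens_in W N M d a b \<rhd> (n >< m)) >< y) = w' \<rhd> ((tens_in W N M d a b \<rhd> (n >< m)) >< y)"
  shows "w = w'"
  by (rule tens_ext_right_iel[OF t o k w iel_gen[of k "unit1 W (src W k)"]]) (auto intro!: eq)

lemma tens_ext_right2:
  assumes t: "tp N M" and o [simp]: "a \<in> obj (pdom M)" "d \<in> obj (pcod N)"
    and k [simp]: "k \<in> one_cells W" "trg W k = extent (pdom M) a" "k' \<in> one_cells W" "trg W k' = src W k"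
    and w: "w \<in> two_cells W" "w' \<in> two_cells W"
      "dom2 W w = tens_cmp W N M d a \<otimes> k \<otimes> k'" "dom2 W w' = tens_cmp W N M d a \<otimes> k \<otimes> k'"
      "cod2 W w' = cod2 W w"
    and eq: "\<And>b n m y y'. \<lbrakk>b \<in> obj (pcod M); el n; el m; el y; el y';
      tgt n = sor m; tgt m = sor y; tgt y = sor y';
      lab n = pcmp N d b; lab m = pcmp M b a; lab y = k; lab y' = k'\<rbrakk> \<Longrightarrow>
      w \<rhd> ((tens_in W N M d a b \<rhd> (n >< m)) >< y >< y') = w' \<rhd> ((tens_in W N M d a b \<rhd> (n >< m)) >< y >< y')"
  shows "w = w'"
proof -
  let ?y' = "gen k' (unit1 W (src W k'))"
  \<comment> \<open>The context is a tensor product of two 1-cells and is therefore tested on a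
    pairing of two generic elements.\<close>
  have i: "iel (gen k (sor ?y') >< ?y')" by (intro iel_pr iel_gen) simp_all
  show ?thesis
    by (rule tens_ext_right_iel[OF t o _ _ w i]) (auto intro!: eq)
qed

lemma tens_ext_left:
  assumes t: "tp N M" and o [simp]: "a \<in> obj (pdom M)" "d \<in> obj (pcod N)"
    and h [simp]: "h \<in> one_cells W" "src W h = extent (pcod N) d"
    and w: "w \<in> two_cells W" "w' \<in> two_cells W"
      "dom2 W w = h \<otimes> tens_cmp W N M d a" "dom2 W w' = h \<otimes> tens_cmp W N M d a"
      "cod2 W w' = cod2 W w"
    and eq: "\<And>b x n m. \<lbrakk>b \<in> obj (pcod M); el x; el n; el m;
      tgt x = sor n; tgt n = sor m;
      lab x = h; lab n = pcmp N d b; lab m = pcmp M b a\<rbrakk> \<Longrightarrow>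
      w \<rhd> (x >< (tens_in W N M d a b \<rhd> (n >< m))) = w' \<rhd> (x >< (tens_in W N M d a b \<rhd> (n >< m)))"
  shows "w = w'"
proof (rule tens_ext_left_iel[OF t o h w, where x = "gen h"])
  fix b n m assume [simp]: "b \<in> obj (pcod M)" "el n" "el m" "tgt n = sor m" "lab n = pcmp N d b" "lab m = pcmp M b a"
  have [simp]: "trg W (sor n) = extent (pcod N) d" using el_D[of n] tpD[OF t] by simp
  show "w \<rhd> (gen h (sor n) >< (tens_in W N M d a b \<rhd> (n >< m))) =
      w' \<rhd> (gen h (sor n) >< (tens_in W N M d a b \<rhd> (n >< m)))"
    by (rule eq) simp_all
qed (simp_all add: iel_gen)

lemma tens_ext_left2:
  assumes t: "tp N M" and o [simp]: "a \<in> obj (pdom M)" "d \<in> obj (pcod N)"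
    and h [simp]: "h \<in> one_cells W" "src W h = extent (pcod N) d" "h' \<in> one_cells W" "src W h' = trg W h"
    and w: "w \<in> two_cells W" "w' \<in> two_cells W"
      "dom2 W w = (h' \<otimes> h) \<otimes> tens_cmp W N M d a" "dom2 W w' = (h' \<otimes> h) \<otimes> tens_cmp W N M d a"
      "cod2 W w' = cod2 W w"
    and eq: "\<And>b x' x n m. \<lbrakk>b \<in> obj (pcod M); el x'; el x; el n; el m;
      tgt x' = sor x; tgt x = sor n; tgt n = sor m;
      lab x' = h'; lab x = h; lab n = pcmp N d b; lab m = pcmp M b a\<rbrakk> \<Longrightarrow>
      w \<rhd> ((x' >< x) >< (tens_in W N M d a b \<rhd> (n >< m))) = w' \<rhd> ((x' >< x) >< (tens_in W N M d a b \<rhd> (n >< m)))"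
  shows "w = w'"
proof (rule tens_ext_left_iel[OF t o _ _ w, where x = "\<lambda>j. gen h' (h \<otimes> j) >< gen h j"])
  fix b n m assume [simp]: "b \<in> obj (pcod M)" "el n" "el m" "tgt n = sor m" "lab n = pcmp N d b" "lab m = pcmp M b a"
  have [simp]: "trg W (sor n) = extent (pcod N) d" using el_D[of n] tpD[OF t] by simp
  show "w \<rhd> ((gen h' (h \<otimes> sor n) >< gen h (sor n)) >< (tens_in W N M d a b \<rhd> (n >< m))) =
      w' \<rhd> ((gen h' (h \<otimes> sor n) >< gen h (sor n)) >< (tens_in W N M d a b \<rhd> (n >< m)))"
    by (rule eq) simp_all
next
  fix j assume "j \<in> one_cells W" "trg W j = src W (h' \<otimes> h)"
  then show "iel (gen h' (h \<otimes> j) >< gen h j) \<and> lab (gen h' (h \<otimes> j) >< gen h j) = h' \<otimes> h \<and>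
    tgt (gen h' (h \<otimes> j) >< gen h j) = j"
    by (auto intro!: iel_pr iel_gen)
qed simp_all

section \<open>The actions on a tensor product\<close>

lemma tens_prof_sel [simp]:
  "pdom (tens_prof W N M) = pdom M" "pcod (tens_prof W N M) = pcod N"
  "pcmp (tens_prof W N M) = tens_cmp W N M"
  by (simp_all add: tens_prof_def)

text \<open>\<open>tens_prof\<close> describes the action as the unique 2-cell with prescribed
  restrictions. It exists and is unique because a tensor product with 1-cells on both sides is still
  presented by its summands.\<close>

lemma tens_pact:
  assumes t: "tp N M" and o [simp]: "a \<in> obj (pdom M)" "d \<in> obj (pcod N)" "a' \<in> obj (pdom M)" "d' \<in> obj (pcod N)"
  shows "pact (tens_prof W N M) d' d a a' \<in> two_cells W"
    "dom2 W (pact (tens_prof W N M) d' d a a') = (whom (pcod N) d' d \<otimes> tens_cmp W N M d a) \<otimes> whom (pdom M) a a'"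
    "cod2 W (pact (tens_prof W N M) d' d a a') = tens_cmp W N M d' a'"
    "\<And>b x n m y. \<lbrakk>b \<in> obj (pcod M); el x; el n; el m; el y;
      tgt x = sor n; tgt n = sor m; tgt m = sor y;
      lab x = whom (pcod N) d' d; lab n = pcmp N d b; lab m = pcmp M b a; lab y = whom (pdom M) a a'\<rbrakk> \<Longrightarrow>
      pact (tens_prof W N M) d' d a a' \<rhd> ((x >< (tens_in W N M d a b \<rhd> (n >< m))) >< y) =
      tens_in W N M d' a' b \<rhd> ((lact W N d' d b \<rhd> (x >< n)) >< (ract W M b a a' \<rhd> (m >< y)))"
proof -
  note [simp] = tpD[OF t] tens_cell[OF t]
  let ?h = "whom (pcod N) d' d" and ?k = "whom (pdom M) a a'"
  define f where "f b = tens_in W N M d' a' b \<cdot>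
             (lact W N d' d b \<odot> ract W M b a a') \<cdot>
             assoc W (?h \<otimes> pcmp N d b) (pcmp M b a) ?k \<cdot>
             (inv2 W (assoc W ?h (pcmp N d b) (pcmp M b a)) \<odot> id2 W ?k)" for b
  have f [simp]: "f b \<in> two_cells W" "dom2 W (f b) = (?h \<otimes> (pcmp N d b \<otimes> pcmp M b a)) \<otimes> ?k"
    "cod2 W (f b) = tens_cmp W N M d' a'" if "b \<in> obj (pcod M)" for b
    using that by (simp_all add: f_def)
  have fap: "f b \<rhd> ((x >< (n >< m)) >< y) =
      tens_in W N M d' a' b \<rhd> ((lact W N d' d b \<rhd> (x >< n)) >< (ract W M b a a' \<rhd> (m >< y)))"
    if [simp]: "b \<in> obj (pcod M)" "el x" "el n" "el m" "el y" "tgt x = sor n" "tgt n = sor m" "tgt m = sor y"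
      "lab x = ?h" "lab n = pcmp N d b" "lab m = pcmp M b a" "lab y = ?k" for b x n m y
    by (simp add: f_def ap_comp ap_tens ap_assoc ap_assoc_inv)
  obtain w where w: "w \<in> two_cells W" "dom2 W w = (?h \<otimes> tens_cmp W N M d a) \<otimes> ?k" "cod2 W w = tens_cmp W N M d' a'"
    "\<And>b. b \<in> obj (pcod M) \<Longrightarrow> w \<cdot> ((id2 W ?h \<odot> tens_in W N M d a b) \<odot> id2 W ?k) = f b"
  proof (rule tens_ex_both[OF t o(1,2), where h = ?h and k = ?k and f = f and p = "tens_cmp W N M d' a'"])
    fix b b' x n g m y
    assume [simp]: "b \<in> obj (pcod M)" "b' \<in> obj (pcod M)" "el x" "el n" "el g" "el m" "el y"
      "tgt x = sor n" "tgt n = sor g" "tgt g = sor m" "tgt m = sor y" "lab x = ?h" "lab y = ?k"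
      "lab n = pcmp N d b" "lab g = whom (pcod M) b b'" "lab m = pcmp M b' a"
    \<comment> \<open>The middle factor \<open>g\<close> is pulled out of the outer actions; there
      the balance of the tensor product moves it across.\<close>
    have "f b' \<rhd> ((x >< (ract W N d b b' \<rhd> (n >< g)) >< m) >< y) =
      tens_in W N M d' a' b' \<rhd> ((ract W N d' b b' \<rhd> ((lact W N d' d b \<rhd> (x >< n)) >< g)) >< (ract W M b' a a' \<rhd> (m >< y)))"
      by (simp add: fap ract_lact)
    also have "\<dots> = f b \<rhd> ((x >< n >< (lact W M b b' a \<rhd> (g >< m))) >< y)"
      by (subst tens_balanced[OF t]) (simp_all add: fap ract_lact)
    finally show "f b' \<rhd> ((x >< (ract W N d b b' \<rhd> (n >< g)) >< m) >< y) =
      f b \<rhd> ((x >< n >< (lact W M b b' a \<rhd> (g >< m))) >< y)" .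
  qed auto
  have pw: "pact (tens_prof W N M) d' d a a' = w"
    unfolding tens_prof_def prof.simps
  proof (rule the_equality)
    show "w \<in> cells W ((?h \<otimes> tens_cmp W N M d a) \<otimes> ?k) (tens_cmp W N M d' a') \<and>
      (\<forall>b\<in>obj (pcod M). w \<cdot> ((id2 W ?h \<odot> tens_in W N M d a b) \<odot> id2 W ?k) =
           tens_in W N M d' a' b \<cdot>
             (lact W N d' d b \<odot> ract W M b a a') \<cdot>
             assoc W (?h \<otimes> pcmp N d b) (pcmp M b a) ?k \<cdot>
             (inv2 W (assoc W ?h (pcmp N d b) (pcmp M b a)) \<odot> id2 W ?k))"
      using w unfolding f_def by (simp add: cells_def)
    fix u assume u: "u \<in> cells W ((?h \<otimes> tens_cmp W N M d a) \<otimes> ?k) (tens_cmp W N M d' a') \<and>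
      (\<forall>b\<in>obj (pcod M). u \<cdot> ((id2 W ?h \<odot> tens_in W N M d a b) \<odot> id2 W ?k) =
           tens_in W N M d' a' b \<cdot>
             (lact W N d' d b \<odot> ract W M b a a') \<cdot>
             assoc W (?h \<otimes> pcmp N d b) (pcmp M b a) ?k \<cdot>
             (inv2 W (assoc W ?h (pcmp N d b) (pcmp M b a)) \<odot> id2 W ?k))"
    show "u = w"
      by (rule presents_hom_ext[OF tens_pres(3)[OF t o(1,2), of ?h ?k]])
        (use u w in \<open>simp_all add: cells_def f_def tu_tv_cell[OF t]\<close>)
  qed
  with w show p [simp]: "pact (tens_prof W N M) d' d a a' \<in> two_cells W"
    "dom2 W (pact (tens_prof W N M) d' d a a') = (?h \<otimes> tens_cmp W N M d a) \<otimes> ?k"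
    "cod2 W (pact (tens_prof W N M) d' d a a') = tens_cmp W N M d' a'"
    by simp_all
  have eq: "\<And>b. b \<in> obj (pcod M) \<Longrightarrow>
      pact (tens_prof W N M) d' d a a' \<cdot> ((id2 W ?h \<odot> tens_in W N M d a b) \<odot> id2 W ?k) = f b"
    using pw w by simp
  fix b x n m y
  assume [simp]: "b \<in> obj (pcod M)" "el x" "el n" "el m" "el y" "tgt x = sor n" "tgt n = sor m" "tgt m = sor y"
      "lab x = ?h" "lab n = pcmp N d b" "lab m = pcmp M b a" "lab y = ?k"
  have "f b \<rhd> ((x >< (n >< m)) >< y) = pact (tens_prof W N M) d' d a a' \<rhd> ((x >< (tens_in W N M d a b \<rhd> (n >< m))) >< y)"
    unfolding eq[symmetric, OF \<open>b \<in> _\<close>] by (simp add: ap_comp ap_tens)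
  then show "pact (tens_prof W N M) d' d a a' \<rhd> ((x >< (tens_in W N M d a b \<rhd> (n >< m))) >< y) =
      tens_in W N M d' a' b \<rhd> ((lact W N d' d b \<rhd> (x >< n)) >< (ract W M b a a' \<rhd> (m >< y)))"
    by (simp add: fap)
qed

lemma tens_prof_pf:
  assumes t: "tp N M"
  shows "pf (tens_prof W N M)"
proof -
  note [simp] = tpD[OF t] tens_cell[OF t] tens_pact(1-3)[OF t]
  let ?T = "tens_prof W N M" and ?A = "pdom M" and ?D = "pcod N"
  show ?thesis
  proof (rule profI[where R = "\<lambda>_ _. UNIV"])
    fix a d m assume "a \<in> obj (pdom ?T)" "d \<in> obj (pcod ?T)" "el m" "lab m = pcmp ?T d a"
    then have [simp]: "a \<in> obj ?A" "d \<in> obj ?D" "el m" "lab m = tens_cmp W N M d a" by simp_all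
    let ?t = "tens_cmp W N M d a"
    \<comment> \<open>The unit axiom concerns an arbitrary element of the tensor product, whereas
      the action is known only on images of pairings. As an equation between \<open>?c\<close> and
      an identity 2-cell it can be tested on those.\<close>
    let ?c = "pact ?T d d a a \<cdot> ((wid ?D d \<odot> id2 W ?t) \<odot> wid ?A a) \<cdot>
      inv2 W (run W (unit1 W (extent ?D d) \<otimes> ?t)) \<cdot> inv2 W (lun W ?t)"
    have c: "?c \<rhd> x = pact ?T d d a a \<rhd> (((wid ?D d \<rhd> one (sor x)) >< x) >< (wid ?A a \<rhd> one (tgt x)))"
      if [simp]: "el x" "lab x = ?t" for x
    by (simp add: ap_comp ap_tens ap_lun_inv ap_run_inv)
    have "?c = id2 W ?t"
    proof (rule tens_ext[OF t])
      fix b n m assume [simp]: "b \<in> obj (pcod M)" "el n" "el m" "tgt n = sor m" "lab n = pcmp N d b" "lab m = pcmp M b a"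
      have [simp]: "ract W M b a a \<rhd> (m >< (wid ?A a \<rhd> one (tgt m))) = m"
        "lact W N d d b \<rhd> ((wid ?D d \<rhd> one (sor n)) >< n) = n"
        by simp_all
      show "?c \<rhd> tens_in W N M d a b \<rhd> (n >< m) = id2 W ?t \<rhd> tens_in W N M d a b \<rhd> (n >< m)"
        by (subst c) (simp_all add: tens_pact[OF t])
    qed simp_all
    then show "pact ?T d d a a \<rhd> (((wid (pcod ?T) d \<rhd> one (sor m)) >< m) >< (wid (pdom ?T) a \<rhd> one (tgt m))) = m"
      using c[of m] by simp
  next
    fix a a' a'' d d' d'' g' g x f f'
    assume "a \<in> obj (pdom ?T)" "a' \<in> obj (pdom ?T)" "a'' \<in> obj (pdom ?T)"
      "d \<in> obj (pcod ?T)" "d' \<in> obj (pcod ?T)" "d'' \<in> obj (pcod ?T)"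
      and el [simp]: "el g'" "el g" "el x" "el f" "el f'" "tgt g' = sor g" "tgt g = sor x" "tgt x = sor f" "tgt f = sor f'"
      and "lab g' = whom (pcod ?T) d'' d'" "lab g = whom (pcod ?T) d' d" "lab x = pcmp ?T d a"
        "lab f = whom (pdom ?T) a a'" "lab f' = whom (pdom ?T) a' a''"
    then have [simp]: "a \<in> obj ?A" "a' \<in> obj ?A" "a'' \<in> obj ?A" "d \<in> obj ?D" "d' \<in> obj ?D" "d'' \<in> obj ?D"
      and lab [simp]: "lab g' = whom ?D d'' d'" "lab g = whom ?D d' d" "lab x = tens_cmp W N M d a"
        "lab f = whom ?A a a'" "lab f' = whom ?A a' a''" by simp_all
    let ?h' = "whom ?D d'' d'" and ?h = "whom ?D d' d" and ?k = "whom ?A a a'" and ?k' = "whom ?A a' a''"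
    let ?t = "tens_cmp W N M d a"
    \<comment> \<open>The constraints give \<open>?w\<close> the source
      \<open>((h' \<otimes> h) \<otimes> t) \<otimes> (k \<otimes> k')\<close>, in which the tensor
      product stands between two contexts as \<open>tens_ext_iel\<close> requires.\<close>
    let ?w = "(pact ?T d'' d' a' a'' \<cdot> ((id2 W ?h' \<odot> pact ?T d' d a a') \<odot> id2 W ?k')) \<cdot>
      (assoc W ?h' (?h \<otimes> ?t) ?k \<odot> id2 W ?k') \<cdot> inv2 W (assoc W (?h' \<otimes> ?h \<otimes> ?t) ?k ?k') \<cdot>
      (assoc W ?h' ?h ?t \<odot> id2 W (?k \<otimes> ?k'))"
    let ?w' = "pact ?T d'' d a a'' \<cdot> ((wmult ?D d'' d' d \<odot> id2 W ?t) \<odot> wmult ?A a a' a'')"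
    have w: "?w \<rhd> (((p' >< p) >< y) >< q >< q') =
        pact ?T d'' d' a' a'' \<rhd> ((p' >< (pact ?T d' d a a' \<rhd> ((p >< y) >< q))) >< q')"
      "?w' \<rhd> (((p' >< p) >< y) >< q >< q') =
        pact ?T d'' d a a'' \<rhd> (((wmult ?D d'' d' d \<rhd> (p' >< p)) >< y) >< (wmult ?A a a' a'' \<rhd> (q >< q')))"
      if [simp]: "el p'" "el p" "el y" "el q" "el q'" "tgt p' = sor p" "tgt p = sor y" "tgt y = sor q" "tgt q = sor q'"
        "lab p' = ?h'" "lab p = ?h" "lab y = ?t" "lab q = ?k" "lab q' = ?k'" for p' p y q q'
      by (simp_all add: ap_comp ap_tens ap_assoc ap_assoc_inv)
    have "?w = ?w'"
    proof (rule tens_ext_iel[OF t, where x = "\<lambda>j. gen ?h' (?h \<otimes> j) >< gen ?h j"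
          and y = "gen ?k (?k' \<otimes> unit1 W (extent ?A a'')) >< gen ?k' (unit1 W (extent ?A a''))"
          and h = "?h' \<otimes> ?h" and k = "?k \<otimes> ?k'"])
      show "iel (gen ?k (?k' \<otimes> unit1 W (extent ?A a'')) >< gen ?k' (unit1 W (extent ?A a'')))"
        by (intro iel_pr iel_gen) simp_all
      show "iel (gen ?h' (?h \<otimes> j) >< gen ?h j) \<and> lab (gen ?h' (?h \<otimes> j) >< gen ?h j) = ?h' \<otimes> ?h \<and>
        tgt (gen ?h' (?h \<otimes> j) >< gen ?h j) = j" if "j \<in> one_cells W" "trg W j = src W (?h' \<otimes> ?h)" for j
        using that by (auto intro!: iel_pr iel_gen)
      fix b n m
      let ?y' = "gen ?k' (unit1 W (extent ?A a''))"
      let ?y = "gen ?k (?k' \<otimes> unit1 W (extent ?A a''))"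
      assume "b \<in> obj (pcod M)" "el n" "el m" "tgt n = sor m" "tgt m = sor (?y >< ?y')" "lab n = pcmp N d b" "lab m = pcmp M b a"
      then have [simp]: "b \<in> obj (pcod M)" "el n" "el m" "tgt n = sor m" "lab n = pcmp N d b" "lab m = pcmp M b a"
        and ym: "tgt m = sor ?y"
        by simp_all
      define p' where "p' = gen ?h' (?h \<otimes> sor n)"
      define p where "p = gen ?h (sor n)"
      define q where "q = ?y" define q' where "q' = ?y'"
      have [simp]: "el p'" "el p" "el q" "el q'" "tgt p' = sor p" "tgt p = sor n" "tgt q = sor q'"
        "lab p' = ?h'" "lab p = ?h" "lab q = ?k" "lab q' = ?k'"
        unfolding p'_def p_def q_def q'_def by simp_all
      have [simp]: "tgt m = sor q" unfolding q_def by (rule ym)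
      have "?w \<rhd> (((p' >< p) >< (tens_in W N M d a b \<rhd> (n >< m))) >< q >< q') =
        ?w' \<rhd> (((p' >< p) >< (tens_in W N M d a b \<rhd> (n >< m))) >< q >< q')"
        by (simp add: w tens_pact(4)[OF t] lact_lact ract_ract)
      then show "?w \<rhd> (((gen ?h' (?h \<otimes> sor n) >< gen ?h (sor n)) >< (tens_in W N M d a b \<rhd> (n >< m))) >< ?y >< ?y') =
        ?w' \<rhd> (((gen ?h' (?h \<otimes> sor n) >< gen ?h (sor n)) >< (tens_in W N M d a b \<rhd> (n >< m))) >< ?y >< ?y')"
        unfolding p'_def p_def q_def q'_def .
    qed simp_all
    then show "pact ?T d'' d' a' a'' \<rhd> ((g' >< (pact ?T d' d a a' \<rhd> ((g >< x) >< f))) >< f') =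
      pact ?T d'' d a a'' \<rhd> (((wmult (pcod ?T) d'' d' d \<rhd> (g' >< g)) >< x) >< (wmult (pdom ?T) a a' a'' \<rhd> (f >< f')))"
      using w[OF el lab] by simp
  qed simp_all
qed

lemma tens_act:
  assumes t: "tp N M"
  shows tens_lact: "\<lbrakk>a \<in> obj (pdom M); b \<in> obj (pcod M); d \<in> obj (pcod N); d' \<in> obj (pcod N);
    el x; el n; el m; tgt x = sor n; tgt n = sor m;
    lab x = whom (pcod N) d' d; lab n = pcmp N d b; lab m = pcmp M b a\<rbrakk> \<Longrightarrow>
    lact W (tens_prof W N M) d' d a \<rhd> (x >< (tens_in W N M d a b \<rhd> (n >< m))) =
    tens_in W N M d' a b \<rhd> ((lact W N d' d b \<rhd> (x >< n)) >< m)"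
  and tens_ract: "\<lbrakk>a \<in> obj (pdom M); a' \<in> obj (pdom M); b \<in> obj (pcod M); d \<in> obj (pcod N);
    el n; el m; el y; tgt n = sor m; tgt m = sor y;
    lab n = pcmp N d b; lab m = pcmp M b a; lab y = whom (pdom M) a a'\<rbrakk> \<Longrightarrow>
    ract W (tens_prof W N M) d a a' \<rhd> ((tens_in W N M d a b \<rhd> (n >< m)) >< y) =
    tens_in W N M d a' b \<rhd> (n >< (ract W M b a a' \<rhd> (m >< y)))"
proof -
  note [simp] = tpD[OF t] tens_cell[OF t] tens_prof_pf[OF t]
  show "lact W (tens_prof W N M) d' d a \<rhd> (x >< (tens_in W N M d a b \<rhd> (n >< m))) =
    tens_in W N M d' a b \<rhd> ((lact W N d' d b \<rhd> (x >< n)) >< m)"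
    if [simp]: "a \<in> obj (pdom M)" "b \<in> obj (pcod M)" "d \<in> obj (pcod N)" "d' \<in> obj (pcod N)"
    "el x" "el n" "el m" "tgt x = sor n" "tgt n = sor m"
    "lab x = whom (pcod N) d' d" "lab n = pcmp N d b" "lab m = pcmp M b a"
  by (simp add: lact_ap tens_pact(4)[OF t])
  show "ract W (tens_prof W N M) d a a' \<rhd> ((tens_in W N M d a b \<rhd> (n >< m)) >< y) =
    tens_in W N M d a' b \<rhd> (n >< (ract W M b a a' \<rhd> (m >< y)))"
    if [simp]: "a \<in> obj (pdom M)" "a' \<in> obj (pdom M)" "b \<in> obj (pcod M)" "d \<in> obj (pcod N)"
    "el n" "el m" "el y" "tgt n = sor m" "tgt m = sor y"
    "lab n = pcmp N d b" "lab m = pcmp M b a" "lab y = whom (pdom M) a a'"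
  by (simp add: ract_ap tens_pact(4)[OF t])
qed

section \<open>Maps out of a tensor product\<close>

definition tens_out ::
  "('y, 'z, 'o, 'f, 'c) prof \<Rightarrow> ('x, 'y, 'o, 'f, 'c) prof \<Rightarrow> ('x, 'z, 'o, 'f, 'c) prof \<Rightarrow>
   ('z \<Rightarrow> 'y \<Rightarrow> 'x \<Rightarrow> 'c) \<Rightarrow> ('x, 'z, 'o, 'f, 'c) pmap" where
  "tens_out N M L t =
     \<lparr>mdom = tens_prof W N M, mcod = L,
      mcmp = (\<lambda>(d, a) \<in> obj (pcod N) \<times> obj (pdom M). THE u.
         u \<in> cells W (tens_cmp W N M d a) (pcmp L d a) \<and>
         (\<forall>b \<in> obj (pcod M). u \<cdot> tens_in W N M d a b = t d b a))\<rparr>"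

lemma tens_out_sel [simp]:
  "mdom (tens_out N M L t) = tens_prof W N M" "mcod (tens_out N M L t) = L"
  by (simp_all add: tens_out_def)

text \<open>
  A family of 2-cells \<open>N(d,b) \<otimes> M(b,a) \<rightarrow> L(d,a)\<close> that respects all actions, the middle one in the
  sense of \<open>n g \<otimes> m \<mapsto> n \<otimes> g m\<close>.
\<close>

inductive bimap ::
  "('y, 'z, 'o, 'f, 'c) prof \<Rightarrow> ('x, 'y, 'o, 'f, 'c) prof \<Rightarrow> ('x, 'z, 'o, 'f, 'c) prof \<Rightarrow>
   ('z \<Rightarrow> 'y \<Rightarrow> 'x \<Rightarrow> 'c) \<Rightarrow> bool" for N M L t where
  bimapI: "bimap N M L t"
if "\<And>a b d. \<lbrakk>a \<in> obj (pdom M); b \<in> obj (pcod M); d \<in> obj (pcod N)\<rbrakk> \<Longrightarrow>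
      t d b a \<in> two_cells W \<and> dom2 W (t d b a) = pcmp N d b \<otimes> pcmp M b a \<and> cod2 W (t d b a) = pcmp L d a"
  and "\<And>a b b' d n g m. \<lbrakk>a \<in> obj (pdom M); b \<in> obj (pcod M); b' \<in> obj (pcod M); d \<in> obj (pcod N);
      el n; el g; el m; tgt n = sor g; tgt g = sor m;
      lab n = pcmp N d b; lab g = whom (pcod M) b b'; lab m = pcmp M b' a\<rbrakk> \<Longrightarrow>
      t d b' a \<rhd> ((ract W N d b b' \<rhd> (n >< g)) >< m) = t d b a \<rhd> (n >< (lact W M b b' a \<rhd> (g >< m)))"
  and "\<And>a b d d' x n m. \<lbrakk>a \<in> obj (pdom M); b \<in> obj (pcod M); d \<in> obj (pcod N); d' \<in> obj (pcod N);
      el x; el n; el m; tgt x = sor n; tgt n = sor m;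
      lab x = whom (pcod N) d' d; lab n = pcmp N d b; lab m = pcmp M b a\<rbrakk> \<Longrightarrow>
      t d' b a \<rhd> ((lact W N d' d b \<rhd> (x >< n)) >< m) = lact W L d' d a \<rhd> (x >< (t d b a \<rhd> (n >< m)))"
  and "\<And>a a' b d n m y. \<lbrakk>a \<in> obj (pdom M); a' \<in> obj (pdom M); b \<in> obj (pcod M); d \<in> obj (pcod N);
      el n; el m; el y; tgt n = sor m; tgt m = sor y;
      lab n = pcmp N d b; lab m = pcmp M b a; lab y = whom (pdom M) a a'\<rbrakk> \<Longrightarrow>
      t d b a' \<rhd> (n >< (ract W M b a a' \<rhd> (m >< y))) = ract W L d a a' \<rhd> ((t d b a \<rhd> (n >< m)) >< y)"

lemmas bimapD = bimap.simps[THEN iffD1, THEN conjunct1, rule_format, THEN conjunct1]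
  bimap.simps[THEN iffD1, THEN conjunct1, rule_format, THEN conjunct2, THEN conjunct1]
  bimap.simps[THEN iffD1, THEN conjunct1, rule_format, THEN conjunct2, THEN conjunct2]
  and bimap_balanced = bimap.simps[THEN iffD1, THEN conjunct2, THEN conjunct1, rule_format]
  and bimap_lact = bimap.simps[THEN iffD1, THEN conjunct2, THEN conjunct2, THEN conjunct1, rule_format]
  and bimap_ract = bimap.simps[THEN iffD1, THEN conjunct2, THEN conjunct2, THEN conjunct2, rule_format]

text \<open>The universal property of the coequaliser gives the components, and the action laws hold
  because they hold on summands. \<open>tens_map\<close>, \<open>prof_lun\<close>,
  \<open>prof_run\<close> and \<open>mult_map\<close> are all of this form, so that for each of them
  it remains to check a \<open>bimap\<close>.\<close>

lemma tens_out:
  assumes t: "tp N M" and L: "pf L" "pdom L = pdom M" "pcod L = pcod N" and b: "bimap N M L t"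
  shows tens_out_in: "tens_out N M L t \<in> pmaps W (tens_prof W N M) L"
    and tens_out_cell: "\<lbrakk>a \<in> obj (pdom M); b \<in> obj (pcod M); d \<in> obj (pcod N)\<rbrakk> \<Longrightarrow>
      mcmp (tens_out N M L t) (d, a) \<cdot> tens_in W N M d a b = t d b a"
    and tens_out_ap: "\<lbrakk>a \<in> obj (pdom M); b \<in> obj (pcod M); d \<in> obj (pcod N);
      el x; lab x = pcmp N d b \<otimes> pcmp M b a\<rbrakk> \<Longrightarrow>
      mcmp (tens_out N M L t) (d, a) \<rhd> tens_in W N M d a b \<rhd> x = t d b a \<rhd> x"
proof -
  note [simp] = tpD[OF t] tens_cell[OF t] tens_prof_pf[OF t] L
  have tc [simp]: "t d b a \<in> two_cells W" "dom2 W (t d b a) = pcmp N d b \<otimes> pcmp M b a" "cod2 W (t d b a) = pcmp L d a"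
    if "a \<in> obj (pdom M)" "b \<in> obj (pcod M)" "d \<in> obj (pcod N)" for a b d
    using bimapD[OF b] bimap_balanced[OF b] that by blast+
  let ?u = "\<lambda>d a. mcmp (tens_out N M L t) (d, a)"
  have u: "?u d a \<in> cells W (tens_cmp W N M d a) (pcmp L d a) \<and> (\<forall>b \<in> obj (pcod M). ?u d a \<cdot> tens_in W N M d a b = t d b a)"
    if o [simp]: "a \<in> obj (pdom M)" "d \<in> obj (pcod N)" for a d
  proof -
    obtain w where w: "w \<in> two_cells W" "dom2 W w = tens_cmp W N M d a" "cod2 W w = pcmp L d a"
      "\<And>b. b \<in> obj (pcod M) \<Longrightarrow> w \<cdot> tens_in W N M d a b = t d b a"
      by (rule tens_ex[OF t o, of "pcmp L d a" "\<lambda>b. t d b a"])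
        (use bimapD[OF b] bimap_balanced[OF b] o in simp_all)
    let ?P = "\<lambda>w. w \<in> cells W (tens_cmp W N M d a) (pcmp L d a) \<and> (\<forall>b \<in> obj (pcod M). w \<cdot> tens_in W N M d a b = t d b a)"
    have e: "?u d a = (THE w. ?P w)" by (simp add: tens_out_def)
    show "?P (?u d a)" unfolding e
    proof (rule theI[of ?P w])
      show "?P w" using w by (simp add: cells_def)
      fix v assume v: "?P v" show "v = w"
        by (rule presents_hom_ext[OF tens_presents[OF t o]])
          (use v w in \<open>simp_all add: cells_def tu_tv_cell[OF t]\<close>)
    qed
  qed
  have [simp]: "?u d a \<in> two_cells W" "dom2 W (?u d a) = tens_cmp W N M d a" "cod2 W (?u d a) = pcmp L d a"
    if "a \<in> obj (pdom M)" "d \<in> obj (pcod N)" for a d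
    using u[OF that] by (simp_all add: cells_def)
  show 1: "\<lbrakk>a \<in> obj (pdom M); b \<in> obj (pcod M); d \<in> obj (pcod N)\<rbrakk> \<Longrightarrow>
      ?u d a \<cdot> tens_in W N M d a b = t d b a" for a b d
    using u by blast
  show 2: "?u d a \<rhd> tens_in W N M d a b \<rhd> x = t d b a \<rhd> x"
    if "a \<in> obj (pdom M)" "b \<in> obj (pcod M)" "d \<in> obj (pcod N)" "el x" "lab x = pcmp N d b \<otimes> pcmp M b a" for a b d x
    unfolding 1[OF that(1-3), symmetric] using that by (subst ap_comp) simp_all
  show "tens_out N M L t \<in> pmaps W (tens_prof W N M) L"
  proof (rule pmapI)
    show "mcmp (tens_out N M L t) \<in> extensional (obj (pcod (tens_prof W N M)) \<times> obj (pdom (tens_prof W N M)))"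
      by (simp add: tens_out_def)
    fix a d d' x y assume "a \<in> obj (pdom (tens_prof W N M))" "d \<in> obj (pcod (tens_prof W N M))" "d' \<in> obj (pcod (tens_prof W N M))"
      and el: "el x" "el y" "tgt x = sor y" and "lab x = whom (pcod (tens_prof W N M)) d' d" "lab y = pcmp (tens_prof W N M) d a"
    then have [simp]: "a \<in> obj (pdom M)" "d \<in> obj (pcod N)" "d' \<in> obj (pcod N)" "lab x = whom (pcod N) d' d" "lab y = tens_cmp W N M d a"
      by simp_all
    note [simp] = el
    \<comment> \<open>The law is lifted from elements to 2-cells, where it may be tested on images
      of pairings, and then evaluated at the given element.\<close>
    have "?u d' a \<cdot> lact W (tens_prof W N M) d' d a = lact W L d' d a \<cdot> (id2 W (whom (pcod N) d' d) \<odot> ?u d a)"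
    proof (rule tens_ext_left[OF t])
      fix b x n m assume [simp]: "b \<in> obj (pcod M)" "el x" "el n" "el m" "tgt x = sor n" "tgt n = sor m"
        "lab x = whom (pcod N) d' d" "lab n = pcmp N d b" "lab m = pcmp M b a"
      have "t d' b a \<rhd> ((lact W N d' d b \<rhd> (x >< n)) >< m) = lact W L d' d a \<rhd> (x >< (t d b a \<rhd> (n >< m)))"
        using bimapD[OF b] bimap_balanced[OF b] bimap_lact[OF b] bimap_ract[OF b] by simp
      then show "(?u d' a \<cdot> lact W (tens_prof W N M) d' d a) \<rhd> (x >< (tens_in W N M d a b \<rhd> (n >< m))) =
        (lact W L d' d a \<cdot> (id2 W (whom (pcod N) d' d) \<odot> ?u d a)) \<rhd> (x >< (tens_in W N M d a b \<rhd> (n >< m)))"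
        by (simp add: ap_comp ap_tens 2 tens_lact[OF t])
    qed simp_all
    then have "(?u d' a \<cdot> lact W (tens_prof W N M) d' d a) \<rhd> (x >< y) =
      (lact W L d' d a \<cdot> (id2 W (whom (pcod N) d' d) \<odot> ?u d a)) \<rhd> (x >< y)" by simp
    then show "?u d' a \<rhd> lact W (tens_prof W N M) d' d a \<rhd> (x >< y) = lact W L d' d a \<rhd> (x >< (?u d a \<rhd> y))"
      by (simp add: ap_comp ap_tens)
  next
    fix a a' d x y assume "a \<in> obj (pdom (tens_prof W N M))" "a' \<in> obj (pdom (tens_prof W N M))" "d \<in> obj (pcod (tens_prof W N M))"
      and el: "el x" "el y" "tgt x = sor y" and "lab y = whom (pdom (tens_prof W N M)) a a'" "lab x = pcmp (tens_prof W N M) d a"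
    then have [simp]: "a \<in> obj (pdom M)" "d \<in> obj (pcod N)" "a' \<in> obj (pdom M)" "lab y = whom (pdom M) a a'" "lab x = tens_cmp W N M d a"
      by simp_all
    note [simp] = el
    have "?u d a' \<cdot> ract W (tens_prof W N M) d a a' = ract W L d a a' \<cdot> (?u d a \<odot> id2 W (whom (pdom M) a a'))"
    proof (rule tens_ext_right[OF t])
      fix b n m y assume [simp]: "b \<in> obj (pcod M)" "el n" "el m" "el y" "tgt n = sor m" "tgt m = sor y"
        "lab y = whom (pdom M) a a'" "lab n = pcmp N d b" "lab m = pcmp M b a"
      have "t d b a' \<rhd> (n >< (ract W M b a a' \<rhd> (m >< y))) = ract W L d a a' \<rhd> ((t d b a \<rhd> (n >< m)) >< y)"
        using bimapD[OF b] bimap_balanced[OF b] bimap_lact[OF b] bimap_ract[OF b] by simp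
      then show "(?u d a' \<cdot> ract W (tens_prof W N M) d a a') \<rhd> ((tens_in W N M d a b \<rhd> (n >< m)) >< y) =
        (ract W L d a a' \<cdot> (?u d a \<odot> id2 W (whom (pdom M) a a'))) \<rhd> ((tens_in W N M d a b \<rhd> (n >< m)) >< y)"
        by (simp add: ap_comp ap_tens 2 tens_ract[OF t])
    qed simp_all
    then have "(?u d a' \<cdot> ract W (tens_prof W N M) d a a') \<rhd> (x >< y) =
      (ract W L d a a' \<cdot> (?u d a \<odot> id2 W (whom (pdom M) a a'))) \<rhd> (x >< y)" by simp
    then show "?u d a' \<rhd> ract W (tens_prof W N M) d a a' \<rhd> (x >< y) = ract W L d a a' \<rhd> ((?u d a \<rhd> x) >< y)"
      by (simp add: ap_comp ap_tens)
  qed simp_all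
qed

lemma tens_pmap_eqI:
  assumes t: "tp N M" and uv: "u \<in> pmaps W (tens_prof W N M) L" "v \<in> pmaps W (tens_prof W N M) L"
    and eq: "\<And>a b d n m. \<lbrakk>a \<in> obj (pdom M); b \<in> obj (pcod M); d \<in> obj (pcod N);
      el n; el m; tgt n = sor m; lab n = pcmp N d b; lab m = pcmp M b a\<rbrakk> \<Longrightarrow>
      mcmp u (d, a) \<rhd> tens_in W N M d a b \<rhd> (n >< m) = mcmp v (d, a) \<rhd> tens_in W N M d a b \<rhd> (n >< m)"
  shows "u = v"
proof (rule pmap_eqI[OF uv])
  fix a d assume "a \<in> obj (pdom (tens_prof W N M))" "d \<in> obj (pcod (tens_prof W N M))"
  then have o: "a \<in> obj (pdom M)" "d \<in> obj (pcod N)" by simp_all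
  show "mcmp u (d, a) = mcmp v (d, a)"
    by (rule tens_ext[OF t o]) (use o pmapD[OF uv(1)] pmapD[OF uv(2)] eq in simp_all)
qed

lemma bimap_of_pmap:
  assumes t: "tp N M" and u: "u \<in> pmaps W (tens_prof W N M) L"
  shows "bimap N M L (\<lambda>d b a. mcmp u (d, a) \<cdot> tens_in W N M d a b)"
proof -
  note [simp] = tpD[OF t] tens_cell[OF t] tens_prof_pf[OF t]
  have L [simp]: "pf L" "pdom L = pdom M" "pcod L = pcod N"
    "\<And>a d. a \<in> obj (pdom M) \<Longrightarrow> d \<in> obj (pcod N) \<Longrightarrow> mcmp u (d, a) \<in> two_cells W"
    "\<And>a d. a \<in> obj (pdom M) \<Longrightarrow> d \<in> obj (pcod N) \<Longrightarrow> dom2 W (mcmp u (d, a)) = tens_cmp W N M d a"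
    "\<And>a d. a \<in> obj (pdom M) \<Longrightarrow> d \<in> obj (pcod N) \<Longrightarrow> cod2 W (mcmp u (d, a)) = pcmp L d a"
    using pmapD[OF u] by simp_all
  show ?thesis
    by (rule bimapI) (simp_all add: ap_comp tens_balanced[OF t] tens_lact[OF t, symmetric] tens_ract[OF t, symmetric]
        pmap_lact[OF u] pmap_ract[OF u])
qed

lemma tens_map_eq_tens_out:
  assumes "mdom t = N" "mdom s = M" "mcod t = N'" "mcod s = M'"
  shows "tens_map W t s = tens_out N M (tens_prof W N' M')
    (\<lambda>d b a. tens_in W N' M' d a b \<cdot> (mcmp t (d, b) \<odot> mcmp s (b, a)))"
  using assms by (simp add: tens_map_def tens_out_def Let_def)

lemma tens_map:
  assumes t: "t \<in> pmaps W N N'" and s: "s \<in> pmaps W M M'" and NM: "tp N M"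
  shows tens_map_in: "tens_map W t s \<in> pmaps W (tens_prof W N M) (tens_prof W N' M')"
    and tens_map_ap: "\<lbrakk>a \<in> obj (pdom M); b \<in> obj (pcod M); d \<in> obj (pcod N);
      el n; el m; tgt n = sor m; lab n = pcmp N d b; lab m = pcmp M b a\<rbrakk> \<Longrightarrow>
      mcmp (tens_map W t s) (d, a) \<rhd> tens_in W N M d a b \<rhd> (n >< m) =
      tens_in W N' M' d a b \<rhd> ((mcmp t (d, b) \<rhd> n) >< (mcmp s (b, a) \<rhd> m))"
proof -
  note [simp] = pmapD(1-9)[OF t] pmapD(1-9)[OF s] tpD[OF NM]
  have NM' [simp]: "tp N' M'" using tpD[OF NM] unfolding tp_def by simp
  note [simp] = tens_cell[OF NM] tens_cell[OF NM'] tens_prof_pf[OF NM']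
  let ?f = "\<lambda>d b a. tens_in W N' M' d a b \<cdot> (mcmp t (d, b) \<odot> mcmp s (b, a))"
  have e: "tens_map W t s = tens_out N M (tens_prof W N' M') ?f"
    by (rule tens_map_eq_tens_out) simp_all
  have b: "bimap N M (tens_prof W N' M') ?f"
    by (rule bimapI) (simp_all add: ap_comp ap_tens pmap_lact[OF t] pmap_lact[OF s] pmap_ract[OF t] pmap_ract[OF s]
        tens_balanced[OF NM'] tens_lact[OF NM'] tens_ract[OF NM'])
  show "tens_map W t s \<in> pmaps W (tens_prof W N M) (tens_prof W N' M')"
    unfolding e by (rule tens_out_in[OF NM _ _ _ b]) simp_all
  show "mcmp (tens_map W t s) (d, a) \<rhd> tens_in W N M d a b \<rhd> (n >< m) =
      tens_in W N' M' d a b \<rhd> ((mcmp t (d, b) \<rhd> n) >< (mcmp s (b, a) \<rhd> m))"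
    if [simp]: "a \<in> obj (pdom M)" "b \<in> obj (pcod M)" "d \<in> obj (pcod N)"
      "el n" "el m" "tgt n = sor m" "lab n = pcmp N d b" "lab m = pcmp M b a"
    unfolding e by (subst tens_out_ap[OF NM _ _ _ b]) (simp_all add: ap_comp ap_tens)
qed

lemma tp_id_left: "pf M \<Longrightarrow> small_set \<kappa> (obj (pcod M)) \<Longrightarrow> tp (id_prof W (pcod M)) M"
  by (simp add: tp_def)

lemma tp_id_right: "pf M \<Longrightarrow> small_set \<kappa> (obj (pdom M)) \<Longrightarrow> tp M (id_prof W (pdom M))"
  by (simp add: tp_def)

text \<open>Associativity of \<open>C\<close> gives balance over the domain of \<open>H\<close> as
  well as compatibility with the two outer actions.\<close>

lemma mult_map:
  assumes [simp]: "wf G" "wf H" "wf K" and C [simp]: "fcod G = C" "fcod H = C" "fcod K = C"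
    and s: "small_set \<kappa> (obj (fdom H))"
  shows mult_map_in: "mult_map W G H K \<in> pmaps W (tens_prof W (fun_prof W G H) (fun_prof W H K)) (fun_prof W G K)"
    and mult_map_ap: "\<lbrakk>a \<in> obj (fdom G); b \<in> obj (fdom H); c \<in> obj (fdom K);
      el x; lab x = whom C (fobj G a) (fobj H b) \<otimes> whom C (fobj H b) (fobj K c)\<rbrakk> \<Longrightarrow>
      mcmp (mult_map W G H K) (a, c) \<rhd> tens_in W (fun_prof W G H) (fun_prof W H K) a c b \<rhd> x =
      wmult C (fobj G a) (fobj H b) (fobj K c) \<rhd> x"
proof -
  have t: "tp (fun_prof W G H) (fun_prof W H K)" using s by (simp add: tp_def)
  have [simp]: "wcategory W C" using wf(2)[of G] by simp
  have [simp]: "fobj G x \<in> obj C" "extent C (fobj G x) = extent (fdom G) x" if "x \<in> obj (fdom G)" for x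
    using wf(3)[of G x] wf(4)[of G x] that by simp_all
  have [simp]: "fobj H x \<in> obj C" "extent C (fobj H x) = extent (fdom H) x" if "x \<in> obj (fdom H)" for x
    using wf(3)[of H x] wf(4)[of H x] that by simp_all
  have [simp]: "fobj K x \<in> obj C" "extent C (fobj K x) = extent (fdom K) x" if "x \<in> obj (fdom K)" for x
    using wf(3)[of K x] wf(4)[of K x] that by simp_all
  have [simp]: "cod2 W (fhom G b a) = whom C (fobj G b) (fobj G a)"
    if "a \<in> obj (fdom G)" "b \<in> obj (fdom G)" for a b using wf(7)[of G a b] that by simp
  have [simp]: "cod2 W (fhom H b a) = whom C (fobj H b) (fobj H a)"
    if "a \<in> obj (fdom H)" "b \<in> obj (fdom H)" for a b using wf(7)[of H a b] that by simp
  have [simp]: "cod2 W (fhom K b a) = whom C (fobj K b) (fobj K a)"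
    if "a \<in> obj (fdom K)" "b \<in> obj (fdom K)" for a b using wf(7)[of K a b] that by simp
  let ?f = "\<lambda>a b c. wmult C (fobj G a) (fobj H b) (fobj K c)"
  have b: "bimap (fun_prof W G H) (fun_prof W H K) (fun_prof W G K) ?f"
    by (rule bimapI) (simp_all add: fun_prof_act wmult_assoc)
  have e: "mult_map W G H K = tens_out (fun_prof W G H) (fun_prof W H K) (fun_prof W G K) ?f"
    by (simp add: mult_map_def tens_out_def Let_def)
  show "mult_map W G H K \<in> pmaps W (tens_prof W (fun_prof W G H) (fun_prof W H K)) (fun_prof W G K)"
    unfolding e by (rule tens_out_in[OF t _ _ _ b]) simp_all
  show "mcmp (mult_map W G H K) (a, c) \<rhd> tens_in W (fun_prof W G H) (fun_prof W H K) a c b \<rhd> x = ?f a b c \<rhd> x"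
    if "a \<in> obj (fdom G)" "b \<in> obj (fdom H)" "c \<in> obj (fdom K)"
      "el x" "lab x = whom C (fobj G a) (fobj H b) \<otimes> whom C (fobj H b) (fobj K c)"
    unfolding e using that by (intro tens_out_ap[OF t _ _ _ b]) simp_all
qed

lemma hom_map:
  assumes [simp]: "wf H"
  shows hom_map_in: "hom_map W H \<in> pmaps W (id_prof W (fdom H)) (fun_prof W H H)"
    and hom_map_cmp: "a \<in> obj (fdom H) \<Longrightarrow> b \<in> obj (fdom H) \<Longrightarrow> mcmp (hom_map W H) (b, a) = fhom H b a"
proof -
  show c: "a \<in> obj (fdom H) \<Longrightarrow> b \<in> obj (fdom H) \<Longrightarrow> mcmp (hom_map W H) (b, a) = fhom H b a" for a b
    by (simp add: hom_map_def)
  show "hom_map W H \<in> pmaps W (id_prof W (fdom H)) (fun_prof W H H)"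
    by (rule pmapI) (simp_all add: c id_prof_act fun_prof_act fhom_wmult, simp_all add: hom_map_def)
qed

section \<open>Unit constraints of profunctors and their inverses\<close>

lemma prof_lun:
  assumes [simp]: "pf M" "small_set \<kappa> (obj (pcod M))"
  shows prof_lun_in: "prof_lun W M \<in> pmaps W (tens_prof W (id_prof W (pcod M)) M) M"
    and prof_lun_ap: "\<lbrakk>a \<in> obj (pdom M); b \<in> obj (pcod M); b' \<in> obj (pcod M);
      el x; lab x = whom (pcod M) b' b \<otimes> pcmp M b a\<rbrakk> \<Longrightarrow>
      mcmp (prof_lun W M) (b', a) \<rhd> tens_in W (id_prof W (pcod M)) M b' a b \<rhd> x = lact W M b' b a \<rhd> x"
proof -
  let ?B = "id_prof W (pcod M)" and ?f = "lact W M"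
  have t: "tp ?B M" by (simp add: tp_id_left)
  have b: "bimap ?B M M ?f"
    by (rule bimapI) (simp_all add: id_prof_act lact_lact ract_lact)
  have e: "prof_lun W M = tens_out ?B M M ?f"
    by (simp add: prof_lun_def tens_out_def Let_def)
  show "prof_lun W M \<in> pmaps W (tens_prof W ?B M) M"
    unfolding e by (rule tens_out_in[OF t _ _ _ b]) simp_all
  show "mcmp (prof_lun W M) (b', a) \<rhd> tens_in W ?B M b' a b \<rhd> x = lact W M b' b a \<rhd> x"
    if "a \<in> obj (pdom M)" "b \<in> obj (pcod M)" "b' \<in> obj (pcod M)"
      "el x" "lab x = whom (pcod M) b' b \<otimes> pcmp M b a"
    unfolding e using that by (intro tens_out_ap[OF t _ _ _ b]) simp_all
qed

lemma prof_run:
  assumes [simp]: "pf M" "small_set \<kappa> (obj (pdom M))"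
  shows prof_run_in: "prof_run W M \<in> pmaps W (tens_prof W M (id_prof W (pdom M))) M"
    and prof_run_ap: "\<lbrakk>a \<in> obj (pdom M); a' \<in> obj (pdom M); b \<in> obj (pcod M);
      el x; lab x = pcmp M b a \<otimes> whom (pdom M) a a'\<rbrakk> \<Longrightarrow>
      mcmp (prof_run W M) (b, a') \<rhd> tens_in W M (id_prof W (pdom M)) b a' a \<rhd> x = ract W M b a a' \<rhd> x"
proof -
  let ?A = "id_prof W (pdom M)" and ?f = "ract W M"
  have t: "tp M ?A" by (simp add: tp_id_right)
  have b: "bimap M ?A M ?f"
    by (rule bimapI) (simp_all add: id_prof_act ract_ract ract_lact)
  have e: "prof_run W M = tens_out M ?A M ?f"
    by (simp add: prof_run_def tens_out_def Let_def)
  show "prof_run W M \<in> pmaps W (tens_prof W M ?A) M"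
    unfolding e by (rule tens_out_in[OF t _ _ _ b]) simp_all
  show "mcmp (prof_run W M) (b, a') \<rhd> tens_in W M ?A b a' a \<rhd> x = ract W M b a a' \<rhd> x"
    if "a \<in> obj (pdom M)" "a' \<in> obj (pdom M)" "b \<in> obj (pcod M)"
      "el x" "lab x = pcmp M b a \<otimes> whom (pdom M) a a'"
    unfolding e using that by (intro tens_out_ap[OF t _ _ _ b]) simp_all
qed

text \<open>The inverse inserts an identity, \<open>m \<mapsto> m \<otimes> 1\<close>; it undoes the
  action because \<open>m \<otimes> f = m f \<otimes> 1\<close> in a balanced tensor
  product.\<close>

lemma prof_run_inverse:
  assumes [simp]: "pf M" "small_set \<kappa> (obj (pdom M))"
  obtains r where "r \<in> pmaps W M (tens_prof W M (id_prof W (pdom M)))"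
    "pmap_comp W (prof_run W M) r = pmap_id W M"
    "pmap_comp W r (prof_run W M) = pmap_id W (tens_prof W M (id_prof W (pdom M)))"
    "\<And>a b x. \<lbrakk>a \<in> obj (pdom M); b \<in> obj (pcod M); el x; lab x = pcmp M b a\<rbrakk> \<Longrightarrow>
      mcmp r (b, a) \<rhd> x = tens_in W M (id_prof W (pdom M)) b a a \<rhd> (x >< (wid (pdom M) a \<rhd> one (tgt x)))"
proof -
  let ?A = "id_prof W (pdom M)"
  have t: "tp M ?A" by (simp add: tp_id_right)
  note [simp] = tens_cell[OF t] tens_prof_pf[OF t]
  define r where "r = \<lparr>mdom = M, mcod = tens_prof W M ?A,
    mcmp = (\<lambda>(b, a) \<in> obj (pcod M) \<times> obj (pdom M).
      tens_in W M ?A b a a \<cdot> (id2 W (pcmp M b a) \<odot> wid (pdom M) a) \<cdot> inv2 W (run W (pcmp M b a)))\<rparr>"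
  have rs [simp]: "mdom r = M" "mcod r = tens_prof W M ?A" by (simp_all add: r_def)
  have rc: "mcmp r (b, a) = tens_in W M ?A b a a \<cdot> (id2 W (pcmp M b a) \<odot> wid (pdom M) a) \<cdot> inv2 W (run W (pcmp M b a))"
    if "a \<in> obj (pdom M)" "b \<in> obj (pcod M)" for a b using that by (simp add: r_def)
  have rap: "mcmp r (b, a) \<rhd> x = tens_in W M ?A b a a \<rhd> (x >< (wid (pdom M) a \<rhd> one (tgt x)))"
    if [simp]: "a \<in> obj (pdom M)" "b \<in> obj (pcod M)" "el x" "lab x = pcmp M b a" for a b x
  by (simp add: rc ap_comp ap_tens ap_run_inv)
  have rt [simp]: "mcmp r (b, a) \<in> two_cells W" "dom2 W (mcmp r (b, a)) = pcmp M b a"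
    "cod2 W (mcmp r (b, a)) = tens_cmp W M ?A b a"
    if "a \<in> obj (pdom M)" "b \<in> obj (pcod M)" for a b
    using that by (simp_all add: rc)
  \<comment> \<open>By balance and the unit law,
    \<open>m f \<otimes> 1 = m \<otimes> f 1 = m \<otimes> f\<close>.\<close>
  have rr: "mcmp r (b, a') \<rhd> (ract W M b a a' \<rhd> (m >< f)) = tens_in W M ?A b a' a \<rhd> (m >< f)"
    if [simp]: "a \<in> obj (pdom M)" "a' \<in> obj (pdom M)" "b \<in> obj (pcod M)" "el m" "el f" "tgt m = sor f"
    "lab m = pcmp M b a" "lab f = whom (pdom M) a a'" for a a' b m f
  proof -
    show ?thesis
      by (simp add: rap tens_balanced[OF t] id_prof_act)
  qed
  have r: "r \<in> pmaps W M (tens_prof W M ?A)"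
  proof (rule pmapI)
    fix a b b' g m
    assume [simp]: "a \<in> obj (pdom M)" "b \<in> obj (pcod M)" "b' \<in> obj (pcod M)" "el g" "el m" "tgt g = sor m"
      "lab g = whom (pcod M) b' b" "lab m = pcmp M b a"
    show "mcmp r (b', a) \<rhd> lact W M b' b a \<rhd> (g >< m) = lact W (tens_prof W M ?A) b' b a \<rhd> (g >< (mcmp r (b, a) \<rhd> m))"
      by (simp add: rap tens_lact[OF t])
  next
    fix a a' b m f
    assume [simp]: "a \<in> obj (pdom M)" "a' \<in> obj (pdom M)" "b \<in> obj (pcod M)" "el m" "el f" "tgt m = sor f"
      "lab f = whom (pdom M) a a'" "lab m = pcmp M b a"
    show "mcmp r (b, a') \<rhd> ract W M b a a' \<rhd> (m >< f) = ract W (tens_prof W M ?A) b a a' \<rhd> ((mcmp r (b, a) \<rhd> m) >< f)"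
      by (subst rr) (simp_all add: rap tens_ract[OF t] id_prof_act)
  qed (simp_all, simp add: r_def)
  note [simp] = pmapD(1-4,7-9)[OF prof_run_in[of M]]
  show ?thesis
  proof (rule that[OF r])
    show "pmap_comp W (prof_run W M) r = pmap_id W M"
    proof (rule pmap_eqI[OF pmap_comp_in[OF r prof_run_in] pmap_id_in])
      fix a b assume [simp]: "a \<in> obj (pdom M)" "b \<in> obj (pcod M)"
      show "mcmp (pmap_comp W (prof_run W M) r) (b, a) = mcmp (pmap_id W M) (b, a)"
      proof (rule ext1)
        fix x assume [simp]: "el x" "lab x = pcmp M b a"
        show "mcmp (pmap_comp W (prof_run W M) r) (b, a) \<rhd> x = mcmp (pmap_id W M) (b, a) \<rhd> x"
          by (simp add: ap_comp rap prof_run_ap)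
      qed simp_all
    qed simp_all
    show "pmap_comp W r (prof_run W M) = pmap_id W (tens_prof W M ?A)"
      by (rule tens_pmap_eqI[OF t pmap_comp_in[OF prof_run_in r] pmap_id_in])
        (simp_all add: ap_comp prof_run_ap rr)
  qed (rule rap)
qed

text \<open>The mirror image of the right-hand case, with \<open>m \<mapsto> 1 \<otimes> m\<close>
  and balance applied in the other direction.\<close>

lemma prof_lun_inverse:
  assumes [simp]: "pf M" "small_set \<kappa> (obj (pcod M))"
  obtains r where "r \<in> pmaps W M (tens_prof W (id_prof W (pcod M)) M)"
    "pmap_comp W (prof_lun W M) r = pmap_id W M"
    "pmap_comp W r (prof_lun W M) = pmap_id W (tens_prof W (id_prof W (pcod M)) M)"
    "\<And>a b x. \<lbrakk>a \<in> obj (pdom M); b \<in> obj (pcod M); el x; lab x = pcmp M b a\<rbrakk> \<Longrightarrow>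
      mcmp r (b, a) \<rhd> x = tens_in W (id_prof W (pcod M)) M b a b \<rhd> ((wid (pcod M) b \<rhd> one (sor x)) >< x)"
proof -
  let ?B = "id_prof W (pcod M)"
  have t: "tp ?B M" by (simp add: tp_id_left)
  note [simp] = tens_cell[OF t] tens_prof_pf[OF t]
  define r where "r = \<lparr>mdom = M, mcod = tens_prof W ?B M,
    mcmp = (\<lambda>(b, a) \<in> obj (pcod M) \<times> obj (pdom M).
      tens_in W ?B M b a b \<cdot> (wid (pcod M) b \<odot> id2 W (pcmp M b a)) \<cdot> inv2 W (lun W (pcmp M b a)))\<rparr>"
  have rs [simp]: "mdom r = M" "mcod r = tens_prof W ?B M" by (simp_all add: r_def)
  have rc: "mcmp r (b, a) = tens_in W ?B M b a b \<cdot> (wid (pcod M) b \<odot> id2 W (pcmp M b a)) \<cdot> inv2 W (lun W (pcmp M b a))"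
    if "a \<in> obj (pdom M)" "b \<in> obj (pcod M)" for a b using that by (simp add: r_def)
  have rap: "mcmp r (b, a) \<rhd> x = tens_in W ?B M b a b \<rhd> ((wid (pcod M) b \<rhd> one (sor x)) >< x)"
    if [simp]: "a \<in> obj (pdom M)" "b \<in> obj (pcod M)" "el x" "lab x = pcmp M b a" for a b x
  by (simp add: rc ap_comp ap_tens ap_lun_inv)
  have rt [simp]: "mcmp r (b, a) \<in> two_cells W" "dom2 W (mcmp r (b, a)) = pcmp M b a"
    "cod2 W (mcmp r (b, a)) = tens_cmp W ?B M b a"
    if "a \<in> obj (pdom M)" "b \<in> obj (pcod M)" for a b
    using that by (simp_all add: rc)
  have rl: "mcmp r (b', a) \<rhd> (lact W M b' b a \<rhd> (g >< m)) = tens_in W ?B M b' a b \<rhd> (g >< m)"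
    if [simp]: "a \<in> obj (pdom M)" "b \<in> obj (pcod M)" "b' \<in> obj (pcod M)" "el g" "el m" "tgt g = sor m"
    "lab m = pcmp M b a" "lab g = whom (pcod M) b' b" for a b b' m g
  proof -
    show ?thesis
      by (simp add: rap tens_balanced[OF t, symmetric] id_prof_act)
  qed
  have r: "r \<in> pmaps W M (tens_prof W ?B M)"
  proof (rule pmapI)
    fix a b b' g m
    assume [simp]: "a \<in> obj (pdom M)" "b \<in> obj (pcod M)" "b' \<in> obj (pcod M)" "el g" "el m" "tgt g = sor m"
      "lab g = whom (pcod M) b' b" "lab m = pcmp M b a"
    show "mcmp r (b', a) \<rhd> lact W M b' b a \<rhd> (g >< m) = lact W (tens_prof W ?B M) b' b a \<rhd> (g >< (mcmp r (b, a) \<rhd> m))"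
      by (subst rl) (simp_all add: rap tens_lact[OF t] id_prof_act)
  next
    fix a a' b m f
    assume [simp]: "a \<in> obj (pdom M)" "a' \<in> obj (pdom M)" "b \<in> obj (pcod M)" "el m" "el f" "tgt m = sor f"
      "lab f = whom (pdom M) a a'" "lab m = pcmp M b a"
    show "mcmp r (b, a') \<rhd> ract W M b a a' \<rhd> (m >< f) = ract W (tens_prof W ?B M) b a a' \<rhd> ((mcmp r (b, a) \<rhd> m) >< f)"
      by (simp add: rap tens_ract[OF t])
  qed (simp_all, simp add: r_def)
  note [simp] = pmapD(1-4,7-9)[OF prof_lun_in[of M]]
  show ?thesis
  proof (rule that[OF r])
    show "pmap_comp W (prof_lun W M) r = pmap_id W M"
    proof (rule pmap_eqI[OF pmap_comp_in[OF r prof_lun_in] pmap_id_in])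
      fix a b assume [simp]: "a \<in> obj (pdom M)" "b \<in> obj (pcod M)"
      show "mcmp (pmap_comp W (prof_lun W M) r) (b, a) = mcmp (pmap_id W M) (b, a)"
      proof (rule ext1)
        fix x assume [simp]: "el x" "lab x = pcmp M b a"
        show "mcmp (pmap_comp W (prof_lun W M) r) (b, a) \<rhd> x = mcmp (pmap_id W M) (b, a) \<rhd> x"
          by (simp add: ap_comp rap prof_lun_ap)
      qed simp_all
    qed simp_all
    show "pmap_comp W r (prof_lun W M) = pmap_id W (tens_prof W ?B M)"
      by (rule tens_pmap_eqI[OF t pmap_comp_in[OF prof_lun_in r] pmap_id_in])
        (simp_all add: ap_comp prof_lun_ap rl)
  qed (rule rap)
qed

section \<open>Associativity of the tensor product\<close>

lemma tp_tens_left: "tp N M \<Longrightarrow> tp P N \<Longrightarrow> tp (tens_prof W P N) M"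
  using tens_prof_pf[of P N] by (simp add: tp_def)

lemma tp_tens_right: "tp N M \<Longrightarrow> tp P N \<Longrightarrow> tp P (tens_prof W N M)"
  using tens_prof_pf[of N M] by (simp add: tp_def)

text \<open>The map \<open>p \<otimes> (n \<otimes> m) \<mapsto> (p \<otimes> n) \<otimes> m\<close>, before it is known to be inverse to the associativity constraint.\<close>

lemma prof_assoc_back:
  assumes NM: "tp N M" and PN: "tp P N"
  obtains r where "r \<in> pmaps W (tens_prof W P (tens_prof W N M)) (tens_prof W (tens_prof W P N) M)"
    "\<And>a b c d x y z. \<lbrakk>a \<in> obj (pdom M); b \<in> obj (pcod M); c \<in> obj (pcod N); d \<in> obj (pcod P);
      el x; el y; el z; tgt x = sor y; tgt y = sor z;
      lab x = pcmp P d c; lab y = pcmp N c b; lab z = pcmp M b a\<rbrakk> \<Longrightarrow>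
      mcmp r (d, a) \<rhd> tens_in W P (tens_prof W N M) d a c \<rhd> (x >< (tens_in W N M c a b \<rhd> (y >< z))) =
      tens_in W (tens_prof W P N) M d a b \<rhd> ((tens_in W P N d b c \<rhd> (x >< y)) >< z)"
proof -
  have t1: "tp (tens_prof W P N) M" and t2: "tp P (tens_prof W N M)"
    using tp_tens_left[OF NM PN] tp_tens_right[OF NM PN] by auto
  note [simp] = tpD[OF NM] tpD[OF PN] tens_cell[OF NM] tens_cell[OF PN] tens_cell[OF t1] tens_cell[OF t2]
    tens_prof_pf[OF NM] tens_prof_pf[OF PN] tens_prof_pf[OF t1] tens_prof_pf[OF t2]
  let ?PN = "tens_prof W P N" and ?NM = "tens_prof W N M"
  \<comment> \<open>With the factor \<open>P(d,c)\<close> fixed, \<open>N \<otimes> M\<close> stays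
    presented by its summands, so a 2-cell on \<open>P(d,c) \<otimes> (N \<otimes> M)(c,a)\<close>
    may be prescribed on elements \<open>x >< (y >< z)\<close>.\<close>
  let ?S = "\<lambda>d c a w. w \<in> two_cells W \<and> dom2 W w = pcmp P d c \<otimes> tens_cmp W N M c a \<and>
    cod2 W w = tens_cmp W ?PN M d a \<and> (\<forall>b x y z. b \<in> obj (pcod M) \<longrightarrow>
      el x \<longrightarrow> el y \<longrightarrow> el z \<longrightarrow> tgt x = sor y \<longrightarrow> tgt y = sor z \<longrightarrow>
      lab x = pcmp P d c \<longrightarrow> lab y = pcmp N c b \<longrightarrow> lab z = pcmp M b a \<longrightarrow>
      w \<rhd> (x >< (tens_in W N M c a b \<rhd> (y >< z))) =
      tens_in W ?PN M d a b \<rhd> ((tens_in W P N d b c \<rhd> (x >< y)) >< z))"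
  have ex: "\<exists>w. ?S d c a w" if o [simp]: "a \<in> obj (pdom M)" "c \<in> obj (pcod N)" "d \<in> obj (pcod P)" for a c d
  proof -
    let ?f = "\<lambda>b. tens_in W ?PN M d a b \<cdot> (tens_in W P N d b c \<odot> id2 W (pcmp M b a)) \<cdot>
      inv2 W (assoc W (pcmp P d c) (pcmp N c b) (pcmp M b a))"
    have f: "?f b \<rhd> (x >< (y >< z)) = tens_in W ?PN M d a b \<rhd> ((tens_in W P N d b c \<rhd> (x >< y)) >< z)"
      if [simp]: "b \<in> obj (pcod M)" "el x" "el y" "el z" "tgt x = sor y" "tgt y = sor z"
        "lab x = pcmp P d c" "lab y = pcmp N c b" "lab z = pcmp M b a" for b x y z
      by (simp add: ap_comp ap_tens ap_assoc_inv)
    have "\<exists>w. w \<in> two_cells W \<and> dom2 W w = pcmp P d c \<otimes> tens_cmp W N M c a \<and> cod2 W w = tens_cmp W ?PN M d a \<and>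
      (\<forall>b x y. b \<in> obj (pcod M) \<longrightarrow> el x \<longrightarrow> el y \<longrightarrow> tgt x = sor y \<longrightarrow>
      lab x = pcmp P d c \<longrightarrow> lab y = pcmp N c b \<otimes> pcmp M b a \<longrightarrow>
      w \<rhd> (x >< (tens_in W N M c a b \<rhd> y)) = ?f b \<rhd> (x >< y))"
    proof (rule tens_ex_left[OF NM o(1,2), of "pcmp P d c" "tens_cmp W ?PN M d a" ?f])
      fix b b' x n g m
      assume [simp]: "b \<in> obj (pcod M)" "b' \<in> obj (pcod M)" "el x" "el n" "el g" "el m" "tgt x = sor n" "tgt n = sor g"
        "tgt g = sor m" "lab x = pcmp P d c" "lab n = pcmp N c b" "lab g = whom (pcod M) b b'" "lab m = pcmp M b' a"
      show "?f b' \<rhd> (x >< (ract W N c b b' \<rhd> (n >< g)) >< m) = ?f b \<rhd> (x >< n >< (lact W M b b' a \<rhd> (g >< m)))"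
        by (simp add: f tens_balanced[OF t1, symmetric] tens_ract[OF PN])
    qed (simp_all, blast)
    then obtain w where w: "w \<in> two_cells W" "dom2 W w = pcmp P d c \<otimes> tens_cmp W N M c a" "cod2 W w = tens_cmp W ?PN M d a"
      "\<And>b x y. \<lbrakk>b \<in> obj (pcod M); el x; el y; tgt x = sor y;
      lab x = pcmp P d c; lab y = pcmp N c b \<otimes> pcmp M b a\<rbrakk> \<Longrightarrow>
      w \<rhd> (x >< (tens_in W N M c a b \<rhd> y)) = ?f b \<rhd> (x >< y)"
      by blast
    show ?thesis
      by (rule exI[of _ w]) (simp add: w(1-3), simp add: w(4) f)
  qed
  define s where "s d c a = (SOME w. ?S d c a w)" for d c a
  have s: "?S d c a (s d c a)" if "a \<in> obj (pdom M)" "c \<in> obj (pcod N)" "d \<in> obj (pcod P)" for a c d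
    unfolding s_def by (rule someI_ex[OF ex[OF that]])
  have st [simp]: "s d c a \<in> two_cells W" "dom2 W (s d c a) = pcmp P d c \<otimes> tens_cmp W N M c a"
    "cod2 W (s d c a) = tens_cmp W ?PN M d a"
    if "a \<in> obj (pdom M)" "c \<in> obj (pcod N)" "d \<in> obj (pcod P)" for a c d
    using s[OF that] by blast+
  have sap: "s d c a \<rhd> (x >< (tens_in W N M c a b \<rhd> (y >< z))) =
      tens_in W ?PN M d a b \<rhd> ((tens_in W P N d b c \<rhd> (x >< y)) >< z)"
    if "a \<in> obj (pdom M)" "c \<in> obj (pcod N)" "d \<in> obj (pcod P)"
      "b \<in> obj (pcod M)" "el x" "el y" "el z" "tgt x = sor y" "tgt y = sor z"
        "lab x = pcmp P d c" "lab y = pcmp N c b" "lab z = pcmp M b a" for a b c d x y z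
    using s[OF that(1-3)] that(4-) by blast
  \<comment> \<open>Each law becomes an equation between 2-cells in which
    \<open>N \<otimes> M\<close> occurs in one position with 1-cells around it, and is then decided
    on pairings.\<close>
  have b: "bimap P ?NM (tens_prof W ?PN M) s"
  proof (rule bimapI)
    fix a c c' d p g t
    assume "a \<in> obj (pdom ?NM)" "c \<in> obj (pcod ?NM)" "c' \<in> obj (pcod ?NM)" "d \<in> obj (pcod P)"
      and [simp]: "el p" "el g" "el t" "tgt p = sor g" "tgt g = sor t"
      and "lab p = pcmp P d c" "lab g = whom (pcod ?NM) c c'" "lab t = pcmp ?NM c' a"
    then have o [simp]: "a \<in> obj (pdom M)" "c \<in> obj (pcod N)" "c' \<in> obj (pcod N)" "d \<in> obj (pcod P)"
      and [simp]: "lab p = pcmp P d c" "lab g = whom (pcod N) c c'" "lab t = tens_cmp W N M c' a"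
      by simp_all
    let ?l = "s d c' a \<cdot> (ract W P d c c' \<odot> id2 W (tens_cmp W N M c' a))"
    let ?r = "s d c a \<cdot> (id2 W (pcmp P d c) \<odot> lact W ?NM c c' a) \<cdot> assoc W (pcmp P d c) (whom (pcod N) c c') (tens_cmp W N M c' a)"
    have "?l = ?r"
      by (rule tens_ext_left2[OF NM o(1,3), where h' = "pcmp P d c" and h = "whom (pcod N) c c'"])
        (simp_all add: ap_comp ap_tens ap_assoc sap tens_lact[OF NM] tens_balanced[OF PN])
    from arg_cong[OF this, of "\<lambda>w. w \<rhd> ((p >< g) >< t)"] show "s d c' a \<rhd> ((ract W P d c c' \<rhd> (p >< g)) >< t) = s d c a \<rhd> (p >< (lact W ?NM c c' a \<rhd> (g >< t)))"
      by (simp add: ap_comp ap_tens ap_assoc)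
  next
    fix a c d d' x p t
    assume "a \<in> obj (pdom ?NM)" "c \<in> obj (pcod ?NM)" "d \<in> obj (pcod P)" "d' \<in> obj (pcod P)"
      and [simp]: "el x" "el p" "el t" "tgt x = sor p" "tgt p = sor t"
      and "lab x = whom (pcod P) d' d" "lab p = pcmp P d c" "lab t = pcmp ?NM c a"
    then have o [simp]: "a \<in> obj (pdom M)" "c \<in> obj (pcod N)" "d \<in> obj (pcod P)" "d' \<in> obj (pcod P)"
      and [simp]: "lab x = whom (pcod P) d' d" "lab p = pcmp P d c" "lab t = tens_cmp W N M c a"
      by simp_all
    let ?l = "s d' c a \<cdot> (lact W P d' d c \<odot> id2 W (tens_cmp W N M c a))"
    let ?r = "lact W (tens_prof W ?PN M) d' d a \<cdot> (id2 W (whom (pcod P) d' d) \<odot> s d c a) \<cdot>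
      assoc W (whom (pcod P) d' d) (pcmp P d c) (tens_cmp W N M c a)"
    have "?l = ?r"
      by (rule tens_ext_left2[OF NM o(1,2), where h' = "whom (pcod P) d' d" and h = "pcmp P d c"])
        (simp_all add: ap_comp ap_tens ap_assoc sap tens_lact[OF t1] tens_lact[OF PN])
    from arg_cong[OF this, of "\<lambda>w. w \<rhd> ((x >< p) >< t)"] show "s d' c a \<rhd> ((lact W P d' d c \<rhd> (x >< p)) >< t) =
      lact W (tens_prof W ?PN M) d' d a \<rhd> (x >< (s d c a \<rhd> (p >< t)))"
      by (simp add: ap_comp ap_tens ap_assoc)
  next
    fix a a' c d p t y
    assume "a \<in> obj (pdom ?NM)" "a' \<in> obj (pdom ?NM)" "c \<in> obj (pcod ?NM)" "d \<in> obj (pcod P)"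
      and [simp]: "el p" "el t" "el y" "tgt p = sor t" "tgt t = sor y"
      and "lab p = pcmp P d c" "lab t = pcmp ?NM c a" "lab y = whom (pdom ?NM) a a'"
    then have o [simp]: "a \<in> obj (pdom M)" "a' \<in> obj (pdom M)" "c \<in> obj (pcod N)" "d \<in> obj (pcod P)"
      and [simp]: "lab p = pcmp P d c" "lab t = tens_cmp W N M c a" "lab y = whom (pdom M) a a'"
      by simp_all
    let ?l = "s d c a' \<cdot> (id2 W (pcmp P d c) \<odot> ract W ?NM c a a') \<cdot> assoc W (pcmp P d c) (tens_cmp W N M c a) (whom (pdom M) a a')"
    let ?r = "ract W (tens_prof W ?PN M) d a a' \<cdot> (s d c a \<odot> id2 W (whom (pdom M) a a'))"
    have "?l = ?r"
      by (rule tens_ext_both[OF NM o(1,3), where h = "pcmp P d c" and k = "whom (pdom M) a a'"])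
        (simp_all add: ap_comp ap_tens ap_assoc sap tens_ract[OF t1] tens_ract[OF NM])
    from arg_cong[OF this, of "\<lambda>w. w \<rhd> ((p >< t) >< y)"] show "s d c a' \<rhd> (p >< (ract W ?NM c a a' \<rhd> (t >< y))) =
      ract W (tens_prof W ?PN M) d a a' \<rhd> ((s d c a \<rhd> (p >< t)) >< y)"
      by (simp add: ap_comp ap_tens ap_assoc)
  qed simp_all
  show ?thesis
  proof (rule that[of "tens_out P ?NM (tens_prof W ?PN M) s"])
    show "tens_out P ?NM (tens_prof W ?PN M) s \<in> pmaps W (tens_prof W P ?NM) (tens_prof W ?PN M)"
      by (rule tens_out_in[OF t2 _ _ _ b]) simp_all
    fix a b c d x y z
    assume [simp]: "a \<in> obj (pdom M)" "b \<in> obj (pcod M)" "c \<in> obj (pcod N)" "d \<in> obj (pcod P)"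
      "el x" "el y" "el z" "tgt x = sor y" "tgt y = sor z"
      "lab x = pcmp P d c" "lab y = pcmp N c b" "lab z = pcmp M b a"
    show "mcmp (tens_out P ?NM (tens_prof W ?PN M) s) (d, a) \<rhd> tens_in W P ?NM d a c \<rhd> (x >< (tens_in W N M c a b \<rhd> (y >< z))) =
      tens_in W ?PN M d a b \<rhd> ((tens_in W P N d b c \<rhd> (x >< y)) >< z)"
      by (subst tens_out_ap[OF t2 _ _ _ b]) (simp_all add: sap)
  qed
qed

end

section \<open>The bicategory of profunctors\<close>

context cobicat
begin

text \<open>Only single components are built here. Their compatibility with the actions is inherited
  later from the map in the opposite direction, which is already a profunctor map.\<close>

lemma prof_assoc_cell:
  assumes NM: "tp N M" and PN: "tp P N" and o [simp]: "a \<in> obj (pdom M)" "d \<in> obj (pcod P)"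
  obtains w where "w \<in> two_cells W" "dom2 W w = tens_cmp W (tens_prof W P N) M d a"
    "cod2 W w = tens_cmp W P (tens_prof W N M) d a"
    "\<And>b c x y z. \<lbrakk>b \<in> obj (pcod M); c \<in> obj (pcod N);
      el x; el y; el z; tgt x = sor y; tgt y = sor z;
      lab x = pcmp P d c; lab y = pcmp N c b; lab z = pcmp M b a\<rbrakk> \<Longrightarrow>
      w \<rhd> tens_in W (tens_prof W P N) M d a b \<rhd> ((tens_in W P N d b c \<rhd> (x >< y)) >< z) =
      tens_in W P (tens_prof W N M) d a c \<rhd> (x >< (tens_in W N M c a b \<rhd> (y >< z)))"
proof -
  have t1: "tp (tens_prof W P N) M" and t2: "tp P (tens_prof W N M)"
    using tp_tens_left[OF NM PN] tp_tens_right[OF NM PN] by auto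
  note [simp] = tpD[OF NM] tpD[OF PN] tens_cell[OF NM] tens_cell[OF PN] tens_cell[OF t1] tens_cell[OF t2]
    tens_prof_pf[OF NM] tens_prof_pf[OF PN] tens_prof_pf[OF t1] tens_prof_pf[OF t2]
  let ?PN = "tens_prof W P N" and ?NM = "tens_prof W N M"
  let ?S = "\<lambda>b w. w \<in> two_cells W \<and> dom2 W w = tens_cmp W P N d b \<otimes> pcmp M b a \<and>
    cod2 W w = tens_cmp W P ?NM d a \<and> (\<forall>c x y z. c \<in> obj (pcod N) \<longrightarrow>
      el x \<longrightarrow> el y \<longrightarrow> el z \<longrightarrow> tgt x = sor y \<longrightarrow> tgt y = sor z \<longrightarrow>
      lab x = pcmp P d c \<longrightarrow> lab y = pcmp N c b \<longrightarrow> lab z = pcmp M b a \<longrightarrow>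
      w \<rhd> ((tens_in W P N d b c \<rhd> (x >< y)) >< z) =
      tens_in W P ?NM d a c \<rhd> (x >< (tens_in W N M c a b \<rhd> (y >< z))))"
  have ex: "\<exists>w. ?S b w" if b [simp]: "b \<in> obj (pcod M)" for b
  proof -
    have b': "b \<in> obj (pdom N)" by simp
    let ?f = "\<lambda>c. tens_in W P ?NM d a c \<cdot> (id2 W (pcmp P d c) \<odot> tens_in W N M c a b) \<cdot>
      assoc W (pcmp P d c) (pcmp N c b) (pcmp M b a)"
    have f: "?f c \<rhd> ((x >< y) >< z) = tens_in W P ?NM d a c \<rhd> (x >< (tens_in W N M c a b \<rhd> (y >< z)))"
      if [simp]: "c \<in> obj (pcod N)" "el x" "el y" "el z" "tgt x = sor y" "tgt y = sor z"
        "lab x = pcmp P d c" "lab y = pcmp N c b" "lab z = pcmp M b a" for c x y z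
      by (simp add: ap_comp ap_tens ap_assoc)
    have "\<exists>w. w \<in> two_cells W \<and> dom2 W w = tens_cmp W P N d b \<otimes> pcmp M b a \<and> cod2 W w = tens_cmp W P ?NM d a \<and>
      (\<forall>c x y. c \<in> obj (pcod N) \<longrightarrow> el x \<longrightarrow> el y \<longrightarrow> tgt x = sor y \<longrightarrow>
      lab x = pcmp P d c \<otimes> pcmp N c b \<longrightarrow> lab y = pcmp M b a \<longrightarrow>
      w \<rhd> ((tens_in W P N d b c \<rhd> x) >< y) = ?f c \<rhd> (x >< y))"
    proof (rule tens_ex_right[OF PN b' o(2), of "pcmp M b a" "tens_cmp W P ?NM d a" ?f])
      fix c c' n g m y
      assume [simp]: "c \<in> obj (pcod N)" "c' \<in> obj (pcod N)" "el n" "el g" "el m" "el y" "tgt n = sor g"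
        "tgt g = sor m" "tgt m = sor y" "lab n = pcmp P d c" "lab g = whom (pcod N) c c'" "lab m = pcmp N c' b"
        "lab y = pcmp M b a"
      show "?f c' \<rhd> (((ract W P d c c' \<rhd> (n >< g)) >< m) >< y) = ?f c \<rhd> ((n >< (lact W N c c' b \<rhd> (g >< m))) >< y)"
        by (simp add: f tens_balanced[OF t2] tens_lact[OF NM])
    qed (simp_all, blast)
    then obtain w where w: "w \<in> two_cells W" "dom2 W w = tens_cmp W P N d b \<otimes> pcmp M b a" "cod2 W w = tens_cmp W P ?NM d a"
      "\<And>c x y. \<lbrakk>c \<in> obj (pcod N); el x; el y; tgt x = sor y;
      lab x = pcmp P d c \<otimes> pcmp N c b; lab y = pcmp M b a\<rbrakk> \<Longrightarrow>
      w \<rhd> ((tens_in W P N d b c \<rhd> x) >< y) = ?f c \<rhd> (x >< y)"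
      by blast
    show ?thesis
      by (rule exI[of _ w]) (simp add: w(1-3), simp add: w(4) f)
  qed
  define s where "s b = (SOME w. ?S b w)" for b
  have s: "?S b (s b)" if "b \<in> obj (pcod M)" for b
    unfolding s_def by (rule someI_ex[OF ex[OF that]])
  have st [simp]: "s b \<in> two_cells W" "dom2 W (s b) = tens_cmp W P N d b \<otimes> pcmp M b a"
    "cod2 W (s b) = tens_cmp W P ?NM d a" if "b \<in> obj (pcod M)" for b
    using s[OF that] by blast+
  have sap: "s b \<rhd> ((tens_in W P N d b c \<rhd> (x >< y)) >< z) =
      tens_in W P ?NM d a c \<rhd> (x >< (tens_in W N M c a b \<rhd> (y >< z)))"
    if "b \<in> obj (pcod M)" "c \<in> obj (pcod N)" "el x" "el y" "el z" "tgt x = sor y" "tgt y = sor z"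
        "lab x = pcmp P d c" "lab y = pcmp N c b" "lab z = pcmp M b a" for b c x y z
    using s[OF that(1)] that(2-) by blast
  show ?thesis
  proof (rule tens_ex[OF t1, of a d "tens_cmp W P ?NM d a" s])
    fix b b' n g m
    assume b [simp]: "b \<in> obj (pcod M)" "b' \<in> obj (pcod M)" and [simp]: "el n" "el g" "el m" "tgt n = sor g" "tgt g = sor m"
      and "lab n = pcmp ?PN d b" "lab g = whom (pcod M) b b'" "lab m = pcmp M b' a"
    then have lab [simp]: "lab n = tens_cmp W P N d b" "lab g = whom (pcod M) b b'" "lab m = pcmp M b' a" by simp_all
    let ?l = "s b' \<cdot> (ract W ?PN d b b' \<odot> id2 W (pcmp M b' a)) \<cdot>
      inv2 W (assoc W (tens_cmp W P N d b) (whom (pcod M) b b') (pcmp M b' a))"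
    let ?r = "s b \<cdot> (id2 W (tens_cmp W P N d b) \<odot> lact W M b b' a)"
    have b': "b \<in> obj (pdom N)" by simp
    have "?l = ?r"
      by (rule tens_ext_right2[OF PN b' o(2), where k = "whom (pcod M) b b'" and k' = "pcmp M b' a"])
        (simp_all add: ap_comp ap_tens ap_assoc_inv sap tens_ract[OF PN] tens_balanced[OF NM])
    from arg_cong[OF this, of "\<lambda>w. w \<rhd> (n >< g >< m)"] show "s b' \<rhd> ((ract W ?PN d b b' \<rhd> (n >< g)) >< m) = s b \<rhd> (n >< (lact W M b b' a \<rhd> (g >< m)))"
      by (simp add: ap_comp ap_tens ap_assoc_inv)
  next
    fix w assume w: "w \<in> two_cells W" "dom2 W w = tens_cmp W ?PN M d a" "cod2 W w = tens_cmp W P ?NM d a"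
      "\<And>b x. \<lbrakk>b \<in> obj (pcod M); el x; lab x = pcmp ?PN d b \<otimes> pcmp M b a\<rbrakk> \<Longrightarrow>
        w \<rhd> tens_in W ?PN M d a b \<rhd> x = s b \<rhd> x"
    show ?thesis
    proof (rule that[OF w(1-3)])
      fix b c x y z
      assume [simp]: "b \<in> obj (pcod M)" "c \<in> obj (pcod N)" "el x" "el y" "el z" "tgt x = sor y" "tgt y = sor z"
        "lab x = pcmp P d c" "lab y = pcmp N c b" "lab z = pcmp M b a"
      show "w \<rhd> tens_in W ?PN M d a b \<rhd> ((tens_in W P N d b c \<rhd> (x >< y)) >< z) =
        tens_in W P ?NM d a c \<rhd> (x >< (tens_in W N M c a b \<rhd> (y >< z)))"
        by (subst w(4)) (simp_all add: sap)
    qed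
  qed simp_all
qed

lemma prof_assoc:
  assumes NM: "tp N M" and PN: "tp P N"
  obtains r where "prof_assoc W P N M \<in> pmaps W (tens_prof W (tens_prof W P N) M) (tens_prof W P (tens_prof W N M))"
    "\<And>a b c d x y z. \<lbrakk>a \<in> obj (pdom M); b \<in> obj (pcod M); c \<in> obj (pcod N); d \<in> obj (pcod P);
      el x; el y; el z; tgt x = sor y; tgt y = sor z;
      lab x = pcmp P d c; lab y = pcmp N c b; lab z = pcmp M b a\<rbrakk> \<Longrightarrow>
      mcmp (prof_assoc W P N M) (d, a) \<rhd> tens_in W (tens_prof W P N) M d a b \<rhd> ((tens_in W P N d b c \<rhd> (x >< y)) >< z) =
      tens_in W P (tens_prof W N M) d a c \<rhd> (x >< (tens_in W N M c a b \<rhd> (y >< z)))"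
    "r \<in> pmaps W (tens_prof W P (tens_prof W N M)) (tens_prof W (tens_prof W P N) M)"
    "pmap_comp W r (prof_assoc W P N M) = pmap_id W (tens_prof W (tens_prof W P N) M)"
    "pmap_comp W (prof_assoc W P N M) r = pmap_id W (tens_prof W P (tens_prof W N M))"
    "\<And>a b c d x y z. \<lbrakk>a \<in> obj (pdom M); b \<in> obj (pcod M); c \<in> obj (pcod N); d \<in> obj (pcod P);
      el x; el y; el z; tgt x = sor y; tgt y = sor z;
      lab x = pcmp P d c; lab y = pcmp N c b; lab z = pcmp M b a\<rbrakk> \<Longrightarrow>
      mcmp r (d, a) \<rhd> tens_in W P (tens_prof W N M) d a c \<rhd> (x >< (tens_in W N M c a b \<rhd> (y >< z))) =
      tens_in W (tens_prof W P N) M d a b \<rhd> ((tens_in W P N d b c \<rhd> (x >< y)) >< z)"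
proof -
  have t1: "tp (tens_prof W P N) M" and t2: "tp P (tens_prof W N M)"
    using tp_tens_left[OF NM PN] tp_tens_right[OF NM PN] by auto
  note [simp] = tpD[OF NM] tpD[OF PN] tens_cell[OF NM] tens_cell[OF PN] tens_cell[OF t1] tens_cell[OF t2]
    tens_prof_pf[OF NM] tens_prof_pf[OF PN] tens_prof_pf[OF t1] tens_prof_pf[OF t2]
  let ?PN = "tens_prof W P N" and ?NM = "tens_prof W N M"
  let ?L = "tens_prof W ?PN M" and ?R = "tens_prof W P ?NM" and ?\<alpha> = "prof_assoc W P N M"
  obtain r where r: "r \<in> pmaps W ?R ?L" and rap:
    "\<And>a b c d x y z. \<lbrakk>a \<in> obj (pdom M); b \<in> obj (pcod M); c \<in> obj (pcod N); d \<in> obj (pcod P);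
      el x; el y; el z; tgt x = sor y; tgt y = sor z;
      lab x = pcmp P d c; lab y = pcmp N c b; lab z = pcmp M b a\<rbrakk> \<Longrightarrow>
      mcmp r (d, a) \<rhd> tens_in W P ?NM d a c \<rhd> (x >< (tens_in W N M c a b \<rhd> (y >< z))) =
      tens_in W ?PN M d a b \<rhd> ((tens_in W P N d b c \<rhd> (x >< y)) >< z)"
    by (rule prof_assoc_back[OF NM PN]) blast
  note [simp] = pmapD(7-9)[OF r]
  \<comment> \<open>The outer tensor product is removed by \<open>tens_ext\<close>; the inner one is
    then tested with the remaining factor as context.\<close>
  have ext: "u = v"
    if o [simp]: "a \<in> obj (pdom M)" "d \<in> obj (pcod P)"
      and uv [simp]: "u \<in> two_cells W" "v \<in> two_cells W" "dom2 W u = tens_cmp W ?PN M d a" "dom2 W v = tens_cmp W ?PN M d a"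
        "cod2 W v = cod2 W u"
      and eq: "\<And>b c x y z. \<lbrakk>b \<in> obj (pcod M); c \<in> obj (pcod N);
      el x; el y; el z; tgt x = sor y; tgt y = sor z;
      lab x = pcmp P d c; lab y = pcmp N c b; lab z = pcmp M b a\<rbrakk> \<Longrightarrow>
      u \<rhd> tens_in W ?PN M d a b \<rhd> ((tens_in W P N d b c \<rhd> (x >< y)) >< z) =
      v \<rhd> tens_in W ?PN M d a b \<rhd> ((tens_in W P N d b c \<rhd> (x >< y)) >< z)" for u v a d
  proof (rule tens_ext[OF t1, of a d])
    fix b n m assume [simp]: "b \<in> obj (pcod M)" "el n" "el m" "tgt n = sor m"
      and "lab n = pcmp ?PN d b" "lab m = pcmp M b a"
    then have [simp]: "lab n = tens_cmp W P N d b" "lab m = pcmp M b a" by simp_all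
    have b': "b \<in> obj (pdom N)" by simp
    have "u \<cdot> tens_in W ?PN M d a b = v \<cdot> tens_in W ?PN M d a b"
      by (rule tens_ext_right[OF PN b' o(2), where k = "pcmp M b a"]) (simp_all add: ap_comp eq)
    then have "(u \<cdot> tens_in W ?PN M d a b) \<rhd> (n >< m) = (v \<cdot> tens_in W ?PN M d a b) \<rhd> (n >< m)" by simp
    then show "u \<rhd> tens_in W ?PN M d a b \<rhd> (n >< m) = v \<rhd> tens_in W ?PN M d a b \<rhd> (n >< m)"
      by (simp add: ap_comp)
  qed simp_all
  have ext': "u = v"
    if o [simp]: "a \<in> obj (pdom M)" "d \<in> obj (pcod P)"
      and uv [simp]: "u \<in> two_cells W" "v \<in> two_cells W" "dom2 W u = tens_cmp W P ?NM d a" "dom2 W v = tens_cmp W P ?NM d a"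
        "cod2 W v = cod2 W u"
      and eq: "\<And>b c x y z. \<lbrakk>b \<in> obj (pcod M); c \<in> obj (pcod N);
      el x; el y; el z; tgt x = sor y; tgt y = sor z;
      lab x = pcmp P d c; lab y = pcmp N c b; lab z = pcmp M b a\<rbrakk> \<Longrightarrow>
      u \<rhd> tens_in W P ?NM d a c \<rhd> (x >< (tens_in W N M c a b \<rhd> (y >< z))) =
      v \<rhd> tens_in W P ?NM d a c \<rhd> (x >< (tens_in W N M c a b \<rhd> (y >< z)))" for u v a d
  proof (rule tens_ext[OF t2, of a d])
    fix c n m assume "c \<in> obj (pcod ?NM)" and [simp]: "el n" "el m" "tgt n = sor m"
      and "lab n = pcmp P d c" "lab m = pcmp ?NM c a"
    then have c [simp]: "c \<in> obj (pcod N)" "lab n = pcmp P d c" "lab m = tens_cmp W N M c a" by simp_all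
    have "u \<cdot> tens_in W P ?NM d a c = v \<cdot> tens_in W P ?NM d a c"
      by (rule tens_ext_left[OF NM o(1) c(1), where h = "pcmp P d c"]) (simp_all add: ap_comp eq)
    then have "(u \<cdot> tens_in W P ?NM d a c) \<rhd> (n >< m) = (v \<cdot> tens_in W P ?NM d a c) \<rhd> (n >< m)" by simp
    then show "u \<rhd> tens_in W P ?NM d a c \<rhd> (n >< m) = v \<rhd> tens_in W P ?NM d a c \<rhd> (n >< m)"
      by (simp add: ap_comp)
  qed simp_all
  have main: "mcmp ?\<alpha> (d, a) \<in> two_cells W \<and> dom2 W (mcmp ?\<alpha> (d, a)) = tens_cmp W ?PN M d a \<and>
      cod2 W (mcmp ?\<alpha> (d, a)) = tens_cmp W P ?NM d a \<and>
      (\<forall>b c x y z. b \<in> obj (pcod M) \<longrightarrow> c \<in> obj (pcod N) \<longrightarrow>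
      el x \<longrightarrow> el y \<longrightarrow> el z \<longrightarrow> tgt x = sor y \<longrightarrow> tgt y = sor z \<longrightarrow>
      lab x = pcmp P d c \<longrightarrow> lab y = pcmp N c b \<longrightarrow> lab z = pcmp M b a \<longrightarrow>
      mcmp ?\<alpha> (d, a) \<rhd> tens_in W ?PN M d a b \<rhd> ((tens_in W P N d b c \<rhd> (x >< y)) >< z) =
      tens_in W P ?NM d a c \<rhd> (x >< (tens_in W N M c a b \<rhd> (y >< z))))"
    if o [simp]: "a \<in> obj (pdom M)" "d \<in> obj (pcod P)" for a d
  proof -
    obtain w where [simp]: "w \<in> two_cells W" "dom2 W w = tens_cmp W ?PN M d a" "cod2 W w = tens_cmp W P ?NM d a"
      and wap: "\<And>b c x y z. \<lbrakk>b \<in> obj (pcod M); c \<in> obj (pcod N);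
      el x; el y; el z; tgt x = sor y; tgt y = sor z;
      lab x = pcmp P d c; lab y = pcmp N c b; lab z = pcmp M b a\<rbrakk> \<Longrightarrow>
      w \<rhd> tens_in W ?PN M d a b \<rhd> ((tens_in W P N d b c \<rhd> (x >< y)) >< z) =
      tens_in W P ?NM d a c \<rhd> (x >< (tens_in W N M c a b \<rhd> (y >< z)))"
      by (rule prof_assoc_cell[OF NM PN o]) blast
    have "mcmp ?\<alpha> (d, a) = (THE u. u \<in> cells W (tens_cmp W ?PN M d a) (tens_cmp W P ?NM d a) \<and>
        (\<forall>b \<in> obj (pcod M). \<forall>c \<in> obj (pcod N).
           u \<cdot> tens_in W ?PN M d a b \<cdot> (tens_in W P N d b c \<odot> id2 W (pcmp M b a)) =
           tens_in W P ?NM d a c \<cdot> (id2 W (pcmp P d c) \<odot> tens_in W N M c a b) \<cdot>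
             assoc W (pcmp P d c) (pcmp N c b) (pcmp M b a)))"
      by (simp add: prof_assoc_def)
    also have "\<dots> = w"
    proof (rule the_equality, intro conjI ballI)
      show "w \<in> cells W (tens_cmp W ?PN M d a) (tens_cmp W P ?NM d a)" by (simp add: cells_def)
      fix b c assume [simp]: "b \<in> obj (pcod M)" "c \<in> obj (pcod N)"
      show "w \<cdot> tens_in W ?PN M d a b \<cdot> (tens_in W P N d b c \<odot> id2 W (pcmp M b a)) =
           tens_in W P ?NM d a c \<cdot> (id2 W (pcmp P d c) \<odot> tens_in W N M c a b) \<cdot>
             assoc W (pcmp P d c) (pcmp N c b) (pcmp M b a)"
        by (rule ext3'[of _ _ "pcmp P d c" "pcmp N c b" "pcmp M b a"])
          (simp_all add: ap_comp ap_tens ap_assoc wap)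
    next
      fix u assume u: "u \<in> cells W (tens_cmp W ?PN M d a) (tens_cmp W P ?NM d a) \<and>
        (\<forall>b \<in> obj (pcod M). \<forall>c \<in> obj (pcod N).
           u \<cdot> tens_in W ?PN M d a b \<cdot> (tens_in W P N d b c \<odot> id2 W (pcmp M b a)) =
           tens_in W P ?NM d a c \<cdot> (id2 W (pcmp P d c) \<odot> tens_in W N M c a b) \<cdot>
             assoc W (pcmp P d c) (pcmp N c b) (pcmp M b a))"
      have [simp]: "u \<in> two_cells W" "dom2 W u = tens_cmp W ?PN M d a" "cod2 W u = tens_cmp W P ?NM d a"
        using u by (simp_all add: cells_def)
      show "u = w"
      proof (rule ext[OF o])
        fix b c x y z
        assume [simp]: "b \<in> obj (pcod M)" "c \<in> obj (pcod N)" "el x" "el y" "el z" "tgt x = sor y" "tgt y = sor z"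
          "lab x = pcmp P d c" "lab y = pcmp N c b" "lab z = pcmp M b a"
        have "(u \<cdot> tens_in W ?PN M d a b \<cdot> (tens_in W P N d b c \<odot> id2 W (pcmp M b a))) \<rhd> ((x >< y) >< z) =
           (tens_in W P ?NM d a c \<cdot> (id2 W (pcmp P d c) \<odot> tens_in W N M c a b) \<cdot>
             assoc W (pcmp P d c) (pcmp N c b) (pcmp M b a)) \<rhd> ((x >< y) >< z)"
          using u by simp
        then show "u \<rhd> tens_in W ?PN M d a b \<rhd> ((tens_in W P N d b c \<rhd> (x >< y)) >< z) =
          w \<rhd> tens_in W ?PN M d a b \<rhd> ((tens_in W P N d b c \<rhd> (x >< y)) >< z)"
          by (simp add: ap_comp ap_tens ap_assoc wap)
      qed simp_all
    qed
    finally show ?thesis using wap by simp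
  qed
  have at [simp]: "mcmp ?\<alpha> (d, a) \<in> two_cells W" "dom2 W (mcmp ?\<alpha> (d, a)) = tens_cmp W ?PN M d a"
      "cod2 W (mcmp ?\<alpha> (d, a)) = tens_cmp W P ?NM d a"
    if "a \<in> obj (pdom M)" "d \<in> obj (pcod P)" for a d
    using main[OF that] by blast+
  have aap: "mcmp ?\<alpha> (d, a) \<rhd> tens_in W ?PN M d a b \<rhd> ((tens_in W P N d b c \<rhd> (x >< y)) >< z) =
      tens_in W P ?NM d a c \<rhd> (x >< (tens_in W N M c a b \<rhd> (y >< z)))"
    if "a \<in> obj (pdom M)" "b \<in> obj (pcod M)" "c \<in> obj (pcod N)" "d \<in> obj (pcod P)"
      "el x" "el y" "el z" "tgt x = sor y" "tgt y = sor z"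
      "lab x = pcmp P d c" "lab y = pcmp N c b" "lab z = pcmp M b a" for a b c d x y z
    using main[OF that(1,4)] that by blast
  have ra: "mcmp r (d, a) \<cdot> mcmp ?\<alpha> (d, a) = id2 W (tens_cmp W ?PN M d a)"
    if o [simp]: "a \<in> obj (pdom M)" "d \<in> obj (pcod P)" for a d
    by (rule ext[OF o]) (simp_all add: ap_comp aap rap)
  have ar: "mcmp ?\<alpha> (d, a) \<cdot> mcmp r (d, a) = id2 W (tens_cmp W P ?NM d a)"
    if o [simp]: "a \<in> obj (pdom M)" "d \<in> obj (pcod P)" for a d
    by (rule ext'[OF o]) (simp_all add: ap_comp aap rap)
  have ra': "mcmp r (d, a) \<rhd> mcmp ?\<alpha> (d, a) \<rhd> x = x"
    if [simp]: "a \<in> obj (pdom M)" "d \<in> obj (pcod P)" "el x" "lab x = tens_cmp W ?PN M d a" for a d x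
    by (subst ap_comp[symmetric]) (simp_all add: ra)
  have ar': "mcmp ?\<alpha> (d, a) \<rhd> mcmp r (d, a) \<rhd> x = x"
    if [simp]: "a \<in> obj (pdom M)" "d \<in> obj (pcod P)" "el x" "lab x = tens_cmp W P ?NM d a" for a d x
    by (subst ap_comp[symmetric]) (simp_all add: ar)
  have as [simp]: "mdom ?\<alpha> = ?L" "mcod ?\<alpha> = ?R" by (simp_all add: prof_assoc_def)
  \<comment> \<open>The components are inverse to those of the profunctor map \<open>r\<close>, so
    the action laws of \<open>r\<close> can be transported along the inverse pair.\<close>
  have \<alpha>: "?\<alpha> \<in> pmaps W ?L ?R"
  proof (rule pmapI)
    fix a d d' g m
    assume "a \<in> obj (pdom ?L)" "d \<in> obj (pcod ?L)" "d' \<in> obj (pcod ?L)" and [simp]: "el g" "el m" "tgt g = sor m"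
      and "lab g = whom (pcod ?L) d' d" "lab m = pcmp ?L d a"
    then have [simp]: "a \<in> obj (pdom M)" "d \<in> obj (pcod P)" "d' \<in> obj (pcod P)" "lab g = whom (pcod P) d' d"
      "lab m = tens_cmp W ?PN M d a" by simp_all
    have "lact W ?L d' d a \<rhd> (g >< m) = mcmp r (d', a) \<rhd> lact W ?R d' d a \<rhd> (g >< (mcmp ?\<alpha> (d, a) \<rhd> m))"
      by (subst pmap_lact[OF r]) (simp_all add: ra')
    then show "mcmp ?\<alpha> (d', a) \<rhd> lact W ?L d' d a \<rhd> (g >< m) = lact W ?R d' d a \<rhd> (g >< (mcmp ?\<alpha> (d, a) \<rhd> m))"
      by (simp add: ar')
  next
    fix a a' d m f
    assume "a \<in> obj (pdom ?L)" "a' \<in> obj (pdom ?L)" "d \<in> obj (pcod ?L)" and [simp]: "el m" "el f" "tgt m = sor f"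
      and "lab f = whom (pdom ?L) a a'" "lab m = pcmp ?L d a"
    then have [simp]: "a \<in> obj (pdom M)" "a' \<in> obj (pdom M)" "d \<in> obj (pcod P)" "lab f = whom (pdom M) a a'"
      "lab m = tens_cmp W ?PN M d a" by simp_all
    have "ract W ?L d a a' \<rhd> (m >< f) = mcmp r (d, a') \<rhd> ract W ?R d a a' \<rhd> ((mcmp ?\<alpha> (d, a) \<rhd> m) >< f)"
      by (subst pmap_ract[OF r]) (simp_all add: ra')
    then show "mcmp ?\<alpha> (d, a') \<rhd> ract W ?L d a a' \<rhd> (m >< f) = ract W ?R d a a' \<rhd> ((mcmp ?\<alpha> (d, a) \<rhd> m) >< f)"
      by (simp add: ar')
  qed (simp_all, simp add: prof_assoc_def)
  have rs [simp]: "mdom r = ?R" "mcod r = ?L" using pmapD[OF r] by simp_all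
  have 1: "pmap_comp W r ?\<alpha> = pmap_id W ?L"
    by (rule pmap_eqI[OF pmap_comp_in[OF \<alpha> r] pmap_id_in]) (simp_all add: ra)
  have 2: "pmap_comp W ?\<alpha> r = pmap_id W ?R"
    by (rule pmap_eqI[OF pmap_comp_in[OF r \<alpha>] pmap_id_in]) (simp_all add: ar)
  show ?thesis by (rule that[OF \<alpha> aap r 1 2 rap])
qed

section \<open>Inverse 2-cells in the bicategory of profunctors\<close>

lemma Mod_sel [simp]:
  "src (Mod W \<kappa>) = pdom" "trg (Mod W \<kappa>) = pcod" "dom2 (Mod W \<kappa>) = mdom" "cod2 (Mod W \<kappa>) = mcod"
  "id2 (Mod W \<kappa>) = pmap_id W" "vcomp (Mod W \<kappa>) = pmap_comp W" "unit1 (Mod W \<kappa>) = id_prof W"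
  "tens1 (Mod W \<kappa>) = tens_prof W" "tens2 (Mod W \<kappa>) = tens_map W"
  "assoc (Mod W \<kappa>) = prof_assoc W" "lun (Mod W \<kappa>) = prof_lun W" "run (Mod W \<kappa>) = prof_run W"
  by (simp_all add: Mod_def)

lemma Mod_two_cells: "t \<in> two_cells (Mod W \<kappa>) \<longleftrightarrow>
    t \<in> pmaps W (mdom t) (mcod t) \<and> small_wcategory W \<kappa> (pdom (mdom t)) \<and> small_wcategory W \<kappa> (pcod (mdom t))"
proof
  assume "t \<in> two_cells (Mod W \<kappa>)"
  then obtain A B M N where t: "small_wcategory W \<kappa> A" "small_wcategory W \<kappa> B" "profunctor W A B M" "t \<in> pmaps W M N"
    unfolding Mod_def by auto
  have "pdom M = A" "pcod M = B" using t(3) by (simp_all add: profunctor_def)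
  with t pmapD(3,4)[OF t(4)]
  show "t \<in> pmaps W (mdom t) (mcod t) \<and> small_wcategory W \<kappa> (pdom (mdom t)) \<and> small_wcategory W \<kappa> (pcod (mdom t))"
    by simp
next
  assume *: "t \<in> pmaps W (mdom t) (mcod t) \<and> small_wcategory W \<kappa> (pdom (mdom t)) \<and> small_wcategory W \<kappa> (pcod (mdom t))"
  then have t: "t \<in> pmaps W (mdom t) (mcod t)" by simp
  have "profunctor W (pdom (mdom t)) (pcod (mdom t)) (mdom t)" "profunctor W (pdom (mdom t)) (pcod (mdom t)) (mcod t)"
    using pmapD(1,2,5,6)[OF t] unfolding pf_def by simp_all
  with * show "t \<in> two_cells (Mod W \<kappa>)" unfolding Mod_def by auto
qed

text \<open>\<open>inv2\<close> is a definite description, so uniqueness of inverses is required. It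
  is checked on components, which compose in \<open>W\<close>.\<close>

lemma Mod_inv2:
  assumes t: "t \<in> pmaps W M N" and s: "s \<in> pmaps W N M"
    and small: "small_wcategory W \<kappa> (pdom M)" "small_wcategory W \<kappa> (pcod M)"
    and st: "pmap_comp W s t = pmap_id W M" and ts: "pmap_comp W t s = pmap_id W N"
  shows "inv2 (Mod W \<kappa>) t = s"
proof -
  note [simp] = pmapD[OF t] pmapD(3,4,7-9)[OF s]
  have inv: "inverse_cells (Mod W \<kappa>) t u \<longleftrightarrow> u \<in> pmaps W N M \<and> pmap_comp W u t = pmap_id W M \<and> pmap_comp W t u = pmap_id W N" for u
    using t small by (auto simp: inverse_cells_def cells_def Mod_two_cells pmapD(3,4))
  show ?thesis
    unfolding inv2_def
  proof (rule the_equality)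
    show "inverse_cells (Mod W \<kappa>) t s" unfolding inv using s st ts by simp
    fix u assume "inverse_cells (Mod W \<kappa>) t u"
    then have u: "u \<in> pmaps W N M" and ut: "pmap_comp W u t = pmap_id W M" unfolding inv by simp_all
    note [simp] = pmapD(3,4,7-9)[OF u]
    show "u = s"
    proof (rule pmap_eqI[OF u s])
      fix a b assume "a \<in> obj (pdom N)" "b \<in> obj (pcod N)"
      then have [simp]: "a \<in> obj (pdom M)" "b \<in> obj (pcod M)" using pmapD(5,6)[OF t] by simp_all
      have 1: "mcmp t (b, a) \<cdot> mcmp s (b, a) = id2 W (pcmp N b a)"
        using arg_cong[OF ts, of "\<lambda>p. mcmp p (b, a)"] by simp
      have 2: "mcmp u (b, a) \<cdot> mcmp t (b, a) = id2 W (pcmp M b a)"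
        using arg_cong[OF ut, of "\<lambda>p. mcmp p (b, a)"] by simp
      have "mcmp u (b, a) = mcmp u (b, a) \<cdot> mcmp t (b, a) \<cdot> mcmp s (b, a)" unfolding 1 by simp
      also have "\<dots> = (mcmp u (b, a) \<cdot> mcmp t (b, a)) \<cdot> mcmp s (b, a)" by (simp add: vc_assoc)
      also have "\<dots> = mcmp s (b, a)" unfolding 2 by simp
      finally show "mcmp u (b, a) = mcmp s (b, a)" .
    qed
  qed
qed

end

section \<open>The adjunction between the weights, on elements\<close>

locale adjunction = cobicat W \<kappa> for W :: "('o, 'f, 'c) bicat"  (structure) and \<kappa> :: "'k rel" +
  fixes A B :: "('x, 'o, 'f, 'c) wcat" and \<phi> \<psi> :: "('x, 'x, 'o, 'f, 'c) prof"
    and \<eta> \<epsilon> :: "('x, 'x, 'o, 'f, 'c) pmap"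
  assumes smA: "small_wcategory W \<kappa> A" and smB: "small_wcategory W \<kappa> B"
    and \<phi>: "profunctor W A B \<phi>" and \<psi>: "profunctor W B A \<psi>"
    and adj: "adjunction_in (Mod W \<kappa>) \<phi> \<psi> \<eta> \<epsilon>"
begin

abbreviation "T \<equiv> tens_prof W \<psi> \<phi>"
abbreviation "S \<equiv> tens_prof W \<phi> \<psi>"

lemma AB [simp]: "wcategory W A" "wcategory W B" "small_set \<kappa> (obj A)" "small_set \<kappa> (obj B)"
  using smA smB by (simp_all add: small_wcategory_def)

lemma \<phi>\<psi> [simp]: "pf \<phi>" "pf \<psi>" "pdom \<phi> = A" "pcod \<phi> = B" "pdom \<psi> = B" "pcod \<psi> = A"
  using \<phi> \<psi> unfolding pf_def by (simp_all add: profunctor_def)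

lemma tp\<psi>\<phi>: "tp \<psi> \<phi>" and tp\<phi>\<psi>: "tp \<phi> \<psi>"
  by (simp_all add: tp_def)

lemma T [simp]: "pf T" "pf S"
  using tens_prof_pf[OF tp\<psi>\<phi>] tens_prof_pf[OF tp\<phi>\<psi>] by auto

lemma unit_in: "\<eta> \<in> pmaps W (id_prof W A) T" and counit_in: "\<epsilon> \<in> pmaps W S (id_prof W B)"
proof -
  have "\<eta> \<in> cells (Mod W \<kappa>) (id_prof W A) T" "\<epsilon> \<in> cells (Mod W \<kappa>) S (id_prof W B)"
    using adj by (simp_all add: adjunction_in_def)
  then show "\<eta> \<in> pmaps W (id_prof W A) T" "\<epsilon> \<in> pmaps W S (id_prof W B)"
    by (auto simp: cells_def Mod_two_cells)
qed

lemma unit_counit [simp]: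
  "mdom \<eta> = id_prof W A" "mcod \<eta> = T" "mdom \<epsilon> = S" "mcod \<epsilon> = id_prof W B"
  "a \<in> obj A \<Longrightarrow> a' \<in> obj A \<Longrightarrow> mcmp \<eta> (a', a) \<in> two_cells W"
  "a \<in> obj A \<Longrightarrow> a' \<in> obj A \<Longrightarrow> dom2 W (mcmp \<eta> (a', a)) = whom A a' a"
  "a \<in> obj A \<Longrightarrow> a' \<in> obj A \<Longrightarrow> cod2 W (mcmp \<eta> (a', a)) = tens_cmp W \<psi> \<phi> a' a"
  "b \<in> obj B \<Longrightarrow> b' \<in> obj B \<Longrightarrow> mcmp \<epsilon> (b', b) \<in> two_cells W"
  "b \<in> obj B \<Longrightarrow> b' \<in> obj B \<Longrightarrow> dom2 W (mcmp \<epsilon> (b', b)) = tens_cmp W \<phi> \<psi> b' b"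
  "b \<in> obj B \<Longrightarrow> b' \<in> obj B \<Longrightarrow> cod2 W (mcmp \<epsilon> (b', b)) = whom B b' b"
  using pmapD[OF unit_in] pmapD[OF counit_in] by simp_all

text \<open>
  The counit induces maps \<open>\<tau> : \<phi> \<otimes> (\<psi> \<otimes> \<phi>) \<rightarrow> \<phi>\<close> and \<open>\<sigma> : (\<psi> \<otimes> \<phi>) \<otimes> \<psi> \<rightarrow> \<psi>\<close>; the triangle
  identities are \<open>\<tau>_one\<close> and \<open>\<sigma>_one\<close>.
\<close>

definition ev :: "'x \<Rightarrow> 'x \<Rightarrow> 'x \<Rightarrow> 'c" where
  "ev b i b' = mcmp \<epsilon> (b, b') \<cdot> tens_in W \<phi> \<psi> b b' i"

definition \<tau> :: "'x \<Rightarrow> 'x \<Rightarrow> 'x \<Rightarrow> 'c" where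
  "\<tau> b i' i = mcmp (pmap_comp W (prof_lun W \<phi>) (pmap_comp W (tens_map W \<epsilon> (pmap_id W \<phi>))
    (inv2 (Mod W \<kappa>) (prof_assoc W \<phi> \<psi> \<phi>)))) (b, i) \<cdot> tens_in W \<phi> T b i i'"

definition \<sigma> :: "'x \<Rightarrow> 'x \<Rightarrow> 'x \<Rightarrow> 'c" where
  "\<sigma> i i' b = mcmp (pmap_comp W (prof_run W \<psi>) (pmap_comp W (tens_map W (pmap_id W \<psi>) \<epsilon>)
    (prof_assoc W \<psi> \<phi> \<psi>))) (i, b) \<cdot> tens_in W T \<psi> i b i'"

text \<open>With explicit inverses for the constraints, the triangle identity is a composite whose
  effect on elements is known:
  \<open>x \<mapsto> x \<otimes> 1 \<mapsto> x \<otimes> \<eta>(1)\<close>, followed by the map that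
  defines \<tau>. It has to return \<open>x\<close>.\<close>

lemma
  shows \<tau>_bimap: "bimap \<phi> T \<phi> \<tau>"
    and \<tau>_tens: "\<lbrakk>i \<in> obj A; i' \<in> obj A; b \<in> obj B; b' \<in> obj B;
      el x; el p; el q; tgt x = sor p; tgt p = sor q;
      lab x = pcmp \<phi> b i'; lab p = pcmp \<psi> i' b'; lab q = pcmp \<phi> b' i\<rbrakk> \<Longrightarrow>
      \<tau> b i' i \<rhd> (x >< (tens_in W \<psi> \<phi> i' i b' \<rhd> (p >< q))) =
      lact W \<phi> b b' i \<rhd> ((ev b i' b' \<rhd> (x >< p)) >< q)"
    and \<tau>_one: "\<lbrakk>i \<in> obj A; b \<in> obj B; el x; lab x = pcmp \<phi> b i; tgt x = k\<rbrakk> \<Longrightarrow>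
      \<tau> b i i \<rhd> (x >< (mcmp \<eta> (i, i) \<rhd> wid A i \<rhd> one k)) = x"
proof -
  let ?A = "id_prof W A" and ?B = "id_prof W B"
  have tA: "tp \<phi> ?A" and tB: "tp ?B \<phi>" and tT: "tp \<phi> T" and tS: "tp S \<phi>"
    using tp_id_right[of \<phi>] tp_id_left[of \<phi>] tp_tens_right[OF tp\<psi>\<phi> tp\<phi>\<psi>] tp_tens_left[OF tp\<psi>\<phi> tp\<phi>\<psi>] by simp_all
  have pfs [simp]: "pf (tens_prof W \<phi> ?A)" "pf (tens_prof W ?B \<phi>)" "pf (tens_prof W \<phi> T)" "pf (tens_prof W S \<phi>)"
    using tens_prof_pf[OF tA] tens_prof_pf[OF tB] tens_prof_pf[OF tT] tens_prof_pf[OF tS] by auto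
  note [simp] = tens_cell[OF tA] tens_cell[OF tB] tens_cell[OF tT] tens_cell[OF tS] tens_cell[OF tp\<psi>\<phi>] tens_cell[OF tp\<phi>\<psi>]
  obtain r where r: "r \<in> pmaps W \<phi> (tens_prof W \<phi> ?A)"
    "pmap_comp W (prof_run W \<phi>) r = pmap_id W \<phi>"
    "pmap_comp W r (prof_run W \<phi>) = pmap_id W (tens_prof W \<phi> ?A)"
    and rap: "\<And>a b x. \<lbrakk>a \<in> obj A; b \<in> obj B; el x; lab x = pcmp \<phi> b a\<rbrakk> \<Longrightarrow>
      mcmp r (b, a) \<rhd> x = tens_in W \<phi> ?A b a a \<rhd> (x >< (wid A a \<rhd> one (tgt x)))"
    by (rule prof_run_inverse[of \<phi>, simplified]) (rule that)
  obtain s where \<alpha>: "prof_assoc W \<phi> \<psi> \<phi> \<in> pmaps W (tens_prof W S \<phi>) (tens_prof W \<phi> T)"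
    and s: "s \<in> pmaps W (tens_prof W \<phi> T) (tens_prof W S \<phi>)"
    "pmap_comp W s (prof_assoc W \<phi> \<psi> \<phi>) = pmap_id W (tens_prof W S \<phi>)"
    "pmap_comp W (prof_assoc W \<phi> \<psi> \<phi>) s = pmap_id W (tens_prof W \<phi> T)"
    and sap: "\<And>a b c d x y z. \<lbrakk>a \<in> obj A; b \<in> obj B; c \<in> obj A; d \<in> obj B;
      el x; el y; el z; tgt x = sor y; tgt y = sor z;
      lab x = pcmp \<phi> d c; lab y = pcmp \<psi> c b; lab z = pcmp \<phi> b a\<rbrakk> \<Longrightarrow>
      mcmp s (d, a) \<rhd> tens_in W \<phi> T d a c \<rhd> (x >< (tens_in W \<psi> \<phi> c a b \<rhd> (y >< z))) =
      tens_in W S \<phi> d a b \<rhd> ((tens_in W \<phi> \<psi> d b c \<rhd> (x >< y)) >< z)"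
    by (rule prof_assoc[OF tp\<psi>\<phi> tp\<phi>\<psi>]) simp
  \<comment> \<open>The abstract inverses in \<open>adjunction_in\<close> are identified with the
    maps whose values on elements have been computed.\<close>
  have i1: "inv2 (Mod W \<kappa>) (prof_run W \<phi>) = r"
    by (rule Mod_inv2[OF _ r(1)]) (use prof_run_in[of \<phi>] r smA smB in simp_all)
  have i2: "inv2 (Mod W \<kappa>) (prof_assoc W \<phi> \<psi> \<phi>) = s"
    by (rule Mod_inv2[OF \<alpha> s(1)]) (use s smA smB in simp_all)
  have eq: "pmap_comp W (prof_lun W \<phi>) (pmap_comp W (tens_map W \<epsilon> (pmap_id W \<phi>)) (pmap_comp W s
      (pmap_comp W (tens_map W (pmap_id W \<phi>) \<eta>) r))) = pmap_id W \<phi>"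
    using adj i1 i2 by (simp add: adjunction_in_def)
  have l: "prof_lun W \<phi> \<in> pmaps W (tens_prof W ?B \<phi>) \<phi>" using prof_lun_in[of \<phi>] by simp
  have e: "tens_map W \<epsilon> (pmap_id W \<phi>) \<in> pmaps W (tens_prof W S \<phi>) (tens_prof W ?B \<phi>)"
    by (rule tens_map_in[OF counit_in pmap_id_in tS]) simp
  have h: "tens_map W (pmap_id W \<phi>) \<eta> \<in> pmaps W (tens_prof W \<phi> ?A) (tens_prof W \<phi> T)"
    by (rule tens_map_in[OF pmap_id_in unit_in tA]) simp
  \<comment> \<open>The composite \<open>\<phi> \<otimes> T \<rightarrow> S \<otimes> \<phi>
    \<rightarrow> B \<otimes> \<phi> \<rightarrow> \<phi>\<close>, whose restrictions to summands
    are \<tau>.\<close>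
  let ?\<Theta> = "pmap_comp W (prof_lun W \<phi>) (pmap_comp W (tens_map W \<epsilon> (pmap_id W \<phi>)) s)"
  have \<Theta>: "?\<Theta> \<in> pmaps W (tens_prof W \<phi> T) \<phi>"
    by (rule pmap_comp_in[OF pmap_comp_in[OF s(1) e] l])
  note [simp] = pmapD(3,4,7-9)[OF l] pmapD(3,4,7-9)[OF e] pmapD(3,4,7-9)[OF h] pmapD(3,4,7-9)[OF s(1)] pmapD(3,4,7-9)[OF r(1)]
  have hap: "mcmp (tens_map W (pmap_id W \<phi>) \<eta>) (b, a) \<rhd> tens_in W \<phi> ?A b a a' \<rhd> (x >< y) =
      tens_in W \<phi> T b a a' \<rhd> (x >< (mcmp \<eta> (a', a) \<rhd> y))"
    if "a \<in> obj A" "a' \<in> obj A" "b \<in> obj B" "el x" "el y" "tgt x = sor y" "lab x = pcmp \<phi> b a'" "lab y = whom A a' a"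
    for a a' b x y
    using tens_map_ap[OF pmap_id_in unit_in tA, of a a' b x y] that by simp
  have eap: "mcmp (tens_map W \<epsilon> (pmap_id W \<phi>)) (b, a) \<rhd> tens_in W S \<phi> b a b' \<rhd> (x >< y) =
      tens_in W ?B \<phi> b a b' \<rhd> ((mcmp \<epsilon> (b, b') \<rhd> x) >< y)"
    if "a \<in> obj A" "b \<in> obj B" "b' \<in> obj B" "el x" "el y" "tgt x = sor y" "lab x = tens_cmp W \<phi> \<psi> b b'" "lab y = pcmp \<phi> b' a"
    for a b b' x y
    using tens_map_ap[OF counit_in pmap_id_in tS, of a b' b x y] that by simp
  have lap: "mcmp (prof_lun W \<phi>) (b, a) \<rhd> tens_in W ?B \<phi> b a b' \<rhd> x = lact W \<phi> b b' a \<rhd> x"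
    if "a \<in> obj A" "b \<in> obj B" "b' \<in> obj B" "el x" "lab x = whom B b b' \<otimes> pcmp \<phi> b' a" for a b b' x
    using prof_lun_ap[of \<phi> a b' b x] that by simp
  have \<tau>: "\<tau> = (\<lambda>b i' i. mcmp ?\<Theta> (b, i) \<cdot> tens_in W \<phi> T b i i')"
    unfolding \<tau>_def[abs_def] i2 ..
  show "bimap \<phi> T \<phi> \<tau>" using bimap_of_pmap[OF tT \<Theta>] unfolding \<tau> .
  show "\<tau> b i' i \<rhd> (x >< (tens_in W \<psi> \<phi> i' i b' \<rhd> (p >< q))) = lact W \<phi> b b' i \<rhd> ((ev b i' b' \<rhd> (x >< p)) >< q)"
    if "i \<in> obj A" "i' \<in> obj A" "b \<in> obj B" "b' \<in> obj B" "el x" "el p" "el q" "tgt x = sor p" "tgt p = sor q"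
      "lab x = pcmp \<phi> b i'" "lab p = pcmp \<psi> i' b'" "lab q = pcmp \<phi> b' i"
    unfolding \<tau> ev_def using that by (simp add: ap_comp sap eap lap)
  show "\<tau> b i i \<rhd> (x >< (mcmp \<eta> (i, i) \<rhd> wid A i \<rhd> one k)) = x"
    if [simp]: "i \<in> obj A" "b \<in> obj B" "el x" "lab x = pcmp \<phi> b i" "tgt x = k"
  proof -
    have [simp]: "trg W k = extent A i" "k \<in> one_cells W" using el_D[of x] by simp_all
    have "mcmp (prof_lun W \<phi>) (b, i) \<cdot> mcmp (tens_map W \<epsilon> (pmap_id W \<phi>)) (b, i) \<cdot> mcmp s (b, i) \<cdot>
      mcmp (tens_map W (pmap_id W \<phi>) \<eta>) (b, i) \<cdot> mcmp r (b, i) = id2 W (pcmp \<phi> b i)"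
      using arg_cong[OF eq, of "\<lambda>t. mcmp t (b, i)"] by simp
    then have "(mcmp (prof_lun W \<phi>) (b, i) \<cdot> mcmp (tens_map W \<epsilon> (pmap_id W \<phi>)) (b, i) \<cdot> mcmp s (b, i) \<cdot>
      mcmp (tens_map W (pmap_id W \<phi>) \<eta>) (b, i) \<cdot> mcmp r (b, i)) \<rhd> x = x" by simp
    then show ?thesis unfolding \<tau> by (simp add: ap_comp rap hap)
  qed
qed

text \<open>The other triangle identity contains the associativity constraint itself instead of its
  inverse, so only the left unit constraint has to be inverted.\<close>

lemma
  shows \<sigma>_bimap: "bimap T \<psi> \<psi> \<sigma>"
    and \<sigma>_tens: "\<lbrakk>i \<in> obj A; i' \<in> obj A; b \<in> obj B; b' \<in> obj B;
      el p; el q; el x; tgt p = sor q; tgt q = sor x;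
      lab p = pcmp \<psi> i b'; lab q = pcmp \<phi> b' i'; lab x = pcmp \<psi> i' b\<rbrakk> \<Longrightarrow>
      \<sigma> i i' b \<rhd> ((tens_in W \<psi> \<phi> i i' b' \<rhd> (p >< q)) >< x) =
      ract W \<psi> i b' b \<rhd> (p >< (ev b' i' b \<rhd> (q >< x)))"
    and \<sigma>_one: "\<lbrakk>i \<in> obj A; b \<in> obj B; el x; lab x = pcmp \<psi> i b; sor x = k\<rbrakk> \<Longrightarrow>
      \<sigma> i i b \<rhd> ((mcmp \<eta> (i, i) \<rhd> wid A i \<rhd> one k) >< x) = x"
proof -
  let ?A = "id_prof W A" and ?B = "id_prof W B"
  have tA: "tp ?A \<psi>" and tB: "tp \<psi> ?B" and tT: "tp T \<psi>" and tS: "tp \<psi> S"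
    using tp_id_left[of \<psi>] tp_id_right[of \<psi>] tp_tens_left[OF tp\<phi>\<psi> tp\<psi>\<phi>] tp_tens_right[OF tp\<phi>\<psi> tp\<psi>\<phi>] by simp_all
  have pfs [simp]: "pf (tens_prof W ?A \<psi>)" "pf (tens_prof W \<psi> ?B)" "pf (tens_prof W T \<psi>)" "pf (tens_prof W \<psi> S)"
    using tens_prof_pf[OF tA] tens_prof_pf[OF tB] tens_prof_pf[OF tT] tens_prof_pf[OF tS] by auto
  note [simp] = tens_cell[OF tA] tens_cell[OF tB] tens_cell[OF tT] tens_cell[OF tS] tens_cell[OF tp\<psi>\<phi>] tens_cell[OF tp\<phi>\<psi>]
  obtain r where r: "r \<in> pmaps W \<psi> (tens_prof W ?A \<psi>)"
    "pmap_comp W (prof_lun W \<psi>) r = pmap_id W \<psi>"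
    "pmap_comp W r (prof_lun W \<psi>) = pmap_id W (tens_prof W ?A \<psi>)"
    and rap: "\<And>b a x. \<lbrakk>b \<in> obj B; a \<in> obj A; el x; lab x = pcmp \<psi> a b\<rbrakk> \<Longrightarrow>
      mcmp r (a, b) \<rhd> x = tens_in W ?A \<psi> a b a \<rhd> ((wid A a \<rhd> one (sor x)) >< x)"
    by (rule prof_lun_inverse[of \<psi>, simplified]) (rule that)
  let ?\<alpha> = "prof_assoc W \<psi> \<phi> \<psi>"
  obtain s where \<alpha>: "?\<alpha> \<in> pmaps W (tens_prof W T \<psi>) (tens_prof W \<psi> S)"
    and \<alpha>ap: "\<And>a b c d x y z. \<lbrakk>a \<in> obj B; b \<in> obj A; c \<in> obj B; d \<in> obj A;
      el x; el y; el z; tgt x = sor y; tgt y = sor z;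
      lab x = pcmp \<psi> d c; lab y = pcmp \<phi> c b; lab z = pcmp \<psi> b a\<rbrakk> \<Longrightarrow>
      mcmp ?\<alpha> (d, a) \<rhd> tens_in W T \<psi> d a b \<rhd> ((tens_in W \<psi> \<phi> d b c \<rhd> (x >< y)) >< z) =
      tens_in W \<psi> S d a c \<rhd> (x >< (tens_in W \<phi> \<psi> c a b \<rhd> (y >< z)))"
    by (rule prof_assoc[OF tp\<phi>\<psi> tp\<psi>\<phi>]) simp
  have i1: "inv2 (Mod W \<kappa>) (prof_lun W \<psi>) = r"
    by (rule Mod_inv2[OF _ r(1)]) (use prof_lun_in[of \<psi>] r smA smB in simp_all)
  have eq: "pmap_comp W (prof_run W \<psi>) (pmap_comp W (tens_map W (pmap_id W \<psi>) \<epsilon>) (pmap_comp W ?\<alpha>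
      (pmap_comp W (tens_map W \<eta> (pmap_id W \<psi>)) r))) = pmap_id W \<psi>"
    using adj i1 by (simp add: adjunction_in_def)
  have l: "prof_run W \<psi> \<in> pmaps W (tens_prof W \<psi> ?B) \<psi>" using prof_run_in[of \<psi>] by simp
  have e: "tens_map W (pmap_id W \<psi>) \<epsilon> \<in> pmaps W (tens_prof W \<psi> S) (tens_prof W \<psi> ?B)"
    by (rule tens_map_in[OF pmap_id_in counit_in tS]) simp
  have h: "tens_map W \<eta> (pmap_id W \<psi>) \<in> pmaps W (tens_prof W ?A \<psi>) (tens_prof W T \<psi>)"
    by (rule tens_map_in[OF unit_in pmap_id_in tA]) simp
  let ?\<Theta> = "pmap_comp W (prof_run W \<psi>) (pmap_comp W (tens_map W (pmap_id W \<psi>) \<epsilon>) ?\<alpha>)"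
  have \<Theta>: "?\<Theta> \<in> pmaps W (tens_prof W T \<psi>) \<psi>"
    by (rule pmap_comp_in[OF pmap_comp_in[OF \<alpha> e] l])
  note [simp] = pmapD(3,4,7-9)[OF l] pmapD(3,4,7-9)[OF e] pmapD(3,4,7-9)[OF h] pmapD(3,4,7-9)[OF \<alpha>] pmapD(3,4,7-9)[OF r(1)]
  have hap: "mcmp (tens_map W \<eta> (pmap_id W \<psi>)) (a, b) \<rhd> tens_in W ?A \<psi> a b a' \<rhd> (x >< y) =
      tens_in W T \<psi> a b a' \<rhd> ((mcmp \<eta> (a, a') \<rhd> x) >< y)"
    if "a \<in> obj A" "a' \<in> obj A" "b \<in> obj B" "el x" "el y" "tgt x = sor y" "lab x = whom A a a'" "lab y = pcmp \<psi> a' b"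
    for a a' b x y
    using tens_map_ap[OF unit_in pmap_id_in tA, of b a' a x y] that by simp
  have eap: "mcmp (tens_map W (pmap_id W \<psi>) \<epsilon>) (a, b) \<rhd> tens_in W \<psi> S a b b' \<rhd> (x >< y) =
      tens_in W \<psi> ?B a b b' \<rhd> (x >< (mcmp \<epsilon> (b', b) \<rhd> y))"
    if "a \<in> obj A" "b \<in> obj B" "b' \<in> obj B" "el x" "el y" "tgt x = sor y" "lab x = pcmp \<psi> a b'" "lab y = tens_cmp W \<phi> \<psi> b' b"
    for a b b' x y
    using tens_map_ap[OF pmap_id_in counit_in tS, of b b' a x y] that by simp
  have lap: "mcmp (prof_run W \<psi>) (a, b) \<rhd> tens_in W \<psi> ?B a b b' \<rhd> x = ract W \<psi> a b' b \<rhd> x"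
    if "a \<in> obj A" "b \<in> obj B" "b' \<in> obj B" "el x" "lab x = pcmp \<psi> a b' \<otimes> whom B b' b" for a b b' x
    using prof_run_ap[of \<psi> b' b a x] that by simp
  have \<sigma>: "\<sigma> = (\<lambda>i i' b. mcmp ?\<Theta> (i, b) \<cdot> tens_in W T \<psi> i b i')"
    unfolding \<sigma>_def[abs_def] ..
  show "bimap T \<psi> \<psi> \<sigma>" using bimap_of_pmap[OF tT \<Theta>] unfolding \<sigma> .
  show "\<sigma> i i' b \<rhd> ((tens_in W \<psi> \<phi> i i' b' \<rhd> (p >< q)) >< x) = ract W \<psi> i b' b \<rhd> (p >< (ev b' i' b \<rhd> (q >< x)))"
    if "i \<in> obj A" "i' \<in> obj A" "b \<in> obj B" "b' \<in> obj B" "el p" "el q" "el x" "tgt p = sor q" "tgt q = sor x"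
      "lab p = pcmp \<psi> i b'" "lab q = pcmp \<phi> b' i'" "lab x = pcmp \<psi> i' b"
    unfolding \<sigma> ev_def using that by (simp add: ap_comp \<alpha>ap eap lap)
  show "\<sigma> i i b \<rhd> ((mcmp \<eta> (i, i) \<rhd> wid A i \<rhd> one k) >< x) = x"
    if [simp]: "i \<in> obj A" "b \<in> obj B" "el x" "lab x = pcmp \<psi> i b" "sor x = k"
  proof -
    have [simp]: "trg W k = extent A i" "k \<in> one_cells W" using el_D[of x] by auto
    have "mcmp (prof_run W \<psi>) (i, b) \<cdot> mcmp (tens_map W (pmap_id W \<psi>) \<epsilon>) (i, b) \<cdot> mcmp ?\<alpha> (i, b) \<cdot>
      mcmp (tens_map W \<eta> (pmap_id W \<psi>)) (i, b) \<cdot> mcmp r (i, b) = id2 W (pcmp \<psi> i b)"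
      using arg_cong[OF eq, of "\<lambda>t. mcmp t (i, b)"] by simp
    then have "(mcmp (prof_run W \<psi>) (i, b) \<cdot> mcmp (tens_map W (pmap_id W \<psi>) \<epsilon>) (i, b) \<cdot> mcmp ?\<alpha> (i, b) \<cdot>
      mcmp (tens_map W \<eta> (pmap_id W \<psi>)) (i, b) \<cdot> mcmp r (i, b)) \<rhd> x = x" by simp
    then show ?thesis unfolding \<sigma> by (simp add: ap_comp rap hap)
  qed
qed

end

section \<open>Free profunctors\<close>

context cobicat
begin

section \<open>Unit constraints on arbitrary elements of unit 1-cells\<close>

lemma run_ap:
  assumes [simp]: "el w" "el y" "tgt w = sor y" "lab w = f" "lab y = unit1 W (src W f)" "t \<in> two_cells W" "dom2 W t = f" "cod2 W t = g"
  shows "run W g \<rhd> ((t \<rhd> w) >< y) = t \<rhd> run W f \<rhd> (w >< y)"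
proof -
  have [simp]: "g \<in> one_cells W" "src W g = src W f" "f \<in> one_cells W" using cod2_in[of t] src_cod2[of t] el_D(1)[of w] by simp_all
  have "(run W g \<cdot> (t \<odot> id2 W (unit1 W (src W f)))) \<rhd> (w >< y) = (t \<cdot> run W f) \<rhd> (w >< y)"
    using run_nat[of t] by simp
  then show ?thesis by (simp add: ap_comp ap_tens)
qed

lemma lun_ap:
  assumes [simp]: "el w" "el y" "tgt y = sor w" "lab w = f" "lab y = unit1 W (trg W f)" "t \<in> two_cells W" "dom2 W t = f" "cod2 W t = g"
  shows "lun W g \<rhd> (y >< (t \<rhd> w)) = t \<rhd> lun W f \<rhd> (y >< w)"
proof -
  have [simp]: "g \<in> one_cells W" "trg W g = trg W f" "f \<in> one_cells W" using cod2_in[of t] trg_cod2[of t] el_D(1)[of w] by simp_all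
  have "(lun W g \<cdot> (id2 W (unit1 W (trg W f)) \<odot> t)) \<rhd> (y >< w) = (t \<cdot> lun W f) \<rhd> (y >< w)"
    using lun_nat[of t] by simp
  then show ?thesis by (simp add: ap_comp ap_tens)
qed

text \<open>\<open>ap_run\<close> covers only \<open>one\<close> in the last place. Equality of the
  two 2-cells is decided there and afterwards evaluated on an arbitrary element \<open>y\<close> of
  the unit 1-cell.\<close>

lemma run_pr:
  assumes [simp]: "el x" "el m" "el y" "tgt x = sor m" "tgt m = sor y" "lab x = f" "lab m = g" "lab y = unit1 W (src W g)"
  shows "run W (f \<otimes> g) \<rhd> ((x >< m) >< y) = x >< (run W g \<rhd> (m >< y))"
proof -
  let ?I = "unit1 W (src W g)"
  have [simp]: "src W f = trg W g" "f \<in> one_cells W" "g \<in> one_cells W"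
    using el_seq[of x m] el_D(1)[of x] el_D(1)[of m] by simp_all
  let ?l = "run W (f \<otimes> g)" and ?r = "(id2 W f \<odot> run W g) \<cdot> assoc W f g ?I"
  have "?l = ?r"
  proof (rule cell_eqI_lab)
    let ?m = "gen g ?I"
    let ?x = "gen f (sor ?m)"
    show "iel ((?x >< ?m) >< one ?I)" by (intro iel_pr iel_gen iel_one) simp_all
    have 1: "run W (f \<otimes> g) \<rhd> ((?x >< ?m) >< one ?I) = ?x >< ?m"
      by (rule ap_run) simp_all
    show "?l \<rhd> ((?x >< ?m) >< one ?I) = ?r \<rhd> ((?x >< ?m) >< one ?I)"
      unfolding 1 by (simp add: ap_comp ap_tens ap_assoc ap_run)
  qed simp_all
  then have "?l \<rhd> ((x >< m) >< y) = ?r \<rhd> ((x >< m) >< y)" by simp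
  then show ?thesis by (simp add: ap_comp ap_tens ap_assoc)
qed

lemma lun_pr:
  assumes [simp]: "el x" "el m" "el y" "tgt y = sor x" "tgt x = sor m" "lab x = f" "lab m = g" "lab y = unit1 W (trg W f)"
  shows "lun W (f \<otimes> g) \<rhd> (y >< (x >< m)) = (lun W f \<rhd> (y >< x)) >< m"
proof -
  have [simp]: "src W f = trg W g" "f \<in> one_cells W" "g \<in> one_cells W"
    using el_seq[of x m] el_D(1)[of x] el_D(1)[of m] by simp_all
  have "(lun W (f \<otimes> g) \<cdot> assoc W (unit1 W (trg W f)) f g) \<rhd> ((y >< x) >< m) = (lun W f \<odot> id2 W g) \<rhd> ((y >< x) >< m)"
    using lun_tens[of g f] by simp
  then show ?thesis by (simp add: ap_comp ap_tens ap_assoc)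
qed

text \<open>The triangle identity for \<open>k\<close> and the unit, in the shape of the
  associativity axiom for the right action of a one-object category.\<close>

lemma run_run:
  assumes [simp]: "el y" "el f" "el f'" "tgt y = sor f" "tgt f = sor f'" "lab y = k" "lab f = unit1 W (src W k)" "lab f' = unit1 W (src W k)"
  shows "run W k \<rhd> ((run W k \<rhd> (y >< f)) >< f') = run W k \<rhd> (y >< (lun W (unit1 W (src W k)) \<rhd> (f >< f')))"
proof -
  let ?I = "unit1 W (src W k)"
  have [simp]: "k \<in> one_cells W" using el_D(1)[of y] by simp
  have "(run W k \<odot> id2 W ?I) \<rhd> ((y >< f) >< f') = ((id2 W k \<odot> lun W ?I) \<cdot> assoc W k ?I ?I) \<rhd> ((y >< f) >< f')"
    using triangle[of ?I k] by simp
  then show ?thesis by (simp add: ap_comp ap_tens ap_assoc)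
qed

lemma lun_lun:
  assumes [simp]: "el y" "el f" "el f'" "tgt f' = sor f" "tgt f = sor y" "lab y = k" "lab f = unit1 W (trg W k)" "lab f' = unit1 W (trg W k)"
  shows "lun W k \<rhd> (f' >< (lun W k \<rhd> (f >< y))) = lun W k \<rhd> ((lun W (unit1 W (trg W k)) \<rhd> (f' >< f)) >< y)"
proof -
  let ?I = "unit1 W (trg W k)"
  have [simp]: "k \<in> one_cells W" using el_D(1)[of y] by simp
  have "(run W ?I \<odot> id2 W k) \<rhd> ((f' >< f) >< y) = ((id2 W ?I \<odot> lun W k) \<cdot> assoc W ?I ?I k) \<rhd> ((f' >< f) >< y)"
    using triangle[of k ?I] by simp
  then show ?thesis by (simp add: ap_comp ap_tens ap_assoc lun_unit_eq_run_unit)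
qed

text \<open>The profunctor \<open>A(-,i) \<otimes> k\<close>, free on the 1-cell \<open>k\<close> at \<open>i\<close>.\<close>

definition free_left :: "('x, 'o, 'f, 'c) wcat \<Rightarrow> 'x \<Rightarrow> 'f \<Rightarrow> (unit, 'x, 'o, 'f, 'c) prof" where
  "free_left A i k = \<lparr>pdom = unit_wcat W (src W k), pcod = A, pcmp = (\<lambda>j _. whom A j i \<otimes> k),
    pact = (\<lambda>j' j _ _. (wmult A j' j i \<odot> run W k) \<cdot> assoc W (whom A j' j \<otimes> whom A j i) k (unit1 W (src W k)) \<cdot>
      (inv2 W (assoc W (whom A j' j) (whom A j i) k) \<odot> id2 W (unit1 W (src W k))))\<rparr>"

lemma free_left:
  assumes [simp]: "wcategory W A" "i \<in> obj A" "k \<in> one_cells W" "trg W k = extent A i"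
  shows "pf (free_left A i k)" "pdom (free_left A i k) = unit_wcat W (src W k)" "pcod (free_left A i k) = A"
    "pcmp (free_left A i k) j u = whom A j i \<otimes> k"
    "\<And>j j' g h y. \<lbrakk>j \<in> obj A; j' \<in> obj A; el g; el h; el y; tgt g = sor h; tgt h = sor y;
      lab g = whom A j' j; lab h = whom A j i; lab y = k\<rbrakk> \<Longrightarrow>
      lact W (free_left A i k) j' j () \<rhd> (g >< (h >< y)) = (wmult A j' j i \<rhd> (g >< h)) >< y"
proof -
  let ?K = "free_left A i k" and ?I = "unit1 W (src W k)"
  show sel [simp]: "pdom ?K = unit_wcat W (src W k)" "pcod ?K = A" "pcmp ?K j u = whom A j i \<otimes> k" for j u
    by (simp_all add: free_left_def)
  have s [simp]: "src W (whom A j i \<otimes> k) = src W k" if "j \<in> obj A" for j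
    using that by simp
  have pt [simp]: "pact ?K j' j u v \<in> two_cells W" "dom2 W (pact ?K j' j u v) = (whom A j' j \<otimes> whom A j i \<otimes> k) \<otimes> ?I"
    "cod2 W (pact ?K j' j u v) = whom A j' i \<otimes> k"
    if "j \<in> obj A" "j' \<in> obj A" for j j' u v
    using that by (simp_all add: free_left_def)
  have pap: "pact ?K j' j u v \<rhd> ((g >< (h >< y)) >< f) = (wmult A j' j i \<rhd> (g >< h)) >< (run W k \<rhd> (y >< f))"
    if [simp]: "j \<in> obj A" "j' \<in> obj A" "el g" "el h" "el y" "el f" "tgt g = sor h" "tgt h = sor y" "tgt y = sor f"
      "lab g = whom A j' j" "lab h = whom A j i" "lab y = k" "lab f = ?I" for j j' u v g h y f
    by (simp add: free_left_def ap_comp ap_tens ap_assoc ap_assoc_inv)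
  \<comment> \<open>The action has a closed form on pairings \<open>h >< y\<close>. They include
    pairings of generic elements, so they are an admissible test family for
    \<open>profI\<close>.\<close>
  let ?R = "\<lambda>_ b. {h >< y | h y. el h \<and> el y \<and> tgt h = sor y \<and> lab h = whom A b i \<and> lab y = k}"
  show pfK: "pf ?K"
  proof (rule profI[where R = ?R])
    fix a :: unit and b l assume "b \<in> obj (pcod ?K)" "l \<in> one_cells W" "trg W l = extent (pdom ?K) a"
    then have [simp]: "b \<in> obj A" "l \<in> one_cells W" "trg W l = src W k" by simp_all
    let ?m = "gen (whom A b i) (sor (gen k l)) >< gen k l"
    have "?m \<in> ?R a b" by (rule CollectI, rule exI, rule exI, intro conjI, rule refl) simp_all
    moreover have "iel ?m" by (intro iel_pr iel_gen) simp_all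
    ultimately show "\<exists>m \<in> ?R a b. iel m \<and> lab m = pcmp ?K b a \<and> tgt m = l"
      by (intro bexI[of _ ?m]) simp_all
  qed ((elim CollectE exE conjE)?, simp add: pap ap_run wmult_assoc run_run)+
  show "lact W ?K j' j () \<rhd> (g >< (h >< y)) = (wmult A j' j i \<rhd> (g >< h)) >< y"
    if [simp]: "j \<in> obj A" "j' \<in> obj A" "el g" "el h" "el y" "tgt g = sor h" "tgt h = sor y"
      "lab g = whom A j' j" "lab h = whom A j i" "lab y = k" for j j' g h y
  using lact_ap[OF pfK, of "()" j j' g "h >< y"] by (simp add: pap ap_run)
qed

text \<open>The mirror image \<open>k \<otimes> A(i,-)\<close>, which plays for limits the role of
  \<open>free_left\<close> for colimits.\<close>

definition free_right :: "('x, 'o, 'f, 'c) wcat \<Rightarrow> 'x \<Rightarrow> 'f \<Rightarrow> ('x, unit, 'o, 'f, 'c) prof" where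
  "free_right A i k = \<lparr>pdom = A, pcod = unit_wcat W (trg W k), pcmp = (\<lambda>_ j. k \<otimes> whom A i j),
    pact = (\<lambda>_ _ j j'. (lun W k \<odot> wmult A i j j') \<cdot> assoc W (unit1 W (trg W k) \<otimes> k) (whom A i j) (whom A j j') \<cdot>
      (inv2 W (assoc W (unit1 W (trg W k)) k (whom A i j)) \<odot> id2 W (whom A j j')))\<rparr>"

lemma free_right:
  assumes [simp]: "wcategory W A" "i \<in> obj A" "k \<in> one_cells W" "src W k = extent A i"
  shows "pf (free_right A i k)" "pcod (free_right A i k) = unit_wcat W (trg W k)" "pdom (free_right A i k) = A"
    "pcmp (free_right A i k) u j = k \<otimes> whom A i j"
    "\<And>j j' g h y. \<lbrakk>j \<in> obj A; j' \<in> obj A; el y; el h; el g; tgt y = sor h; tgt h = sor g;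
      lab g = whom A j j'; lab h = whom A i j; lab y = k\<rbrakk> \<Longrightarrow>
      ract W (free_right A i k) () j j' \<rhd> ((y >< h) >< g) = y >< (wmult A i j j' \<rhd> (h >< g))"
proof -
  let ?K = "free_right A i k" and ?I = "unit1 W (trg W k)"
  show sel [simp]: "pcod ?K = unit_wcat W (trg W k)" "pdom ?K = A" "pcmp ?K u j = k \<otimes> whom A i j" for j u
    by (simp_all add: free_right_def)
  have s [simp]: "trg W (k \<otimes> whom A i j) = trg W k" if "j \<in> obj A" for j
    using that by simp
  have pt [simp]: "pact ?K u v j j' \<in> two_cells W" "dom2 W (pact ?K u v j j') = (?I \<otimes> (k \<otimes> whom A i j)) \<otimes> whom A j j'"
    "cod2 W (pact ?K u v j j') = k \<otimes> whom A i j'"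
    if "j \<in> obj A" "j' \<in> obj A" for j j' u v
    using that by (simp_all add: free_right_def)
  have pap: "pact ?K u v j j' \<rhd> ((f >< (y >< h)) >< g) = (lun W k \<rhd> (f >< y)) >< (wmult A i j j' \<rhd> (h >< g))"
    if [simp]: "j \<in> obj A" "j' \<in> obj A" "el f" "el y" "el h" "el g" "tgt f = sor y" "tgt y = sor h" "tgt h = sor g"
      "lab g = whom A j j'" "lab h = whom A i j" "lab y = k" "lab f = ?I" for j j' u v g h y f
    by (simp add: free_right_def ap_comp ap_tens ap_assoc ap_assoc_inv)
  let ?R = "\<lambda>a _. {y >< h | y h. el y \<and> el h \<and> tgt y = sor h \<and> lab h = whom A i a \<and> lab y = k}"
  show pfK: "pf ?K"
  proof (rule profI[where R = ?R])
    fix a l and b :: unit assume "a \<in> obj (pdom ?K)" "l \<in> one_cells W" "trg W l = extent (pdom ?K) a"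
    then have [simp]: "a \<in> obj A" "l \<in> one_cells W" "trg W l = extent A a" by simp_all
    let ?m = "gen k (sor (gen (whom A i a) l)) >< gen (whom A i a) l"
    have "?m \<in> ?R a b" by (rule CollectI, rule exI, rule exI, intro conjI, rule refl) simp_all
    moreover have "iel ?m" by (intro iel_pr iel_gen) simp_all
    ultimately show "\<exists>m \<in> ?R a b. iel m \<and> lab m = pcmp ?K b a \<and> tgt m = l"
      by (intro bexI[of _ ?m]) simp_all
  qed ((elim CollectE exE conjE)?, simp add: pap ap_lun wmult_assoc lun_lun)+
  show "ract W ?K () j j' \<rhd> ((y >< h) >< g) = y >< (wmult A i j j' \<rhd> (h >< g))"
    if [simp]: "j \<in> obj A" "j' \<in> obj A" "el y" "el h" "el g" "tgt y = sor h" "tgt h = sor g"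
      "lab g = whom A j j'" "lab h = whom A i j" "lab y = k" for j j' g h y
  using ract_ap[OF pfK, of j j' "()" "y >< h" g] by (simp add: pap ap_lun)
qed

end

section \<open>Weighted colimits\<close>

locale cospan = cobicat W \<kappa> for W :: "('o, 'f, 'c) bicat"  (structure) and \<kappa> :: "'k rel" +
  fixes A :: "('x, 'o, 'f, 'c) wcat" and B :: "('y, 'o, 'f, 'c) wcat" and C :: "('z, 'o, 'f, 'c) wcat"
    and F :: "('y, 'z, 'o, 'f, 'c) wfun" and Z :: "('x, 'z, 'o, 'f, 'c) wfun"
  assumes smallA: "small_wcategory W \<kappa> A" and F: "wfunctor W B C F" and Z: "wfunctor W A C Z"
begin

lemma FZ [simp]:
  "wcategory W A" "wcategory W B" "wcategory W C" "small_set \<kappa> (obj A)"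
  "wf F" "wf Z" "fdom F = B" "fdom Z = A" "fcod F = C" "fcod Z = C"
  using F Z smallA unfolding wf_def by (simp_all add: wfunctor_def small_wcategory_def)

lemma F_sel [simp]:
  "b \<in> obj B \<Longrightarrow> fobj F b \<in> obj C" "b \<in> obj B \<Longrightarrow> extent C (fobj F b) = extent B b"
  "b \<in> obj B \<Longrightarrow> b' \<in> obj B \<Longrightarrow> fhom F b' b \<in> two_cells W"
  "b \<in> obj B \<Longrightarrow> b' \<in> obj B \<Longrightarrow> dom2 W (fhom F b' b) = whom B b' b"
  "b \<in> obj B \<Longrightarrow> b' \<in> obj B \<Longrightarrow> cod2 W (fhom F b' b) = whom C (fobj F b') (fobj F b)"
  "\<lbrakk>b \<in> obj B; k \<in> one_cells W; trg W k = extent B b\<rbrakk> \<Longrightarrow>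
    fhom F b b \<rhd> wid B b \<rhd> one k = wid C (fobj F b) \<rhd> one k"
  using wf(3-7)[of F] fhom_wid[of F] by simp_all

lemma Z_sel [simp]:
  "b \<in> obj A \<Longrightarrow> fobj Z b \<in> obj C" "b \<in> obj A \<Longrightarrow> extent C (fobj Z b) = extent A b"
  "b \<in> obj A \<Longrightarrow> b' \<in> obj A \<Longrightarrow> fhom Z b' b \<in> two_cells W"
  "b \<in> obj A \<Longrightarrow> b' \<in> obj A \<Longrightarrow> dom2 W (fhom Z b' b) = whom A b' b"
  "b \<in> obj A \<Longrightarrow> b' \<in> obj A \<Longrightarrow> cod2 W (fhom Z b' b) = whom C (fobj Z b') (fobj Z b)"
  "\<lbrakk>b \<in> obj A; k \<in> one_cells W; trg W k = extent A b\<rbrakk> \<Longrightarrow>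
    fhom Z b b \<rhd> wid A b \<rhd> one k = wid C (fobj Z b) \<rhd> one k"
  using wf(3-7)[of Z] fhom_wid[of Z] by simp_all

lemma F_wmult:
  assumes "a \<in> obj B" "b \<in> obj B" "c \<in> obj B" "el x" "el y" "tgt x = sor y" "lab x = whom B c b" "lab y = whom B b a"
  shows "fhom F c a \<rhd> wmult B c b a \<rhd> (x >< y) =
    wmult C (fobj F c) (fobj F b) (fobj F a) \<rhd> ((fhom F c b \<rhd> x) >< (fhom F b a \<rhd> y))"
  using fhom_wmult[of F a b c x y] assms by simp

lemma Z_wmult:
  assumes "a \<in> obj A" "b \<in> obj A" "c \<in> obj A" "el x" "el y" "tgt x = sor y" "lab x = whom A c b" "lab y = whom A b a"
  shows "fhom Z c a \<rhd> wmult A c b a \<rhd> (x >< y) =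
    wmult C (fobj Z c) (fobj Z b) (fobj Z a) \<rhd> ((fhom Z c b \<rhd> x) >< (fhom Z b a \<rhd> y))"
  using fhom_wmult[of Z a b c x y] assms by simp

end

locale weighted_colimit = cospan W \<kappa> A B C F Z for W :: "('o, 'f, 'c) bicat"  (structure) and \<kappa> :: "'k rel"
    and A :: "('x, 'o, 'f, 'c) wcat" and B :: "('y, 'o, 'f, 'c) wcat" and C :: "('z, 'o, 'f, 'c) wcat"
    and F :: "('y, 'z, 'o, 'f, 'c) wfun" and Z :: "('x, 'z, 'o, 'f, 'c) wfun" +
  fixes \<phi> :: "('x, 'y, 'o, 'f, 'c) prof"
  assumes \<phi>: "profunctor W A B \<phi>"
begin

lemma \<phi>_sel [simp]: "pf \<phi>" "pdom \<phi> = A" "pcod \<phi> = B"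
  using \<phi> unfolding pf_def by (simp_all add: profunctor_def)

text \<open>\<open>\<phi>(b,i) \<otimes> k \<rightarrow> C(F b, c)\<close>, natural in \<open>b\<close>.\<close>

inductive cocone :: "'z \<Rightarrow> 'x \<Rightarrow> 'f \<Rightarrow> ('y \<Rightarrow> 'c) \<Rightarrow> bool" for c i k f where
  coconeI: "cocone c i k f"
if "\<And>b. b \<in> obj B \<Longrightarrow> f b \<in> two_cells W \<and> dom2 W (f b) = pcmp \<phi> b i \<otimes> k \<and> cod2 W (f b) = whom C (fobj F b) c"
  and "\<And>b b' g x y. \<lbrakk>b \<in> obj B; b' \<in> obj B; el g; el x; el y; tgt g = sor x; tgt x = sor y;
      lab g = whom B b' b; lab x = pcmp \<phi> b i; lab y = k\<rbrakk> \<Longrightarrow>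
      f b' \<rhd> ((lact W \<phi> b' b i \<rhd> (g >< x)) >< y) =
      wmult C (fobj F b') (fobj F b) c \<rhd> ((fhom F b' b \<rhd> g) >< (f b \<rhd> (x >< y)))"

lemmas coconeD = cocone.simps[THEN iffD1, THEN conjunct1, rule_format, THEN conjunct1]
  cocone.simps[THEN iffD1, THEN conjunct1, rule_format, THEN conjunct2, THEN conjunct1]
  cocone.simps[THEN iffD1, THEN conjunct1, rule_format, THEN conjunct2, THEN conjunct2]
  cocone.simps[THEN iffD1, THEN conjunct2, rule_format]

text \<open>The universal property of \<open>C(Z,c)\<close>, tested on the free profunctors \<open>A(-,i) \<otimes> k\<close> only.\<close>

definition factors :: "('x, 'y, 'o, 'f, 'c) pmap \<Rightarrow> 'z \<Rightarrow> 'x \<Rightarrow> 'f \<Rightarrow> ('y \<Rightarrow> 'c) \<Rightarrow> 'c \<Rightarrow> bool" where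
  "factors a c i k f s \<longleftrightarrow> s \<in> two_cells W \<and> dom2 W s = k \<and> cod2 W s = whom C (fobj Z i) c \<and>
    (\<forall>b\<in>obj B. f b = wmult C (fobj F b) (fobj Z i) c \<cdot> (mcmp a (b, i) \<odot> s))"

definition pointwise_colimit :: "('x, 'y, 'o, 'f, 'c) pmap \<Rightarrow> bool" where
  "pointwise_colimit a \<longleftrightarrow> (\<forall>c\<in>obj C. \<forall>i\<in>obj A. \<forall>k\<in>one_cells W. \<forall>f.
    src W k = extent C c \<longrightarrow> trg W k = extent A i \<longrightarrow> cocone c i k f \<longrightarrow> (\<exists>!s. factors a c i k f s))"

context
  fixes a assumes a: "a \<in> pmaps W \<phi> (fun_prof W F Z)"
begin

lemma a_sel [simp]:
  "i \<in> obj A \<Longrightarrow> b \<in> obj B \<Longrightarrow> mcmp a (b, i) \<in> two_cells W"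
  "i \<in> obj A \<Longrightarrow> b \<in> obj B \<Longrightarrow> dom2 W (mcmp a (b, i)) = pcmp \<phi> b i"
  "i \<in> obj A \<Longrightarrow> b \<in> obj B \<Longrightarrow> cod2 W (mcmp a (b, i)) = whom C (fobj F b) (fobj Z i)"
  using pmapD(7-9)[OF a] by simp_all

lemma a_lact:
  assumes [simp]: "i \<in> obj A" "b \<in> obj B" "b' \<in> obj B" "el g" "el x" "tgt g = sor x" "lab g = whom B b' b" "lab x = pcmp \<phi> b i"
  shows "mcmp a (b', i) \<rhd> lact W \<phi> b' b i \<rhd> (g >< x) =
    wmult C (fobj F b') (fobj F b) (fobj Z i) \<rhd> ((fhom F b' b \<rhd> g) >< (mcmp a (b, i) \<rhd> x))"
  by (subst pmap_lact[OF a]) (simp_all add: fun_prof_act)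

lemma a_ract:
  assumes [simp]: "i \<in> obj A" "i' \<in> obj A" "b \<in> obj B" "el g" "el x" "tgt x = sor g" "lab g = whom A i i'" "lab x = pcmp \<phi> b i"
  shows "mcmp a (b, i') \<rhd> ract W \<phi> b i i' \<rhd> (x >< g) =
    wmult C (fobj F b) (fobj Z i) (fobj Z i') \<rhd> ((mcmp a (b, i) \<rhd> x) >< (fhom Z i i' \<rhd> g))"
  by (subst pmap_ract[OF a]) (simp_all add: fun_prof_act)

lemma factors_ap:
  assumes "factors a c i k f s" and [simp]: "c \<in> obj C" "i \<in> obj A" "b \<in> obj B" "el x" "el y" "tgt x = sor y" "lab x = pcmp \<phi> b i" "lab y = k"
  shows "f b \<rhd> (x >< y) = wmult C (fobj F b) (fobj Z i) c \<rhd> ((mcmp a (b, i) \<rhd> x) >< (s \<rhd> y))"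
proof -
  have [simp]: "s \<in> two_cells W" "dom2 W s = k" "cod2 W s = whom C (fobj Z i) c"
    and f: "f b = wmult C (fobj F b) (fobj Z i) c \<cdot> (mcmp a (b, i) \<odot> s)"
    using assms(1) unfolding factors_def by simp_all
  have [simp]: "trg W k = extent A i" using el_seq[of x y] by simp
  show ?thesis unfolding f by (simp add: ap_comp ap_tens)
qed

lemma factorsI:
  assumes "cocone c i k f" and [simp]: "c \<in> obj C" "i \<in> obj A" "k \<in> one_cells W" "trg W k = extent A i"
    and [simp]: "s \<in> two_cells W" "dom2 W s = k" "cod2 W s = whom C (fobj Z i) c"
    and eq: "\<And>b x y. \<lbrakk>b \<in> obj B; el x; el y; tgt x = sor y; lab x = pcmp \<phi> b i; lab y = k\<rbrakk> \<Longrightarrow>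
      f b \<rhd> (x >< y) = wmult C (fobj F b) (fobj Z i) c \<rhd> ((mcmp a (b, i) \<rhd> x) >< (s \<rhd> y))"
  shows "factors a c i k f s"
  unfolding factors_def
proof (intro conjI ballI)
  note [simp] = coconeD(1-3)[OF assms(1)]
  fix b assume [simp]: "b \<in> obj B"
  show "f b = wmult C (fobj F b) (fobj Z i) c \<cdot> (mcmp a (b, i) \<odot> s)"
    by (rule ext2[of _ _ "pcmp \<phi> b i" k]) (simp_all add: eq ap_comp ap_tens)
qed simp_all

lemma cocone_of_cell:
  assumes [simp]: "c \<in> obj C" "i \<in> obj A" "k \<in> one_cells W" "trg W k = extent A i"
    and [simp]: "s \<in> two_cells W" "dom2 W s = k" "cod2 W s = whom C (fobj Z i) c"
  shows "cocone c i k (\<lambda>b. wmult C (fobj F b) (fobj Z i) c \<cdot> (mcmp a (b, i) \<odot> s))"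
  by (rule coconeI) (simp_all add: ap_comp ap_tens a_lact wmult_assoc)

text \<open>Composing the components of \<open>a\<close> with any 2-cell gives a cocone, so the
  uniqueness clause of the universal property turns into a cancellation rule.\<close>

lemma pointwise_unique:
  assumes p: "pointwise_colimit a" and [simp]: "c \<in> obj C" "i \<in> obj A" "k \<in> one_cells W" "src W k = extent C c" "trg W k = extent A i"
    and s [simp]: "s \<in> two_cells W" "dom2 W s = k" "cod2 W s = whom C (fobj Z i) c"
    and t [simp]: "t \<in> two_cells W" "dom2 W t = k" "cod2 W t = whom C (fobj Z i) c"
    and eq: "\<And>b. b \<in> obj B \<Longrightarrow> wmult C (fobj F b) (fobj Z i) c \<cdot> (mcmp a (b, i) \<odot> s) =
      wmult C (fobj F b) (fobj Z i) c \<cdot> (mcmp a (b, i) \<odot> t)"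
  shows "s = t"
proof -
  let ?f = "\<lambda>b. wmult C (fobj F b) (fobj Z i) c \<cdot> (mcmp a (b, i) \<odot> s)"
  have "cocone c i k ?f" by (rule cocone_of_cell) simp_all
  then have ex: "\<exists>!s. factors a c i k ?f s" using p unfolding pointwise_colimit_def by simp
  show ?thesis
    by (rule ex1_implies_eq[OF ex]) (use eq in \<open>simp_all add: factors_def\<close>)
qed

lemma pointwise_unique1:
  assumes p: "pointwise_colimit a" and [simp]: "c \<in> obj C" "i \<in> obj A" "k \<in> one_cells W" "src W k = extent C c" "trg W k = extent A i"
    and [simp]: "s \<in> two_cells W" "dom2 W s = k" "cod2 W s = whom C (fobj Z i) c"
    and [simp]: "t \<in> two_cells W" "dom2 W t = k" "cod2 W t = whom C (fobj Z i) c"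
    and eq: "\<And>b x y. \<lbrakk>b \<in> obj B; el x; el y; tgt x = sor y; lab x = pcmp \<phi> b i; lab y = k\<rbrakk> \<Longrightarrow>
      wmult C (fobj F b) (fobj Z i) c \<rhd> ((mcmp a (b, i) \<rhd> x) >< (s \<rhd> y)) =
      wmult C (fobj F b) (fobj Z i) c \<rhd> ((mcmp a (b, i) \<rhd> x) >< (t \<rhd> y))"
  shows "s = t"
proof (rule pointwise_unique[OF p, of c i k])
  fix b assume [simp]: "b \<in> obj B"
  show "wmult C (fobj F b) (fobj Z i) c \<cdot> (mcmp a (b, i) \<odot> s) = wmult C (fobj F b) (fobj Z i) c \<cdot> (mcmp a (b, i) \<odot> t)"
    by (rule ext2[of _ _ "pcmp \<phi> b i" k]) (simp_all add: eq ap_comp ap_tens)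
qed simp_all

lemma pointwise_unique2:
  assumes p: "pointwise_colimit a" and [simp]: "c \<in> obj C" "i \<in> obj A" "h \<in> one_cells W" "k \<in> one_cells W" "src W h = trg W k"
      "src W k = extent C c" "trg W h = extent A i"
    and [simp]: "s \<in> two_cells W" "dom2 W s = h \<otimes> k" "cod2 W s = whom C (fobj Z i) c"
    and [simp]: "t \<in> two_cells W" "dom2 W t = h \<otimes> k" "cod2 W t = whom C (fobj Z i) c"
    and eq: "\<And>b x y z. \<lbrakk>b \<in> obj B; el x; el y; el z; tgt x = sor y; tgt y = sor z;
      lab x = pcmp \<phi> b i; lab y = h; lab z = k\<rbrakk> \<Longrightarrow>
      wmult C (fobj F b) (fobj Z i) c \<rhd> ((mcmp a (b, i) \<rhd> x) >< (s \<rhd> (y >< z))) =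
      wmult C (fobj F b) (fobj Z i) c \<rhd> ((mcmp a (b, i) \<rhd> x) >< (t \<rhd> (y >< z)))"
  shows "s = t"
proof (rule pointwise_unique[OF p, of c i "h \<otimes> k"])
  fix b assume [simp]: "b \<in> obj B"
  show "wmult C (fobj F b) (fobj Z i) c \<cdot> (mcmp a (b, i) \<odot> s) = wmult C (fobj F b) (fobj Z i) c \<cdot> (mcmp a (b, i) \<odot> t)"
    by (rule ext3[of _ _ "pcmp \<phi> b i" h k]) (simp_all add: eq ap_comp ap_tens)
qed simp_all

section \<open>The universal property at a fixed object of the target category\<close>

context
  fixes c assumes c [simp]: "c \<in> obj C"
begin

abbreviation "X \<equiv> obj_fun W C c"
abbreviation "U \<equiv> unit_wcat W (extent C c)"
abbreviation "M \<equiv> fun_prof W Z X"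
abbreviation "L \<equiv> fun_prof W F X"
abbreviation "u \<equiv> pmap_comp W (mult_map W F Z X) (tens_map W a (pmap_id W M))"

lemma hom_prof_pf [simp]: "pf M" "pf L"
  by simp_all

lemma tpM: "tp \<phi> M"
  by (simp add: tp_def)

lemma u_in: "u \<in> pmaps W (tens_prof W \<phi> M) L"
proof (rule pmap_comp_in)
  show "tens_map W a (pmap_id W M) \<in> pmaps W (tens_prof W \<phi> M) (tens_prof W (fun_prof W F Z) M)"
    by (rule tens_map_in[OF a pmap_id_in tpM]) simp
  show "mult_map W F Z X \<in> pmaps W (tens_prof W (fun_prof W F Z) M) L"
    by (rule mult_map_in[where C = C]) simp_all
qed

lemma u_ap:
  assumes [simp]: "i \<in> obj A" "b \<in> obj B" "el x" "el m" "tgt x = sor m" "lab x = pcmp \<phi> b i" "lab m = whom C (fobj Z i) c"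
  shows "mcmp u (b, ()) \<rhd> tens_in W \<phi> M b () i \<rhd> (x >< m) =
    wmult C (fobj F b) (fobj Z i) c \<rhd> ((mcmp a (b, i) \<rhd> x) >< m)"
proof -
  have t: "tens_map W a (pmap_id W M) \<in> pmaps W (tens_prof W \<phi> M) (tens_prof W (fun_prof W F Z) M)"
    by (rule tens_map_in[OF a pmap_id_in tpM]) simp
  have m: "mult_map W F Z X \<in> pmaps W (tens_prof W (fun_prof W F Z) M) L"
    by (rule mult_map_in[where C = C]) simp_all
  note [simp] = pmapD(3,4,7-9)[OF t] pmapD(3,4,7-9)[OF m]
  note [simp] = tens_cell(4-6)[OF tpM]
  have "mcmp u (b, ()) \<rhd> tens_in W \<phi> M b () i \<rhd> (x >< m) =
      mcmp (mult_map W F Z X) (b, ()) \<rhd> mcmp (tens_map W a (pmap_id W M)) (b, ()) \<rhd> tens_in W \<phi> M b () i \<rhd> (x >< m)"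
    by (simp add: ap_comp)
  also have "\<dots> = mcmp (mult_map W F Z X) (b, ()) \<rhd> tens_in W (fun_prof W F Z) M b () i \<rhd> ((mcmp a (b, i) \<rhd> x) >< m)"
    using tens_map_ap[OF a pmap_id_in tpM, of "()" i b x m] by simp
  also have "\<dots> = wmult C (fobj F b) (fobj Z i) c \<rhd> ((mcmp a (b, i) \<rhd> x) >< m)"
    using mult_map_ap[where G = F and H = Z and K = X and C = C and a = b and b = i and c = "()"
        and x = "(mcmp a (b, i) \<rhd> x) >< m"] by simp
  finally show ?thesis .
qed

text \<open>A profunctor determines its domain and codomain, so the categories quantified
  existentially in \<open>exhibits_right_hom\<close> are known, and \<open>K\<close> ranges over
  profunctors from the one-object category to \<open>A\<close>.\<close>

lemma exhibits_iff:
  "exhibits_right_hom W u M \<phi> L \<longleftrightarrow>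
    (\<forall>K. pf K \<longrightarrow> pdom K = U \<longrightarrow> pcod K = A \<longrightarrow> (\<forall>f \<in> pmaps W (tens_prof W \<phi> K) L.
      \<exists>!f'. f' \<in> pmaps W K M \<and> f = pmap_comp W u (tens_map W (pmap_id W \<phi>) f')))"
proof -
  have 1: "profunctor W U A M" "profunctor W A B \<phi>" "profunctor W U B L"
    using hom_prof_pf \<phi> unfolding pf_def by simp_all
  have 2: "profunctor W A' B' K \<longleftrightarrow> pf K \<and> pdom K = A' \<and> pcod K = B'" for A' B' and K :: "(unit, 'x, 'o, 'f, 'c) prof"
    unfolding pf_def by (auto simp: profunctor_def)
  have "exhibits_right_hom W u M \<phi> L \<longleftrightarrow>
    (\<forall>K. profunctor W U A K \<longrightarrow> (\<forall>f \<in> pmaps W (tens_prof W \<phi> K) L.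
      \<exists>!f'. f' \<in> pmaps W K M \<and> f = pmap_comp W u (tens_map W (pmap_id W \<phi>) f')))"
    (is "_ \<longleftrightarrow> ?R")
  proof
    assume "exhibits_right_hom W u M \<phi> L"
    then obtain A' B' D' where "profunctor W A' B' M"
      and *: "\<forall>K. profunctor W A' B' K \<longrightarrow> (\<forall>f \<in> pmaps W (tens_prof W \<phi> K) L.
        \<exists>!f'. f' \<in> pmaps W K M \<and> f = pmap_comp W u (tens_map W (pmap_id W \<phi>) f'))"
      unfolding exhibits_right_hom_def by blast
    then have "A' = U" "B' = A" unfolding 2 by simp_all
    with * show ?R by simp
  next
    assume ?R
    with 1 u_in show "exhibits_right_hom W u M \<phi> L" unfolding exhibits_right_hom_def by blast
  qed
  then show ?thesis unfolding 2 by blast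
qed

text \<open>Maps out of \<open>\<phi> \<otimes> K\<close> are determined on summands, and there the
  equation has the form of \<open>factors\<close>, with the 1-cell \<open>K(i)\<close> as
  \<open>k\<close>.\<close>

lemma comp_eq_iff:
  assumes [simp]: "pf K" "pdom K = U" "pcod K = A"
    and f: "f \<in> pmaps W (tens_prof W \<phi> K) L" and f': "f' \<in> pmaps W K M"
  shows "f = pmap_comp W u (tens_map W (pmap_id W \<phi>) f') \<longleftrightarrow>
    (\<forall>b\<in>obj B. \<forall>i\<in>obj A. mcmp f (b, ()) \<cdot> tens_in W \<phi> K b () i =
      wmult C (fobj F b) (fobj Z i) c \<cdot> (mcmp a (b, i) \<odot> mcmp f' (i, ())))"
proof -
  have tK: "tp \<phi> K" by (simp add: tp_def)
  have tm: "tens_map W (pmap_id W \<phi>) f' \<in> pmaps W (tens_prof W \<phi> K) (tens_prof W \<phi> M)"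
    by (rule tens_map_in[OF pmap_id_in f' tK]) simp
  have g: "pmap_comp W u (tens_map W (pmap_id W \<phi>) f') \<in> pmaps W (tens_prof W \<phi> K) L"
    by (rule pmap_comp_in[OF tm u_in])
  note [simp] = pmapD(3,4,7-9)[OF tm] pmapD(3,4,7-9)[OF f] pmapD(3,4,7-9)[OF f']
  have [simp]: "mcmp u (b, ()) \<in> two_cells W" "dom2 W (mcmp u (b, ())) = tens_cmp W \<phi> M b ()" "cod2 W (mcmp u (b, ())) = whom C (fobj F b) c"
    if "b \<in> obj B" for b
    using pmapD(7-9)[OF u_in, of "()" b] that by simp_all
  note [simp] = tens_cell(4-6)[OF tK]
  have md: "mdom (tens_map W (pmap_id W \<phi>) f') = tens_prof W \<phi> K" by simp
  have ap: "mcmp (pmap_comp W u (tens_map W (pmap_id W \<phi>) f')) (b, ()) \<rhd> tens_in W \<phi> K b () i \<rhd> (x >< m) =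
      wmult C (fobj F b) (fobj Z i) c \<rhd> ((mcmp a (b, i) \<rhd> x) >< (mcmp f' (i, ()) \<rhd> m))"
    if [simp]: "i \<in> obj A" "b \<in> obj B" "el x" "el m" "tgt x = sor m" "lab x = pcmp \<phi> b i" "lab m = pcmp K i ()" for i b x m
  proof -
    have "mcmp (pmap_comp W u (tens_map W (pmap_id W \<phi>) f')) (b, ()) =
        mcmp u (b, ()) \<cdot> mcmp (tens_map W (pmap_id W \<phi>) f') (b, ())"
      by (rule pmap_comp_sel(1)) simp_all
    then have "mcmp (pmap_comp W u (tens_map W (pmap_id W \<phi>) f')) (b, ()) \<rhd> tens_in W \<phi> K b () i \<rhd> (x >< m) =
        mcmp u (b, ()) \<rhd> mcmp (tens_map W (pmap_id W \<phi>) f') (b, ()) \<rhd> tens_in W \<phi> K b () i \<rhd> (x >< m)"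
      by (simp del: pmap_comp_sel add: ap_comp)
    also have "\<dots> = mcmp u (b, ()) \<rhd> tens_in W \<phi> M b () i \<rhd> (x >< (mcmp f' (i, ()) \<rhd> m))"
      using tens_map_ap[OF pmap_id_in f' tK, of "()" i b x m] by simp
    also have "\<dots> = wmult C (fobj F b) (fobj Z i) c \<rhd> ((mcmp a (b, i) \<rhd> x) >< (mcmp f' (i, ()) \<rhd> m))"
      by (rule u_ap) simp_all
    finally show ?thesis .
  qed
  show ?thesis
  proof (intro iffI ballI)
    fix b i assume eq: "f = pmap_comp W u (tens_map W (pmap_id W \<phi>) f')" and [simp]: "b \<in> obj B" "i \<in> obj A"
    have "mcmp f (b, ()) \<rhd> tens_in W \<phi> K b () i \<rhd> (x >< m) =
        wmult C (fobj F b) (fobj Z i) c \<rhd> ((mcmp a (b, i) \<rhd> x) >< (mcmp f' (i, ()) \<rhd> m))"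
      if "el x" "el m" "tgt x = sor m" "lab x = pcmp \<phi> b i" "lab m = pcmp K i ()" for x m
      unfolding eq by (rule ap) (use that in simp_all)
    then show "mcmp f (b, ()) \<cdot> tens_in W \<phi> K b () i = wmult C (fobj F b) (fobj Z i) c \<cdot> (mcmp a (b, i) \<odot> mcmp f' (i, ()))"
      by (intro ext2[of _ _ "pcmp \<phi> b i" "pcmp K i ()"]) (simp_all add: ap_comp ap_tens)
  next
    assume eq: "\<forall>b\<in>obj B. \<forall>i\<in>obj A. mcmp f (b, ()) \<cdot> tens_in W \<phi> K b () i =
      wmult C (fobj F b) (fobj Z i) c \<cdot> (mcmp a (b, i) \<odot> mcmp f' (i, ()))"
    show "f = pmap_comp W u (tens_map W (pmap_id W \<phi>) f')"
    proof (rule tens_pmap_eqI[OF tK f g])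
      fix v i b x m
      assume "v \<in> obj (pdom K)" "i \<in> obj (pcod K)" "b \<in> obj (pcod \<phi>)" and [simp]: "el x" "el m" "tgt x = sor m" "lab x = pcmp \<phi> b i"
        and "lab m = pcmp K i v"
      then have [simp]: "i \<in> obj A" "b \<in> obj B" "lab m = pcmp K i ()" by simp_all
      have "(mcmp f (b, ()) \<cdot> tens_in W \<phi> K b () i) \<rhd> (x >< m) =
        (wmult C (fobj F b) (fobj Z i) c \<cdot> (mcmp a (b, i) \<odot> mcmp f' (i, ()))) \<rhd> (x >< m)"
        using eq by simp
      then show "mcmp f (b, v) \<rhd> tens_in W \<phi> K b v i \<rhd> (x >< m) =
        mcmp (pmap_comp W u (tens_map W (pmap_id W \<phi>) f')) (b, v) \<rhd> tens_in W \<phi> K b v i \<rhd> (x >< m)"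
        using ap[of i b x m] by (simp del: pmap_comp_sel add: ap_comp ap_tens)
    qed
  qed
qed

text \<open>A Yoneda argument: evaluation at the identity of \<open>i\<close> relates maps
  \<open>A(-,i) \<otimes> k \<rightarrow> C(Z,c)\<close> to 2-cells
  \<open>k \<rightarrow> C(Z i,c)\<close>, and a cocone at \<open>i\<close> extends to a map on
  \<open>\<phi> \<otimes> (A(-,i) \<otimes> k)\<close>.\<close>

lemma cocone_factors:
  assumes ex: "exhibits_right_hom W u M \<phi> L"
    and [simp]: "i \<in> obj A" "k \<in> one_cells W" "src W k = extent C c" "trg W k = extent A i" and f: "cocone c i k f"
  shows "\<exists>!s. factors a c i k f s"
proof -
  let ?K = "free_left A i k"
  have K [simp]: "pf ?K" "pdom ?K = U" "pcod ?K = A" "\<And>j v. pcmp ?K j v = whom A j i \<otimes> k"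
    using free_left[of A i k] by simp_all
  have Kl: "lact W ?K j' j () \<rhd> (g >< (h >< y)) = (wmult A j' j i \<rhd> (g >< h)) >< y"
    if "j \<in> obj A" "j' \<in> obj A" "el g" "el h" "el y" "tgt g = sor h" "tgt h = sor y"
      "lab g = whom A j' j" "lab h = whom A j i" "lab y = k" for j j' g h y
    using free_left(5)[of A i k j j' g h y] that by simp
  have tK: "tp \<phi> ?K" by (simp add: tp_def)
  note [simp] = coconeD(1-3)[OF f]
  \<comment> \<open>The extension of \<open>f\<close> from \<open>i\<close> to all \<open>j\<close>,
    using the action of \<open>A\<close> on \<phi>:
    \<open>x \<otimes> (h \<otimes> y) \<mapsto> f(x h \<otimes> y)\<close>.\<close>
  define t where "t b j = f b \<cdot> (ract W \<phi> b j i \<odot> id2 W k) \<cdot> inv2 W (assoc W (pcmp \<phi> b j) (whom A j i) k)" for b j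
  have t [simp]: "t b j \<in> two_cells W" "dom2 W (t b j) = pcmp \<phi> b j \<otimes> whom A j i \<otimes> k" "cod2 W (t b j) = whom C (fobj F b) c"
    if "b \<in> obj B" "j \<in> obj A" for b j
    using that by (simp_all add: t_def)
  have tap: "t b j \<rhd> (x >< (h >< y)) = f b \<rhd> ((ract W \<phi> b j i \<rhd> (x >< h)) >< y)"
    if [simp]: "b \<in> obj B" "j \<in> obj A" "el x" "el h" "el y" "tgt x = sor h" "tgt h = sor y"
      "lab x = pcmp \<phi> b j" "lab h = whom A j i" "lab y = k" for b j x h y
    by (simp add: t_def ap_comp ap_tens ap_assoc_inv)
  have bi: "bimap \<phi> ?K L (\<lambda>b j _. t b j)"
  proof (rule bimapI)
    fix v j j' b x g m
    assume "j \<in> obj (pcod ?K)" "j' \<in> obj (pcod ?K)" "b \<in> obj (pcod \<phi>)" and [simp]: "el x" "el g" "el m" "tgt x = sor g" "tgt g = sor m"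
      and "lab x = pcmp \<phi> b j" "lab g = whom (pcod ?K) j j'" "lab m = pcmp ?K j' v"
    then have [simp]: "j \<in> obj A" "j' \<in> obj A" "b \<in> obj B" "lab x = pcmp \<phi> b j" "lab g = whom A j j'" "lab m = whom A j' i \<otimes> k" by simp_all
    let ?l = "t b j' \<cdot> (ract W \<phi> b j j' \<odot> id2 W (whom A j' i \<otimes> k))"
    let ?r = "t b j \<cdot> (id2 W (pcmp \<phi> b j) \<odot> lact W ?K j j' ()) \<cdot> assoc W (pcmp \<phi> b j) (whom A j j') (whom A j' i \<otimes> k)"
    have "?l = ?r"
      by (rule ext4[of _ _ "pcmp \<phi> b j" "whom A j j'" "whom A j' i" k])
        (simp_all add: ap_comp ap_tens ap_assoc tap Kl ract_ract)
    then have "?l \<rhd> ((x >< g) >< m) = ?r \<rhd> ((x >< g) >< m)" by simp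
    then show "t b j' \<rhd> ((ract W \<phi> b j j' \<rhd> (x >< g)) >< m) = t b j \<rhd> (x >< (lact W ?K j j' v \<rhd> (g >< m)))"
      by (simp add: ap_comp ap_tens ap_assoc)
  next
    fix v j b b' g x m
    assume "j \<in> obj (pcod ?K)" "b \<in> obj (pcod \<phi>)" "b' \<in> obj (pcod \<phi>)" and [simp]: "el g" "el x" "el m" "tgt g = sor x" "tgt x = sor m"
      and "lab g = whom (pcod \<phi>) b' b" "lab x = pcmp \<phi> b j" "lab m = pcmp ?K j v"
    then have [simp]: "j \<in> obj A" "b' \<in> obj B" "b \<in> obj B" "lab g = whom B b' b" "lab x = pcmp \<phi> b j" "lab m = whom A j i \<otimes> k" by simp_all
    let ?l = "t b' j \<cdot> (lact W \<phi> b' b j \<odot> id2 W (whom A j i \<otimes> k))"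
    let ?r = "wmult C (fobj F b') (fobj F b) c \<cdot> (fhom F b' b \<odot> t b j) \<cdot> assoc W (whom B b' b) (pcmp \<phi> b j) (whom A j i \<otimes> k)"
    have "?l = ?r"
      by (rule ext4[of _ _ "whom B b' b" "pcmp \<phi> b j" "whom A j i" k])
        (simp_all add: ap_comp ap_tens ap_assoc tap ract_lact coconeD(4)[OF f])
    then have "?l \<rhd> ((g >< x) >< m) = ?r \<rhd> ((g >< x) >< m)" by simp
    then show "t b' j \<rhd> ((lact W \<phi> b' b j \<rhd> (g >< x)) >< m) = lact W L b' b v \<rhd> (g >< (t b j \<rhd> (x >< m)))"
      by (simp add: ap_comp ap_tens ap_assoc fun_prof_act)
  qed (simp_all add: ract_unit_wcat[where x = "extent C c"] run_ap run_pr)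
  define fK where "fK = tens_out \<phi> ?K L (\<lambda>b j _. t b j)"
  have fK: "fK \<in> pmaps W (tens_prof W \<phi> ?K) L"
    unfolding fK_def by (rule tens_out_in[OF tK _ _ _ bi]) simp_all
  have fKc: "mcmp fK (b, ()) \<cdot> tens_in W \<phi> ?K b () j = t b j" if "b \<in> obj B" "j \<in> obj A" for b j
    unfolding fK_def using that by (intro tens_out_cell[OF tK _ _ _ bi]) simp_all
  have univ: "\<exists>!f'. f' \<in> pmaps W ?K M \<and> fK = pmap_comp W u (tens_map W (pmap_id W \<phi>) f')"
    using ex fK K unfolding exhibits_iff by blast
  then obtain f' where f': "f' \<in> pmaps W ?K M" and fe: "fK = pmap_comp W u (tens_map W (pmap_id W \<phi>) f')" by blast
  note [simp] = pmapD(7-9)[OF f']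
  have te: "t b j = wmult C (fobj F b) (fobj Z j) c \<cdot> (mcmp a (b, j) \<odot> mcmp f' (j, ()))" if "b \<in> obj B" "j \<in> obj A" for b j
    using fe comp_eq_iff[OF K(1-3) fK f'] fKc that by simp
  \<comment> \<open>Evaluation of \<open>f'\<close> at the identity of \<open>i\<close>, that is,
    \<open>y \<mapsto> f'(1 \<otimes> y)\<close>.\<close>
  define s where "s = mcmp f' (i, ()) \<cdot> (wid A i \<odot> id2 W k) \<cdot> inv2 W (lun W k)"
  have s [simp]: "s \<in> two_cells W" "dom2 W s = k" "cod2 W s = whom C (fobj Z i) c"
    by (simp_all add: s_def)
  have sap: "s \<rhd> y = mcmp f' (i, ()) \<rhd> ((wid A i \<rhd> one (sor y)) >< y)" if [simp]: "el y" "lab y = k" for y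
  by (simp add: s_def ap_comp ap_tens ap_lun_inv)
  have fs: "factors a c i k f s"
  proof (rule factorsI[OF f])
    fix b x y assume [simp]: "b \<in> obj B" "el x" "el y" "tgt x = sor y" "lab x = pcmp \<phi> b i" "lab y = k"
    have [simp]: "ract W \<phi> b i i \<rhd> (x >< (wid A i \<rhd> one (sor y))) = x"
      using ract_wid[of \<phi> i b x "sor y"] by simp
    have "f b \<rhd> (x >< y) = t b i \<rhd> (x >< ((wid A i \<rhd> one (sor y)) >< y))"
      by (simp add: tap)
    also have "\<dots> = wmult C (fobj F b) (fobj Z i) c \<rhd> ((mcmp a (b, i) \<rhd> x) >< (s \<rhd> y))"
      by (subst te) (simp_all add: sap ap_comp ap_tens)
    finally show "f b \<rhd> (x >< y) = wmult C (fobj F b) (fobj Z i) c \<rhd> ((mcmp a (b, i) \<rhd> x) >< (s \<rhd> y))" .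
  qed simp_all
  \<comment> \<open>The profunctor map generated by \<open>r\<close>, namely
    \<open>h \<otimes> y \<mapsto> Z(h) r(y)\<close>. Through it, uniqueness of profunctor maps
    yields uniqueness of 2-cells.\<close>
  define G where "G r = \<lparr>mdom = ?K, mcod = M,
    mcmp = (\<lambda>(j, v) \<in> obj A \<times> {()}. wmult C (fobj Z j) (fobj Z i) c \<cdot> (fhom Z j i \<odot> r))\<rparr>" for r
  have Gc: "mcmp (G r) (j, ()) = wmult C (fobj Z j) (fobj Z i) c \<cdot> (fhom Z j i \<odot> r)" if "j \<in> obj A" for r j
    using that by (simp add: G_def)
  have G: "G r \<in> pmaps W ?K M \<and> fK = pmap_comp W u (tens_map W (pmap_id W \<phi>) (G r))"
    if r: "factors a c i k f r" for r
  proof -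
    have [simp]: "r \<in> two_cells W" "dom2 W r = k" "cod2 W r = whom C (fobj Z i) c"
      using r unfolding factors_def by simp_all
    have Gin: "G r \<in> pmaps W ?K M"
    proof (rule pmapI)
      fix v j j' g m
      assume "j \<in> obj (pcod ?K)" "j' \<in> obj (pcod ?K)" and el [simp]: "el g" "el m" "tgt g = sor m"
        and "lab g = whom (pcod ?K) j' j" "lab m = pcmp ?K j v"
      then have [simp]: "j \<in> obj A" "j' \<in> obj A" and lab [simp]: "lab g = whom A j' j" "lab m = whom A j i \<otimes> k" by simp_all
      let ?l = "mcmp (G r) (j', ()) \<cdot> lact W ?K j' j ()"
      let ?r = "wmult C (fobj Z j') (fobj Z j) c \<cdot> (fhom Z j' j \<odot> mcmp (G r) (j, ()))"
      have "?l = ?r"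
        by (rule ext3[of _ _ "whom A j' j" "whom A j i" k])
          (simp_all add: Gc ap_comp ap_tens Kl Z_wmult wmult_assoc)
      then have "?l \<rhd> (g >< m) = ?r \<rhd> (g >< m)" by simp
      then show "mcmp (G r) (j', v) \<rhd> lact W ?K j' j v \<rhd> (g >< m) = lact W M j' j v \<rhd> (g >< (mcmp (G r) (j, v) \<rhd> m))"
        by (simp add: Gc ap_comp ap_tens fun_prof_act)
    qed (simp_all add: Gc ract_unit_wcat[where x = "extent C c"] run_ap, simp_all add: G_def)
    have "\<forall>b\<in>obj B. \<forall>j\<in>obj A. mcmp fK (b, ()) \<cdot> tens_in W \<phi> ?K b () j =
      wmult C (fobj F b) (fobj Z j) c \<cdot> (mcmp a (b, j) \<odot> mcmp (G r) (j, ()))"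
    proof (intro ballI)
      fix b j assume [simp]: "b \<in> obj B" "j \<in> obj A"
      have "t b j = wmult C (fobj F b) (fobj Z j) c \<cdot> (mcmp a (b, j) \<odot> mcmp (G r) (j, ()))"
        by (rule ext3[of _ _ "pcmp \<phi> b j" "whom A j i" k])
          (simp_all add: Gc ap_comp ap_tens tap factors_ap[OF r] a_ract wmult_assoc)
      then show "mcmp fK (b, ()) \<cdot> tens_in W \<phi> ?K b () j =
          wmult C (fobj F b) (fobj Z j) c \<cdot> (mcmp a (b, j) \<odot> mcmp (G r) (j, ()))"
        by (simp add: fKc)
    qed
    then show ?thesis using comp_eq_iff[OF K(1-3) fK Gin] Gin by simp
  qed
  show ?thesis
  proof (rule ex1I[of _ s], rule fs)
    fix r assume r: "factors a c i k f r"
    then have [simp]: "r \<in> two_cells W" "dom2 W r = k" "cod2 W r = whom C (fobj Z i) c"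
      unfolding factors_def by simp_all
    have Ge: "G r = G s" by (rule ex1_implies_eq[OF univ G[OF r] G[OF fs]])
    show "r = s"
    proof (rule ext1)
      fix y assume [simp]: "el y" "lab y = k"
      \<comment> \<open>At the identity of \<open>i\<close> the generated map returns its
        generator.\<close>
      have "mcmp (G r) (i, ()) \<rhd> ((wid A i \<rhd> one (sor y)) >< y) = mcmp (G s) (i, ()) \<rhd> ((wid A i \<rhd> one (sor y)) >< y)"
        unfolding Ge ..
      then show "r \<rhd> y = s \<rhd> y" by (simp add: Gc ap_comp ap_tens)
    qed simp_all
  qed
qed

text \<open>For arbitrary \<open>K\<close>, the restrictions of \<open>f\<close> to the summands at
  \<open>i\<close> form a cocone with \<open>k = K(i)\<close>. The factorisations are chosen
  separately for each \<open>i\<close>, and cancelling \<open>a\<close> shows that they fit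
  together.\<close>

lemma pointwise_exhibits:
  assumes p: "pointwise_colimit a"
  shows "exhibits_right_hom W u M \<phi> L"
  unfolding exhibits_iff
proof (intro allI impI ballI)
  fix K f assume K [simp]: "pf K" "pdom K = U" "pcod K = A" and f: "f \<in> pmaps W (tens_prof W \<phi> K) L"
  have tK: "tp \<phi> K" by (simp add: tp_def)
  let ?t = "\<lambda>b i v. mcmp f (b, v) \<cdot> tens_in W \<phi> K b v i"
  have t: "bimap \<phi> K L ?t" by (rule bimap_of_pmap[OF tK f])
  have [simp]: "mcmp f (b, ()) \<cdot> tens_in W \<phi> K b () i \<in> two_cells W"
    "dom2 W (mcmp f (b, ()) \<cdot> tens_in W \<phi> K b () i) = pcmp \<phi> b i \<otimes> pcmp K i ()"
    "cod2 W (mcmp f (b, ()) \<cdot> tens_in W \<phi> K b () i) = whom C (fobj F b) c"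
    if "i \<in> obj A" "b \<in> obj B" for b i
    using bimapD(1-3)[OF t, of "()" i b] that by simp_all
  have tb: "?t b i' () \<rhd> ((ract W \<phi> b i i' \<rhd> (n >< g)) >< m) = ?t b i () \<rhd> (n >< (lact W K i i' () \<rhd> (g >< m)))"
    if "b \<in> obj B" "i \<in> obj A" "i' \<in> obj A" "el n" "el g" "el m" "tgt n = sor g" "tgt g = sor m"
      "lab n = pcmp \<phi> b i" "lab g = whom A i i'" "lab m = pcmp K i' ()" for b i i' n g m
    using bimap_balanced[OF t, of "()" i i' b n g m] that by simp
  have co: "cocone c i (pcmp K i ()) (\<lambda>b. ?t b i ())" if [simp]: "i \<in> obj A" for i
  proof (rule coconeI)
    fix b b' g x y
    assume [simp]: "b \<in> obj B" "b' \<in> obj B" "el g" "el x" "el y" "tgt g = sor x" "tgt x = sor y"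
      "lab g = whom B b' b" "lab x = pcmp \<phi> b i" "lab y = pcmp K i ()"
    show "?t b' i () \<rhd> ((lact W \<phi> b' b i \<rhd> (g >< x)) >< y) =
      wmult C (fobj F b') (fobj F b) c \<rhd> ((fhom F b' b \<rhd> g) >< (?t b i () \<rhd> (x >< y)))"
      using bimap_lact[OF t, of "()" i b b' g x y] by (simp add: fun_prof_act)
  qed simp_all
  have ex: "\<exists>!s. factors a c i (pcmp K i ()) (\<lambda>b. ?t b i ()) s" if "i \<in> obj A" for i
    using p co[OF that] that unfolding pointwise_colimit_def by simp
  define s where "s i = (SOME s. factors a c i (pcmp K i ()) (\<lambda>b. ?t b i ()) s)" for i
  have s: "factors a c i (pcmp K i ()) (\<lambda>b. ?t b i ()) (s i)" if "i \<in> obj A" for i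
    unfolding s_def by (rule someI_ex[OF ex1_implies_ex[OF ex[OF that]]])
  have st [simp]: "s i \<in> two_cells W" "dom2 W (s i) = pcmp K i ()" "cod2 W (s i) = whom C (fobj Z i) c" if "i \<in> obj A" for i
    using s[OF that] unfolding factors_def by simp_all
  define f' where "f' = \<lparr>mdom = K, mcod = M, mcmp = (\<lambda>(i, v) \<in> obj A \<times> {()}. s i)\<rparr>"
  have fc: "mcmp f' (i, ()) = s i" if "i \<in> obj A" for i using that by (simp add: f'_def)
  have f': "f' \<in> pmaps W K M"
  proof (rule pmapI)
    fix v i i' g m assume "i \<in> obj (pcod K)" "i' \<in> obj (pcod K)" and [simp]: "el g" "el m" "tgt g = sor m"
      and "lab g = whom (pcod K) i' i" "lab m = pcmp K i v"
    then have [simp]: "i \<in> obj A" "i' \<in> obj A" "lab g = whom A i' i" "lab m = pcmp K i ()" by simp_all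
    \<comment> \<open>After composition with \<open>a\<close>, the two sides are \<open>f\<close> at
      \<open>x \<otimes> y z\<close> and \<open>f\<close> at \<open>x y \<otimes> z\<close>, which
      are equal by balance.\<close>
    have "s i' \<cdot> lact W K i' i () = wmult C (fobj Z i') (fobj Z i) c \<cdot> (fhom Z i' i \<odot> s i)"
    proof (rule pointwise_unique2[OF p, of c i' "whom A i' i" "pcmp K i ()"])
      fix b x y z
      assume [simp]: "b \<in> obj B" "el x" "el y" "el z" "tgt x = sor y" "tgt y = sor z"
        "lab x = pcmp \<phi> b i'" "lab y = whom A i' i" "lab z = pcmp K i ()"
      have "wmult C (fobj F b) (fobj Z i') c \<rhd> ((mcmp a (b, i') \<rhd> x) >< (s i' \<rhd> lact W K i' i () \<rhd> (y >< z))) =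
          ?t b i' () \<rhd> (x >< (lact W K i' i () \<rhd> (y >< z)))"
        by (rule factors_ap[OF s, symmetric]) simp_all
      also have "\<dots> = ?t b i () \<rhd> ((ract W \<phi> b i' i \<rhd> (x >< y)) >< z)"
        by (rule tb[symmetric]) simp_all
      also have "\<dots> = wmult C (fobj F b) (fobj Z i) c \<rhd> ((mcmp a (b, i) \<rhd> ract W \<phi> b i' i \<rhd> (x >< y)) >< (s i \<rhd> z))"
        by (rule factors_ap[OF s]) (simp_all add: ract_cell(3)[of \<phi>])
      also have "\<dots> = wmult C (fobj F b) (fobj Z i') c \<rhd> ((mcmp a (b, i') \<rhd> x) ><
          (wmult C (fobj Z i') (fobj Z i) c \<rhd> ((fhom Z i' i \<rhd> y) >< (s i \<rhd> z))))"
        by (simp add: a_ract wmult_assoc)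
      finally show "wmult C (fobj F b) (fobj Z i') c \<rhd> ((mcmp a (b, i') \<rhd> x) >< ((s i' \<cdot> lact W K i' i ()) \<rhd> (y >< z))) =
        wmult C (fobj F b) (fobj Z i') c \<rhd> ((mcmp a (b, i') \<rhd> x) ><
          ((wmult C (fobj Z i') (fobj Z i) c \<cdot> (fhom Z i' i \<odot> s i)) \<rhd> (y >< z)))"
        by (simp add: ap_comp ap_tens)
    qed simp_all
    then have "(s i' \<cdot> lact W K i' i ()) \<rhd> (g >< m) = (wmult C (fobj Z i') (fobj Z i) c \<cdot> (fhom Z i' i \<odot> s i)) \<rhd> (g >< m)"
      by simp
    then show "mcmp f' (i', v) \<rhd> lact W K i' i v \<rhd> (g >< m) = lact W M i' i v \<rhd> (g >< (mcmp f' (i, v) \<rhd> m))"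
      by (simp add: fc ap_comp ap_tens fun_prof_act)
  qed (simp_all add: fc ract_unit_wcat[where x = "extent C c"] run_ap, simp_all add: f'_def)
  show "\<exists>!f'. f' \<in> pmaps W K M \<and> f = pmap_comp W u (tens_map W (pmap_id W \<phi>) f')"
  proof (rule ex1I[of _ f'], rule conjI[OF f'])
    show "f = pmap_comp W u (tens_map W (pmap_id W \<phi>) f')"
      unfolding comp_eq_iff[OF K f f'] using s unfolding factors_def by (simp add: fc)
  next
    fix g assume g': "g \<in> pmaps W K M \<and> f = pmap_comp W u (tens_map W (pmap_id W \<phi>) g)"
    then have g: "g \<in> pmaps W K M" by simp
    show "g = f'"
    proof (rule pmap_eqI[OF g f'])
      fix v i assume "v \<in> obj (pdom K)" "i \<in> obj (pcod K)"
      then have [simp]: "i \<in> obj A" by simp_all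
      have "factors a c i (pcmp K i ()) (\<lambda>b. ?t b i ()) (mcmp g (i, ()))"
        using g' pmapD(7-9)[OF g, of "()" i] unfolding comp_eq_iff[OF K f g] factors_def by simp
      then show "mcmp g (i, v) = mcmp f' (i, v)"
        using ex1_implies_eq[OF ex s] by (simp add: fc)
    qed
  qed
qed

end

lemma exhibits_weighted_colimit_iff:
  "exhibits_weighted_colimit W \<phi> F Z a \<longleftrightarrow> pointwise_colimit a"
proof
  assume ex: "exhibits_weighted_colimit W \<phi> F Z a"
  show "pointwise_colimit a"
    unfolding pointwise_colimit_def
  proof (intro ballI allI impI)
    fix c i k f
    assume "c \<in> obj C" "i \<in> obj A" "k \<in> one_cells W" "src W k = extent C c" "trg W k = extent A i" "cocone c i k f"
    then show "\<exists>!s. factors a c i k f s"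
      using ex unfolding exhibits_weighted_colimit_def Let_def FZ
      by (intro cocone_factors) simp_all
  qed
next
  assume "pointwise_colimit a"
  then show "exhibits_weighted_colimit W \<phi> F Z a"
    unfolding exhibits_weighted_colimit_def Let_def FZ
    using a pointwise_exhibits by simp
qed

end

end

section \<open>Weighted limits\<close>

locale weighted_limit = cospan W \<kappa> A B C F Z for W :: "('o, 'f, 'c) bicat"  (structure) and \<kappa> :: "'k rel"
    and A :: "('x, 'o, 'f, 'c) wcat" and B :: "('y, 'o, 'f, 'c) wcat" and C :: "('z, 'o, 'f, 'c) wcat"
    and F :: "('y, 'z, 'o, 'f, 'c) wfun" and Z :: "('x, 'z, 'o, 'f, 'c) wfun" +
  fixes \<psi> :: "('y, 'x, 'o, 'f, 'c) prof"
  assumes \<psi>: "profunctor W B A \<psi>"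
begin

lemma \<psi>_sel [simp]: "pf \<psi>" "pdom \<psi> = B" "pcod \<psi> = A"
  using \<psi> unfolding pf_def by (simp_all add: profunctor_def)

text \<open>The test 1-cell \<open>k\<close> stands on the left because \<psi> is the right factor
  of \<open>C(c,Z) \<otimes> \<psi>\<close>.\<close>

inductive cone :: "'z \<Rightarrow> 'x \<Rightarrow> 'f \<Rightarrow> ('y \<Rightarrow> 'c) \<Rightarrow> bool" for c i k f where
  coneI: "cone c i k f"
if "\<And>b. b \<in> obj B \<Longrightarrow> f b \<in> two_cells W \<and> dom2 W (f b) = k \<otimes> pcmp \<psi> i b \<and> cod2 W (f b) = whom C c (fobj F b)"
  and "\<And>b b' y x g. \<lbrakk>b \<in> obj B; b' \<in> obj B; el y; el x; el g; tgt y = sor x; tgt x = sor g;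
      lab y = k; lab x = pcmp \<psi> i b; lab g = whom B b b'\<rbrakk> \<Longrightarrow>
      f b' \<rhd> (y >< (ract W \<psi> i b b' \<rhd> (x >< g))) =
      wmult C c (fobj F b) (fobj F b') \<rhd> ((f b \<rhd> (y >< x)) >< (fhom F b b' \<rhd> g))"

lemmas coneD = cone.simps[THEN iffD1, THEN conjunct1, rule_format, THEN conjunct1]
  cone.simps[THEN iffD1, THEN conjunct1, rule_format, THEN conjunct2, THEN conjunct1]
  cone.simps[THEN iffD1, THEN conjunct1, rule_format, THEN conjunct2, THEN conjunct2]
  cone.simps[THEN iffD1, THEN conjunct2, rule_format]

definition factors :: "('y, 'x, 'o, 'f, 'c) pmap \<Rightarrow> 'z \<Rightarrow> 'x \<Rightarrow> 'f \<Rightarrow> ('y \<Rightarrow> 'c) \<Rightarrow> 'c \<Rightarrow> bool" where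
  "factors \<beta> c i k f s \<longleftrightarrow> s \<in> two_cells W \<and> dom2 W s = k \<and> cod2 W s = whom C c (fobj Z i) \<and>
    (\<forall>b\<in>obj B. f b = wmult C c (fobj Z i) (fobj F b) \<cdot> (s \<odot> mcmp \<beta> (i, b)))"

definition pointwise_limit :: "('y, 'x, 'o, 'f, 'c) pmap \<Rightarrow> bool" where
  "pointwise_limit \<beta> \<longleftrightarrow> (\<forall>c\<in>obj C. \<forall>i\<in>obj A. \<forall>k\<in>one_cells W. \<forall>f.
    src W k = extent A i \<longrightarrow> trg W k = extent C c \<longrightarrow> cone c i k f \<longrightarrow> (\<exists>!s. factors \<beta> c i k f s))"

context
  fixes \<beta> assumes \<beta>: "\<beta> \<in> pmaps W \<psi> (fun_prof W Z F)"
begin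

lemma \<beta>_sel [simp]:
  "i \<in> obj A \<Longrightarrow> b \<in> obj B \<Longrightarrow> mcmp \<beta> (i, b) \<in> two_cells W"
  "i \<in> obj A \<Longrightarrow> b \<in> obj B \<Longrightarrow> dom2 W (mcmp \<beta> (i, b)) = pcmp \<psi> i b"
  "i \<in> obj A \<Longrightarrow> b \<in> obj B \<Longrightarrow> cod2 W (mcmp \<beta> (i, b)) = whom C (fobj Z i) (fobj F b)"
  using pmapD(7-9)[OF \<beta>] by simp_all

lemma \<beta>_lact:
  assumes [simp]: "i \<in> obj A" "i' \<in> obj A" "b \<in> obj B" "el g" "el x" "tgt g = sor x" "lab g = whom A i' i" "lab x = pcmp \<psi> i b"
  shows "mcmp \<beta> (i', b) \<rhd> lact W \<psi> i' i b \<rhd> (g >< x) =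
    wmult C (fobj Z i') (fobj Z i) (fobj F b) \<rhd> ((fhom Z i' i \<rhd> g) >< (mcmp \<beta> (i, b) \<rhd> x))"
  by (subst pmap_lact[OF \<beta>]) (simp_all add: fun_prof_act)

lemma \<beta>_ract:
  assumes [simp]: "i \<in> obj A" "b \<in> obj B" "b' \<in> obj B" "el g" "el x" "tgt x = sor g" "lab g = whom B b b'" "lab x = pcmp \<psi> i b"
  shows "mcmp \<beta> (i, b') \<rhd> ract W \<psi> i b b' \<rhd> (x >< g) =
    wmult C (fobj Z i) (fobj F b) (fobj F b') \<rhd> ((mcmp \<beta> (i, b) \<rhd> x) >< (fhom F b b' \<rhd> g))"
  by (subst pmap_ract[OF \<beta>]) (simp_all add: fun_prof_act)

lemma factors_ap:
  assumes "factors \<beta> c i k f s" and [simp]: "c \<in> obj C" "i \<in> obj A" "b \<in> obj B" "el y" "el x" "tgt y = sor x" "lab y = k" "lab x = pcmp \<psi> i b"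
  shows "f b \<rhd> (y >< x) = wmult C c (fobj Z i) (fobj F b) \<rhd> ((s \<rhd> y) >< (mcmp \<beta> (i, b) \<rhd> x))"
proof -
  have [simp]: "s \<in> two_cells W" "dom2 W s = k" "cod2 W s = whom C c (fobj Z i)"
    and f: "f b = wmult C c (fobj Z i) (fobj F b) \<cdot> (s \<odot> mcmp \<beta> (i, b))"
    using assms(1) unfolding factors_def by simp_all
  have [simp]: "src W k = extent A i" using el_seq[of y x] by simp
  show ?thesis unfolding f by (simp add: ap_comp ap_tens)
qed

lemma factorsI:
  assumes "cone c i k f" and [simp]: "c \<in> obj C" "i \<in> obj A" "k \<in> one_cells W" "src W k = extent A i"
    and [simp]: "s \<in> two_cells W" "dom2 W s = k" "cod2 W s = whom C c (fobj Z i)"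
    and eq: "\<And>b y x. \<lbrakk>b \<in> obj B; el y; el x; tgt y = sor x; lab y = k; lab x = pcmp \<psi> i b\<rbrakk> \<Longrightarrow>
      f b \<rhd> (y >< x) = wmult C c (fobj Z i) (fobj F b) \<rhd> ((s \<rhd> y) >< (mcmp \<beta> (i, b) \<rhd> x))"
  shows "factors \<beta> c i k f s"
  unfolding factors_def
proof (intro conjI ballI)
  note [simp] = coneD(1-3)[OF assms(1)]
  fix b assume [simp]: "b \<in> obj B"
  show "f b = wmult C c (fobj Z i) (fobj F b) \<cdot> (s \<odot> mcmp \<beta> (i, b))"
    by (rule ext2[of _ _ k "pcmp \<psi> i b"]) (simp_all add: eq ap_comp ap_tens)
qed simp_all

lemma cone_of_cell:
  assumes [simp]: "c \<in> obj C" "i \<in> obj A" "k \<in> one_cells W" "src W k = extent A i"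
    and [simp]: "s \<in> two_cells W" "dom2 W s = k" "cod2 W s = whom C c (fobj Z i)"
  shows "cone c i k (\<lambda>b. wmult C c (fobj Z i) (fobj F b) \<cdot> (s \<odot> mcmp \<beta> (i, b)))"
  by (rule coneI) (simp_all add: ap_comp ap_tens \<beta>_ract wmult_assoc)

text \<open>As for colimits, every 2-cell into \<open>C(c,Z i)\<close> induces a cone, so the
  components of \<beta> can be cancelled, now on the right.\<close>

lemma pointwise_unique:
  assumes p: "pointwise_limit \<beta>" and [simp]: "c \<in> obj C" "i \<in> obj A" "k \<in> one_cells W" "src W k = extent A i" "trg W k = extent C c"
    and s [simp]: "s \<in> two_cells W" "dom2 W s = k" "cod2 W s = whom C c (fobj Z i)"
    and t [simp]: "t \<in> two_cells W" "dom2 W t = k" "cod2 W t = whom C c (fobj Z i)"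
    and eq: "\<And>b. b \<in> obj B \<Longrightarrow> wmult C c (fobj Z i) (fobj F b) \<cdot> (s \<odot> mcmp \<beta> (i, b)) =
      wmult C c (fobj Z i) (fobj F b) \<cdot> (t \<odot> mcmp \<beta> (i, b))"
  shows "s = t"
proof -
  let ?f = "\<lambda>b. wmult C c (fobj Z i) (fobj F b) \<cdot> (s \<odot> mcmp \<beta> (i, b))"
  have "cone c i k ?f" by (rule cone_of_cell) simp_all
  then have ex: "\<exists>!s. factors \<beta> c i k ?f s" using p unfolding pointwise_limit_def by simp
  show ?thesis
    by (rule ex1_implies_eq[OF ex]) (use eq in \<open>simp_all add: factors_def\<close>)
qed

lemma pointwise_unique1:
  assumes p: "pointwise_limit \<beta>" and [simp]: "c \<in> obj C" "i \<in> obj A" "k \<in> one_cells W" "src W k = extent A i" "trg W k = extent C c"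
    and [simp]: "s \<in> two_cells W" "dom2 W s = k" "cod2 W s = whom C c (fobj Z i)"
    and [simp]: "t \<in> two_cells W" "dom2 W t = k" "cod2 W t = whom C c (fobj Z i)"
    and eq: "\<And>b y x. \<lbrakk>b \<in> obj B; el y; el x; tgt y = sor x; lab y = k; lab x = pcmp \<psi> i b\<rbrakk> \<Longrightarrow>
      wmult C c (fobj Z i) (fobj F b) \<rhd> ((s \<rhd> y) >< (mcmp \<beta> (i, b) \<rhd> x)) =
      wmult C c (fobj Z i) (fobj F b) \<rhd> ((t \<rhd> y) >< (mcmp \<beta> (i, b) \<rhd> x))"
  shows "s = t"
proof (rule pointwise_unique[OF p, of c i k])
  fix b assume [simp]: "b \<in> obj B"
  show "wmult C c (fobj Z i) (fobj F b) \<cdot> (s \<odot> mcmp \<beta> (i, b)) = wmult C c (fobj Z i) (fobj F b) \<cdot> (t \<odot> mcmp \<beta> (i, b))"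
    by (rule ext2[of _ _ k "pcmp \<psi> i b"]) (simp_all add: eq ap_comp ap_tens)
qed simp_all

lemma pointwise_unique2:
  assumes p: "pointwise_limit \<beta>" and [simp]: "c \<in> obj C" "i \<in> obj A" "h \<in> one_cells W" "k \<in> one_cells W" "src W h = trg W k"
      "src W k = extent A i" "trg W h = extent C c"
    and [simp]: "s \<in> two_cells W" "dom2 W s = h \<otimes> k" "cod2 W s = whom C c (fobj Z i)"
    and [simp]: "t \<in> two_cells W" "dom2 W t = h \<otimes> k" "cod2 W t = whom C c (fobj Z i)"
    and eq: "\<And>b y z x. \<lbrakk>b \<in> obj B; el y; el z; el x; tgt y = sor z; tgt z = sor x;
      lab y = h; lab z = k; lab x = pcmp \<psi> i b\<rbrakk> \<Longrightarrow>
      wmult C c (fobj Z i) (fobj F b) \<rhd> ((s \<rhd> (y >< z)) >< (mcmp \<beta> (i, b) \<rhd> x)) =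
      wmult C c (fobj Z i) (fobj F b) \<rhd> ((t \<rhd> (y >< z)) >< (mcmp \<beta> (i, b) \<rhd> x))"
  shows "s = t"
proof (rule pointwise_unique[OF p, of c i "h \<otimes> k"])
  fix b assume [simp]: "b \<in> obj B"
  show "wmult C c (fobj Z i) (fobj F b) \<cdot> (s \<odot> mcmp \<beta> (i, b)) = wmult C c (fobj Z i) (fobj F b) \<cdot> (t \<odot> mcmp \<beta> (i, b))"
    by (rule ext3'[of _ _ h k "pcmp \<psi> i b"]) (simp_all add: eq ap_comp ap_tens)
qed simp_all

section \<open>The universal property of limits at a fixed object\<close>

context
  fixes c assumes c [simp]: "c \<in> obj C"
begin

abbreviation "X \<equiv> obj_fun W C c"
abbreviation "U \<equiv> unit_wcat W (extent C c)"
abbreviation "M \<equiv> fun_prof W X Z"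
abbreviation "L \<equiv> fun_prof W X F"
abbreviation "u \<equiv> pmap_comp W (mult_map W X Z F) (tens_map W (pmap_id W M) \<beta>)"

lemma hom_prof_pf [simp]: "pf M" "pf L"
  by simp_all

lemma tpM: "tp M \<psi>"
  by (simp add: tp_def)

lemma u_in: "u \<in> pmaps W (tens_prof W M \<psi>) L"
proof (rule pmap_comp_in)
  show "tens_map W (pmap_id W M) \<beta> \<in> pmaps W (tens_prof W M \<psi>) (tens_prof W M (fun_prof W Z F))"
    by (rule tens_map_in[OF pmap_id_in \<beta> tpM]) simp
  show "mult_map W X Z F \<in> pmaps W (tens_prof W M (fun_prof W Z F)) L"
    by (rule mult_map_in[where C = C]) simp_all
qed

lemma u_ap:
  assumes [simp]: "i \<in> obj A" "b \<in> obj B" "el m" "el x" "tgt m = sor x" "lab m = whom C c (fobj Z i)" "lab x = pcmp \<psi> i b"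
  shows "mcmp u ((), b) \<rhd> tens_in W M \<psi> () b i \<rhd> (m >< x) =
    wmult C c (fobj Z i) (fobj F b) \<rhd> (m >< (mcmp \<beta> (i, b) \<rhd> x))"
proof -
  have t: "tens_map W (pmap_id W M) \<beta> \<in> pmaps W (tens_prof W M \<psi>) (tens_prof W M (fun_prof W Z F))"
    by (rule tens_map_in[OF pmap_id_in \<beta> tpM]) simp
  have m: "mult_map W X Z F \<in> pmaps W (tens_prof W M (fun_prof W Z F)) L"
    by (rule mult_map_in[where C = C]) simp_all
  note [simp] = pmapD(3,4,7-9)[OF t] pmapD(3,4,7-9)[OF m]
  note [simp] = tens_cell(4-6)[OF tpM]
  have "mcmp u ((), b) \<rhd> tens_in W M \<psi> () b i \<rhd> (m >< x) =
      mcmp (mult_map W X Z F) ((), b) \<rhd> mcmp (tens_map W (pmap_id W M) \<beta>) ((), b) \<rhd> tens_in W M \<psi> () b i \<rhd> (m >< x)"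
    by (simp add: ap_comp)
  also have "\<dots> = mcmp (mult_map W X Z F) ((), b) \<rhd> tens_in W M (fun_prof W Z F) () b i \<rhd> (m >< (mcmp \<beta> (i, b) \<rhd> x))"
    using tens_map_ap[OF pmap_id_in \<beta> tpM, of b i "()" m x] by simp
  also have "\<dots> = wmult C c (fobj Z i) (fobj F b) \<rhd> (m >< (mcmp \<beta> (i, b) \<rhd> x))"
    using mult_map_ap[where G = X and H = Z and K = F and C = C and a = "()" and b = i and c = b
        and x = "m >< (mcmp \<beta> (i, b) \<rhd> x)"] by simp
  finally show ?thesis .
qed

lemma exhibits_iff:
  "exhibits_left_hom W u M \<psi> L \<longleftrightarrow>
    (\<forall>K. pf K \<longrightarrow> pdom K = A \<longrightarrow> pcod K = U \<longrightarrow> (\<forall>f \<in> pmaps W (tens_prof W K \<psi>) L.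
      \<exists>!f'. f' \<in> pmaps W K M \<and> f = pmap_comp W u (tens_map W f' (pmap_id W \<psi>))))"
proof -
  have 1: "profunctor W A U M" "profunctor W B A \<psi>" "profunctor W B U L"
    using hom_prof_pf \<psi> unfolding pf_def by simp_all
  have 2: "profunctor W A' B' K \<longleftrightarrow> pf K \<and> pdom K = A' \<and> pcod K = B'" for A' B' and K :: "('x, unit, 'o, 'f, 'c) prof"
    unfolding pf_def by (auto simp: profunctor_def)
  have "exhibits_left_hom W u M \<psi> L \<longleftrightarrow>
    (\<forall>K. profunctor W A U K \<longrightarrow> (\<forall>f \<in> pmaps W (tens_prof W K \<psi>) L.
      \<exists>!f'. f' \<in> pmaps W K M \<and> f = pmap_comp W u (tens_map W f' (pmap_id W \<psi>))))"
    (is "_ \<longleftrightarrow> ?R")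
  proof
    assume "exhibits_left_hom W u M \<psi> L"
    then obtain A' B' D' where "profunctor W B' D' M"
      and *: "\<forall>K. profunctor W B' D' K \<longrightarrow> (\<forall>f \<in> pmaps W (tens_prof W K \<psi>) L.
        \<exists>!f'. f' \<in> pmaps W K M \<and> f = pmap_comp W u (tens_map W f' (pmap_id W \<psi>)))"
      unfolding exhibits_left_hom_def by blast
    then have "B' = A" "D' = U" unfolding 2 by simp_all
    with * show ?R by simp
  next
    assume ?R
    with 1 u_in show "exhibits_left_hom W u M \<psi> L" unfolding exhibits_left_hom_def by blast
  qed
  then show ?thesis unfolding 2 by blast
qed

lemma comp_eq_iff:
  assumes [simp]: "pf K" "pdom K = A" "pcod K = U"
    and f: "f \<in> pmaps W (tens_prof W K \<psi>) L" and f': "f' \<in> pmaps W K M"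
  shows "f = pmap_comp W u (tens_map W f' (pmap_id W \<psi>)) \<longleftrightarrow>
    (\<forall>b\<in>obj B. \<forall>i\<in>obj A. mcmp f ((), b) \<cdot> tens_in W K \<psi> () b i =
      wmult C c (fobj Z i) (fobj F b) \<cdot> (mcmp f' ((), i) \<odot> mcmp \<beta> (i, b)))"
proof -
  have tK: "tp K \<psi>" by (simp add: tp_def)
  have tm: "tens_map W f' (pmap_id W \<psi>) \<in> pmaps W (tens_prof W K \<psi>) (tens_prof W M \<psi>)"
    by (rule tens_map_in[OF f' pmap_id_in tK]) simp
  have g: "pmap_comp W u (tens_map W f' (pmap_id W \<psi>)) \<in> pmaps W (tens_prof W K \<psi>) L"
    by (rule pmap_comp_in[OF tm u_in])
  note [simp] = pmapD(3,4,7-9)[OF tm] pmapD(3,4,7-9)[OF f] pmapD(3,4,7-9)[OF f']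
  have [simp]: "mcmp u ((), b) \<in> two_cells W" "dom2 W (mcmp u ((), b)) = tens_cmp W M \<psi> () b" "cod2 W (mcmp u ((), b)) = whom C c (fobj F b)"
    if "b \<in> obj B" for b
    using pmapD(7-9)[OF u_in, of b "()"] that by simp_all
  note [simp] = tens_cell(4-6)[OF tK]
  have ap: "mcmp (pmap_comp W u (tens_map W f' (pmap_id W \<psi>))) ((), b) \<rhd> tens_in W K \<psi> () b i \<rhd> (m >< x) =
      wmult C c (fobj Z i) (fobj F b) \<rhd> ((mcmp f' ((), i) \<rhd> m) >< (mcmp \<beta> (i, b) \<rhd> x))"
    if [simp]: "i \<in> obj A" "b \<in> obj B" "el m" "el x" "tgt m = sor x" "lab m = pcmp K () i" "lab x = pcmp \<psi> i b" for i b x m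
  proof -
    have "mcmp (pmap_comp W u (tens_map W f' (pmap_id W \<psi>))) ((), b) =
        mcmp u ((), b) \<cdot> mcmp (tens_map W f' (pmap_id W \<psi>)) ((), b)"
      by (rule pmap_comp_sel(1)) simp_all
    then have "mcmp (pmap_comp W u (tens_map W f' (pmap_id W \<psi>))) ((), b) \<rhd> tens_in W K \<psi> () b i \<rhd> (m >< x) =
        mcmp u ((), b) \<rhd> mcmp (tens_map W f' (pmap_id W \<psi>)) ((), b) \<rhd> tens_in W K \<psi> () b i \<rhd> (m >< x)"
      by (simp del: pmap_comp_sel add: ap_comp)
    also have "\<dots> = mcmp u ((), b) \<rhd> tens_in W M \<psi> () b i \<rhd> ((mcmp f' ((), i) \<rhd> m) >< x)"
      using tens_map_ap[OF f' pmap_id_in tK, of b i "()" m x] by simp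
    also have "\<dots> = wmult C c (fobj Z i) (fobj F b) \<rhd> ((mcmp f' ((), i) \<rhd> m) >< (mcmp \<beta> (i, b) \<rhd> x))"
      by (rule u_ap) simp_all
    finally show ?thesis .
  qed
  show ?thesis
  proof (intro iffI ballI)
    fix b i assume eq: "f = pmap_comp W u (tens_map W f' (pmap_id W \<psi>))" and [simp]: "b \<in> obj B" "i \<in> obj A"
    show "mcmp f ((), b) \<cdot> tens_in W K \<psi> () b i = wmult C c (fobj Z i) (fobj F b) \<cdot> (mcmp f' ((), i) \<odot> mcmp \<beta> (i, b))"
    proof (rule ext2[of _ _ "pcmp K () i" "pcmp \<psi> i b"])
      fix m x assume [simp]: "el m" "el x" "tgt m = sor x" "lab x = pcmp \<psi> i b" "lab m = pcmp K () i"
      have "mcmp f ((), b) \<rhd> tens_in W K \<psi> () b i \<rhd> (m >< x) =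
        wmult C c (fobj Z i) (fobj F b) \<rhd> ((mcmp f' ((), i) \<rhd> m) >< (mcmp \<beta> (i, b) \<rhd> x))"
        by (subst eq, rule ap) simp_all
      then show "(mcmp f ((), b) \<cdot> tens_in W K \<psi> () b i) \<rhd> (m >< x) =
        (wmult C c (fobj Z i) (fobj F b) \<cdot> (mcmp f' ((), i) \<odot> mcmp \<beta> (i, b))) \<rhd> (m >< x)"
        by (simp add: ap_comp ap_tens)
    qed simp_all
  next
    assume eq: "\<forall>b\<in>obj B. \<forall>i\<in>obj A. mcmp f ((), b) \<cdot> tens_in W K \<psi> () b i =
      wmult C c (fobj Z i) (fobj F b) \<cdot> (mcmp f' ((), i) \<odot> mcmp \<beta> (i, b))"
    show "f = pmap_comp W u (tens_map W f' (pmap_id W \<psi>))"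
    proof (rule tens_pmap_eqI[OF tK f g])
      fix b i v m x
      assume "b \<in> obj (pdom \<psi>)" "i \<in> obj (pcod \<psi>)" "v \<in> obj (pcod K)" and [simp]: "el m" "el x" "tgt m = sor x"
        and "lab m = pcmp K v i" "lab x = pcmp \<psi> i b"
      then have [simp]: "i \<in> obj A" "b \<in> obj B" "lab m = pcmp K () i" "lab x = pcmp \<psi> i b" by simp_all
      have "(mcmp f ((), b) \<cdot> tens_in W K \<psi> () b i) \<rhd> (m >< x) =
        (wmult C c (fobj Z i) (fobj F b) \<cdot> (mcmp f' ((), i) \<odot> mcmp \<beta> (i, b))) \<rhd> (m >< x)"
        using eq by simp
      then have "mcmp f ((), b) \<rhd> tens_in W K \<psi> () b i \<rhd> (m >< x) =
        wmult C c (fobj Z i) (fobj F b) \<rhd> ((mcmp f' ((), i) \<rhd> m) >< (mcmp \<beta> (i, b) \<rhd> x))"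
        by (simp add: ap_comp ap_tens)
      also have "\<dots> = mcmp (pmap_comp W u (tens_map W f' (pmap_id W \<psi>))) ((), b) \<rhd> tens_in W K \<psi> () b i \<rhd> (m >< x)"
        by (rule ap[symmetric]) simp_all
      finally show "mcmp f (v, b) \<rhd> tens_in W K \<psi> v b i \<rhd> (m >< x) =
        mcmp (pmap_comp W u (tens_map W f' (pmap_id W \<psi>))) (v, b) \<rhd> tens_in W K \<psi> v b i \<rhd> (m >< x)"
        by simp
    qed
  qed
qed

text \<open>The Yoneda argument for \<open>k \<otimes> A(i,-)\<close>, whose maps into
  \<open>C(c,Z)\<close> are recovered from their values at the identity of \<open>i\<close>.\<close>

lemma cone_factors:
  assumes ex: "exhibits_left_hom W u M \<psi> L"
    and [simp]: "i \<in> obj A" "k \<in> one_cells W" "src W k = extent A i" "trg W k = extent C c" and f: "cone c i k f"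
  shows "\<exists>!s. factors \<beta> c i k f s"
proof -
  let ?K = "free_right A i k"
  have K [simp]: "pf ?K" "pdom ?K = A" "pcod ?K = U" "\<And>j v. pcmp ?K v j = k \<otimes> whom A i j"
    using free_right[of A i k] by simp_all
  have Kr: "ract W ?K () j j' \<rhd> ((y >< h) >< g) = y >< (wmult A i j j' \<rhd> (h >< g))"
    if "j \<in> obj A" "j' \<in> obj A" "el y" "el h" "el g" "tgt y = sor h" "tgt h = sor g"
      "lab g = whom A j j'" "lab h = whom A i j" "lab y = k" for j j' g h y
    using free_right(5)[of A i k j j' y h g] that by simp
  have tK: "tp ?K \<psi>" by (simp add: tp_def)
  note [simp] = coneD(1-3)[OF f]
  \<comment> \<open>The extension
    \<open>(y \<otimes> h) \<otimes> x \<mapsto> f(y \<otimes> h x)\<close>, which uses the left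
    action of \<open>A\<close> on \<psi>.\<close>
  define t where "t b j = f b \<cdot> (id2 W k \<odot> lact W \<psi> i j b) \<cdot> assoc W k (whom A i j) (pcmp \<psi> j b)" for b j
  have t [simp]: "t b j \<in> two_cells W" "dom2 W (t b j) = (k \<otimes> whom A i j) \<otimes> pcmp \<psi> j b" "cod2 W (t b j) = whom C c (fobj F b)"
    if "b \<in> obj B" "j \<in> obj A" for b j
    using that by (simp_all add: t_def)
  have tap: "t b j \<rhd> ((y >< h) >< x) = f b \<rhd> (y >< (lact W \<psi> i j b \<rhd> (h >< x)))"
    if [simp]: "b \<in> obj B" "j \<in> obj A" "el y" "el h" "el x" "tgt y = sor h" "tgt h = sor x"
      "lab x = pcmp \<psi> j b" "lab h = whom A i j" "lab y = k" for b j x h y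
    by (simp add: t_def ap_comp ap_tens ap_assoc)
  have bi: "bimap ?K \<psi> L (\<lambda>_ j b. t b j)"
  proof (rule bimapI)
    fix b j j' v m g x
    assume "b \<in> obj (pdom \<psi>)" "j \<in> obj (pcod \<psi>)" "j' \<in> obj (pcod \<psi>)" and [simp]: "el m" "el g" "el x" "tgt m = sor g" "tgt g = sor x"
      and "lab m = pcmp ?K v j" "lab g = whom (pcod \<psi>) j j'" "lab x = pcmp \<psi> j' b"
    then have [simp]: "j \<in> obj A" "j' \<in> obj A" "b \<in> obj B" "lab m = k \<otimes> whom A i j" "lab g = whom A j j'" "lab x = pcmp \<psi> j' b" by simp_all
    let ?l = "t b j' \<cdot> (ract W ?K () j j' \<odot> id2 W (pcmp \<psi> j' b))"
    let ?r = "t b j \<cdot> (id2 W (k \<otimes> whom A i j) \<odot> lact W \<psi> j j' b) \<cdot> assoc W (k \<otimes> whom A i j) (whom A j j') (pcmp \<psi> j' b)"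
    have "?l = ?r"
      by (rule ext4'[of _ _ k "whom A i j" "whom A j j'" "pcmp \<psi> j' b"])
        (simp_all add: ap_comp ap_tens ap_assoc tap Kr lact_lact)
    then have "?l \<rhd> ((m >< g) >< x) = ?r \<rhd> ((m >< g) >< x)" by simp
    then show "t b j' \<rhd> ((ract W ?K v j j' \<rhd> (m >< g)) >< x) = t b j \<rhd> (m >< (lact W \<psi> j j' b \<rhd> (g >< x)))"
      by (simp add: ap_comp ap_tens ap_assoc)
  next
    fix b b' j v m x g
    assume "b \<in> obj (pdom \<psi>)" "b' \<in> obj (pdom \<psi>)" "j \<in> obj (pcod \<psi>)" and [simp]: "el m" "el x" "el g" "tgt m = sor x" "tgt x = sor g"
      and "lab m = pcmp ?K v j" "lab x = pcmp \<psi> j b" "lab g = whom (pdom \<psi>) b b'"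
    then have [simp]: "j \<in> obj A" "b' \<in> obj B" "b \<in> obj B" "lab m = k \<otimes> whom A i j" "lab x = pcmp \<psi> j b" "lab g = whom B b b'" by simp_all
    let ?l = "t b' j \<cdot> (id2 W (k \<otimes> whom A i j) \<odot> ract W \<psi> j b b') \<cdot> assoc W (k \<otimes> whom A i j) (pcmp \<psi> j b) (whom B b b')"
    let ?r = "wmult C c (fobj F b) (fobj F b') \<cdot> (t b j \<odot> fhom F b b')"
    have "?l = ?r"
      by (rule ext4'[of _ _ k "whom A i j" "pcmp \<psi> j b" "whom B b b'"])
        (simp_all add: ap_comp ap_tens ap_assoc tap ract_lact[symmetric] coneD(4)[OF f])
    then have "?l \<rhd> ((m >< x) >< g) = ?r \<rhd> ((m >< x) >< g)" by simp
    then show "t b' j \<rhd> (m >< (ract W \<psi> j b b' \<rhd> (x >< g))) = ract W L v b b' \<rhd> ((t b j \<rhd> (m >< x)) >< g)"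
      by (simp add: ap_comp ap_tens ap_assoc fun_prof_act)
  qed (simp_all add: lact_unit_wcat[where x = "extent C c"] lun_ap lun_pr)
  define fK where "fK = tens_out ?K \<psi> L (\<lambda>_ j b. t b j)"
  have fK: "fK \<in> pmaps W (tens_prof W ?K \<psi>) L"
    unfolding fK_def by (rule tens_out_in[OF tK _ _ _ bi]) simp_all
  have fKc: "mcmp fK ((), b) \<cdot> tens_in W ?K \<psi> () b j = t b j" if "b \<in> obj B" "j \<in> obj A" for b j
    unfolding fK_def using that by (intro tens_out_cell[OF tK _ _ _ bi]) simp_all
  have univ: "\<exists>!f'. f' \<in> pmaps W ?K M \<and> fK = pmap_comp W u (tens_map W f' (pmap_id W \<psi>))"
    using ex fK K unfolding exhibits_iff by blast
  then obtain f' where f': "f' \<in> pmaps W ?K M" and fe: "fK = pmap_comp W u (tens_map W f' (pmap_id W \<psi>))" by blast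
  note [simp] = pmapD(7-9)[OF f']
  have te: "t b j = wmult C c (fobj Z j) (fobj F b) \<cdot> (mcmp f' ((), j) \<odot> mcmp \<beta> (j, b))" if "b \<in> obj B" "j \<in> obj A" for b j
    using fe comp_eq_iff[OF K(1-3) fK f'] fKc that by simp
  define s where "s = mcmp f' ((), i) \<cdot> (id2 W k \<odot> wid A i) \<cdot> inv2 W (run W k)"
  have s [simp]: "s \<in> two_cells W" "dom2 W s = k" "cod2 W s = whom C c (fobj Z i)"
    by (simp_all add: s_def)
  have sap: "s \<rhd> y = mcmp f' ((), i) \<rhd> (y >< (wid A i \<rhd> one (tgt y)))" if [simp]: "el y" "lab y = k" for y
  by (simp add: s_def ap_comp ap_tens ap_run_inv)
  have fs: "factors \<beta> c i k f s"
  proof (rule factorsI[OF f])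
    fix b y x assume [simp]: "b \<in> obj B" "el y" "el x" "tgt y = sor x" "lab y = k" "lab x = pcmp \<psi> i b"
    have [simp]: "lact W \<psi> i i b \<rhd> ((wid A i \<rhd> one (sor x)) >< x) = x"
      using lact_wid[of \<psi> b i x "sor x"] by simp
    have "f b \<rhd> (y >< x) = t b i \<rhd> ((y >< (wid A i \<rhd> one (sor x))) >< x)"
      by (simp add: tap)
    also have "\<dots> = wmult C c (fobj Z i) (fobj F b) \<rhd> ((s \<rhd> y) >< (mcmp \<beta> (i, b) \<rhd> x))"
      by (subst te) (simp_all add: sap ap_comp ap_tens)
    finally show "f b \<rhd> (y >< x) = wmult C c (fobj Z i) (fobj F b) \<rhd> ((s \<rhd> y) >< (mcmp \<beta> (i, b) \<rhd> x))" .
  qed simp_all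
  \<comment> \<open>The profunctor map generated by \<open>r\<close>, namely
    \<open>y \<otimes> h \<mapsto> r(y) Z(h)\<close>.\<close>
  define G where "G r = \<lparr>mdom = ?K, mcod = M,
    mcmp = (\<lambda>(v, j) \<in> {()} \<times> obj A. wmult C c (fobj Z i) (fobj Z j) \<cdot> (r \<odot> fhom Z i j))\<rparr>" for r
  have Gc: "mcmp (G r) ((), j) = wmult C c (fobj Z i) (fobj Z j) \<cdot> (r \<odot> fhom Z i j)" if "j \<in> obj A" for r j
    using that by (simp add: G_def)
  have G: "G r \<in> pmaps W ?K M \<and> fK = pmap_comp W u (tens_map W (G r) (pmap_id W \<psi>))"
    if r: "factors \<beta> c i k f r" for r
  proof -
    have [simp]: "r \<in> two_cells W" "dom2 W r = k" "cod2 W r = whom C c (fobj Z i)"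
      using r unfolding factors_def by simp_all
    have Gin: "G r \<in> pmaps W ?K M"
    proof (rule pmapI)
      fix j j' v m g
      assume "j \<in> obj (pdom ?K)" "j' \<in> obj (pdom ?K)" and el [simp]: "el m" "el g" "tgt m = sor g"
        and "lab g = whom (pdom ?K) j j'" "lab m = pcmp ?K v j"
      then have [simp]: "j \<in> obj A" "j' \<in> obj A" and lab [simp]: "lab g = whom A j j'" "lab m = k \<otimes> whom A i j" by simp_all
      let ?l = "mcmp (G r) ((), j') \<cdot> ract W ?K () j j'"
      let ?r = "wmult C c (fobj Z j) (fobj Z j') \<cdot> (mcmp (G r) ((), j) \<odot> fhom Z j j')"
      have "?l = ?r"
        by (rule ext3'[of _ _ k "whom A i j" "whom A j j'"])
          (simp_all add: Gc ap_comp ap_tens Kr Z_wmult wmult_assoc)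
      then have "?l \<rhd> (m >< g) = ?r \<rhd> (m >< g)" by simp
      then show "mcmp (G r) (v, j') \<rhd> ract W ?K v j j' \<rhd> (m >< g) = ract W M v j j' \<rhd> ((mcmp (G r) (v, j) \<rhd> m) >< g)"
        by (simp add: Gc ap_comp ap_tens fun_prof_act)
    qed (simp_all add: Gc lact_unit_wcat[where x = "extent C c"] lun_ap, simp_all add: G_def)
    have "\<forall>b\<in>obj B. \<forall>j\<in>obj A. mcmp fK ((), b) \<cdot> tens_in W ?K \<psi> () b j =
      wmult C c (fobj Z j) (fobj F b) \<cdot> (mcmp (G r) ((), j) \<odot> mcmp \<beta> (j, b))"
    proof (intro ballI)
      fix b j assume [simp]: "b \<in> obj B" "j \<in> obj A"
      have "t b j = wmult C c (fobj Z j) (fobj F b) \<cdot> (mcmp (G r) ((), j) \<odot> mcmp \<beta> (j, b))"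
        by (rule ext3'[of _ _ k "whom A i j" "pcmp \<psi> j b"])
          (simp_all add: Gc ap_comp ap_tens tap factors_ap[OF r] \<beta>_lact wmult_assoc)
      then show "mcmp fK ((), b) \<cdot> tens_in W ?K \<psi> () b j =
          wmult C c (fobj Z j) (fobj F b) \<cdot> (mcmp (G r) ((), j) \<odot> mcmp \<beta> (j, b))"
        by (simp add: fKc)
    qed
    then show ?thesis using comp_eq_iff[OF K(1-3) fK Gin] Gin by simp
  qed
  show ?thesis
  proof (rule ex1I[of _ s], rule fs)
    fix r assume r: "factors \<beta> c i k f r"
    then have [simp]: "r \<in> two_cells W" "dom2 W r = k" "cod2 W r = whom C c (fobj Z i)"
      unfolding factors_def by simp_all
    have Ge: "G r = G s" by (rule ex1_implies_eq[OF univ G[OF r] G[OF fs]])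
    show "r = s"
    proof (rule ext1)
      fix y assume [simp]: "el y" "lab y = k"
      have "mcmp (G r) ((), i) \<rhd> (y >< (wid A i \<rhd> one (tgt y))) = mcmp (G s) ((), i) \<rhd> (y >< (wid A i \<rhd> one (tgt y)))"
        unfolding Ge ..
      then show "r \<rhd> y = s \<rhd> y" by (simp add: Gc ap_comp ap_tens)
    qed simp_all
  qed
qed

text \<open>The restrictions of \<open>f\<close> at \<open>i\<close> form a cone with
  \<open>k = K(i)\<close>; separately chosen factorisations are natural in \<open>i\<close> because
  \<beta> can be cancelled.\<close>

lemma pointwise_exhibits:
  assumes p: "pointwise_limit \<beta>"
  shows "exhibits_left_hom W u M \<psi> L"
  unfolding exhibits_iff
proof (intro allI impI ballI)
  fix K f assume K [simp]: "pf K" "pdom K = A" "pcod K = U" and f: "f \<in> pmaps W (tens_prof W K \<psi>) L"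
  have tK: "tp K \<psi>" by (simp add: tp_def)
  let ?t = "\<lambda>v i b. mcmp f (v, b) \<cdot> tens_in W K \<psi> v b i"
  have t: "bimap K \<psi> L ?t" by (rule bimap_of_pmap[OF tK f])
  have [simp]: "mcmp f ((), b) \<cdot> tens_in W K \<psi> () b i \<in> two_cells W"
    "dom2 W (mcmp f ((), b) \<cdot> tens_in W K \<psi> () b i) = pcmp K () i \<otimes> pcmp \<psi> i b"
    "cod2 W (mcmp f ((), b) \<cdot> tens_in W K \<psi> () b i) = whom C c (fobj F b)"
    if "i \<in> obj A" "b \<in> obj B" for b i
    using bimapD(1-3)[OF t, of b i "()"] that by simp_all
  have tb: "?t () i' b \<rhd> ((ract W K () i i' \<rhd> (n >< g)) >< m) = ?t () i b \<rhd> (n >< (lact W \<psi> i i' b \<rhd> (g >< m)))"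
    if "b \<in> obj B" "i \<in> obj A" "i' \<in> obj A" "el n" "el g" "el m" "tgt n = sor g" "tgt g = sor m"
      "lab n = pcmp K () i" "lab g = whom A i i'" "lab m = pcmp \<psi> i' b" for b i i' n g m
    using bimap_balanced[OF t, of b i i' "()" n g m] that by simp
  have co: "cone c i (pcmp K () i) (\<lambda>b. ?t () i b)" if [simp]: "i \<in> obj A" for i
  proof (rule coneI)
    fix b b' y x g
    assume [simp]: "b \<in> obj B" "b' \<in> obj B" "el y" "el x" "el g" "tgt y = sor x" "tgt x = sor g"
      "lab y = pcmp K () i" "lab x = pcmp \<psi> i b" "lab g = whom B b b'"
    show "?t () i b' \<rhd> (y >< (ract W \<psi> i b b' \<rhd> (x >< g))) =
      wmult C c (fobj F b) (fobj F b') \<rhd> ((?t () i b \<rhd> (y >< x)) >< (fhom F b b' \<rhd> g))"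
      using bimap_ract[OF t, of b b' i "()" y x g] by (simp add: fun_prof_act)
  qed simp_all
  have ex: "\<exists>!s. factors \<beta> c i (pcmp K () i) (\<lambda>b. ?t () i b) s" if "i \<in> obj A" for i
    using p co[OF that] that unfolding pointwise_limit_def by simp
  define s where "s i = (SOME s. factors \<beta> c i (pcmp K () i) (\<lambda>b. ?t () i b) s)" for i
  have s: "factors \<beta> c i (pcmp K () i) (\<lambda>b. ?t () i b) (s i)" if "i \<in> obj A" for i
    unfolding s_def by (rule someI_ex[OF ex1_implies_ex[OF ex[OF that]]])
  have st [simp]: "s i \<in> two_cells W" "dom2 W (s i) = pcmp K () i" "cod2 W (s i) = whom C c (fobj Z i)" if "i \<in> obj A" for i
    using s[OF that] unfolding factors_def by simp_all
  define f' where "f' = \<lparr>mdom = K, mcod = M, mcmp = (\<lambda>(v, i) \<in> {()} \<times> obj A. s i)\<rparr>"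
  have fc: "mcmp f' ((), i) = s i" if "i \<in> obj A" for i using that by (simp add: f'_def)
  have f': "f' \<in> pmaps W K M"
  proof (rule pmapI)
    fix i i' v m g assume "i \<in> obj (pdom K)" "i' \<in> obj (pdom K)" and [simp]: "el m" "el g" "tgt m = sor g"
      and "lab g = whom (pdom K) i i'" "lab m = pcmp K v i"
    then have [simp]: "i \<in> obj A" "i' \<in> obj A" "lab g = whom A i i'" "lab m = pcmp K () i" by simp_all
    \<comment> \<open>With \<beta> composed on the right, this is balance:
      \<open>y z \<otimes> x = y \<otimes> z x\<close>.\<close>
    have "s i' \<cdot> ract W K () i i' = wmult C c (fobj Z i) (fobj Z i') \<cdot> (s i \<odot> fhom Z i i')"
    proof (rule pointwise_unique2[OF p, of c i' "pcmp K () i" "whom A i i'"])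
      fix b y z x
      assume [simp]: "b \<in> obj B" "el y" "el z" "el x" "tgt y = sor z" "tgt z = sor x"
        "lab y = pcmp K () i" "lab z = whom A i i'" "lab x = pcmp \<psi> i' b"
      have "wmult C c (fobj Z i') (fobj F b) \<rhd> ((s i' \<rhd> ract W K () i i' \<rhd> (y >< z)) >< (mcmp \<beta> (i', b) \<rhd> x)) =
          ?t () i' b \<rhd> ((ract W K () i i' \<rhd> (y >< z)) >< x)"
        by (rule factors_ap[OF s, symmetric]) simp_all
      also have "\<dots> = ?t () i b \<rhd> (y >< (lact W \<psi> i i' b \<rhd> (z >< x)))"
        by (rule tb) simp_all
      also have "\<dots> = wmult C c (fobj Z i) (fobj F b) \<rhd> ((s i \<rhd> y) >< (mcmp \<beta> (i, b) \<rhd> lact W \<psi> i i' b \<rhd> (z >< x)))"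
        by (rule factors_ap[OF s]) (simp_all add: lact_cell(3)[of \<psi>])
      also have "\<dots> = wmult C c (fobj Z i') (fobj F b) \<rhd>
          ((wmult C c (fobj Z i) (fobj Z i') \<rhd> ((s i \<rhd> y) >< (fhom Z i i' \<rhd> z))) >< (mcmp \<beta> (i', b) \<rhd> x))"
        by (simp add: \<beta>_lact wmult_assoc)
      finally show "wmult C c (fobj Z i') (fobj F b) \<rhd> (((s i' \<cdot> ract W K () i i') \<rhd> (y >< z)) >< (mcmp \<beta> (i', b) \<rhd> x)) =
        wmult C c (fobj Z i') (fobj F b) \<rhd>
          (((wmult C c (fobj Z i) (fobj Z i') \<cdot> (s i \<odot> fhom Z i i')) \<rhd> (y >< z)) >< (mcmp \<beta> (i', b) \<rhd> x))"
        by (simp add: ap_comp ap_tens)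
    qed simp_all
    then have "(s i' \<cdot> ract W K () i i') \<rhd> (m >< g) = (wmult C c (fobj Z i) (fobj Z i') \<cdot> (s i \<odot> fhom Z i i')) \<rhd> (m >< g)"
      by simp
    then show "mcmp f' (v, i') \<rhd> ract W K v i i' \<rhd> (m >< g) = ract W M v i i' \<rhd> ((mcmp f' (v, i) \<rhd> m) >< g)"
      by (simp add: fc ap_comp ap_tens fun_prof_act)
  qed (simp_all add: fc lact_unit_wcat[where x = "extent C c"] lun_ap, simp_all add: f'_def)
  show "\<exists>!f'. f' \<in> pmaps W K M \<and> f = pmap_comp W u (tens_map W f' (pmap_id W \<psi>))"
  proof (rule ex1I[of _ f'], rule conjI[OF f'])
    show "f = pmap_comp W u (tens_map W f' (pmap_id W \<psi>))"
      unfolding comp_eq_iff[OF K f f'] using s unfolding factors_def by (simp add: fc)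
  next
    fix g assume g': "g \<in> pmaps W K M \<and> f = pmap_comp W u (tens_map W g (pmap_id W \<psi>))"
    then have g: "g \<in> pmaps W K M" by simp
    show "g = f'"
    proof (rule pmap_eqI[OF g f'])
      fix i v assume "i \<in> obj (pdom K)" "v \<in> obj (pcod K)"
      then have [simp]: "i \<in> obj A" by simp_all
      have "factors \<beta> c i (pcmp K () i) (\<lambda>b. ?t () i b) (mcmp g ((), i))"
        using g' pmapD(7-9)[OF g, of i "()"] unfolding comp_eq_iff[OF K f g] factors_def by simp
      then show "mcmp g (v, i) = mcmp f' (v, i)"
        using ex1_implies_eq[OF ex s] by (simp add: fc)
    qed
  qed
qed

end

lemma exhibits_weighted_limit_iff:
  "exhibits_weighted_limit W \<psi> F Z \<beta> \<longleftrightarrow> pointwise_limit \<beta>"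
proof
  assume ex: "exhibits_weighted_limit W \<psi> F Z \<beta>"
  show "pointwise_limit \<beta>"
    unfolding pointwise_limit_def
  proof (intro ballI allI impI)
    fix c i k f
    assume "c \<in> obj C" "i \<in> obj A" "k \<in> one_cells W" "src W k = extent A i" "trg W k = extent C c" "cone c i k f"
    then show "\<exists>!s. factors \<beta> c i k f s"
      using ex unfolding exhibits_weighted_limit_def Let_def FZ
      by (intro cone_factors) simp_all
  qed
next
  assume "pointwise_limit \<beta>"
  then show "exhibits_weighted_limit W \<psi> F Z \<beta>"
    unfolding exhibits_weighted_limit_def Let_def FZ
    using \<beta> pointwise_exhibits by simp
qed

end

end

section \<open>Weights with an adjoint\<close>

locale absolute_weight = adjunction W \<kappa> A B \<phi> \<psi> \<eta> \<epsilon> + colim: weighted_colimit W \<kappa> A B C F Z \<phi> +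
    lim: weighted_limit W \<kappa> A B C F Z \<psi>
  for W :: "('o, 'f, 'c) bicat"  (structure) and \<kappa> :: "'k rel"
    and A B :: "('x, 'o, 'f, 'c) wcat" and C :: "('z, 'o, 'f, 'c) wcat"
    and F Z :: "('x, 'z, 'o, 'f, 'c) wfun" and \<phi> \<psi> :: "('x, 'x, 'o, 'f, 'c) prof"
    and \<eta> \<epsilon> :: "('x, 'x, 'o, 'f, 'c) pmap"
begin

lemmas T_cell [simp] = tens_cell[OF tp\<psi>\<phi>, simplified] and S_cell [simp] = tens_cell[OF tp\<phi>\<psi>, simplified]

lemma ev_bimap: "bimap \<phi> \<psi> (id_prof W B) ev"
  using bimap_of_pmap[OF tp\<phi>\<psi> counit_in] unfolding ev_def[abs_def] .

lemma ev_cell [simp]: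
  assumes "b \<in> obj B" "i \<in> obj A" "b' \<in> obj B"
  shows "ev b i b' \<in> two_cells W" "dom2 W (ev b i b') = pcmp \<phi> b i \<otimes> pcmp \<psi> i b'" "cod2 W (ev b i b') = whom B b b'"
  using bimapD(1-3)[OF ev_bimap, of b' i b] assms by simp_all

lemma ev_balanced:
  assumes "b \<in> obj B" "b' \<in> obj B" "i \<in> obj A" "i' \<in> obj A" "el x" "el g" "el p" "tgt x = sor g" "tgt g = sor p"
    "lab x = pcmp \<phi> b i" "lab g = whom A i i'" "lab p = pcmp \<psi> i' b'"
  shows "ev b i' b' \<rhd> ((ract W \<phi> b i i' \<rhd> (x >< g)) >< p) = ev b i b' \<rhd> (x >< (lact W \<psi> i i' b' \<rhd> (g >< p)))"
  using bimap_balanced[OF ev_bimap, of b' i i' b x g p] assms by simp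

lemma ev_lact:
  assumes [simp]: "b \<in> obj B" "b' \<in> obj B" "b'' \<in> obj B" "i \<in> obj A" "el g" "el x" "el p" "tgt g = sor x" "tgt x = sor p"
    "lab g = whom B b'' b" "lab x = pcmp \<phi> b i" "lab p = pcmp \<psi> i b'"
  shows "ev b'' i b' \<rhd> ((lact W \<phi> b'' b i \<rhd> (g >< x)) >< p) = wmult B b'' b b' \<rhd> (g >< (ev b i b' \<rhd> (x >< p)))"
  using bimap_lact[OF ev_bimap, of b' i b b'' g x p] by (simp add: id_prof_act)

lemma ev_ract:
  assumes [simp]: "b \<in> obj B" "b' \<in> obj B" "b'' \<in> obj B" "i \<in> obj A" "el g" "el x" "el p" "tgt x = sor p" "tgt p = sor g"
    "lab x = pcmp \<phi> b i" "lab p = pcmp \<psi> i b'" "lab g = whom B b' b''"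
  shows "ev b i b'' \<rhd> (x >< (ract W \<psi> i b' b'' \<rhd> (p >< g))) = wmult B b b' b'' \<rhd> ((ev b i b' \<rhd> (x >< p)) >< g)"
  using bimap_ract[OF ev_bimap, of b' b'' i b x p g] by (simp add: id_prof_act)

lemma \<tau>\<sigma>_cell [simp]:
  assumes "b \<in> obj B" "i \<in> obj A" "i' \<in> obj A"
  shows "\<tau> b i' i \<in> two_cells W" "dom2 W (\<tau> b i' i) = pcmp \<phi> b i' \<otimes> tens_cmp W \<psi> \<phi> i' i" "cod2 W (\<tau> b i' i) = pcmp \<phi> b i"
    "\<sigma> i' i b \<in> two_cells W" "dom2 W (\<sigma> i' i b) = tens_cmp W \<psi> \<phi> i' i \<otimes> pcmp \<psi> i b" "cod2 W (\<sigma> i' i b) = pcmp \<psi> i' b"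
  using bimapD(1-3)[OF \<tau>_bimap, of i i' b] bimapD(1-3)[OF \<sigma>_bimap, of b i i'] assms by simp_all

text \<open>An element of \<open>A(i',i)\<close> is the identity times itself, so \<eta>, being
  compatible with the actions, is known from its values at identities: \<eta>(y) is \<eta>(1) acted
  on by \<open>y\<close>.\<close>

lemma unit_ract:
  assumes [simp]: "i \<in> obj A" "i' \<in> obj A" "el y" "lab y = whom A i' i" "sor y = k"
  shows "mcmp \<eta> (i', i) \<rhd> y = ract W T i' i' i \<rhd> ((mcmp \<eta> (i', i') \<rhd> wid A i' \<rhd> one k) >< y)"
proof -
  have [simp]: "trg W k = extent A i'" "k \<in> one_cells W" using el_D[of y] by auto
  show ?thesis
    using pmap_ract[OF unit_in, of i' i i' "wid A i' \<rhd> one k" y] by (simp add: id_prof_act)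
qed

lemma unit_lact:
  assumes [simp]: "i \<in> obj A" "i' \<in> obj A" "el y" "lab y = whom A i' i" "tgt y = k"
  shows "mcmp \<eta> (i', i) \<rhd> y = lact W T i' i i \<rhd> (y >< (mcmp \<eta> (i, i) \<rhd> wid A i \<rhd> one k))"
proof -
  have [simp]: "trg W k = extent A i" "k \<in> one_cells W" using el_D[of y] by auto
  show ?thesis
    using pmap_lact[OF unit_in, of i i i' y "wid A i \<rhd> one k"] by (simp add: id_prof_act)
qed

section \<open>Equations (i) and (ii) in components\<close>

context
  fixes \<alpha> \<beta> assumes \<alpha>: "\<alpha> \<in> pmaps W \<phi> (fun_prof W F Z)" and \<beta>: "\<beta> \<in> pmaps W \<psi> (fun_prof W Z F)"
begin

lemmas [simp] = colim.a_sel[OF \<alpha>] lim.\<beta>_sel[OF \<beta>]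

text \<open>The left-hand side of (i) without \<eta>, a map
  \<open>p \<otimes> q \<mapsto> b(p) a(q)\<close> from \<open>\<psi> \<otimes> \<phi>\<close> to
  \<open>C(Z,Z)\<close>. It is isolated because later equations compare it with other maps on all of
  \<open>\<psi> \<otimes> \<phi>\<close>, before the unit is inserted.\<close>

definition mult_unit where
  "mult_unit = pmap_comp W (mult_map W Z F Z) (tens_map W \<beta> \<alpha>)"

lemma tens_map_\<beta>\<alpha>: "tens_map W \<beta> \<alpha> \<in> pmaps W T (tens_prof W (fun_prof W Z F) (fun_prof W F Z))"
  by (rule tens_map_in[OF \<beta> \<alpha> tp\<psi>\<phi>])

lemma tens_map_\<alpha>\<beta>: "tens_map W \<alpha> \<beta> \<in> pmaps W S (tens_prof W (fun_prof W F Z) (fun_prof W Z F))"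
  by (rule tens_map_in[OF \<alpha> \<beta> tp\<phi>\<psi>])

lemma mult_unit_cell [simp]:
  assumes "i \<in> obj A" "i' \<in> obj A"
  shows "mcmp mult_unit (i', i) \<in> two_cells W" "dom2 W (mcmp mult_unit (i', i)) = tens_cmp W \<psi> \<phi> i' i"
    "cod2 W (mcmp mult_unit (i', i)) = whom C (fobj Z i') (fobj Z i)"
proof -
  have m: "mult_map W Z F Z \<in> pmaps W (tens_prof W (fun_prof W Z F) (fun_prof W F Z)) (fun_prof W Z Z)"
    by (rule mult_map_in[where C = C]) simp_all
  have "mult_unit \<in> pmaps W T (fun_prof W Z Z)"
    unfolding mult_unit_def by (rule pmap_comp_in[OF tens_map_\<beta>\<alpha> m])
  from pmapD(7-9)[OF this, of i i'] assms show "mcmp mult_unit (i', i) \<in> two_cells W"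
    "dom2 W (mcmp mult_unit (i', i)) = tens_cmp W \<psi> \<phi> i' i"
    "cod2 W (mcmp mult_unit (i', i)) = whom C (fobj Z i') (fobj Z i)" by simp_all
qed

lemma mult_unit_ap:
  assumes [simp]: "i \<in> obj A" "i' \<in> obj A" "b \<in> obj B" "el p" "el q" "tgt p = sor q" "lab p = pcmp \<psi> i' b" "lab q = pcmp \<phi> b i"
  shows "mcmp mult_unit (i', i) \<rhd> tens_in W \<psi> \<phi> i' i b \<rhd> (p >< q) =
    wmult C (fobj Z i') (fobj F b) (fobj Z i) \<rhd> ((mcmp \<beta> (i', b) \<rhd> p) >< (mcmp \<alpha> (b, i) \<rhd> q))"
proof -
  have m: "mult_map W Z F Z \<in> pmaps W (tens_prof W (fun_prof W Z F) (fun_prof W F Z)) (fun_prof W Z Z)"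
    by (rule mult_map_in[where C = C]) simp_all
  note [simp] = pmapD(3,4,7-9)[OF m] pmapD(3,4,7-9)[OF tens_map_\<beta>\<alpha>]
  have "mcmp (tens_map W \<beta> \<alpha>) (i', i) \<rhd> tens_in W \<psi> \<phi> i' i b \<rhd> (p >< q) =
    tens_in W (fun_prof W Z F) (fun_prof W F Z) i' i b \<rhd> ((mcmp \<beta> (i', b) \<rhd> p) >< (mcmp \<alpha> (b, i) \<rhd> q))"
    using tens_map_ap[OF \<beta> \<alpha> tp\<psi>\<phi>, of i b i' p q] by simp
  moreover have "mcmp (mult_map W Z F Z) (i', i) \<rhd> tens_in W (fun_prof W Z F) (fun_prof W F Z) i' i b \<rhd> ((mcmp \<beta> (i', b) \<rhd> p) >< (mcmp \<alpha> (b, i) \<rhd> q)) =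
    wmult C (fobj Z i') (fobj F b) (fobj Z i) \<rhd> ((mcmp \<beta> (i', b) \<rhd> p) >< (mcmp \<alpha> (b, i) \<rhd> q))"
    by (rule mult_map_ap[where C = C]) simp_all
  ultimately show ?thesis by (simp add: mult_unit_def ap_comp)
qed

lemma unit_eq_iff:
  "pmap_comp W (mult_map W Z F Z) (pmap_comp W (tens_map W \<beta> \<alpha>) \<eta>) = hom_map W Z \<longleftrightarrow>
    (\<forall>i\<in>obj A. \<forall>i'\<in>obj A. mcmp mult_unit (i', i) \<cdot> mcmp \<eta> (i', i) = fhom Z i' i)" (is "?l = _ \<longleftrightarrow> ?R")
proof -
  have m: "mult_map W Z F Z \<in> pmaps W (tens_prof W (fun_prof W Z F) (fun_prof W F Z)) (fun_prof W Z Z)"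
    by (rule mult_map_in[where C = C]) simp_all
  have l: "?l \<in> pmaps W (id_prof W A) (fun_prof W Z Z)"
    by (rule pmap_comp_in[OF pmap_comp_in[OF unit_in tens_map_\<beta>\<alpha>] m])
  have h: "hom_map W Z \<in> pmaps W (id_prof W A) (fun_prof W Z Z)"
    using hom_map_in[of Z] by simp
  note [simp] = pmapD(3,4,7-9)[OF m] pmapD(3,4,7-9)[OF tens_map_\<beta>\<alpha>]
  have c: "mcmp ?l (i', i) = mcmp mult_unit (i', i) \<cdot> mcmp \<eta> (i', i)" "mcmp (hom_map W Z) (i', i) = fhom Z i' i"
    if "i \<in> obj A" "i' \<in> obj A" for i i'
    using that hom_map_cmp[of Z i i'] by (simp_all add: mult_unit_def vc_assoc)
  show ?thesis
  proof
    assume "?l = hom_map W Z"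
    then show ?R using c by metis
  next
    assume ?R
    then show "?l = hom_map W Z" by (intro pmap_eqI[OF l h]) (simp add: c del: pmap_comp_sel)
  qed
qed

text \<open>Read on summands, (ii) says two things at once: for fixed \<open>b'\<close>, the
  components of \<beta> factor the cocone \<open>fhom F b b' \<cdot> ev b i b'\<close> through
  \<alpha>; for fixed \<open>b\<close>, the components of \<alpha> factor the same cells, as a cone,
  through \<beta>. This symmetry drives both converse directions.\<close>

lemma counit_eq_iff:
  "pmap_comp W (mult_map W F Z F) (tens_map W \<alpha> \<beta>) = pmap_comp W (hom_map W F) \<epsilon> \<longleftrightarrow>
    (\<forall>b\<in>obj B. \<forall>b'\<in>obj B. \<forall>i\<in>obj A.
      wmult C (fobj F b) (fobj Z i) (fobj F b') \<cdot> (mcmp \<alpha> (b, i) \<odot> mcmp \<beta> (i, b')) = fhom F b b' \<cdot> ev b i b')" (is "?l = ?r \<longleftrightarrow> ?R")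
proof -
  have m: "mult_map W F Z F \<in> pmaps W (tens_prof W (fun_prof W F Z) (fun_prof W Z F)) (fun_prof W F F)"
    by (rule mult_map_in[where C = C]) simp_all
  have l: "?l \<in> pmaps W S (fun_prof W F F)"
    by (rule pmap_comp_in[OF tens_map_\<alpha>\<beta> m])
  have h: "hom_map W F \<in> pmaps W (id_prof W B) (fun_prof W F F)"
    using hom_map_in[of F] by simp
  have r: "?r \<in> pmaps W S (fun_prof W F F)"
    by (rule pmap_comp_in[OF counit_in h])
  note [simp] = pmapD(3,4,7-9)[OF m] pmapD(3,4,7-9)[OF tens_map_\<alpha>\<beta>]
  have hc [simp]: "mcmp (hom_map W F) (b, b') = fhom F b b'" if "b \<in> obj B" "b' \<in> obj B" for b b'
    using that hom_map_cmp[of F b' b] by simp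
  have c: "mcmp ?l (b, b') \<rhd> tens_in W \<phi> \<psi> b b' i \<rhd> (x >< p) =
      (wmult C (fobj F b) (fobj Z i) (fobj F b') \<cdot> (mcmp \<alpha> (b, i) \<odot> mcmp \<beta> (i, b'))) \<rhd> (x >< p)"
    "mcmp ?r (b, b') \<rhd> tens_in W \<phi> \<psi> b b' i \<rhd> (x >< p) = (fhom F b b' \<cdot> ev b i b') \<rhd> (x >< p)"
    if [simp]: "b \<in> obj B" "b' \<in> obj B" "i \<in> obj A" "el x" "el p" "tgt x = sor p" "lab x = pcmp \<phi> b i" "lab p = pcmp \<psi> i b'" for b b' i x p
  proof -
    have "mcmp (tens_map W \<alpha> \<beta>) (b, b') \<rhd> tens_in W \<phi> \<psi> b b' i \<rhd> (x >< p) =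
      tens_in W (fun_prof W F Z) (fun_prof W Z F) b b' i \<rhd> ((mcmp \<alpha> (b, i) \<rhd> x) >< (mcmp \<beta> (i, b') \<rhd> p))"
      using tens_map_ap[OF \<alpha> \<beta> tp\<phi>\<psi>, of b' i b x p] by simp
    moreover have "mcmp (mult_map W F Z F) (b, b') \<rhd> tens_in W (fun_prof W F Z) (fun_prof W Z F) b b' i \<rhd> ((mcmp \<alpha> (b, i) \<rhd> x) >< (mcmp \<beta> (i, b') \<rhd> p)) =
      wmult C (fobj F b) (fobj Z i) (fobj F b') \<rhd> ((mcmp \<alpha> (b, i) \<rhd> x) >< (mcmp \<beta> (i, b') \<rhd> p))"
      by (rule mult_map_ap[where C = C]) simp_all
    ultimately show "mcmp ?l (b, b') \<rhd> tens_in W \<phi> \<psi> b b' i \<rhd> (x >< p) =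
      (wmult C (fobj F b) (fobj Z i) (fobj F b') \<cdot> (mcmp \<alpha> (b, i) \<odot> mcmp \<beta> (i, b'))) \<rhd> (x >< p)"
      by (simp add: ap_comp ap_tens)
    show "mcmp ?r (b, b') \<rhd> tens_in W \<phi> \<psi> b b' i \<rhd> (x >< p) = (fhom F b b' \<cdot> ev b i b') \<rhd> (x >< p)"
      by (simp add: ap_comp ev_def)
  qed
  show ?thesis
  proof (intro iffI ballI)
    fix b b' i assume eq: "?l = ?r" and [simp]: "b \<in> obj B" "b' \<in> obj B" "i \<in> obj A"
    show "wmult C (fobj F b) (fobj Z i) (fobj F b') \<cdot> (mcmp \<alpha> (b, i) \<odot> mcmp \<beta> (i, b')) = fhom F b b' \<cdot> ev b i b'"
    proof (rule ext2[of _ _ "pcmp \<phi> b i" "pcmp \<psi> i b'"])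
      fix x p assume a: "el x" "el p" "tgt x = sor p" "lab x = pcmp \<phi> b i" "lab p = pcmp \<psi> i b'"
      show "(wmult C (fobj F b) (fobj Z i) (fobj F b') \<cdot> (mcmp \<alpha> (b, i) \<odot> mcmp \<beta> (i, b'))) \<rhd> (x >< p) =
        (fhom F b b' \<cdot> ev b i b') \<rhd> (x >< p)"
        using c(1)[of b b' i x p] c(2)[of b b' i x p] a unfolding eq by simp
    qed simp_all
  next
    assume R: ?R
    show "?l = ?r"
    proof (rule tens_pmap_eqI[OF tp\<phi>\<psi> l r])
      fix b' i b x p
      assume "b' \<in> obj (pdom \<psi>)" "i \<in> obj (pcod \<psi>)" "b \<in> obj (pcod \<phi>)"
        "el x" "el p" "tgt x = sor p" "lab x = pcmp \<phi> b i" "lab p = pcmp \<psi> i b'"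
      then show "mcmp ?l (b, b') \<rhd> tens_in W \<phi> \<psi> b b' i \<rhd> (x >< p) =
        mcmp ?r (b, b') \<rhd> tens_in W \<phi> \<psi> b b' i \<rhd> (x >< p)"
        using c(1)[of b b' i x p] c(2)[of b b' i x p] R by simp
    qed
  qed
qed

lemma counit_ap:
  assumes "pmap_comp W (mult_map W F Z F) (tens_map W \<alpha> \<beta>) = pmap_comp W (hom_map W F) \<epsilon>"
    and [simp]: "b \<in> obj B" "b' \<in> obj B" "i \<in> obj A" "el x" "el p" "tgt x = sor p" "lab x = pcmp \<phi> b i" "lab p = pcmp \<psi> i b'"
  shows "wmult C (fobj F b) (fobj Z i) (fobj F b') \<rhd> ((mcmp \<alpha> (b, i) \<rhd> x) >< (mcmp \<beta> (i, b') \<rhd> p)) =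
    fhom F b b' \<rhd> ev b i b' \<rhd> (x >< p)"
proof -
  have "(wmult C (fobj F b) (fobj Z i) (fobj F b') \<cdot> (mcmp \<alpha> (b, i) \<odot> mcmp \<beta> (i, b'))) \<rhd> (x >< p) =
    (fhom F b b' \<cdot> ev b i b') \<rhd> (x >< p)"
    using assms(1) unfolding counit_eq_iff by simp
  then show ?thesis by (simp add: ap_comp ap_tens)
qed

end

section \<open>A colimit and a limit from the two equations\<close>

context
  fixes \<alpha> \<beta> assumes \<alpha>: "\<alpha> \<in> pmaps W \<phi> (fun_prof W F Z)" and \<beta>: "\<beta> \<in> pmaps W \<psi> (fun_prof W Z F)"
begin

lemmas [simp] = colim.a_sel[OF \<alpha>] lim.\<beta>_sel[OF \<beta>] mult_unit_cell[OF \<alpha> \<beta>]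

context
  assumes unit: "pmap_comp W (mult_map W Z F Z) (pmap_comp W (tens_map W \<beta> \<alpha>) \<eta>) = hom_map W Z"
    and counit: "pmap_comp W (mult_map W F Z F) (tens_map W \<alpha> \<beta>) = pmap_comp W (hom_map W F) \<epsilon>"
begin

lemma mult_unit_one:
  assumes [simp]: "i \<in> obj A" "k \<in> one_cells W" "trg W k = extent A i"
  shows "mcmp (mult_unit \<alpha> \<beta>) (i, i) \<rhd> mcmp \<eta> (i, i) \<rhd> wid A i \<rhd> one k = wid C (fobj Z i) \<rhd> one k"
proof -
  have "mcmp (mult_unit \<alpha> \<beta>) (i, i) \<cdot> mcmp \<eta> (i, i) = fhom Z i i"
    using unit unfolding unit_eq_iff[OF \<alpha> \<beta>] by simp
  then have "(mcmp (mult_unit \<alpha> \<beta>) (i, i) \<cdot> mcmp \<eta> (i, i)) \<rhd> wid A i \<rhd> one k = fhom Z i i \<rhd> wid A i \<rhd> one k"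
    by simp
  then show ?thesis by (simp add: ap_comp)
qed

lemma colimit_of_adjoint: "colim.pointwise_colimit \<alpha>"
  unfolding colim.pointwise_colimit_def
proof (intro ballI allI impI)
  fix c i k f
  assume [simp]: "c \<in> obj C" "i \<in> obj A" "k \<in> one_cells W" "src W k = extent C c" "trg W k = extent A i"
    and f: "colim.cocone c i k f"
  note [simp] = colim.coconeD(1-3)[OF f]
  define g where "g b = wmult C (fobj Z i) (fobj F b) c \<cdot> (mcmp \<beta> (i, b) \<odot> f b) \<cdot> assoc W (pcmp \<psi> i b) (pcmp \<phi> b i) k" for b
  have g_ap: "g b \<rhd> ((p >< q) >< y) = wmult C (fobj Z i) (fobj F b) c \<rhd> ((mcmp \<beta> (i, b) \<rhd> p) >< (f b \<rhd> (q >< y)))"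
    if [simp]: "b \<in> obj B" "el p" "el q" "el y" "tgt p = sor q" "tgt q = sor y"
      "lab p = pcmp \<psi> i b" "lab q = pcmp \<phi> b i" "lab y = k" for b p q y
    unfolding g_def by (simp add: ap_comp ap_assoc ap_tens)
  \<comment> \<open>The cells \<open>g b\<close> agree on the identified summands because \<beta>
    respects the action of \<open>B\<close> and \<open>f\<close> is natural. As
    \<open>- \<otimes> k\<close> preserves the presentation, they combine to one cell
    \<omega>.\<close>
  obtain \<omega> where [simp]: "\<omega> \<in> two_cells W" "dom2 W \<omega> = tens_cmp W \<psi> \<phi> i i \<otimes> k" "cod2 W \<omega> = whom C (fobj Z i) c"
    and \<omega>: "\<And>b x y. \<lbrakk>b \<in> obj B; el x; el y; tgt x = sor y;
      lab x = pcmp \<psi> i b \<otimes> pcmp \<phi> b i; lab y = k\<rbrakk> \<Longrightarrow>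
      \<omega> \<rhd> ((tens_in W \<psi> \<phi> i i b \<rhd> x) >< y) = g b \<rhd> (x >< y)"
  proof -
    have 1: "g b \<in> two_cells W \<and> dom2 W (g b) = (pcmp \<psi> i b \<otimes> pcmp \<phi> b i) \<otimes> k \<and> cod2 W (g b) = whom C (fobj Z i) c" if "b \<in> obj B" for b
      using that by (simp add: g_def)
    have 2: "g b' \<rhd> (((ract W \<psi> i b b' \<rhd> (n >< h)) >< m) >< y) = g b \<rhd> ((n >< (lact W \<phi> b b' i \<rhd> (h >< m))) >< y)"
      if [simp]: "b \<in> obj B" "b' \<in> obj B" "el n" "el h" "el m" "el y" "tgt n = sor h" "tgt h = sor m" "tgt m = sor y"
      "lab n = pcmp \<psi> i b" "lab h = whom B b b'" "lab m = pcmp \<phi> b' i" "lab y = k" for b b' n h m y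
      by (simp add: g_ap lim.\<beta>_ract[OF \<beta>] colim.coconeD(4)[OF f] wmult_assoc)
    show thesis
      by (rule tens_ex_right[OF tp\<psi>\<phi>, of i i k "whom C (fobj Z i) c" g, simplified])
        (rule 1, assumption, rule 2, assumption+, rule that)
  qed
  \<comment> \<open>The factorisation before the unit is inserted: \<open>a(x) \<omega>(t \<otimes>
    y) = f(\<tau>(x \<otimes> t) \<otimes> y)\<close>. By (ii) the product \<open>a(x) b(p)\<close>
    is \<open>F\<close> of the counit, and naturality of \<open>f\<close> turns this into an action
    on \<phi>.\<close>
  have key: "wmult C (fobj F b) (fobj Z i) c \<cdot> (mcmp \<alpha> (b, i) \<odot> \<omega>) \<cdot> assoc W (pcmp \<phi> b i) (tens_cmp W \<psi> \<phi> i i) k =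
    f b \<cdot> (\<tau> b i i \<odot> id2 W k)" if [simp]: "b \<in> obj B" for b
  proof (rule tens_ext_both[OF tp\<psi>\<phi>, of i i "pcmp \<phi> b i" k])
    fix b' x n m y
    assume "b' \<in> obj (pcod \<phi>)" and [simp]: "el x" "el n" "el m" "el y" "tgt x = sor n" "tgt n = sor m" "tgt m = sor y"
      "lab x = pcmp \<phi> b i" "lab n = pcmp \<psi> i b'" "lab m = pcmp \<phi> b' i" "lab y = k"
    then have [simp]: "b' \<in> obj B" by simp
    have "wmult C (fobj F b) (fobj Z i) c \<rhd> ((mcmp \<alpha> (b, i) \<rhd> x) ><
        (wmult C (fobj Z i) (fobj F b') c \<rhd> ((mcmp \<beta> (i, b') \<rhd> n) >< (f b' \<rhd> (m >< y))))) =
      wmult C (fobj F b) (fobj F b') c \<rhd> ((fhom F b b' \<rhd> ev b i b' \<rhd> (x >< n)) >< (f b' \<rhd> (m >< y)))"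
      by (subst wmult_assoc[symmetric]) (simp_all add: counit_ap[OF \<alpha> \<beta> counit])
    then show "(wmult C (fobj F b) (fobj Z i) c \<cdot> (mcmp \<alpha> (b, i) \<odot> \<omega>) \<cdot> assoc W (pcmp \<phi> b i) (tens_cmp W \<psi> \<phi> i i) k) \<rhd>
        ((x >< (tens_in W \<psi> \<phi> i i b' \<rhd> (n >< m))) >< y) =
      (f b \<cdot> (\<tau> b i i \<odot> id2 W k)) \<rhd> ((x >< (tens_in W \<psi> \<phi> i i b' \<rhd> (n >< m))) >< y)"
      by (simp add: ap_comp ap_assoc ap_tens \<omega> g_ap \<tau>_tens colim.coconeD(4)[OF f])
  qed simp_all
  \<comment> \<open>Evaluation of \<omega> at \<eta> of the identity of \<open>i\<close>; at this
    element \<open>\<tau>_one\<close> removes \<tau> from \<open>key\<close>.\<close>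
  define s where "s = \<omega> \<cdot> ((mcmp \<eta> (i, i) \<cdot> wid A i) \<odot> id2 W k) \<cdot> inv2 W (lun W k)"
  have [simp]: "s \<in> two_cells W" "dom2 W s = k" "cod2 W s = whom C (fobj Z i) c"
    by (simp_all add: s_def)
  have s_ap: "s \<rhd> y = \<omega> \<rhd> ((mcmp \<eta> (i, i) \<rhd> wid A i \<rhd> one (sor y)) >< y)" if [simp]: "el y" "lab y = k" for y
  by (simp add: s_def ap_comp ap_tens ap_lun_inv)
  show "\<exists>!s. colim.factors \<alpha> c i k f s"
  proof (rule ex1I[of _ s])
    show "colim.factors \<alpha> c i k f s"
    proof (rule colim.factorsI[OF \<alpha> f])
      fix b x y assume [simp]: "b \<in> obj B" "el x" "el y" "tgt x = sor y" "lab x = pcmp \<phi> b i" "lab y = k"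
      let ?t = "mcmp \<eta> (i, i) \<rhd> wid A i \<rhd> one (sor y)"
      have "wmult C (fobj F b) (fobj Z i) c \<rhd> ((mcmp \<alpha> (b, i) \<rhd> x) >< (\<omega> \<rhd> (?t >< y))) = f b \<rhd> ((\<tau> b i i \<rhd> (x >< ?t)) >< y)"
        using arg_cong[OF key, of b "\<lambda>w. w \<rhd> ((x >< ?t) >< y)"]
        by (simp add: ap_comp ap_assoc ap_tens)
      then show "f b \<rhd> (x >< y) = wmult C (fobj F b) (fobj Z i) c \<rhd> ((mcmp \<alpha> (b, i) \<rhd> x) >< (s \<rhd> y))"
        by (simp add: s_ap \<tau>_one)
    qed simp_all
  next
    fix r assume r: "colim.factors \<alpha> c i k f r"
    then have [simp]: "r \<in> two_cells W" "dom2 W r = k" "cod2 W r = whom C (fobj Z i) c"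
      unfolding colim.factors_def by simp_all
    \<comment> \<open>Any factorisation \<open>r\<close> recovers \<omega> as
      \<open>t \<otimes> y \<mapsto> mult_unit(t) r(y)\<close>. At the unit, (i) makes the first
      factor an identity and leaves \<open>r\<close>.\<close>
    have \<omega>r: "\<omega> = wmult C (fobj Z i) (fobj Z i) c \<cdot> (mcmp (mult_unit \<alpha> \<beta>) (i, i) \<odot> r)"
      by (rule tens_ext_right[OF tp\<psi>\<phi>, of i i k])
        (simp_all add: \<omega> g_ap ap_comp ap_tens mult_unit_ap[OF \<alpha> \<beta>] wmult_assoc colim.factors_ap[OF \<alpha> r])
    show "r = s"
    proof (rule ext1[of _ _ k])
      fix y assume [simp]: "el y" "lab y = k"
      show "r \<rhd> y = s \<rhd> y"
        by (simp add: s_ap \<omega>r ap_comp ap_tens mult_unit_one)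
    qed simp_all
  qed
qed

text \<open>The two weights exchange their roles and \<sigma> replaces \<tau>: the cell to be
  evaluated at the unit is now
  \<open>y \<otimes> (p \<otimes> q) \<mapsto> f(y \<otimes> p) a(q)\<close>.\<close>

lemma limit_of_adjoint: "lim.pointwise_limit \<beta>"
  unfolding lim.pointwise_limit_def
proof (intro ballI allI impI)
  fix c i k f
  assume [simp]: "c \<in> obj C" "i \<in> obj A" "k \<in> one_cells W" "src W k = extent A i" "trg W k = extent C c"
    and f: "lim.cone c i k f"
  note [simp] = lim.coneD(1-3)[OF f]
  define g where "g b = wmult C c (fobj F b) (fobj Z i) \<cdot> (f b \<odot> mcmp \<alpha> (b, i)) \<cdot> inv2 W (assoc W k (pcmp \<psi> i b) (pcmp \<phi> b i))" for b
  have g_ap: "g b \<rhd> (y >< (p >< q)) = wmult C c (fobj F b) (fobj Z i) \<rhd> ((f b \<rhd> (y >< p)) >< (mcmp \<alpha> (b, i) \<rhd> q))"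
    if [simp]: "b \<in> obj B" "el p" "el q" "el y" "tgt y = sor p" "tgt p = sor q"
      "lab p = pcmp \<psi> i b" "lab q = pcmp \<phi> b i" "lab y = k" for b p q y
    unfolding g_def by (simp add: ap_comp ap_assoc_inv ap_tens)
  obtain \<omega> where [simp]: "\<omega> \<in> two_cells W" "dom2 W \<omega> = k \<otimes> tens_cmp W \<psi> \<phi> i i" "cod2 W \<omega> = whom C c (fobj Z i)"
    and \<omega>: "\<And>b y x. \<lbrakk>b \<in> obj B; el y; el x; tgt y = sor x;
      lab y = k; lab x = pcmp \<psi> i b \<otimes> pcmp \<phi> b i\<rbrakk> \<Longrightarrow>
      \<omega> \<rhd> (y >< (tens_in W \<psi> \<phi> i i b \<rhd> x)) = g b \<rhd> (y >< x)"
  proof -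
    have 1: "g b \<in> two_cells W \<and> dom2 W (g b) = k \<otimes> pcmp \<psi> i b \<otimes> pcmp \<phi> b i \<and> cod2 W (g b) = whom C c (fobj Z i)" if "b \<in> obj B" for b
      using that by (simp add: g_def)
    have 2: "g b' \<rhd> (y >< ((ract W \<psi> i b b' \<rhd> (n >< h)) >< m)) = g b \<rhd> (y >< (n >< (lact W \<phi> b b' i \<rhd> (h >< m))))"
      if [simp]: "b \<in> obj B" "b' \<in> obj B" "el y" "el n" "el h" "el m" "tgt y = sor n" "tgt n = sor h" "tgt h = sor m" "lab y = k"
      "lab n = pcmp \<psi> i b" "lab h = whom B b b'" "lab m = pcmp \<phi> b' i" for b b' n h m y
      by (simp add: g_ap colim.a_lact[OF \<alpha>] lim.coneD(4)[OF f] wmult_assoc)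
    show thesis
      by (rule tens_ex_left[OF tp\<psi>\<phi>, of i i k "whom C c (fobj Z i)" g, simplified])
        (rule 1, assumption, rule 2, assumption+, rule that)
  qed
  \<comment> \<open>By (ii) the product \<open>a(q) b(x)\<close> is \<open>F\<close> of the counit,
    which naturality of \<open>f\<close> turns into a right action on \<psi>; this is what \<sigma>
    does.\<close>
  have key: "wmult C c (fobj Z i) (fobj F b) \<cdot> (\<omega> \<odot> mcmp \<beta> (i, b)) =
    f b \<cdot> (id2 W k \<odot> \<sigma> i i b) \<cdot> assoc W k (tens_cmp W \<psi> \<phi> i i) (pcmp \<psi> i b)" if [simp]: "b \<in> obj B" for b
    by (rule tens_ext_both[OF tp\<psi>\<phi>, of i i k "pcmp \<psi> i b"])
      (simp_all add: ap_comp ap_assoc ap_tens \<omega> g_ap \<sigma>_tens lim.coneD(4)[OF f] wmult_assoc counit_ap[OF \<alpha> \<beta> counit])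
  define s where "s = \<omega> \<cdot> (id2 W k \<odot> (mcmp \<eta> (i, i) \<cdot> wid A i)) \<cdot> inv2 W (run W k)"
  have [simp]: "s \<in> two_cells W" "dom2 W s = k" "cod2 W s = whom C c (fobj Z i)"
    by (simp_all add: s_def)
  have s_ap: "s \<rhd> y = \<omega> \<rhd> (y >< (mcmp \<eta> (i, i) \<rhd> wid A i \<rhd> one (tgt y)))" if [simp]: "el y" "lab y = k" for y
  by (simp add: s_def ap_comp ap_tens ap_run_inv)
  show "\<exists>!s. lim.factors \<beta> c i k f s"
  proof (rule ex1I[of _ s])
    show "lim.factors \<beta> c i k f s"
    proof (rule lim.factorsI[OF \<beta> f])
      fix b y x assume [simp]: "b \<in> obj B" "el y" "el x" "tgt y = sor x" "lab y = k" "lab x = pcmp \<psi> i b"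
      let ?t = "mcmp \<eta> (i, i) \<rhd> wid A i \<rhd> one (sor x)"
      have "wmult C c (fobj Z i) (fobj F b) \<rhd> ((\<omega> \<rhd> (y >< ?t)) >< (mcmp \<beta> (i, b) \<rhd> x)) = f b \<rhd> (y >< (\<sigma> i i b \<rhd> (?t >< x)))"
        using arg_cong[OF key, of b "\<lambda>w. w \<rhd> ((y >< ?t) >< x)"]
        by (simp add: ap_comp ap_assoc ap_tens)
      then show "f b \<rhd> (y >< x) = wmult C c (fobj Z i) (fobj F b) \<rhd> ((s \<rhd> y) >< (mcmp \<beta> (i, b) \<rhd> x))"
        by (simp add: s_ap \<sigma>_one)
    qed simp_all
  next
    fix r assume r: "lim.factors \<beta> c i k f r"
    then have [simp]: "r \<in> two_cells W" "dom2 W r = k" "cod2 W r = whom C c (fobj Z i)"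
      unfolding lim.factors_def by simp_all
    have \<omega>r: "\<omega> = wmult C c (fobj Z i) (fobj Z i) \<cdot> (r \<odot> mcmp (mult_unit \<alpha> \<beta>) (i, i))"
    proof (rule tens_ext_left[OF tp\<psi>\<phi>, of i i k])
      fix b y n m
      assume "b \<in> obj (pcod \<phi>)" and [simp]: "el y" "el n" "el m" "tgt y = sor n" "tgt n = sor m"
        "lab y = k" "lab n = pcmp \<psi> i b" "lab m = pcmp \<phi> b i"
      then have [simp]: "b \<in> obj B" by simp
      have "wmult C c (fobj Z i) (fobj Z i) \<rhd> ((r \<rhd> y) ><
          (wmult C (fobj Z i) (fobj F b) (fobj Z i) \<rhd> ((mcmp \<beta> (i, b) \<rhd> n) >< (mcmp \<alpha> (b, i) \<rhd> m)))) =
        wmult C c (fobj F b) (fobj Z i) \<rhd> ((f b \<rhd> (y >< n)) >< (mcmp \<alpha> (b, i) \<rhd> m))"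
        by (subst wmult_assoc[symmetric]) (simp_all add: lim.factors_ap[OF \<beta> r])
      then show "\<omega> \<rhd> (y >< (tens_in W \<psi> \<phi> i i b \<rhd> (n >< m))) =
        (wmult C c (fobj Z i) (fobj Z i) \<cdot> (r \<odot> mcmp (mult_unit \<alpha> \<beta>) (i, i))) \<rhd> (y >< (tens_in W \<psi> \<phi> i i b \<rhd> (n >< m)))"
        by (simp add: \<omega> g_ap ap_comp ap_tens mult_unit_ap[OF \<alpha> \<beta>])
    qed simp_all
    show "r = s"
    proof (rule ext1[of _ _ k])
      fix y assume [simp]: "el y" "lab y = k"
      show "r \<rhd> y = s \<rhd> y"
        by (simp add: s_ap \<omega>r ap_comp ap_tens mult_unit_one)
    qed simp_all
  qed
qed

end

end

section \<open>The pair of maps determined by a colimit\<close>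

context
  fixes \<alpha> assumes \<alpha>: "\<alpha> \<in> pmaps W \<phi> (fun_prof W F Z)" and p: "colim.pointwise_colimit \<alpha>"
begin

lemmas [simp] = colim.a_sel[OF \<alpha>]

text \<open>By (ii), both candidates factor the same cocones through \<alpha>, which can be
  cancelled.\<close>

lemma limit_cone_unique:
  assumes \<beta>: "\<beta> \<in> pmaps W \<psi> (fun_prof W Z F)" and \<beta>': "\<beta>' \<in> pmaps W \<psi> (fun_prof W Z F)"
    and counit: "pmap_comp W (mult_map W F Z F) (tens_map W \<alpha> \<beta>) = pmap_comp W (hom_map W F) \<epsilon>"
      "pmap_comp W (mult_map W F Z F) (tens_map W \<alpha> \<beta>') = pmap_comp W (hom_map W F) \<epsilon>"
  shows "\<beta> = \<beta>'"
proof (rule pmap_eqI[OF \<beta> \<beta>'])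
  note [simp] = lim.\<beta>_sel[OF \<beta>] lim.\<beta>_sel[OF \<beta>']
  fix b i assume "b \<in> obj (pdom \<psi>)" "i \<in> obj (pcod \<psi>)"
  then have [simp]: "b \<in> obj B" "i \<in> obj A" by simp_all
  show "mcmp \<beta> (i, b) = mcmp \<beta>' (i, b)"
    by (rule colim.pointwise_unique[OF \<alpha> p, of "fobj F b" i "pcmp \<psi> i b"])
      (use counit in \<open>simp_all add: counit_eq_iff[OF \<alpha> \<beta>] counit_eq_iff[OF \<alpha> \<beta>']\<close>)
qed

lemma adjoint_of_colimit:
  obtains \<beta> where "\<beta> \<in> pmaps W \<psi> (fun_prof W Z F)"
    "pmap_comp W (mult_map W Z F Z) (pmap_comp W (tens_map W \<beta> \<alpha>) \<eta>) = hom_map W Z"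
    "pmap_comp W (mult_map W F Z F) (tens_map W \<alpha> \<beta>) = pmap_comp W (hom_map W F) \<epsilon>"
proof -
  define s where "s i b = (SOME s. colim.factors \<alpha> (fobj F b) i (pcmp \<psi> i b) (\<lambda>b'. fhom F b' b \<cdot> ev b' i b) s)" for i b
  have s: "colim.factors \<alpha> (fobj F b) i (pcmp \<psi> i b) (\<lambda>b'. fhom F b' b \<cdot> ev b' i b) (s i b)"
    if [simp]: "i \<in> obj A" "b \<in> obj B" for i b
  proof -
    \<comment> \<open>Natural in \<open>b'\<close> because the counit respects the left action of
      \<open>B\<close> and \<open>F\<close> preserves composition.\<close>
    have "colim.cocone (fobj F b) i (pcmp \<psi> i b) (\<lambda>b'. fhom F b' b \<cdot> ev b' i b)"
      by (rule colim.coconeI) (simp_all add: ap_comp ev_lact colim.F_wmult)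
    then have "\<exists>!s. colim.factors \<alpha> (fobj F b) i (pcmp \<psi> i b) (\<lambda>b'. fhom F b' b \<cdot> ev b' i b) s"
      using p unfolding colim.pointwise_colimit_def by simp
    then show ?thesis unfolding s_def by (rule someI_ex[OF ex1_implies_ex])
  qed
  have [simp]: "s i b \<in> two_cells W" "dom2 W (s i b) = pcmp \<psi> i b" "cod2 W (s i b) = whom C (fobj Z i) (fobj F b)"
    if "i \<in> obj A" "b \<in> obj B" for i b
    using s[OF that] unfolding colim.factors_def by simp_all
  have s_ap: "wmult C (fobj F b') (fobj Z i) (fobj F b) \<rhd> ((mcmp \<alpha> (b', i) \<rhd> x) >< (s i b \<rhd> y)) =
      fhom F b' b \<rhd> ev b' i b \<rhd> (x >< y)"
    if [simp]: "i \<in> obj A" "b \<in> obj B" "b' \<in> obj B" "el x" "el y" "tgt x = sor y" "lab x = pcmp \<phi> b' i" "lab y = pcmp \<psi> i b"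
    for i b b' x y
    using colim.factors_ap[OF \<alpha> s, of i b b' x y] by (simp add: ap_comp)
  \<comment> \<open>Composites occur bracketed to the right, so \<open>s_ap\<close> is also provided
    in that shape, and compatibility of \<alpha> with the right action likewise.\<close>
  have s_wmult: "wmult C (fobj F b') (fobj Z i) d \<rhd> ((mcmp \<alpha> (b', i) \<rhd> x) >< (wmult C (fobj Z i) (fobj F b) d \<rhd> ((s i b \<rhd> y) >< z))) =
      wmult C (fobj F b') (fobj F b) d \<rhd> ((fhom F b' b \<rhd> ev b' i b \<rhd> (x >< y)) >< z)"
    if [simp]: "i \<in> obj A" "b \<in> obj B" "b' \<in> obj B" "d \<in> obj C" "el x" "el y" "el z" "tgt x = sor y" "tgt y = sor z"
      "lab x = pcmp \<phi> b' i" "lab y = pcmp \<psi> i b" "lab z = whom C (fobj F b) d" for i b b' d x y z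
    by (subst wmult_assoc[symmetric]) (simp_all add: s_ap)
  have \<alpha>_wmult: "wmult C (fobj F b) (fobj Z i') d \<rhd> ((mcmp \<alpha> (b, i') \<rhd> x) >< (wmult C (fobj Z i') (fobj Z i) d \<rhd> ((fhom Z i' i \<rhd> y) >< z))) =
      wmult C (fobj F b) (fobj Z i) d \<rhd> ((mcmp \<alpha> (b, i) \<rhd> ract W \<phi> b i' i \<rhd> (x >< y)) >< z)"
    if [simp]: "i \<in> obj A" "i' \<in> obj A" "b \<in> obj B" "d \<in> obj C" "el x" "el y" "el z" "tgt x = sor y" "tgt y = sor z"
      "lab x = pcmp \<phi> b i'" "lab y = whom A i' i" "lab z = whom C (fobj Z i) d" for i i' b d x y z
    by (subst wmult_assoc[symmetric]) (simp_all add: colim.a_ract[OF \<alpha>])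
  let ?\<beta> = "\<lparr>mdom = \<psi>, mcod = fun_prof W Z F, mcmp = restrict (\<lambda>(i, b). s i b) (obj A \<times> obj B)\<rparr>"
  have \<beta>: "?\<beta> \<in> pmaps W \<psi> (fun_prof W Z F)"
  proof (rule pmapI)
    fix b i i' g m
    assume "b \<in> obj (pdom \<psi>)" "i \<in> obj (pcod \<psi>)" "i' \<in> obj (pcod \<psi>)" "lab g = whom (pcod \<psi>) i' i"
      and a: "el g" "el m" "tgt g = sor m" "lab m = pcmp \<psi> i b"
    then have [simp]: "b \<in> obj B" "i \<in> obj A" "i' \<in> obj A" and g: "lab g = whom A i' i" by simp_all
    \<comment> \<open>With \<alpha> composed on the left, the left action on \<psi> becomes a right
      action on \<phi>, by balance of the counit.\<close>
    have "s i' b \<cdot> lact W \<psi> i' i b = wmult C (fobj Z i') (fobj Z i) (fobj F b) \<cdot> (fhom Z i' i \<odot> s i b)"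
      by (rule colim.pointwise_unique2[OF \<alpha> p, of "fobj F b" i' "whom A i' i" "pcmp \<psi> i b"])
        (simp_all add: ap_comp ap_tens s_ap ev_balanced[symmetric] \<alpha>_wmult)
    then have "(s i' b \<cdot> lact W \<psi> i' i b) \<rhd> (g >< m) = (wmult C (fobj Z i') (fobj Z i) (fobj F b) \<cdot> (fhom Z i' i \<odot> s i b)) \<rhd> (g >< m)"
      by (rule arg_cong)
    then show "mcmp ?\<beta> (i', b) \<rhd> lact W \<psi> i' i b \<rhd> (g >< m) = lact W (fun_prof W Z F) i' i b \<rhd> (g >< (mcmp ?\<beta> (i, b) \<rhd> m))"
      using a g by (simp add: ap_comp ap_tens fun_prof_act)
  next
    fix b b' i m g
    assume "b \<in> obj (pdom \<psi>)" "b' \<in> obj (pdom \<psi>)" "i \<in> obj (pcod \<psi>)" "lab g = whom (pdom \<psi>) b b'"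
      and a: "el m" "el g" "tgt m = sor g" "lab m = pcmp \<psi> i b"
    then have [simp]: "b \<in> obj B" "b' \<in> obj B" "i \<in> obj A" and g: "lab g = whom B b b'" by simp_all
    \<comment> \<open>Here the right action passes through the counit into \<open>B\<close>, where
      \<open>F\<close> preserves composition.\<close>
    have "s i b' \<cdot> ract W \<psi> i b b' = wmult C (fobj Z i) (fobj F b) (fobj F b') \<cdot> (s i b \<odot> fhom F b b')"
      by (rule colim.pointwise_unique2[OF \<alpha> p, of "fobj F b'" i "pcmp \<psi> i b" "whom B b b'"])
        (simp_all add: ap_comp ap_tens s_ap s_wmult ev_ract colim.F_wmult)
    then have "(s i b' \<cdot> ract W \<psi> i b b') \<rhd> (m >< g) = (wmult C (fobj Z i) (fobj F b) (fobj F b') \<cdot> (s i b \<odot> fhom F b b')) \<rhd> (m >< g)"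
      by (rule arg_cong)
    then show "mcmp ?\<beta> (i, b') \<rhd> ract W \<psi> i b b' \<rhd> (m >< g) = ract W (fun_prof W Z F) i b b' \<rhd> ((mcmp ?\<beta> (i, b) \<rhd> m) >< g)"
      using a g by (simp add: ap_comp ap_tens fun_prof_act)
  qed simp_all
  have \<beta>_s: "mcmp ?\<beta> (i, b) = s i b" if "i \<in> obj A" "b \<in> obj B" for i b
    using that by simp
  define \<beta> where "\<beta> = ?\<beta>"
  note \<beta> = \<beta>[folded \<beta>_def] and [simp] = \<beta>_s[folded \<beta>_def]
  note [simp] = mult_unit_cell[OF \<alpha> \<beta>]
  \<comment> \<open>\<open>a(x) mult_unit(t) = a(\<tau>(x \<otimes> t))\<close>: on
    \<open>t = p \<otimes> q\<close> the product \<open>a(x) b(p)\<close> is \<open>F\<close> of the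
    counit, and \<alpha> respects its action on \<open>q\<close>.\<close>
  have key: "wmult C (fobj F b) (fobj Z i') (fobj Z i) \<cdot> (mcmp \<alpha> (b, i') \<odot> mcmp (mult_unit \<alpha> \<beta>) (i', i)) = mcmp \<alpha> (b, i) \<cdot> \<tau> b i' i"
    if [simp]: "b \<in> obj B" "i \<in> obj A" "i' \<in> obj A" for b i i'
    by (rule tens_ext_left[OF tp\<psi>\<phi>, of i i' "pcmp \<phi> b i'"])
      (simp_all add: ap_comp ap_tens mult_unit_ap[OF \<alpha> \<beta>] s_wmult \<tau>_tens colim.a_lact[OF \<alpha>])
  have "mcmp (mult_unit \<alpha> \<beta>) (i', i) \<cdot> mcmp \<eta> (i', i) = fhom Z i' i" if [simp]: "i \<in> obj A" "i' \<in> obj A" for i i'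
  proof (rule colim.pointwise_unique1[OF \<alpha> p, of "fobj Z i" i' "whom A i' i"])
    fix b x y assume [simp]: "b \<in> obj B" "el x" "el y" "tgt x = sor y" "lab x = pcmp \<phi> b i'" "lab y = whom A i' i"
    let ?t = "mcmp \<eta> (i', i') \<rhd> wid A i' \<rhd> one (sor y)"
    have "wmult C (fobj F b) (fobj Z i') (fobj Z i) \<rhd> ((mcmp \<alpha> (b, i') \<rhd> x) >< (mcmp (mult_unit \<alpha> \<beta>) (i', i) \<rhd> mcmp \<eta> (i', i) \<rhd> y)) =
      mcmp \<alpha> (b, i) \<rhd> \<tau> b i' i \<rhd> (x >< (mcmp \<eta> (i', i) \<rhd> y))"
      using arg_cong[OF key, of b i i' "\<lambda>w. w \<rhd> (x >< (mcmp \<eta> (i', i) \<rhd> y))"] by (simp add: ap_comp ap_tens)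
    \<comment> \<open>Writing \<eta>(y) as \<eta>(1) acted on by \<open>y\<close>, the action leaves
      \<tau>, and the triangle identity removes what remains.\<close>
    also have "\<tau> b i' i \<rhd> (x >< (mcmp \<eta> (i', i) \<rhd> y)) = ract W \<phi> b i' i \<rhd> (x >< y)"
      using bimap_ract[OF \<tau>_bimap, of i' i i' b x ?t y] by (simp add: unit_ract[of i i' y "sor y"] \<tau>_one)
    finally show "wmult C (fobj F b) (fobj Z i') (fobj Z i) \<rhd> ((mcmp \<alpha> (b, i') \<rhd> x) >< ((mcmp (mult_unit \<alpha> \<beta>) (i', i) \<cdot> mcmp \<eta> (i', i)) \<rhd> y)) =
      wmult C (fobj F b) (fobj Z i') (fobj Z i) \<rhd> ((mcmp \<alpha> (b, i') \<rhd> x) >< (fhom Z i' i \<rhd> y))"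
      by (simp add: ap_comp colim.a_ract[OF \<alpha>])
  qed simp_all
  then have "pmap_comp W (mult_map W Z F Z) (pmap_comp W (tens_map W \<beta> \<alpha>) \<eta>) = hom_map W Z"
    unfolding unit_eq_iff[OF \<alpha> \<beta>] by simp
  moreover have "pmap_comp W (mult_map W F Z F) (tens_map W \<alpha> \<beta>) = pmap_comp W (hom_map W F) \<epsilon>"
    unfolding counit_eq_iff[OF \<alpha> \<beta>] using s unfolding colim.factors_def by simp
  ultimately show ?thesis by (rule that[OF \<beta>])
qed

end

section \<open>The pair of maps determined by a limit\<close>

context
  fixes \<beta> assumes \<beta>: "\<beta> \<in> pmaps W \<psi> (fun_prof W Z F)" and p: "lim.pointwise_limit \<beta>"
begin

lemmas [simp] = lim.\<beta>_sel[OF \<beta>]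

lemma colimit_cocone_unique:
  assumes \<alpha>: "\<alpha> \<in> pmaps W \<phi> (fun_prof W F Z)" and \<alpha>': "\<alpha>' \<in> pmaps W \<phi> (fun_prof W F Z)"
    and counit: "pmap_comp W (mult_map W F Z F) (tens_map W \<alpha> \<beta>) = pmap_comp W (hom_map W F) \<epsilon>"
      "pmap_comp W (mult_map W F Z F) (tens_map W \<alpha>' \<beta>) = pmap_comp W (hom_map W F) \<epsilon>"
  shows "\<alpha> = \<alpha>'"
proof (rule pmap_eqI[OF \<alpha> \<alpha>'])
  note [simp] = colim.a_sel[OF \<alpha>] colim.a_sel[OF \<alpha>']
  fix i b assume "i \<in> obj (pdom \<phi>)" "b \<in> obj (pcod \<phi>)"
  then have [simp]: "b \<in> obj B" "i \<in> obj A" by simp_all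
  show "mcmp \<alpha> (b, i) = mcmp \<alpha>' (b, i)"
    by (rule lim.pointwise_unique[OF \<beta> p, of "fobj F b" i "pcmp \<phi> b i"])
      (use counit in \<open>simp_all add: counit_eq_iff[OF \<alpha> \<beta>] counit_eq_iff[OF \<alpha>' \<beta>]\<close>)
qed

lemma adjoint_of_limit:
  obtains \<alpha> where "\<alpha> \<in> pmaps W \<phi> (fun_prof W F Z)"
    "pmap_comp W (mult_map W Z F Z) (pmap_comp W (tens_map W \<beta> \<alpha>) \<eta>) = hom_map W Z"
    "pmap_comp W (mult_map W F Z F) (tens_map W \<alpha> \<beta>) = pmap_comp W (hom_map W F) \<epsilon>"
proof -
  define s where "s b i = (SOME s. lim.factors \<beta> (fobj F b) i (pcmp \<phi> b i) (\<lambda>b'. fhom F b b' \<cdot> ev b i b') s)" for b i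
  have s: "lim.factors \<beta> (fobj F b) i (pcmp \<phi> b i) (\<lambda>b'. fhom F b b' \<cdot> ev b i b') (s b i)"
    if [simp]: "i \<in> obj A" "b \<in> obj B" for i b
  proof -
    \<comment> \<open>The same cells as in the colimit case, now with \<open>b\<close> fixed and
      natural in \<open>b'\<close> through the right action of \<open>B\<close> on \<psi>.\<close>
    have "lim.cone (fobj F b) i (pcmp \<phi> b i) (\<lambda>b'. fhom F b b' \<cdot> ev b i b')"
      by (rule lim.coneI) (simp_all add: ap_comp ev_ract colim.F_wmult)
    then have "\<exists>!s. lim.factors \<beta> (fobj F b) i (pcmp \<phi> b i) (\<lambda>b'. fhom F b b' \<cdot> ev b i b') s"
      using p unfolding lim.pointwise_limit_def by simp
    then show ?thesis unfolding s_def by (rule someI_ex[OF ex1_implies_ex])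
  qed
  have [simp]: "s b i \<in> two_cells W" "dom2 W (s b i) = pcmp \<phi> b i" "cod2 W (s b i) = whom C (fobj F b) (fobj Z i)"
    if "i \<in> obj A" "b \<in> obj B" for i b
    using s[OF that] unfolding lim.factors_def by simp_all
  have s_ap: "wmult C (fobj F b) (fobj Z i) (fobj F b') \<rhd> ((s b i \<rhd> y) >< (mcmp \<beta> (i, b') \<rhd> x)) =
      fhom F b b' \<rhd> ev b i b' \<rhd> (y >< x)"
    if [simp]: "i \<in> obj A" "b \<in> obj B" "b' \<in> obj B" "el y" "el x" "tgt y = sor x" "lab y = pcmp \<phi> b i" "lab x = pcmp \<psi> i b'"
    for i b b' x y
    using lim.factors_ap[OF \<beta> s, of i b b' y x] by (simp add: ap_comp)
  let ?\<alpha> = "\<lparr>mdom = \<phi>, mcod = fun_prof W F Z, mcmp = restrict (\<lambda>(b, i). s b i) (obj B \<times> obj A)\<rparr>"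
  have \<alpha>: "?\<alpha> \<in> pmaps W \<phi> (fun_prof W F Z)"
  proof (rule pmapI)
    fix i b b' g m
    assume "i \<in> obj (pdom \<phi>)" "b \<in> obj (pcod \<phi>)" "b' \<in> obj (pcod \<phi>)" "lab g = whom (pcod \<phi>) b' b"
      and a: "el g" "el m" "tgt g = sor m" "lab m = pcmp \<phi> b i"
    then have [simp]: "i \<in> obj A" "b \<in> obj B" "b' \<in> obj B" and g: "lab g = whom B b' b" by simp_all
    \<comment> \<open>With \<beta> composed on the right, the left action of \<open>B\<close> passes
      through the counit, and \<open>F\<close> preserves composition.\<close>
    have "s b' i \<cdot> lact W \<phi> b' b i = wmult C (fobj F b') (fobj F b) (fobj Z i) \<cdot> (fhom F b' b \<odot> s b i)"
      by (rule lim.pointwise_unique2[OF \<beta> p, of "fobj F b'" i "whom B b' b" "pcmp \<phi> b i"])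
        (simp_all add: ap_comp ap_tens s_ap ev_lact colim.F_wmult wmult_assoc)
    then have "(s b' i \<cdot> lact W \<phi> b' b i) \<rhd> (g >< m) = (wmult C (fobj F b') (fobj F b) (fobj Z i) \<cdot> (fhom F b' b \<odot> s b i)) \<rhd> (g >< m)"
      by (rule arg_cong)
    then show "mcmp ?\<alpha> (b', i) \<rhd> lact W \<phi> b' b i \<rhd> (g >< m) = lact W (fun_prof W F Z) b' b i \<rhd> (g >< (mcmp ?\<alpha> (b, i) \<rhd> m))"
      using a g by (simp add: ap_comp ap_tens fun_prof_act)
  next
    fix i i' b m g
    assume "i \<in> obj (pdom \<phi>)" "i' \<in> obj (pdom \<phi>)" "b \<in> obj (pcod \<phi>)" "lab g = whom (pdom \<phi>) i i'"
      and a: "el m" "el g" "tgt m = sor g" "lab m = pcmp \<phi> b i"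
    then have [simp]: "i \<in> obj A" "i' \<in> obj A" "b \<in> obj B" and g: "lab g = whom A i i'" by simp_all
    \<comment> \<open>Balance of the counit moves the right action on \<phi> to a left action on
      \<psi>, which \<beta> respects.\<close>
    have "s b i' \<cdot> ract W \<phi> b i i' = wmult C (fobj F b) (fobj Z i) (fobj Z i') \<cdot> (s b i \<odot> fhom Z i i')"
      by (rule lim.pointwise_unique2[OF \<beta> p, of "fobj F b" i' "pcmp \<phi> b i" "whom A i i'"])
        (simp_all add: ap_comp ap_tens s_ap ev_balanced wmult_assoc lim.\<beta>_lact[OF \<beta>, symmetric])
    then have "(s b i' \<cdot> ract W \<phi> b i i') \<rhd> (m >< g) = (wmult C (fobj F b) (fobj Z i) (fobj Z i') \<cdot> (s b i \<odot> fhom Z i i')) \<rhd> (m >< g)"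
      by (rule arg_cong)
    then show "mcmp ?\<alpha> (b, i') \<rhd> ract W \<phi> b i i' \<rhd> (m >< g) = ract W (fun_prof W F Z) b i i' \<rhd> ((mcmp ?\<alpha> (b, i) \<rhd> m) >< g)"
      using a g by (simp add: ap_comp ap_tens fun_prof_act)
  qed simp_all
  have \<alpha>_s: "mcmp ?\<alpha> (b, i) = s b i" if "i \<in> obj A" "b \<in> obj B" for i b
    using that by simp
  define \<alpha> where "\<alpha> = ?\<alpha>"
  note \<alpha> = \<alpha>[folded \<alpha>_def] and [simp] = \<alpha>_s[folded \<alpha>_def]
  note [simp] = mult_unit_cell[OF \<alpha> \<beta>]
  \<comment> \<open>\<open>mult_unit(t) b(x) = b(\<sigma>(t \<otimes> x))\<close>: on
    \<open>t = p \<otimes> q\<close> the product \<open>a(q) b(x)\<close> is \<open>F\<close> of the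
    counit, and \<beta> respects its action on \<open>p\<close>.\<close>
  have key: "wmult C (fobj Z i') (fobj Z i) (fobj F b) \<cdot> (mcmp (mult_unit \<alpha> \<beta>) (i', i) \<odot> mcmp \<beta> (i, b)) = mcmp \<beta> (i', b) \<cdot> \<sigma> i' i b"
    if [simp]: "b \<in> obj B" "i \<in> obj A" "i' \<in> obj A" for b i i'
    by (rule tens_ext_right[OF tp\<psi>\<phi>, of i i' "pcmp \<psi> i b"])
      (simp_all add: ap_comp ap_tens mult_unit_ap[OF \<alpha> \<beta>] \<sigma>_tens lim.\<beta>_ract[OF \<beta>] wmult_assoc s_ap)
  have "mcmp (mult_unit \<alpha> \<beta>) (i', i) \<cdot> mcmp \<eta> (i', i) = fhom Z i' i" if [simp]: "i \<in> obj A" "i' \<in> obj A" for i i'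
  proof (rule lim.pointwise_unique1[OF \<beta> p, of "fobj Z i'" i "whom A i' i"])
    fix b y x assume [simp]: "b \<in> obj B" "el y" "el x" "tgt y = sor x" "lab y = whom A i' i" "lab x = pcmp \<psi> i b"
    let ?t = "mcmp \<eta> (i, i) \<rhd> wid A i \<rhd> one (sor x)"
    have "wmult C (fobj Z i') (fobj Z i) (fobj F b) \<rhd> ((mcmp (mult_unit \<alpha> \<beta>) (i', i) \<rhd> mcmp \<eta> (i', i) \<rhd> y) >< (mcmp \<beta> (i, b) \<rhd> x)) =
      mcmp \<beta> (i', b) \<rhd> \<sigma> i' i b \<rhd> ((mcmp \<eta> (i', i) \<rhd> y) >< x)"
      using arg_cong[OF key, of b i i' "\<lambda>w. w \<rhd> ((mcmp \<eta> (i', i) \<rhd> y) >< x)"] by (simp add: ap_comp ap_tens)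
    \<comment> \<open>Here \<eta>(y) is written as \<open>y\<close> acting on \<eta>(1), since
      \<sigma> respects the left action; the triangle identity finishes.\<close>
    also have "\<sigma> i' i b \<rhd> ((mcmp \<eta> (i', i) \<rhd> y) >< x) = lact W \<psi> i' i b \<rhd> (y >< x)"
      using bimap_lact[OF \<sigma>_bimap, of b i i i' y ?t x] by (simp add: unit_lact[of i i' y "sor x"] \<sigma>_one)
    finally show "wmult C (fobj Z i') (fobj Z i) (fobj F b) \<rhd> (((mcmp (mult_unit \<alpha> \<beta>) (i', i) \<cdot> mcmp \<eta> (i', i)) \<rhd> y) >< (mcmp \<beta> (i, b) \<rhd> x)) =
      wmult C (fobj Z i') (fobj Z i) (fobj F b) \<rhd> ((fhom Z i' i \<rhd> y) >< (mcmp \<beta> (i, b) \<rhd> x))"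
      by (simp add: ap_comp lim.\<beta>_lact[OF \<beta>])
  qed simp_all
  then have "pmap_comp W (mult_map W Z F Z) (pmap_comp W (tens_map W \<beta> \<alpha>) \<eta>) = hom_map W Z"
    unfolding unit_eq_iff[OF \<alpha> \<beta>] by simp
  moreover have "pmap_comp W (mult_map W F Z F) (tens_map W \<alpha> \<beta>) = pmap_comp W (hom_map W F) \<epsilon>"
    unfolding counit_eq_iff[OF \<alpha> \<beta>] using s unfolding lim.factors_def by simp
  ultimately show ?thesis by (rule that[OF \<alpha>])
qed

end

end

text \<open>The correspondence between (a) and (b) is the composite of one projection with the
  inverse of the other. Stating the bijections as projections records that passing from (c) to (a)
  or (b) only forgets one of the two maps.\<close>

theorem theorem1:
  fixes \<kappa> :: "'k rel"
    and W :: "('o, 'f, 'c) bicat"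
    and A B :: "('x, 'o, 'f, 'c) wcat"
    and C :: "('z, 'o, 'f, 'c) wcat"
    and \<phi> \<psi> :: "('x, 'x, 'o, 'f, 'c) prof"
    and \<eta> \<epsilon> :: "('x, 'x, 'o, 'f, 'c) pmap"
    and F Z :: "('x, 'z, 'o, 'f, 'c) wfun"
  assumes "smallness_cardinal \<kappa>"
    and "bicategory W"
    and "biclosed W"
    and "\<And>x y. x \<in> zero_cells W \<Longrightarrow> y \<in> zero_cells W \<Longrightarrow>
           locally_small \<kappa> (hom_cat W x y) \<and> small_complete \<kappa> (hom_cat W x y) \<and>
           small_cocomplete \<kappa> (hom_cat W x y)"
    and "small_wcategory W \<kappa> A"
    and "small_wcategory W \<kappa> B"
    and "wcategory W C"
    and "profunctor W A B \<phi>"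
    and "profunctor W B A \<psi>"
    and "adjunction_in (Mod W \<kappa>) \<phi> \<psi> \<eta> \<epsilon>"
    and "wfunctor W B C F"
    and "wfunctor W A C Z"
  defines "colimit_data \<equiv> {a. exhibits_weighted_colimit W \<phi> F Z a}"
    and "limit_data \<equiv> {b. exhibits_weighted_limit W \<psi> F Z b}"
    and "adjoint_data \<equiv>
      {(a, b). a \<in> pmaps W \<phi> (fun_prof W F Z) \<and> b \<in> pmaps W \<psi> (fun_prof W Z F) \<and>
         pmap_comp W (mult_map W Z F Z) (pmap_comp W (tens_map W b a) \<eta>) = hom_map W Z \<and>
         pmap_comp W (mult_map W F Z F) (tens_map W a b) = pmap_comp W (hom_map W F) \<epsilon>}"
  shows "bij_betw fst adjoint_data colimit_data \<and> bij_betw snd adjoint_data limit_data"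
proof -
  interpret absolute_weight W \<kappa> A B C F Z \<phi> \<psi> \<eta> \<epsilon>
    by unfold_locales (use assms(1-12) in simp_all)
  have lim: "b \<in> limit_data" and colim: "a \<in> colimit_data" if "(a, b) \<in> adjoint_data" for a b
    using that limit_of_adjoint[of a b] colimit_of_adjoint[of a b] lim.exhibits_weighted_limit_iff[of b]
      colim.exhibits_weighted_colimit_iff[of a]
    by (auto simp: adjoint_data_def limit_data_def colimit_data_def)
  have colim_pmap: "a \<in> pmaps W \<phi> (fun_prof W F Z)" "colim.pointwise_colimit a" if "a \<in> colimit_data" for a
    using that colim.exhibits_weighted_colimit_iff[of a]
    by (auto simp: colimit_data_def exhibits_weighted_colimit_def)
  have lim_pmap: "b \<in> pmaps W \<psi> (fun_prof W Z F)" "lim.pointwise_limit b" if "b \<in> limit_data" for b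
    using that lim.exhibits_weighted_limit_iff[of b]
    by (auto simp: limit_data_def exhibits_weighted_limit_def)
  show ?thesis
  proof (intro conjI bij_betw_imageI inj_onI set_eqI iffI)
    \<comment> \<open>The colimit half of a pair fixes the other half, because (ii) prescribes the
      factorisations through it; for the limit half the argument is the same.\<close>
    fix r r' assume r: "r \<in> adjoint_data" "r' \<in> adjoint_data" "fst r = fst r'"
    obtain a b b' where ab: "r = (a, b)" "r' = (a, b')" using r(3) by (cases r; cases r') auto
    show "r = r'"
      using limit_cone_unique[OF colim_pmap, of a b b'] colim[of a b] r(1,2) unfolding ab adjoint_data_def by simp
  next
    fix r r' assume r: "r \<in> adjoint_data" "r' \<in> adjoint_data" "snd r = snd r'"
    obtain a a' b where ab: "r = (a, b)" "r' = (a', b)" using r(3) by (cases r; cases r') auto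
    show "r = r'"
      using colimit_cocone_unique[OF lim_pmap, of b a a'] lim[of a b] r(1,2) unfolding ab adjoint_data_def by simp
  next
    fix a assume "a \<in> fst ` adjoint_data"
    then show "a \<in> colimit_data" using colim by auto
  next
    fix b assume "b \<in> snd ` adjoint_data"
    then show "b \<in> limit_data" using lim by auto
  next
    fix a assume a: "a \<in> colimit_data"
    obtain b where "b \<in> pmaps W \<psi> (fun_prof W Z F)"
      "pmap_comp W (mult_map W Z F Z) (pmap_comp W (tens_map W b a) \<eta>) = hom_map W Z"
      "pmap_comp W (mult_map W F Z F) (tens_map W a b) = pmap_comp W (hom_map W F) \<epsilon>"
      by (rule adjoint_of_colimit[OF colim_pmap[OF a]])
    then have "(a, b) \<in> adjoint_data" using colim_pmap(1)[OF a] by (simp add: adjoint_data_def)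
    then show "a \<in> fst ` adjoint_data" by force
  next
    fix b assume b: "b \<in> limit_data"
    obtain a where "a \<in> pmaps W \<phi> (fun_prof W F Z)"
      "pmap_comp W (mult_map W Z F Z) (pmap_comp W (tens_map W b a) \<eta>) = hom_map W Z"
      "pmap_comp W (mult_map W F Z F) (tens_map W a b) = pmap_comp W (hom_map W F) \<epsilon>"
      by (rule adjoint_of_limit[OF lim_pmap[OF b]])
    then have "(a, b) \<in> adjoint_data" using lim_pmap(1)[OF b] by (simp add: adjoint_data_def)
    then show "b \<in> snd ` adjoint_data" by force
  qed
qed

end
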